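(* Let $R$ be a noetherian commutative ring, let $I=(g_1,\dots,g_t)$ be an ideal of $R$, and let $\underline f=f_1,\dots,f_c$ be a sequence of elements of $R$. Let $E_2^{i,j}=H^i(K^\bullet(\underline f;H^j_I(R)))\Rightarrow H^{i+j}(T^\bullet)$ be the spectral sequence of the Koszul–Čech double complex of $\underline f$ and $\underline g=g_1,\dots,g_t$ obtained by taking first the Čech differentials and then the Koszul differentials, where $T^\bullet$ is the total complex. Assume that (1) $\operatorname{Supp}(E^{i,j}_\infty)$ is Zariski-closed in $\operatorname{Spec}(R)$ for all integers $i,j$, and (2) $f_1,\dots,f_c$ form a regular sequence in $R$. Then $\operatorname{Supp}(H^k_I(R/(f_1,\dots,f_c)))$ is Zariski-closed for each integer $k$.
   Context: $H^j_I$ denotes the $j$-th local cohomology functor with support in $I$. For an $R$-module $N$, $K^\bullet(\underline f;N)$ is the Koszul cocomplex of $N$ on $f_1,\dots,f_c$ (with $K^i(\underline f;N)\cong N^{\binom{c}{i}}$ in cohomological degree $i$), and $\check C^\bullet(\underline g;N)$ is the Čech complex $0\to N\to\bigoplus_i N_{g_i}\to\bigoplus_{i_1<i_2}N_{g_{i_1}g_{i_2}}\to\cdots\to N_{g_1\cdots g_t}\to 0$, so $H^j(\check C^\bullet(\underline g;N))\cong H^j_I(N)$. The Koszul–Čech double complex $\mathbf D$ has $i$-th row the Čech complex $\check C^\bullet(\underline g;K^i(\underline f;R))$ and $j$-th column the Koszul cocomplex $K^\bullet(\underline f;\check C^j(\underline g;R))$; that is, the entry in position $(i,j)$ is $K^i(\underline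 f;\check C^j(\underline g;R))$, with $0\le i\le c$, $0\le j\le t$. $T^\bullet$ is the total complex of $\mathbf D$. The spectral sequence in question is the convergent spectral sequence of this bounded double complex obtained by first taking cohomology in the Čech direction and then in the Koszul direction, with differentials $d_r^{i,j}:E_r^{i,j}\to E_r^{i+r,j-r+1}$; $E^{i,j}_\infty$ denotes its limit terms. *)

theory Defs
  imports "HOL-Algebra.Ring_Divisibility" "HOL-Algebra.Ideal_Product" "HOL-Algebra.Module"
begin

section \<open>Modules over a ring with carrier\<close>

text \<open>The record type \<open>module\<close> extends \<open>ring\<close>, so a module carries a multiplication and a unit
  which the locale \<open>module\<close> ignores; they are left unspecified below.\<close>

definition regular_module :: "('a, 'm) ring_scheme \<Rightarrow> ('a, 'a) module"
  where "regular_module R =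
    \<lparr>carrier = carrier R, monoid.mult = undefined, one = undefined,
     ring.zero = \<zero>\<^bsub>R\<^esub>, add = (\<lambda>x y. x \<oplus>\<^bsub>R\<^esub> y), smult = (\<lambda>a x. a \<otimes>\<^bsub>R\<^esub> x)\<rparr>"

definition quotient_module :: "('a, 'b) module \<Rightarrow> 'b set \<Rightarrow> ('a, 'b set) module"
  where "quotient_module M N =
    \<lparr>carrier = a_rcosets\<^bsub>M\<^esub> N, monoid.mult = undefined, one = undefined,
     ring.zero = N, add = (\<lambda>X Y. X <+>\<^bsub>M\<^esub> Y),
     smult = (\<lambda>a X. \<Union>x\<in>X. N +>\<^bsub>M\<^esub> (a \<odot>\<^bsub>M\<^esub> x))\<rparr>"

text \<open>The product of a family of modules. All index sets used below are finite, or all but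
  finitely many of the factors are zero, so that it is also the direct sum.\<close>

definition pi_module :: "'i set \<Rightarrow> ('i \<Rightarrow> ('a, 'b) module) \<Rightarrow> ('a, 'i \<Rightarrow> 'b) module"
  where "pi_module J M =
    \<lparr>carrier = (\<Pi>\<^sub>E j\<in>J. carrier (M j)), monoid.mult = undefined, one = undefined,
     ring.zero = (\<lambda>j\<in>J. \<zero>\<^bsub>M j\<^esub>),
     add = (\<lambda>x y. \<lambda>j\<in>J. x j \<oplus>\<^bsub>M j\<^esub> y j),
     smult = (\<lambda>a x. \<lambda>j\<in>J. a \<odot>\<^bsub>M j\<^esub> x j)\<rparr>"

definition module_hom :: "('a, 'm) ring_scheme \<Rightarrow> ('a, 'b) module \<Rightarrow> ('a, 'c) module \<Rightarrow> ('b \<Rightarrow> 'c) set"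
  where "module_hom R M N =
    {h \<in> carrier M \<rightarrow> carrier N.
       (\<forall>x\<in>carrier M. \<forall>y\<in>carrier M. h (x \<oplus>\<^bsub>M\<^esub> y) = h x \<oplus>\<^bsub>N\<^esub> h y) \<and>
       (\<forall>a\<in>carrier R. \<forall>x\<in>carrier M. h (a \<odot>\<^bsub>M\<^esub> x) = a \<odot>\<^bsub>N\<^esub> h x)}"

definition signed :: "('a, 'b) module \<Rightarrow> int \<Rightarrow> 'b \<Rightarrow> 'b"
  where "signed M n x = (if even n then x else \<ominus>\<^bsub>M\<^esub> x)"

definition cohomology ::
    "(int \<Rightarrow> ('a, 'b) module) \<Rightarrow> (int \<Rightarrow> 'b \<Rightarrow> 'b) \<Rightarrow> int \<Rightarrow> ('a, 'b set) module"
  where "cohomology C d n =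
    quotient_module (C n\<lparr>carrier := a_kernel (C n) (C (n + 1)) (d n)\<rparr>)
      (d (n - 1) ` carrier (C (n - 1)))"


section \<open>Localization, support and Zariski-closed sets\<close>

text \<open>\<open>loc_frac R S M m s\<close> is the fraction \<open>m/s\<close>, as an equivalence class of pairs.\<close>

definition loc_frac ::
    "('a, 'm) ring_scheme \<Rightarrow> 'a set \<Rightarrow> ('a, 'b) module \<Rightarrow> 'b \<Rightarrow> 'a \<Rightarrow> ('b \<times> 'a) set"
  where "loc_frac R S M m s =
    {(m', s'). m' \<in> carrier M \<and> s' \<in> S \<and>
       (\<exists>u\<in>S. u \<odot>\<^bsub>M\<^esub> (s' \<odot>\<^bsub>M\<^esub> m) = u \<odot>\<^bsub>M\<^esub> (s \<odot>\<^bsub>M\<^esub> m'))}"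

text \<open>The localization of \<open>M\<close> at a multiplicative set \<open>S\<close>, as an \<open>R\<close>-module. Operations are
  taken over all representatives; the resulting classes coincide, so the unions are these classes.\<close>

definition localization ::
    "('a, 'm) ring_scheme \<Rightarrow> 'a set \<Rightarrow> ('a, 'b) module \<Rightarrow> ('a, ('b \<times> 'a) set) module"
  where "localization R S M =
    \<lparr>carrier = {loc_frac R S M m s | m s. m \<in> carrier M \<and> s \<in> S},
     monoid.mult = undefined, one = undefined,
     ring.zero = loc_frac R S M \<zero>\<^bsub>M\<^esub> \<one>\<^bsub>R\<^esub>,
     add = (\<lambda>X Y. \<Union>(m, s)\<in>X. \<Union>(m', s')\<in>Y.
              loc_frac R S M ((s' \<odot>\<^bsub>M\<^esub> m) \<oplus>\<^bsub>M\<^esub> (s \<odot>\<^bsub>M\<^esub> m')) (s \<otimes>\<^bsub>R\<^esub> s')),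
     smult = (\<lambda>a X. \<Union>(m, s)\<in>X. loc_frac R S M (a \<odot>\<^bsub>M\<^esub> m) s)\<rparr>"

text \<open>The canonical map from a localization of \<open>M\<close> to the localization of \<open>M\<close> at \<open>S\<close>, in the
  situation where the old denominators act invertibly on the latter: \<open>m/s\<close> goes to the unique
  \<open>y\<close> such that \<open>s y = m/1\<close>.\<close>

definition loc_map ::
    "('a, 'm) ring_scheme \<Rightarrow> 'a set \<Rightarrow> ('a, 'b) module \<Rightarrow> ('b \<times> 'a) set \<Rightarrow> ('b \<times> 'a) set"
  where "loc_map R S M x =
    (THE y. y \<in> carrier (localization R S M) \<and>
       (\<forall>(m, s)\<in>x. s \<odot>\<^bsub>localization R S M\<^esub> y = loc_frac R S M m \<one>\<^bsub>R\<^esub>))"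

definition powers :: "('a, 'm) ring_scheme \<Rightarrow> 'a \<Rightarrow> 'a set"
  where "powers R g = {g [^]\<^bsub>R\<^esub> n | n :: nat. True}"

definition Supp :: "('a, 'm) ring_scheme \<Rightarrow> ('a, 'b) module \<Rightarrow> 'a set set"
  where "Supp R M =
    {P. primeideal P R \<and>
        carrier (localization R (carrier R - P) M) \<noteq> {\<zero>\<^bsub>localization R (carrier R - P) M\<^esub>}}"

definition zariski_closed :: "('a, 'm) ring_scheme \<Rightarrow> 'a set set \<Rightarrow> bool"
  where "zariski_closed R Z \<longleftrightarrow> (\<exists>J. ideal J R \<and> Z = {P. primeideal P R \<and> J \<subseteq> P})"


section \<open>Regular sequences\<close>

definition regular_sequence :: "('a, 'm) ring_scheme \<Rightarrow> 'a list \<Rightarrow> bool"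
  where "regular_sequence R fs \<longleftrightarrow>
    set fs \<subseteq> carrier R \<and>
    (\<forall>i<length fs.
       let Q = quotient_module (regular_module R) (Idl\<^bsub>R\<^esub> (set (take i fs)))
       in \<forall>x\<in>carrier Q. (fs ! i) \<odot>\<^bsub>Q\<^esub> x = \<zero>\<^bsub>Q\<^esub> \<longrightarrow> x = \<zero>\<^bsub>Q\<^esub>) \<and>
    Idl\<^bsub>R\<^esub> (set fs) \<noteq> carrier R"


section \<open>Local cohomology\<close>

definition torsion_submodule ::
    "('a, 'm) ring_scheme \<Rightarrow> 'a set \<Rightarrow> ('a, 'b) module \<Rightarrow> ('a, 'b) module"
  where "torsion_submodule R I M =
    M\<lparr>carrier := {x \<in> carrier M.
        \<exists>n :: nat. \<forall>a \<in> I [^]\<^bsub>ideals_set R\<^esub> n. a \<odot>\<^bsub>M\<^esub> x = \<zero>\<^bsub>M\<^esub>}\<rparr>"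

text \<open>A definition cannot quantify over the types carrying the test modules \<open>B\<close>, which here live
  on the type of the ring elements. Nothing is lost: \<open>R\<close> itself is among them, and by Baer's
  criterion extending homomorphisms from ideals to \<open>R\<close> already suffices for injectivity.\<close>

definition injective_module :: "('a, 'm) ring_scheme \<Rightarrow> ('a, 'e) module \<Rightarrow> bool"
  where "injective_module R E \<longleftrightarrow>
    module R E \<and>
    (\<forall>(B :: ('a, 'a) module) A h.
       module R B \<and> submodule A R B \<and> h \<in> module_hom R (B\<lparr>carrier := A\<rparr>) E \<longrightarrow>
       (\<exists>h'\<in>module_hom R B E. \<forall>x\<in>A. h' x = h x))"

definition injective_resolution ::
    "('a, 'm) ring_scheme \<Rightarrow> ('a, 'b) module \<Rightarrow> (int \<Rightarrow> ('a, 'e) module) \<Rightarrow>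
     (int \<Rightarrow> 'e \<Rightarrow> 'e) \<Rightarrow> ('b \<Rightarrow> 'e) \<Rightarrow> bool"
  where "injective_resolution R N E d \<epsilon> \<longleftrightarrow>
    (\<forall>n. injective_module R (E n)) \<and>
    (\<forall>n<0. carrier (E n) = {\<zero>\<^bsub>E n\<^esub>}) \<and>
    (\<forall>n. d n \<in> module_hom R (E n) (E (n + 1))) \<and>
    \<epsilon> \<in> module_hom R N (E 0) \<and> inj_on \<epsilon> (carrier N) \<and>
    \<epsilon> ` carrier N = a_kernel (E 0) (E 1) (d 0) \<and>
    (\<forall>n\<ge>0. d n ` carrier (E n) = a_kernel (E (n + 1)) (E (n + 2)) (d (n + 1)))"

text \<open>The value at \<open>N\<close> of the right derived functors of the \<open>I\<close>-torsion functor, computed from an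
  injective resolution \<open>(E, d)\<close> of \<open>N\<close>; \<open>N\<close> enters only through \<open>injective_resolution\<close>, and the
  module is independent of the resolution up to isomorphism. Over a noetherian \<open>R\<close> such resolutions
  exist on every infinite type whose cardinality is at least those of \<open>R\<close> and \<open>N\<close>.\<close>

definition local_cohomology ::
    "('a, 'm) ring_scheme \<Rightarrow> 'a set \<Rightarrow> (int \<Rightarrow> ('a, 'e) module) \<Rightarrow> (int \<Rightarrow> 'e \<Rightarrow> 'e) \<Rightarrow>
     int \<Rightarrow> ('a, 'e set) module"
  where "local_cohomology R I E d k = cohomology (\<lambda>n. torsion_submodule R I (E n)) d k"


section \<open>The Koszul cocomplex and the Cech complex\<close>

text \<open>Both complexes are indexed in degree \<open>i\<close> by the \<open>i\<close>-element subsets of \<open>{0,\<dots>,n-1}\<close>;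
  there are none for \<open>i < 0\<close> and \<open>i > n\<close>, where the complexes are therefore zero.\<close>

definition subsets :: "nat \<Rightarrow> int \<Rightarrow> nat set set"
  where "subsets n i = {A. A \<subseteq> {..<n} \<and> int (card A) = i}"

definition position :: "nat \<Rightarrow> nat set \<Rightarrow> int"
  where "position a A = int (card {b \<in> A. b < a})"

definition koszul :: "'a list \<Rightarrow> ('a, 'b) module \<Rightarrow> int \<Rightarrow> ('a, nat set \<Rightarrow> 'b) module"
  where "koszul fs N i = pi_module (subsets (length fs) i) (\<lambda>_. N)"

definition koszul_diff ::
    "'a list \<Rightarrow> ('a, 'b) module \<Rightarrow> int \<Rightarrow> (nat set \<Rightarrow> 'b) \<Rightarrow> (nat set \<Rightarrow> 'b)"
  where "koszul_diff fs N i x =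
    (\<lambda>A\<in>subsets (length fs) (i + 1).
       \<Oplus>\<^bsub>N\<^esub>a\<in>A. signed N (position a A) ((fs ! a) \<odot>\<^bsub>N\<^esub> x (A - {a})))"

definition koszul_map :: "'a list \<Rightarrow> ('b \<Rightarrow> 'c) \<Rightarrow> int \<Rightarrow> (nat set \<Rightarrow> 'b) \<Rightarrow> (nat set \<Rightarrow> 'c)"
  where "koszul_map fs h i x = (\<lambda>A\<in>subsets (length fs) i. h (x A))"

text \<open>In degree \<open>0\<close> the product is empty, so that the only entry is the localization of \<open>N\<close> at
  \<open>{1}\<close>, a copy of \<open>N\<close>.\<close>

definition cech_denominators :: "('a, 'm) ring_scheme \<Rightarrow> 'a list \<Rightarrow> nat set \<Rightarrow> 'a set"
  where "cech_denominators R gs B = powers R (\<Otimes>\<^bsub>R\<^esub>b\<in>B. gs ! b)"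

definition cech ::
    "('a, 'm) ring_scheme \<Rightarrow> 'a list \<Rightarrow> ('a, 'b) module \<Rightarrow> int \<Rightarrow> ('a, nat set \<Rightarrow> ('b \<times> 'a) set) module"
  where "cech R gs N j =
    pi_module (subsets (length gs) j) (\<lambda>B. localization R (cech_denominators R gs B) N)"

definition cech_diff ::
    "('a, 'm) ring_scheme \<Rightarrow> 'a list \<Rightarrow> ('a, 'b) module \<Rightarrow> int \<Rightarrow>
     (nat set \<Rightarrow> ('b \<times> 'a) set) \<Rightarrow> (nat set \<Rightarrow> ('b \<times> 'a) set)"
  where "cech_diff R gs N j x =
    (\<lambda>B\<in>subsets (length gs) (j + 1).
       \<Oplus>\<^bsub>localization R (cech_denominators R gs B) N\<^esub>b\<in>B.
         signed (localization R (cech_denominators R gs B) N) (position b B)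
           (loc_map R (cech_denominators R gs B) N (x (B - {b}))))"


section \<open>Total complexes and the spectral sequence of a double complex\<close>

text \<open>In a double complex \<open>D\<close>, \<open>d1 i j\<close> maps \<open>D i j\<close> to \<open>D (i + 1) j\<close> and \<open>d2 i j\<close> maps
  \<open>D i j\<close> to \<open>D i (j + 1)\<close>; these commute, and the total differential is \<open>d1 + (-1)\<^sup>i d2\<close>.
  An element of the total complex in degree \<open>n\<close> is a family with \<open>i\<close>-th entry in \<open>D i (n - i)\<close>.\<close>

definition total_complex ::
    "(int \<Rightarrow> int \<Rightarrow> ('a, 'b) module) \<Rightarrow> int \<Rightarrow> ('a, int \<Rightarrow> 'b) module"
  where "total_complex D n = pi_module UNIV (\<lambda>i. D i (n - i))"

definition total_diff ::
    "(int \<Rightarrow> int \<Rightarrow> ('a, 'b) module) \<Rightarrow> (int \<Rightarrow> int \<Rightarrow> 'b \<Rightarrow> 'b) \<Rightarrow> (int \<Rightarrow> int \<Rightarrow> 'b \<Rightarrow> 'b) \<Rightarrow>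
     int \<Rightarrow> (int \<Rightarrow> 'b) \<Rightarrow> (int \<Rightarrow> 'b)"
  where "total_diff D d1 d2 n x =
    (\<lambda>i. d1 (i - 1) (n - (i - 1)) (x (i - 1)) \<oplus>\<^bsub>D i (n + 1 - i)\<^esub>
         signed (D i (n + 1 - i)) i (d2 i (n - i) (x i)))"

text \<open>The filtration by the first index. Its associated graded complex only retains \<open>d2\<close>, so in the
  spectral sequence one takes cohomology first with respect to \<open>d2\<close> and then with respect to
  \<open>d1\<close>.\<close>

definition total_filtration ::
    "(int \<Rightarrow> int \<Rightarrow> ('a, 'b) module) \<Rightarrow> int \<Rightarrow> int \<Rightarrow> (int \<Rightarrow> 'b) set"
  where "total_filtration D p n =
    {x \<in> carrier (total_complex D n). \<forall>i<p. x i = \<zero>\<^bsub>D i (n - i)\<^esub>}"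

text \<open>The spectral sequence of a complex \<open>(T, d)\<close> with a decreasing filtration, \<open>F p n\<close> being the
  \<open>p\<close>-th step in degree \<open>n\<close>. The cycles and boundaries of the \<open>r\<close>-th page are submodules of
  \<open>F p / F (p + 1)\<close>; they are represented by their preimages in \<open>F p\<close>. The pages are
  \<open>cycles / boundaries\<close>, with differential from \<open>E r i j\<close> to \<open>E r (i + r) (j - r + 1)\<close> induced
  by \<open>d\<close>.\<close>

definition ss_cycles ::
    "(int \<Rightarrow> ('a, 'b) module) \<Rightarrow> (int \<Rightarrow> 'b \<Rightarrow> 'b) \<Rightarrow> (int \<Rightarrow> int \<Rightarrow> 'b set) \<Rightarrow>
     nat \<Rightarrow> int \<Rightarrow> int \<Rightarrow> 'b set"
  where "ss_cycles T d F r p n =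
    {x \<in> F p n. d n x \<in> F (p + int r) (n + 1)} <+>\<^bsub>T n\<^esub> F (p + 1) n"

definition ss_boundaries ::
    "(int \<Rightarrow> ('a, 'b) module) \<Rightarrow> (int \<Rightarrow> 'b \<Rightarrow> 'b) \<Rightarrow> (int \<Rightarrow> int \<Rightarrow> 'b set) \<Rightarrow>
     nat \<Rightarrow> int \<Rightarrow> int \<Rightarrow> 'b set"
  where "ss_boundaries T d F r p n =
    (F p n \<inter> d (n - 1) ` F (p - int r + 1) (n - 1)) <+>\<^bsub>T n\<^esub> F (p + 1) n"

definition ss_page ::
    "(int \<Rightarrow> ('a, 'b) module) \<Rightarrow> (int \<Rightarrow> 'b \<Rightarrow> 'b) \<Rightarrow> (int \<Rightarrow> int \<Rightarrow> 'b set) \<Rightarrow>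
     nat \<Rightarrow> int \<Rightarrow> int \<Rightarrow> ('a, 'b set) module"
  where "ss_page T d F r i j =
    quotient_module (T (i + j)\<lparr>carrier := ss_cycles T d F r i (i + j)\<rparr>)
      (ss_boundaries T d F r i (i + j))"

definition ss_limit ::
    "(int \<Rightarrow> ('a, 'b) module) \<Rightarrow> (int \<Rightarrow> 'b \<Rightarrow> 'b) \<Rightarrow> (int \<Rightarrow> int \<Rightarrow> 'b set) \<Rightarrow>
     int \<Rightarrow> int \<Rightarrow> ('a, 'b set) module"
  where "ss_limit T d F i j =
    quotient_module (T (i + j)\<lparr>carrier := (\<Inter>r. ss_cycles T d F r i (i + j))\<rparr>)
      (\<Union>r. ss_boundaries T d F r i (i + j))"


section \<open>The Koszul-Cech double complex\<close>

definition koszul_cech ::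
    "('a, 'm) ring_scheme \<Rightarrow> 'a list \<Rightarrow> 'a list \<Rightarrow> int \<Rightarrow> int \<Rightarrow>
     ('a, nat set \<Rightarrow> nat set \<Rightarrow> ('a \<times> 'a) set) module"
  where "koszul_cech R fs gs i j = koszul fs (cech R gs (regular_module R) j) i"

definition koszul_cech_total_diff ::
    "('a, 'm) ring_scheme \<Rightarrow> 'a list \<Rightarrow> 'a list \<Rightarrow> int \<Rightarrow>
     (int \<Rightarrow> nat set \<Rightarrow> nat set \<Rightarrow> ('a \<times> 'a) set) \<Rightarrow>
     (int \<Rightarrow> nat set \<Rightarrow> nat set \<Rightarrow> ('a \<times> 'a) set)"
  where "koszul_cech_total_diff R fs gs =
    total_diff (koszul_cech R fs gs)
      (\<lambda>i j. koszul_diff fs (cech R gs (regular_module R) j) i)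
      (\<lambda>i j. koszul_map fs (cech_diff R gs (regular_module R) j) i)"

definition koszul_cech_limit ::
    "('a, 'm) ring_scheme \<Rightarrow> 'a list \<Rightarrow> 'a list \<Rightarrow> int \<Rightarrow> int \<Rightarrow>
     ('a, (int \<Rightarrow> nat set \<Rightarrow> nat set \<Rightarrow> ('a \<times> 'a) set) set) module"
  where "koszul_cech_limit R fs gs =
    ss_limit (total_complex (koszul_cech R fs gs)) (koszul_cech_total_diff R fs gs)
      (total_filtration (koszul_cech R fs gs))"

end

(* By convergence, the support of H^n(T) is the finite union of the supports of the E_infinity terms
   of total degree n, hence closed. For a regular sequence f of length c the Koszul cocomplex is
   acyclic below degree c, also after localization, so that H^(n+c)(T) is the n-th cohomology of the
   complex C(g;R) / (f) C(g;R) = C(g;R/(f)), i.e. the n-th Cech cohomology of R/(f).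

   It remains to compare Cech cohomology with the cohomology of the torsion functor on an injective
   resolution E of R/(f). In the double complex C^j(g;E^i), the columns are exact in positive degree
   since localization is exact, and the rows are exact in positive degree since the power-torsion
   submodules Q of an injective module over a noetherian ring map onto their localizations Q_g. A
   staircase argument then identifies both cohomologies. Everything is done on the level of supports:
   P lies in Supp(Z/B) if and only if some x in Z satisfies s x \<notin> B for all s outside P. *)

theory Submission
  imports Defs
begin

section \<open>Modules, homomorphisms and quotients\<close>

text \<open>The Koszul total complex, the Cech complex and the torsion complex of \<open>E\<close>
  live on different types. The criterion on elements lets one element be traded for another across
  these types, with no isomorphism to be built. The type of R/(f) is avoided altogether: its Cech
  complex is replaced by that of R modulo the fractions with numerators in (f). Both acyclicity
  arguments are inductions over initial segments. On the Koszul side one works with subsets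
  containing 0, ..., i-1 and modulo the first i elements of f, so that a step uses exactly the
  regularity of the next one. On the Cech side a cocycle is moved to subsets avoiding 0, ..., i-1,
  while its numerators become torsion for the first i generators; a step needs torsion elements of
  an injective module to be divisible by the next generator, up to a power of it, within the torsion
  submodule. Injectivity is tested on modules on the type of R, and it is applied to a map from one
  ideal of R to \<open>E\<close>; the work goes into choosing that ideal.\<close>

lemma (in module) smult_left_commute:
  "\<lbrakk>a \<in> carrier R; b \<in> carrier R; x \<in> carrier M\<rbrakk> \<Longrightarrow> a \<odot>\<^bsub>M\<^esub> (b \<odot>\<^bsub>M\<^esub> x) = b \<odot>\<^bsub>M\<^esub> (a \<odot>\<^bsub>M\<^esub> x)"
  by (metis R.m_comm smult_assoc1)

lemma (in module) minus_zero [simp]: "\<ominus>\<^bsub>M\<^esub> \<zero>\<^bsub>M\<^esub> = \<zero>\<^bsub>M\<^esub>"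
  by (rule M.minus_equality) simp_all

text \<open>With these rules the method \<open>algebra\<close> normalises module terms over a
  commutative ring. \<open>smult_left_commute\<close> is among them because clearing denominators
  permutes scalars all the time.\<close>

lemmas (in module) module_simprules
  [algebra module "zero M" "add M" "a_inv M" "a_minus M" "smult M"] =
  M.a_closed M.zero_closed M.a_inv_closed M.minus_closed smult_closed
  M.a_assoc M.l_zero M.l_neg M.a_comm M.minus_eq
  M.r_zero M.r_neg M.r_neg2 M.r_neg1 M.minus_add M.minus_minus minus_zero
  M.a_lcomm smult_l_distr smult_r_distr smult_assoc1 smult_one smult_l_null smult_r_null
  smult_l_minus smult_r_minus smult_left_commute
  R.zero_closed R.one_closed R.a_closed R.m_closed R.a_inv_closed

lemma (in module) minus_zero_right: "x \<in> carrier M \<Longrightarrow> x \<ominus>\<^bsub>M\<^esub> \<zero>\<^bsub>M\<^esub> = x"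
  by algebra

lemma (in module) minus_eq_zero_iff:
  assumes "x \<in> carrier M" "y \<in> carrier M"
  shows "x \<ominus>\<^bsub>M\<^esub> y = \<zero>\<^bsub>M\<^esub> \<longleftrightarrow> x = y"
proof
  assume "x \<ominus>\<^bsub>M\<^esub> y = \<zero>\<^bsub>M\<^esub>"
  then have "x \<ominus>\<^bsub>M\<^esub> y \<oplus>\<^bsub>M\<^esub> y = \<zero>\<^bsub>M\<^esub> \<oplus>\<^bsub>M\<^esub> y" by simp
  moreover have "x \<ominus>\<^bsub>M\<^esub> y \<oplus>\<^bsub>M\<^esub> y = x" using assms by algebra
  ultimately show "x = y" using assms by simp
qed (use assms in \<open>simp add: M.minus_eq M.r_neg\<close>)

lemma (in module) submodule_zero: "submodule H R M \<Longrightarrow> \<zero>\<^bsub>M\<^esub> \<in> H"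
  using submodule.axioms(1) subgroup.one_closed by fastforce

lemma (in module) submodule_minus:
  "submodule H R M \<Longrightarrow> x \<in> H \<Longrightarrow> y \<in> H \<Longrightarrow> x \<ominus>\<^bsub>M\<^esub> y \<in> H"
  unfolding a_minus_def by (simp add: submoduleE)

text \<open>Isolates one summand of a differential: later on, the whole sum and the remaining
  summands are known to lie in a submodule, and the last summand is the one of interest.\<close>

lemma (in module) submodule_add_cancel:
  assumes "submodule H R M" "x \<oplus>\<^bsub>M\<^esub> y \<in> H" "y \<in> H" "x \<in> carrier M"
  shows "x \<in> H"
proof -
  have y: "y \<in> carrier M" using submoduleE(1)[OF assms(1)] assms(3) by blast
  have "(x \<oplus>\<^bsub>M\<^esub> y) \<ominus>\<^bsub>M\<^esub> y \<in> H" using submodule_minus[OF assms(1-3)] .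
  also have "(x \<oplus>\<^bsub>M\<^esub> y) \<ominus>\<^bsub>M\<^esub> y = x" using y assms(4) by algebra
  finally show ?thesis .
qed

lemma (in module) submodule_finsum:
  assumes "submodule H R M" "\<And>a. a \<in> A \<Longrightarrow> h a \<in> H"
  shows "finsum M h A \<in> H"
proof (cases "finite A")
  case True
  then show ?thesis using assms(2)
  proof (induction A)
    case (insert a A)
    have "h \<in> A \<rightarrow> carrier M" "h a \<in> carrier M"
      using insert submoduleE(1)[OF assms(1)] by blast+
    then show ?case using insert submoduleE(5)[OF assms(1)] by (simp add: M.finsum_insert)
  qed (simp add: submodule_zero[OF assms(1)])
qed (simp add: submodule_zero[OF assms(1)])

lemma (in module) finsum_eq_single:
  assumes "finite A" "i \<in> A" "h i \<in> carrier M" "\<And>a. a \<in> A \<Longrightarrow> a \<noteq> i \<Longrightarrow> h a = \<zero>\<^bsub>M\<^esub>"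
  shows "finsum M h A = h i"
proof -
  have "finsum M h A = finsum M h {i}"
    by (rule M.add.finprod_mono_neutral_cong_right) (use assms in \<open>auto, metis M.zero_closed\<close>)
  then show ?thesis using assms(3) by simp
qed

lemma submodule_subset: "submodule H R M \<Longrightarrow> H \<subseteq> carrier M"
  using submodule.axioms(1) subgroup.subset by fastforce

subsection \<open>Homomorphisms\<close>

lemma module_homI:
  assumes "\<And>x. x \<in> carrier M \<Longrightarrow> h x \<in> carrier N"
    "\<And>x y. x \<in> carrier M \<Longrightarrow> y \<in> carrier M \<Longrightarrow> h (x \<oplus>\<^bsub>M\<^esub> y) = h x \<oplus>\<^bsub>N\<^esub> h y"
    "\<And>a x. a \<in> carrier R \<Longrightarrow> x \<in> carrier M \<Longrightarrow> h (a \<odot>\<^bsub>M\<^esub> x) = a \<odot>\<^bsub>N\<^esub> h x"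
  shows "h \<in> module_hom R M N"
  using assms unfolding module_hom_def by auto

lemma module_hom_closed: "h \<in> module_hom R M N \<Longrightarrow> x \<in> carrier M \<Longrightarrow> h x \<in> carrier N"
  unfolding module_hom_def by auto

lemma module_hom_add:
  "h \<in> module_hom R M N \<Longrightarrow> x \<in> carrier M \<Longrightarrow> y \<in> carrier M \<Longrightarrow> h (x \<oplus>\<^bsub>M\<^esub> y) = h x \<oplus>\<^bsub>N\<^esub> h y"
  unfolding module_hom_def by auto

lemma module_hom_smult:
  "h \<in> module_hom R M N \<Longrightarrow> a \<in> carrier R \<Longrightarrow> x \<in> carrier M \<Longrightarrow> h (a \<odot>\<^bsub>M\<^esub> x) = a \<odot>\<^bsub>N\<^esub> h x"
  unfolding module_hom_def by auto

lemma module_hom_comp: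
  "h \<in> module_hom R M N \<Longrightarrow> k \<in> module_hom R N L \<Longrightarrow> (\<lambda>x. k (h x)) \<in> module_hom R M L"
  by (rule module_homI) (simp_all add: module_hom_closed module_hom_add module_hom_smult)

text \<open>The record type of the locale \<open>module\<close> has an extension slot, which \<open>signed\<close> does not allow.\<close>

locale plain_module = module R M for R (structure) and M :: "('a, 'b) module" (structure)

context
  fixes R :: "('a, 'm) ring_scheme" and M :: "('a, 'b) module" and N :: "('a, 'c) module" and h
  assumes M: "module R M" and N: "module R N" and h: "h \<in> module_hom R M N"
begin

interpretation M: module R M by (fact M)
interpretation N: module R N by (fact N)

lemma module_hom_zero: "h \<zero>\<^bsub>M\<^esub> = \<zero>\<^bsub>N\<^esub>"
  using module_hom_smult[OF h, of "\<zero>\<^bsub>R\<^esub>" "\<zero>\<^bsub>M\<^esub>"] module_hom_closed[OF h, of "\<zero>\<^bsub>M\<^esub>"] by simp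

lemma module_hom_neg: "x \<in> carrier M \<Longrightarrow> h (\<ominus>\<^bsub>M\<^esub> x) = \<ominus>\<^bsub>N\<^esub> h x"
  using module_hom_smult[OF h, of "\<ominus>\<^bsub>R\<^esub> \<one>\<^bsub>R\<^esub>" "x"] module_hom_closed[OF h, of x]
  by (simp add: M.smult_l_minus N.smult_l_minus)

lemma module_hom_minus:
  "x \<in> carrier M \<Longrightarrow> y \<in> carrier M \<Longrightarrow> h (x \<ominus>\<^bsub>M\<^esub> y) = h x \<ominus>\<^bsub>N\<^esub> h y"
  unfolding a_minus_def by (simp add: module_hom_neg module_hom_add[OF h])

lemma module_hom_finsum:
  assumes "f \<in> A \<rightarrow> carrier M"
  shows "h (finsum M f A) = finsum N (\<lambda>a. h (f a)) A"
proof (cases "finite A")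
  case True
  then show ?thesis using assms
  proof (induction A)
    case (insert a A)
    have "(\<lambda>a. h (f a)) \<in> A \<rightarrow> carrier N" "h (f a) \<in> carrier N"
      using insert.prems module_hom_closed[OF h] by blast+
    with insert show ?case
      by (simp add: M.M.finsum_insert N.M.finsum_insert module_hom_add[OF h])
  qed (simp add: module_hom_zero)
qed (simp add: module_hom_zero)

lemma module_hom_signed: "x \<in> carrier M \<Longrightarrow> h (signed M n x) = signed N n (h x)"
  by (simp add: signed_def module_hom_neg)

lemma submodule_preimage:
  assumes "submodule H R N"
  shows "submodule {x \<in> carrier M. h x \<in> H} R M"
  using N.submoduleE[OF assms] N.submodule_zero[OF assms]
  by (intro M.submoduleI)
    (auto simp: module_hom_zero module_hom_neg module_hom_add[OF h] module_hom_smult[OF h])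

lemma submodule_image:
  assumes "submodule H R M"
  shows "submodule (h ` H) R N"
proof (intro N.submoduleI)
  note H = M.submoduleE[OF assms] M.submodule_zero[OF assms]
  show "h ` H \<subseteq> carrier N" using H(1) module_hom_closed[OF h] by auto
  show "\<zero>\<^bsub>N\<^esub> \<in> h ` H" using H(7) module_hom_zero by force
  show "\<ominus>\<^bsub>N\<^esub> a \<in> h ` H" if a: "a \<in> h ` H" for a
  proof -
    obtain x where x: "x \<in> H" "a = h x" using a by blast
    then have "\<ominus>\<^bsub>N\<^esub> a = h (\<ominus>\<^bsub>M\<^esub> x)" using H(1) by (auto simp: module_hom_neg)
    then show ?thesis using H(3) x by blast
  qed
  show "a \<oplus>\<^bsub>N\<^esub> b \<in> h ` H" if ab: "a \<in> h ` H" "b \<in> h ` H" for a b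
  proof -
    obtain x y where x: "x \<in> H" "a = h x" "y \<in> H" "b = h y" using ab by blast
    then have "x \<in> carrier M" "y \<in> carrier M" using H(1) by auto
    then have "a \<oplus>\<^bsub>N\<^esub> b = h (x \<oplus>\<^bsub>M\<^esub> y)" using x by (simp add: module_hom_add[OF h])
    then show ?thesis using H(5) x by blast
  qed
  show "c \<odot>\<^bsub>N\<^esub> a \<in> h ` H" if ca: "c \<in> carrier R" "a \<in> h ` H" for c a
  proof -
    obtain x where x: "x \<in> H" "a = h x" using ca by blast
    then have "c \<odot>\<^bsub>N\<^esub> a = h (c \<odot>\<^bsub>M\<^esub> x)" using H(1) ca(1) by (auto simp: module_hom_smult[OF h])
    then show ?thesis using H(4) ca(1) x by blast
  qed
qed

lemma submodule_kernel: "submodule {x \<in> carrier M. h x = \<zero>\<^bsub>N\<^esub>} R M"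
  by (intro M.submoduleI)
    (auto simp: module_hom_zero module_hom_neg module_hom_add[OF h] module_hom_smult[OF h])

end

context plain_module
begin

lemma signed_closed [simp]: "x \<in> carrier M \<Longrightarrow> signed M n x \<in> carrier M"
  by (simp add: signed_def)

lemma signed_zero [simp]: "signed M n \<zero>\<^bsub>M\<^esub> = \<zero>\<^bsub>M\<^esub>"
  by (simp add: signed_def)

lemma signed_signed: "x \<in> carrier M \<Longrightarrow> signed M n (signed M k x) = signed M (n + k) x"
  by (auto simp: signed_def)

lemma signed_Suc: "x \<in> carrier M \<Longrightarrow> signed M (n + 1) x = \<ominus>\<^bsub>M\<^esub> signed M n x"
  by (auto simp: signed_def)

lemma signed_add:
  "x \<in> carrier M \<Longrightarrow> y \<in> carrier M \<Longrightarrow> signed M n (x \<oplus>\<^bsub>M\<^esub> y) = signed M n x \<oplus>\<^bsub>M\<^esub> signed M n y"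
  by (auto simp: signed_def M.minus_add M.a_comm)

lemma signed_smult:
  "a \<in> carrier R \<Longrightarrow> x \<in> carrier M \<Longrightarrow> signed M n (a \<odot>\<^bsub>M\<^esub> x) = a \<odot>\<^bsub>M\<^esub> signed M n x"
  by (auto simp: signed_def smult_r_minus)

lemma signed_in_submodule_iff:
  assumes "submodule H R M" "x \<in> carrier M"
  shows "signed M n x \<in> H \<longleftrightarrow> x \<in> H"
  using submoduleE(3)[OF assms(1)] assms(2) by (auto simp: signed_def) (metis M.minus_minus)

end

subsection \<open>Quotients and support\<close>

lemma abelian_subgroup_submodule:
  assumes "module R M" "submodule N R M"
  shows "abelian_subgroup N M"
proof -
  interpret module R M by fact
  show ?thesis
    by (rule abelian_subgroupI3)
      (use assms submodule.axioms(1) M.abelian_group_axioms in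
        \<open>auto simp: additive_subgroup_def\<close>)
qed

context
  fixes R :: "('a, 'm) ring_scheme" and M :: "('a, 'b) module" and N
  assumes M: "module R M" and N: "submodule N R M"
begin

interpretation M: module R M by (fact M)
interpretation N: abelian_subgroup N M by (rule abelian_subgroup_submodule[OF M N])

lemma coset_eq_iff:
  assumes "x \<in> carrier M" "y \<in> carrier M"
  shows "N +>\<^bsub>M\<^esub> x = N +>\<^bsub>M\<^esub> y \<longleftrightarrow> x \<ominus>\<^bsub>M\<^esub> y \<in> N"
  by (metis M.M.a_coset_add_inv1 M.M.a_coset_add_inv2 M.M.a_coset_join1 M.M.a_coset_join2
      M.M.minus_closed M.M.minus_eq N.a_subgroup N.a_subset assms)

lemma quotient_zero: "\<zero>\<^bsub>quotient_module M N\<^esub> = N +>\<^bsub>M\<^esub> \<zero>\<^bsub>M\<^esub>"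
  by (simp add: quotient_module_def M.M.a_coset_join2 N.a_subgroup)

lemma quotient_carrier: "carrier (quotient_module M N) = {N +>\<^bsub>M\<^esub> x | x. x \<in> carrier M}"
  by (auto simp: quotient_module_def A_RCOSETS_def RCOSETS_def a_r_coset_def)

lemma quotient_add:
  "x \<in> carrier M \<Longrightarrow> y \<in> carrier M \<Longrightarrow>
    (N +>\<^bsub>M\<^esub> x) \<oplus>\<^bsub>quotient_module M N\<^esub> (N +>\<^bsub>M\<^esub> y) = N +>\<^bsub>M\<^esub> (x \<oplus>\<^bsub>M\<^esub> y)"
  by (simp add: quotient_module_def N.a_rcos_sum)

text \<open>The action on a coset is a union over its representatives. All members of this union are
  the same coset, and since the coset is nonempty that common value is the union.\<close>

lemma quotient_smult:
  assumes "a \<in> carrier R" "x \<in> carrier M"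
  shows "a \<odot>\<^bsub>quotient_module M N\<^esub> (N +>\<^bsub>M\<^esub> x) = N +>\<^bsub>M\<^esub> (a \<odot>\<^bsub>M\<^esub> x)"
proof -
  have "N +>\<^bsub>M\<^esub> (a \<odot>\<^bsub>M\<^esub> y) = N +>\<^bsub>M\<^esub> (a \<odot>\<^bsub>M\<^esub> x)" if y: "y \<in> N +>\<^bsub>M\<^esub> x" for y
  proof -
    obtain n where n: "n \<in> N" "y = n \<oplus>\<^bsub>M\<^esub> x" using y by (auto simp: a_r_coset_def')
    have nM: "n \<in> carrier M" using n(1) N.a_subset by blast
    have "a \<odot>\<^bsub>M\<^esub> y \<ominus>\<^bsub>M\<^esub> a \<odot>\<^bsub>M\<^esub> x = a \<odot>\<^bsub>M\<^esub> n" unfolding n(2) using nM assms by algebra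
    then have "a \<odot>\<^bsub>M\<^esub> y \<ominus>\<^bsub>M\<^esub> a \<odot>\<^bsub>M\<^esub> x \<in> N" using M.submoduleE(4)[OF N] n(1) assms(1) by simp
    then show ?thesis using coset_eq_iff n(2) nM assms by auto
  qed
  moreover have "N +>\<^bsub>M\<^esub> x \<noteq> {}" using N.a_rcos_self[OF assms(2)] by blast
  ultimately have "(\<Union>y\<in>N +>\<^bsub>M\<^esub> x. N +>\<^bsub>M\<^esub> (a \<odot>\<^bsub>M\<^esub> y)) = N +>\<^bsub>M\<^esub> (a \<odot>\<^bsub>M\<^esub> x)"
    by (rule SUP_eq_const[rotated])
  then show ?thesis by (simp add: quotient_module_def)
qed

lemma module_quotient: "module R (quotient_module M N)"
proof (rule moduleI)
  let ?Q = "quotient_module M N"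
  note rules = quotient_carrier quotient_add quotient_smult quotient_zero
  show "cring R" by (rule M.R.is_cring)
  show "abelian_group ?Q"
  proof (rule abelian_groupI)
    fix X assume "X \<in> carrier ?Q"
    then obtain x where x: "x \<in> carrier M" "X = N +>\<^bsub>M\<^esub> x" by (auto simp: quotient_carrier)
    have "(N +>\<^bsub>M\<^esub> (\<ominus>\<^bsub>M\<^esub> x)) \<oplus>\<^bsub>?Q\<^esub> X = \<zero>\<^bsub>?Q\<^esub>"
      using x by (simp add: quotient_add quotient_zero M.M.l_neg)
    then show "\<exists>Y\<in>carrier ?Q. Y \<oplus>\<^bsub>?Q\<^esub> X = \<zero>\<^bsub>?Q\<^esub>"
      using x quotient_carrier by blast
  next
    fix X Y assume "X \<in> carrier ?Q" "Y \<in> carrier ?Q"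
    then obtain x y where x: "x \<in> carrier M" "X = N +>\<^bsub>M\<^esub> x" "y \<in> carrier M" "Y = N +>\<^bsub>M\<^esub> y"
      by (auto simp: quotient_carrier)
    then show "X \<oplus>\<^bsub>?Q\<^esub> Y \<in> carrier ?Q" "X \<oplus>\<^bsub>?Q\<^esub> Y = Y \<oplus>\<^bsub>?Q\<^esub> X"
      using M.M.a_comm by (auto simp: rules)
  next
    fix X Y Z assume "X \<in> carrier ?Q" "Y \<in> carrier ?Q" "Z \<in> carrier ?Q"
    then obtain x y z where "x \<in> carrier M" "X = N +>\<^bsub>M\<^esub> x" "y \<in> carrier M" "Y = N +>\<^bsub>M\<^esub> y"
      "z \<in> carrier M" "Z = N +>\<^bsub>M\<^esub> z"
      by (auto simp: quotient_carrier)
    then show "(X \<oplus>\<^bsub>?Q\<^esub> Y) \<oplus>\<^bsub>?Q\<^esub> Z = X \<oplus>\<^bsub>?Q\<^esub> (Y \<oplus>\<^bsub>?Q\<^esub> Z)"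
      by (simp add: rules M.M.a_assoc)
  next
    show "\<zero>\<^bsub>?Q\<^esub> \<in> carrier ?Q" using M.M.zero_closed unfolding rules by blast
  next
    fix X assume "X \<in> carrier ?Q"
    then show "\<zero>\<^bsub>?Q\<^esub> \<oplus>\<^bsub>?Q\<^esub> X = X" by (auto simp: rules)
  qed
  fix a X assume a: "a \<in> carrier R" and "X \<in> carrier ?Q"
  then obtain x where x: "x \<in> carrier M" "X = N +>\<^bsub>M\<^esub> x" by (auto simp: quotient_carrier)
  show "a \<odot>\<^bsub>?Q\<^esub> X \<in> carrier ?Q" using a x by (auto simp: rules)
  fix b assume b: "b \<in> carrier R"
  show "(a \<oplus>\<^bsub>R\<^esub> b) \<odot>\<^bsub>?Q\<^esub> X = (a \<odot>\<^bsub>?Q\<^esub> X) \<oplus>\<^bsub>?Q\<^esub> (b \<odot>\<^bsub>?Q\<^esub> X)"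
    using a b x by (simp add: rules M.smult_l_distr)
  show "(a \<otimes>\<^bsub>R\<^esub> b) \<odot>\<^bsub>?Q\<^esub> X = a \<odot>\<^bsub>?Q\<^esub> (b \<odot>\<^bsub>?Q\<^esub> X)"
    using a b x by (simp add: rules M.smult_assoc1)
next
  show "\<one>\<^bsub>R\<^esub> \<odot>\<^bsub>quotient_module M N\<^esub> X = X" if "X \<in> carrier (quotient_module M N)" for X
    using that by (auto simp: quotient_carrier quotient_smult)
  let ?Q = "quotient_module M N"
  fix a X Y assume a: "a \<in> carrier R" and "X \<in> carrier ?Q" "Y \<in> carrier ?Q"
  then obtain x y where "x \<in> carrier M" "X = N +>\<^bsub>M\<^esub> x" "y \<in> carrier M" "Y = N +>\<^bsub>M\<^esub> y"
    by (auto simp: quotient_carrier)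
  then show "a \<odot>\<^bsub>?Q\<^esub> (X \<oplus>\<^bsub>?Q\<^esub> Y) = (a \<odot>\<^bsub>?Q\<^esub> X) \<oplus>\<^bsub>?Q\<^esub> (a \<odot>\<^bsub>?Q\<^esub> Y)"
    using a by (simp add: quotient_add quotient_smult M.smult_r_distr)
qed

end

lemma (in cring) regular_module_simps [simp]:
  "carrier (regular_module R) = carrier R" "\<zero>\<^bsub>regular_module R\<^esub> = \<zero>"
  "x \<oplus>\<^bsub>regular_module R\<^esub> y = x \<oplus> y" "a \<odot>\<^bsub>regular_module R\<^esub> x = a \<otimes> x"
  by (simp_all add: regular_module_def)

lemma (in cring) regular_module_module: "module R (regular_module R)"
proof (rule moduleI)
  show "abelian_group (regular_module R)"
    by (rule abelian_groupI) (auto simp: a_ac intro: bexI[of _ "\<ominus> x" for x] l_neg)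
qed (auto simp: is_cring l_distr r_distr m_assoc)

lemma (in cring) regular_module_inv [simp]:
  assumes "x \<in> carrier R" shows "\<ominus>\<^bsub>regular_module R\<^esub> x = \<ominus> x"
proof -
  interpret r: module R "regular_module R" by (rule regular_module_module)
  show ?thesis using assms r.M.minus_equality[of "\<ominus> x" x] by (simp add: l_neg)
qed

lemma (in cring) submodule_ideal:
  assumes "ideal J R" shows "submodule J R (regular_module R)"
proof -
  interpret r: module R "regular_module R" by (rule regular_module_module)
  interpret ideal J R by fact
  show ?thesis by (rule r.submoduleI) (auto simp: a_Hcarr I_l_closed)
qed

section \<open>Localization\<close>

lemma submonoid_prime_complement:
  assumes "primeideal P R"
  shows "submonoid (carrier R - P) R"
proof -
  interpret primeideal P R by fact
  have "\<one>\<^bsub>R\<^esub> \<notin> P" using I_notcarr one_imp_carrier by blast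
  then show ?thesis by unfold_locales (use I_prime in auto)
qed

locale localized_module = module R M + S: submonoid S R
  for R (structure) and S and M :: "('a, 'b) module" (structure)
begin

abbreviation frac :: "'b \<Rightarrow> 'a \<Rightarrow> ('b \<times> 'a) set" where "frac \<equiv> loc_frac R S M"
abbreviation L where "L \<equiv> localization R S M"

lemma S_carrier [simp, intro]: "s \<in> S \<Longrightarrow> s \<in> carrier R"
  using S.subset by blast

lemma mem_frac:
  "(m', s') \<in> frac m s \<longleftrightarrow> m' \<in> carrier M \<and> s' \<in> S \<and>
    (\<exists>u\<in>S. u \<odot>\<^bsub>M\<^esub> (s' \<odot>\<^bsub>M\<^esub> m) = u \<odot>\<^bsub>M\<^esub> (s \<odot>\<^bsub>M\<^esub> m'))"
  by (simp add: loc_frac_def)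

lemma mem_frac_self: "m \<in> carrier M \<Longrightarrow> s \<in> S \<Longrightarrow> (m, s) \<in> frac m s"
  unfolding mem_frac by blast

lemma frac_trans:
  assumes "m \<in> carrier M" "s \<in> S" "m' \<in> carrier M" "s' \<in> S" "(m', s') \<in> frac m s"
  shows "frac m' s' \<subseteq> frac m s"
proof safe
  fix m'' s'' assume "(m'', s'') \<in> frac m' s'"
  then obtain v where v: "m'' \<in> carrier M" "s'' \<in> S" "v \<in> S"
    "v \<odot>\<^bsub>M\<^esub> (s'' \<odot>\<^bsub>M\<^esub> m') = v \<odot>\<^bsub>M\<^esub> (s' \<odot>\<^bsub>M\<^esub> m'')" by (auto simp: mem_frac)
  obtain u where u: "u \<in> S" "u \<odot>\<^bsub>M\<^esub> (s' \<odot>\<^bsub>M\<^esub> m) = u \<odot>\<^bsub>M\<^esub> (s \<odot>\<^bsub>M\<^esub> m')"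
    using assms(5) by (auto simp: mem_frac)
  \<comment> \<open>The middle denominator \<open>s'\<close> has to be included besides the two
    witnesses, since \<open>m\<close> and \<open>m''\<close> are only linked through
    \<open>m'\<close>.\<close>
  let ?w = "u \<otimes> v \<otimes> s'"
  have "?w \<odot>\<^bsub>M\<^esub> (s'' \<odot>\<^bsub>M\<^esub> m) = (v \<otimes> s'') \<odot>\<^bsub>M\<^esub> (u \<odot>\<^bsub>M\<^esub> (s' \<odot>\<^bsub>M\<^esub> m))"
    using assms u(1) v S_carrier by algebra
  also have "\<dots> = (u \<otimes> s) \<odot>\<^bsub>M\<^esub> (v \<odot>\<^bsub>M\<^esub> (s'' \<odot>\<^bsub>M\<^esub> m'))"
    unfolding u(2) using assms u(1) v(1-3) S_carrier by algebra
  also have "\<dots> = ?w \<odot>\<^bsub>M\<^esub> (s \<odot>\<^bsub>M\<^esub> m'')"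
    unfolding v(4) using assms u(1) v(1-3) S_carrier by algebra
  finally show "(m'', s'') \<in> frac m s"
    unfolding mem_frac using v(1,2) u(1) v(3) assms(4) by (meson S.m_closed)
qed

lemma frac_eq_iff_mem:
  assumes "m \<in> carrier M" "s \<in> S" "m' \<in> carrier M" "s' \<in> S"
  shows "frac m s = frac m' s' \<longleftrightarrow> (m', s') \<in> frac m s"
proof
  assume a: "(m', s') \<in> frac m s"
  then have "(m, s) \<in> frac m' s'" using assms unfolding mem_frac by metis
  then show "frac m s = frac m' s'" using frac_trans a assms by blast
qed (use assms mem_frac_self in auto)

lemma frac_eq_iff:
  assumes "m \<in> carrier M" "s \<in> S" "m' \<in> carrier M" "s' \<in> S"
  shows "frac m s = frac m' s' \<longleftrightarrow> (\<exists>u\<in>S. u \<odot>\<^bsub>M\<^esub> (s' \<odot>\<^bsub>M\<^esub> m) = u \<odot>\<^bsub>M\<^esub> (s \<odot>\<^bsub>M\<^esub> m'))"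
  using frac_eq_iff_mem[OF assms] assms by (simp add: mem_frac)

lemma frac_cancel:
  assumes "m \<in> carrier M" "s \<in> S" "t \<in> carrier R" "t \<otimes> s \<in> S"
  shows "frac (t \<odot>\<^bsub>M\<^esub> m) (t \<otimes> s) = frac m s"
proof -
  have "\<one> \<odot>\<^bsub>M\<^esub> (s \<odot>\<^bsub>M\<^esub> (t \<odot>\<^bsub>M\<^esub> m)) = \<one> \<odot>\<^bsub>M\<^esub> ((t \<otimes> s) \<odot>\<^bsub>M\<^esub> m)"
    using assms S_carrier[OF assms(2)] by algebra
  then show ?thesis using assms by (subst frac_eq_iff) (auto intro: S.one_closed)
qed

text \<open>All operations on a localization are unions over representatives; this evaluates such a
  union at one chosen representative as soon as the summand depends on the fraction only.\<close>

lemma UN_frac: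
  assumes "m \<in> carrier M" "s \<in> S"
    and "\<And>m' s'. m' \<in> carrier M \<Longrightarrow> s' \<in> S \<Longrightarrow> frac m' s' = frac m s \<Longrightarrow> F m' s' = F m s"
  shows "(\<Union>(m', s')\<in>frac m s. F m' s') = F m s"
proof -
  have "F m' s' = F m s" if "(m', s') \<in> frac m s" for m' s'
  proof -
    have m': "m' \<in> carrier M" "s' \<in> S" using that by (simp_all add: mem_frac)
    then show ?thesis using that assms(3)[OF m'] frac_eq_iff_mem[OF assms(1,2) m'] by simp
  qed
  then have "(\<lambda>(m', s'). F m' s') p = F m s" if "p \<in> frac m s" for p
    using that by (cases p) simp
  then show ?thesis using mem_frac_self[OF assms(1,2)] by (intro SUP_eq_const) blast+
qed

lemma loc_carrier: "carrier L = {frac m s | m s. m \<in> carrier M \<and> s \<in> S}"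
  by (simp add: localization_def)

lemma frac_closed [simp]: "m \<in> carrier M \<Longrightarrow> s \<in> S \<Longrightarrow> frac m s \<in> carrier L"
  by (auto simp: loc_carrier)

lemma locE:
  assumes "x \<in> carrier L"
  obtains m s where "m \<in> carrier M" "s \<in> S" "x = frac m s"
  using assms by (auto simp: loc_carrier)

lemma loc_zero: "\<zero>\<^bsub>L\<^esub> = frac \<zero>\<^bsub>M\<^esub> \<one>"
  by (simp add: localization_def)

lemma frac_eq_zero_iff:
  assumes "m \<in> carrier M" "s \<in> S"
  shows "frac m s = \<zero>\<^bsub>L\<^esub> \<longleftrightarrow> (\<exists>u\<in>S. u \<odot>\<^bsub>M\<^esub> m = \<zero>\<^bsub>M\<^esub>)"
  unfolding loc_zero using assms by (subst frac_eq_iff) (auto intro: S.one_closed)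

lemma loc_smult:
  assumes "a \<in> carrier R" "m \<in> carrier M" "s \<in> S"
  shows "a \<odot>\<^bsub>L\<^esub> frac m s = frac (a \<odot>\<^bsub>M\<^esub> m) s"
proof -
  have "(\<Union>(m', s')\<in>frac m s. frac (a \<odot>\<^bsub>M\<^esub> m') s') = frac (a \<odot>\<^bsub>M\<^esub> m) s"
  proof (rule UN_frac)
    fix m' s' assume m': "m' \<in> carrier M" "s' \<in> S" "frac m' s' = frac m s"
    then obtain u where u: "u \<in> S" "u \<odot>\<^bsub>M\<^esub> (s \<odot>\<^bsub>M\<^esub> m') = u \<odot>\<^bsub>M\<^esub> (s' \<odot>\<^bsub>M\<^esub> m)"
      using assms frac_eq_iff by auto
    have "u \<odot>\<^bsub>M\<^esub> (s \<odot>\<^bsub>M\<^esub> (a \<odot>\<^bsub>M\<^esub> m')) = a \<odot>\<^bsub>M\<^esub> (u \<odot>\<^bsub>M\<^esub> (s \<odot>\<^bsub>M\<^esub> m'))"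
      using assms m'(1,2) u(1) S_carrier by algebra
    also have "\<dots> = u \<odot>\<^bsub>M\<^esub> (s' \<odot>\<^bsub>M\<^esub> (a \<odot>\<^bsub>M\<^esub> m))"
      unfolding u(2) using assms m'(1,2) u(1) S_carrier by algebra
    finally show "frac (a \<odot>\<^bsub>M\<^esub> m') s' = frac (a \<odot>\<^bsub>M\<^esub> m) s"
      using m' assms u(1) by (subst frac_eq_iff) auto
  qed (use assms in auto)
  then show ?thesis by (simp add: localization_def)
qed

lemma loc_add:
  assumes "m \<in> carrier M" "s \<in> S" "n \<in> carrier M" "t \<in> S"
  shows "frac m s \<oplus>\<^bsub>L\<^esub> frac n t = frac ((t \<odot>\<^bsub>M\<^esub> m) \<oplus>\<^bsub>M\<^esub> (s \<odot>\<^bsub>M\<^esub> n)) (s \<otimes> t)"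
proof -
  let ?F = "\<lambda>m s n t. frac ((t \<odot>\<^bsub>M\<^esub> m) \<oplus>\<^bsub>M\<^esub> (s \<odot>\<^bsub>M\<^esub> n)) (s \<otimes> t)"
  \<comment> \<open>Independence of the representative is computed for the first argument only;
    \<open>comm\<close> transfers it to the second.\<close>
  have *: "?F m' s' n' t' = ?F m s n' t'"
    if "m \<in> carrier M" "s \<in> S" "m' \<in> carrier M" "s' \<in> S" "n' \<in> carrier M" "t' \<in> S"
      "frac m' s' = frac m s" for m s m' s' n' t'
  proof -
    note that' = that
    note prems = that(1-6) S_carrier[OF that(2)] S_carrier[OF that(4)] S_carrier[OF that(6)]
    obtain u where u: "u \<in> S" "u \<odot>\<^bsub>M\<^esub> (s \<odot>\<^bsub>M\<^esub> m') = u \<odot>\<^bsub>M\<^esub> (s' \<odot>\<^bsub>M\<^esub> m)"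
      using that' frac_eq_iff[of m' s' m s] by auto
    have "u \<odot>\<^bsub>M\<^esub> ((s \<otimes> t') \<odot>\<^bsub>M\<^esub> (t' \<odot>\<^bsub>M\<^esub> m' \<oplus>\<^bsub>M\<^esub> s' \<odot>\<^bsub>M\<^esub> n')) =
        (t' \<otimes> t') \<odot>\<^bsub>M\<^esub> (u \<odot>\<^bsub>M\<^esub> (s \<odot>\<^bsub>M\<^esub> m')) \<oplus>\<^bsub>M\<^esub> (u \<otimes> s \<otimes> s' \<otimes> t') \<odot>\<^bsub>M\<^esub> n'"
      using prems S_carrier[OF u(1)] by algebra
    also have "\<dots> = u \<odot>\<^bsub>M\<^esub> ((s' \<otimes> t') \<odot>\<^bsub>M\<^esub> (t' \<odot>\<^bsub>M\<^esub> m \<oplus>\<^bsub>M\<^esub> s \<odot>\<^bsub>M\<^esub> n'))"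
      unfolding u(2) using prems S_carrier[OF u(1)] by algebra
    finally show ?thesis using that(1-6) u(1)
      by (subst frac_eq_iff) (auto intro: S.m_closed)
  qed
  have comm: "?F m s n t = ?F n t m s"
    if "m \<in> carrier M" "s \<in> S" "n \<in> carrier M" "t \<in> S" for m s n t
    using that by (simp add: M.a_comm R.m_comm)
  have "frac m s \<oplus>\<^bsub>L\<^esub> frac n t = (\<Union>(m', s')\<in>frac m s. \<Union>(n', t')\<in>frac n t. ?F m' s' n' t')"
    by (simp add: localization_def)
  also have "\<dots> = (\<Union>(m', s')\<in>frac m s. ?F m' s' n t)"
  proof (intro SUP_cong refl, clarify)
    fix m' s' assume "(m', s') \<in> frac m s"
    then have m': "m' \<in> carrier M" "s' \<in> S" by (auto simp: mem_frac)
    show "(\<Union>(n', t')\<in>frac n t. ?F m' s' n' t') = ?F m' s' n t"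
    proof (rule UN_frac[OF assms(3,4)])
      fix n' t' assume n': "n' \<in> carrier M" "t' \<in> S" "frac n' t' = frac n t"
      have "?F m' s' n' t' = ?F n' t' m' s'" using comm m' n' by blast
      also have "\<dots> = ?F n t m' s'" using *[OF assms(3,4) n'(1,2) m' n'(3)] .
      also have "\<dots> = ?F m' s' n t" using comm m' assms by blast
      finally show "?F m' s' n' t' = ?F m' s' n t" .
    qed
  qed
  also have "\<dots> = ?F m s n t"
    using * assms by (intro UN_frac) blast+
  finally show ?thesis .
qed

lemma loc_add_same:
  assumes "m \<in> carrier M" "s \<in> S" "n \<in> carrier M"
  shows "frac m s \<oplus>\<^bsub>L\<^esub> frac n s = frac (m \<oplus>\<^bsub>M\<^esub> n) s"
proof -
  have "s \<odot>\<^bsub>M\<^esub> m \<oplus>\<^bsub>M\<^esub> s \<odot>\<^bsub>M\<^esub> n = s \<odot>\<^bsub>M\<^esub> (m \<oplus>\<^bsub>M\<^esub> n)" using assms by (simp add: smult_r_distr)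
  then show ?thesis using assms by (simp add: loc_add frac_cancel S.m_closed)
qed

text \<open>With a common denominator the additive axioms of the localization reduce to those for
  the numerators.\<close>

lemma frac_common:
  assumes "x \<in> carrier L" "y \<in> carrier L"
  obtains m n s where "m \<in> carrier M" "n \<in> carrier M" "s \<in> S" "x = frac m s" "y = frac n s"
proof -
  obtain m s n t where ms: "m \<in> carrier M" "s \<in> S" "x = frac m s" "n \<in> carrier M" "t \<in> S" "y = frac n t"
    using assms by (auto elim!: locE)
  have "x = frac (t \<odot>\<^bsub>M\<^esub> m) (s \<otimes> t)" "y = frac (s \<odot>\<^bsub>M\<^esub> n) (s \<otimes> t)"
    using ms frac_cancel[of m s t] frac_cancel[of n t s] R.m_comm[of s t] by (simp_all add: S.m_closed)
  moreover have "t \<odot>\<^bsub>M\<^esub> m \<in> carrier M" "s \<odot>\<^bsub>M\<^esub> n \<in> carrier M" "s \<otimes> t \<in> S"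
    using ms by (simp_all add: S.m_closed)
  ultimately show thesis using that by metis
qed

lemma loc_zero_eq: "s \<in> S \<Longrightarrow> \<zero>\<^bsub>L\<^esub> = frac \<zero>\<^bsub>M\<^esub> s"
  by (subst eq_commute, subst frac_eq_zero_iff) (auto intro: S.one_closed)

lemma module_localization: "module R L"
proof (rule moduleI)
  show "cring R" by (rule R.is_cring)
  show "abelian_group L"
  proof (rule abelian_groupI)
    fix x assume x: "x \<in> carrier L"
    then obtain m s where ms: "m \<in> carrier M" "s \<in> S" "x = frac m s" by (rule locE)
    show "\<zero>\<^bsub>L\<^esub> \<oplus>\<^bsub>L\<^esub> x = x" using ms by (simp add: loc_zero_eq[of s] loc_add_same)
    have "frac (\<ominus>\<^bsub>M\<^esub> m) s \<oplus>\<^bsub>L\<^esub> x = \<zero>\<^bsub>L\<^esub>"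
      using ms by (simp add: loc_zero_eq[of s] loc_add_same M.l_neg)
    then show "\<exists>y\<in>carrier L. y \<oplus>\<^bsub>L\<^esub> x = \<zero>\<^bsub>L\<^esub>" using ms by (metis M.a_inv_closed frac_closed)
    fix y assume y: "y \<in> carrier L"
    obtain m n s where mn: "m \<in> carrier M" "n \<in> carrier M" "s \<in> S" "x = frac m s" "y = frac n s"
      using frac_common[OF x y] .
    show "x \<oplus>\<^bsub>L\<^esub> y \<in> carrier L" using mn by (simp add: loc_add_same)
    show "x \<oplus>\<^bsub>L\<^esub> y = y \<oplus>\<^bsub>L\<^esub> x" using mn by (simp add: loc_add_same M.a_comm)
    fix z assume z: "z \<in> carrier L"
    obtain l t where lt: "l \<in> carrier M" "t \<in> S" "z = frac l t" using z by (rule locE)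
    have e: "x = frac (t \<odot>\<^bsub>M\<^esub> m) (t \<otimes> s)" "y = frac (t \<odot>\<^bsub>M\<^esub> n) (t \<otimes> s)"
      using mn lt by (simp_all add: frac_cancel S.m_closed)
    have "z = frac (s \<odot>\<^bsub>M\<^esub> l) (s \<otimes> t)" using mn lt by (simp add: frac_cancel S.m_closed)
    then have e': "z = frac (s \<odot>\<^bsub>M\<^esub> l) (t \<otimes> s)" using mn lt R.m_comm[of s t] by simp
    have "t \<otimes> s \<in> S" using mn lt by (auto intro: S.m_closed)
    then show "(x \<oplus>\<^bsub>L\<^esub> y) \<oplus>\<^bsub>L\<^esub> z = x \<oplus>\<^bsub>L\<^esub> (y \<oplus>\<^bsub>L\<^esub> z)"
      using mn(1-3) lt(1,2) unfolding e e' by (simp add: loc_add_same M.a_assoc)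
  next
    show "\<zero>\<^bsub>L\<^esub> \<in> carrier L" by (simp add: loc_zero S.one_closed)
  qed
  fix a x assume a: "a \<in> carrier R" and x: "x \<in> carrier L"
  then obtain m s where ms: "m \<in> carrier M" "s \<in> S" "x = frac m s" by (auto elim: locE)
  show "a \<odot>\<^bsub>L\<^esub> x \<in> carrier L" using a ms by (simp add: loc_smult)
  fix b assume b: "b \<in> carrier R"
  show "(a \<oplus> b) \<odot>\<^bsub>L\<^esub> x = (a \<odot>\<^bsub>L\<^esub> x) \<oplus>\<^bsub>L\<^esub> (b \<odot>\<^bsub>L\<^esub> x)"
    using a b ms by (simp add: loc_smult loc_add_same smult_l_distr)
  show "(a \<otimes> b) \<odot>\<^bsub>L\<^esub> x = a \<odot>\<^bsub>L\<^esub> (b \<odot>\<^bsub>L\<^esub> x)"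
    using a b ms by (simp add: loc_smult smult_assoc1)
next
  show "\<one> \<odot>\<^bsub>L\<^esub> x = x" if "x \<in> carrier L" for x
    using that by (auto elim!: locE simp: loc_smult)
  fix a x y assume a: "a \<in> carrier R" and x: "x \<in> carrier L" "y \<in> carrier L"
  obtain m n s where mn: "m \<in> carrier M" "n \<in> carrier M" "s \<in> S" "x = frac m s" "y = frac n s"
    using frac_common[OF x] .
  then show "a \<odot>\<^bsub>L\<^esub> (x \<oplus>\<^bsub>L\<^esub> y) = (a \<odot>\<^bsub>L\<^esub> x) \<oplus>\<^bsub>L\<^esub> (a \<odot>\<^bsub>L\<^esub> y)"
    using a by (simp add: loc_smult loc_add_same smult_r_distr)
qed

end

lemma localized_module_prime:
  "module R M \<Longrightarrow> primeideal P R \<Longrightarrow> localized_module R (carrier R - P) M"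
  using submonoid_prime_complement by (auto simp: localized_module_def)

text \<open>A fraction \<open>m/s\<close> vanishes if and only if some element outside
  \<open>P\<close> kills \<open>m\<close>, so the denominator drops out. From here on localizations
  at primes no longer occur.\<close>

lemma Supp_iff:
  assumes "module R M"
  shows "P \<in> Supp R M \<longleftrightarrow>
    primeideal P R \<and> (\<exists>x\<in>carrier M. \<forall>s\<in>carrier R - P. s \<odot>\<^bsub>M\<^esub> x \<noteq> \<zero>\<^bsub>M\<^esub>)"
proof (cases "primeideal P R")
  case True
  interpret localized_module R "carrier R - P" M
    by (rule localized_module_prime[OF assms True])
  have one: "\<one>\<^bsub>R\<^esub> \<in> carrier R - P" by (rule S.one_closed)
  have "\<zero>\<^bsub>L\<^esub> \<in> carrier L" by (simp add: loc_zero frac_closed[OF _ one] del: Diff_iff)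
  then have "carrier L \<noteq> {\<zero>\<^bsub>L\<^esub>} \<longleftrightarrow> (\<exists>x\<in>carrier L. x \<noteq> \<zero>\<^bsub>L\<^esub>)" by auto
  also have "\<dots> \<longleftrightarrow> (\<exists>m\<in>carrier M. \<exists>s\<in>carrier R - P. frac m s \<noteq> \<zero>\<^bsub>L\<^esub>)"
    unfolding loc_carrier by blast
  also have "\<dots> \<longleftrightarrow> (\<exists>m\<in>carrier M. \<exists>s\<in>carrier R - P. \<forall>u\<in>carrier R - P. u \<odot>\<^bsub>M\<^esub> m \<noteq> \<zero>\<^bsub>M\<^esub>)"
    by (intro bex_cong refl) (simp add: frac_eq_zero_iff del: Diff_iff)
  also have "\<dots> \<longleftrightarrow> (\<exists>m\<in>carrier M. \<forall>u\<in>carrier R - P. u \<odot>\<^bsub>M\<^esub> m \<noteq> \<zero>\<^bsub>M\<^esub>)"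
    by (intro bex_cong refl) (use one in blast)
  finally have "carrier L \<noteq> {\<zero>\<^bsub>L\<^esub>} \<longleftrightarrow>
    (\<exists>m\<in>carrier M. \<forall>u\<in>carrier R - P. u \<odot>\<^bsub>M\<^esub> m \<noteq> \<zero>\<^bsub>M\<^esub>)" .
  then show ?thesis using True unfolding Supp_def by blast
qed (simp add: Supp_def)

text \<open>The condition mentions elements of the ambient module only, neither cosets nor
  fractions. This makes subquotients of modules on unrelated types comparable.\<close>

lemma Supp_quotient_iff:
  assumes M: "module R M" and Z: "submodule Z R M" and N: "submodule N R M" and "N \<subseteq> Z"
  shows "P \<in> Supp R (quotient_module (M\<lparr>carrier := Z\<rparr>) N) \<longleftrightarrow>
    primeideal P R \<and> (\<exists>x\<in>Z. \<forall>s\<in>carrier R - P. s \<odot>\<^bsub>M\<^esub> x \<notin> N)"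
proof -
  let ?Z = "M\<lparr>carrier := Z\<rparr>"
  interpret M: module R M by fact
  interpret Z: module R ?Z by (rule submodule.submodule_is_module[OF Z M])
  have N': "submodule N R ?Z"
  proof (rule Z.module_incl_imp_submodule)
    have "module R (M\<lparr>carrier := N\<rparr>)" by (rule submodule.submodule_is_module[OF N M])
    then show "module R (?Z\<lparr>carrier := N\<rparr>)" by simp
  qed (use \<open>N \<subseteq> Z\<close> in simp)
  interpret Q: module R "quotient_module ?Z N" by (rule module_quotient[OF Z.module_axioms N'])
  have eq: "s \<odot>\<^bsub>quotient_module ?Z N\<^esub> (N +>\<^bsub>?Z\<^esub> x) = \<zero>\<^bsub>quotient_module ?Z N\<^esub> \<longleftrightarrow> s \<odot>\<^bsub>M\<^esub> x \<in> N"
    if "x \<in> Z" "s \<in> carrier R" for x s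
  proof -
    have sx: "s \<odot>\<^bsub>M\<^esub> x \<in> Z" using Z.smult_closed[of s x] that by simp
    note zz = module.minus_zero_right[OF Z.module_axioms]
    have "N +>\<^bsub>?Z\<^esub> (s \<odot>\<^bsub>M\<^esub> x) = N +>\<^bsub>?Z\<^esub> \<zero>\<^bsub>?Z\<^esub> \<longleftrightarrow> s \<odot>\<^bsub>M\<^esub> x \<in> N"
      using coset_eq_iff[OF Z.module_axioms N', of "s \<odot>\<^bsub>M\<^esub> x" "\<zero>\<^bsub>?Z\<^esub>"] zz[of "s \<odot>\<^bsub>M\<^esub> x"] sx Z.M.zero_closed
      by simp
    then show ?thesis
      using that quotient_smult[OF Z.module_axioms N', of s x]
      by (simp add: quotient_zero[OF Z.module_axioms N'])
  qed
  have "(\<exists>X\<in>carrier (quotient_module ?Z N). \<forall>s\<in>carrier R - P.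
      s \<odot>\<^bsub>quotient_module ?Z N\<^esub> X \<noteq> \<zero>\<^bsub>quotient_module ?Z N\<^esub>) \<longleftrightarrow>
    (\<exists>x\<in>Z. \<forall>s\<in>carrier R - P. s \<odot>\<^bsub>quotient_module ?Z N\<^esub> (N +>\<^bsub>?Z\<^esub> x) \<noteq> \<zero>\<^bsub>quotient_module ?Z N\<^esub>)"
    unfolding quotient_carrier[OF Z.module_axioms N'] by (simp add: Bex_def) blast
  also have "\<dots> \<longleftrightarrow> (\<exists>x\<in>Z. \<forall>s\<in>carrier R - P. s \<odot>\<^bsub>M\<^esub> x \<notin> N)"
    by (intro bex_cong ball_cong refl) (simp add: eq)
  finally have main: "(\<exists>X\<in>carrier (quotient_module ?Z N). \<forall>s\<in>carrier R - P.
      s \<odot>\<^bsub>quotient_module ?Z N\<^esub> X \<noteq> \<zero>\<^bsub>quotient_module ?Z N\<^esub>) \<longleftrightarrow>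
    (\<exists>x\<in>Z. \<forall>s\<in>carrier R - P. s \<odot>\<^bsub>M\<^esub> x \<notin> N)" .
  show ?thesis unfolding Supp_iff[OF Q.module_axioms] main ..
qed

subsection \<open>Maps between localizations\<close>

lemma (in cring) powers_submonoid: "g \<in> carrier R \<Longrightarrow> submonoid (powers R g) R"
proof (unfold_locales)
  assume g: "g \<in> carrier R"
  then show "powers R g \<subseteq> carrier R" by (auto simp: powers_def)
  show "\<one> \<in> powers R g" unfolding powers_def by (auto intro: exI[of _ 0])
  fix x y assume "x \<in> powers R g" "y \<in> powers R g"
  then obtain n k :: nat where "x = g [^] n" "y = g [^] k" by (auto simp: powers_def)
  then have "x \<otimes> y = g [^] (n + k)" by (simp add: g nat_pow_mult)
  then show "x \<otimes> y \<in> powers R g" by (auto simp: powers_def)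
qed

lemma power_in_powers: "g [^]\<^bsub>R\<^esub> (n::nat) \<in> powers R g"
  by (auto simp: powers_def)

definition loc_hom ::
    "('a, 'm) ring_scheme \<Rightarrow> 'a set \<Rightarrow> ('a, 'c) module \<Rightarrow> ('b \<Rightarrow> 'c) \<Rightarrow> ('b \<times> 'a) set \<Rightarrow> ('c \<times> 'a) set"
  where "loc_hom R S N h x = (\<Union>(m, s)\<in>x. loc_frac R S N (h m) s)"

context
  fixes R :: "('a, 'm) ring_scheme" and S and M :: "('a, 'b) module" and N :: "('a, 'c) module" and h
  assumes S: "submonoid S R" and M: "module R M" and N: "module R N" and h: "h \<in> module_hom R M N"
begin

interpretation M: localized_module R S M using S M by (simp add: localized_module_def)
interpretation N: localized_module R S N using S N by (simp add: localized_module_def)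

lemma loc_hom_frac:
  assumes "m \<in> carrier M" "s \<in> S"
  shows "loc_hom R S N h (loc_frac R S M m s) = loc_frac R S N (h m) s"
  unfolding loc_hom_def
proof (rule M.UN_frac[OF assms])
  fix m' s' assume m': "m' \<in> carrier M" "s' \<in> S" "loc_frac R S M m' s' = loc_frac R S M m s"
  then obtain u where u: "u \<in> S" "u \<odot>\<^bsub>M\<^esub> (s \<odot>\<^bsub>M\<^esub> m') = u \<odot>\<^bsub>M\<^esub> (s' \<odot>\<^bsub>M\<^esub> m)"
    using M.frac_eq_iff[OF m'(1,2) assms] by auto
  then have "h (u \<odot>\<^bsub>M\<^esub> (s \<odot>\<^bsub>M\<^esub> m')) = h (u \<odot>\<^bsub>M\<^esub> (s' \<odot>\<^bsub>M\<^esub> m))" by simp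
  then have "u \<odot>\<^bsub>N\<^esub> (s \<odot>\<^bsub>N\<^esub> h m') = u \<odot>\<^bsub>N\<^esub> (s' \<odot>\<^bsub>N\<^esub> h m)"
    using u(1) m'(1,2) assms by (simp add: module_hom_smult[OF h])
  then show "loc_frac R S N (h m') s' = loc_frac R S N (h m) s"
    using u(1) m' assms module_hom_closed[OF h] by (subst N.frac_eq_iff) auto
qed

lemma loc_hom_hom: "loc_hom R S N h \<in> module_hom R (localization R S M) (localization R S N)"
proof (rule module_homI)
  note [simp] = loc_hom_frac module_hom_closed[OF h]
  show "loc_hom R S N h x \<in> carrier (localization R S N)" if x: "x \<in> carrier (localization R S M)" for x
    using x by (auto elim!: M.locE)
  show "loc_hom R S N h (a \<odot>\<^bsub>localization R S M\<^esub> x) = a \<odot>\<^bsub>localization R S N\<^esub> loc_hom R S N h x"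
    if "a \<in> carrier R" "x \<in> carrier (localization R S M)" for a x
    using that by (auto elim!: M.locE simp: M.loc_smult N.loc_smult module_hom_smult[OF h])
  show "loc_hom R S N h (x \<oplus>\<^bsub>localization R S M\<^esub> y) =
      loc_hom R S N h x \<oplus>\<^bsub>localization R S N\<^esub> loc_hom R S N h y"
    if x: "x \<in> carrier (localization R S M)" "y \<in> carrier (localization R S M)" for x y
  proof -
    obtain m n s where "m \<in> carrier M" "n \<in> carrier M" "s \<in> S"
      "x = loc_frac R S M m s" "y = loc_frac R S M n s"
      using M.frac_common[OF x] .
    then show ?thesis by (simp add: M.loc_add_same N.loc_add_same module_hom_add[OF h])
  qed
qed

text \<open>The image \<open>h m\<close> is only killed by some \<open>u\<close> in
  \<open>S\<close>. Rewriting \<open>m/s\<close> as \<open>(u m)/(u s)\<close> moves this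
  \<open>u\<close> into the numerator, which is how localization preserves kernels.\<close>

lemma loc_hom_kernel:
  assumes x: "x \<in> carrier (localization R S M)" and "loc_hom R S N h x = \<zero>\<^bsub>localization R S N\<^esub>"
  obtains m s where "m \<in> carrier M" "s \<in> S" "h m = \<zero>\<^bsub>N\<^esub>" "x = loc_frac R S M m s"
proof -
  obtain m s where ms: "m \<in> carrier M" "s \<in> S" "x = loc_frac R S M m s" using x by (rule M.locE)
  then obtain u where u: "u \<in> S" "u \<odot>\<^bsub>N\<^esub> h m = \<zero>\<^bsub>N\<^esub>"
    using assms(2) N.frac_eq_zero_iff[of "h m" s] by (auto simp: loc_hom_frac module_hom_closed[OF h])
  have "h (u \<odot>\<^bsub>M\<^esub> m) = \<zero>\<^bsub>N\<^esub>" using u ms by (simp add: module_hom_smult[OF h])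
  moreover have "x = loc_frac R S M (u \<odot>\<^bsub>M\<^esub> m) (u \<otimes>\<^bsub>R\<^esub> s)"
    using u ms by (simp add: M.frac_cancel M.S.m_closed)
  moreover have "u \<odot>\<^bsub>M\<^esub> m \<in> carrier M" "u \<otimes>\<^bsub>R\<^esub> s \<in> S"
    using u ms by (simp_all add: M.S.m_closed)
  ultimately show thesis using that by blast
qed

end

text \<open>The hypothesis on \<open>S\<close> and \<open>T\<close> says that the elements of \<open>S\<close> act invertibly on localizations
  at \<open>T\<close>.\<close>

context
  fixes R :: "('a, 'm) ring_scheme" and S T and M :: "('a, 'b) module"
  assumes S: "submonoid S R" and T: "submonoid T R" and M: "module R M"
    and dvd: "\<And>s. s \<in> S \<Longrightarrow> \<exists>t\<in>carrier R. t \<otimes>\<^bsub>R\<^esub> s \<in> T"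
begin

interpretation S: localized_module R S M using S M by (simp add: localized_module_def)
interpretation T: localized_module R T M using T M by (simp add: localized_module_def)

text \<open>\<open>loc_map\<close> is a definite description, so both existence and uniqueness of
  the value are to be shown; the multiplier \<open>t\<close> turns the old denominator into an
  admissible new one.\<close>

lemma loc_map_frac:
  assumes m: "m \<in> carrier M" and s: "s \<in> S" and t: "t \<in> carrier R" "t \<otimes>\<^bsub>R\<^esub> s \<in> T"
  shows "loc_map R T M (loc_frac R S M m s) = loc_frac R T M (t \<odot>\<^bsub>M\<^esub> m) (t \<otimes>\<^bsub>R\<^esub> s)"
  unfolding loc_map_def
proof (rule the_equality)
  { fix m' s' assume "(m', s') \<in> loc_frac R S M m s"
  then obtain v where v: "m' \<in> carrier M" "s' \<in> S" "v \<in> S"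
    "v \<odot>\<^bsub>M\<^esub> (s' \<odot>\<^bsub>M\<^esub> m) = v \<odot>\<^bsub>M\<^esub> (s \<odot>\<^bsub>M\<^esub> m')" by (auto simp: S.mem_frac)
  \<comment> \<open>The witness \<open>v\<close> belongs to \<open>S\<close>, whereas equality of
    fractions over \<open>T\<close> needs a witness in \<open>T\<close>; a multiple of
    \<open>v\<close> serves.\<close>
  obtain r where r: "r \<in> carrier R" "r \<otimes>\<^bsub>R\<^esub> v \<in> T" using dvd v(3) by blast
  have carr: "v \<in> carrier R" "s \<in> carrier R" "s' \<in> carrier R" using v s by auto
  have "(r \<otimes>\<^bsub>R\<^esub> v) \<odot>\<^bsub>M\<^esub> (\<one>\<^bsub>R\<^esub> \<odot>\<^bsub>M\<^esub> (s' \<odot>\<^bsub>M\<^esub> (t \<odot>\<^bsub>M\<^esub> m))) = (r \<otimes>\<^bsub>R\<^esub> t) \<odot>\<^bsub>M\<^esub> (v \<odot>\<^bsub>M\<^esub> (s' \<odot>\<^bsub>M\<^esub> m))"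
    using carr m t r(1) by algebra
  also have "\<dots> = (r \<otimes>\<^bsub>R\<^esub> v) \<odot>\<^bsub>M\<^esub> ((t \<otimes>\<^bsub>R\<^esub> s) \<odot>\<^bsub>M\<^esub> m')"
    unfolding v(4) using carr v(1) t r(1) by algebra
  finally have "\<exists>u\<in>T. u \<odot>\<^bsub>M\<^esub> (\<one>\<^bsub>R\<^esub> \<odot>\<^bsub>M\<^esub> (s' \<odot>\<^bsub>M\<^esub> (t \<odot>\<^bsub>M\<^esub> m))) = u \<odot>\<^bsub>M\<^esub> ((t \<otimes>\<^bsub>R\<^esub> s) \<odot>\<^bsub>M\<^esub> m')"
    using r(2) by blast
  then have "s' \<odot>\<^bsub>localization R T M\<^esub> loc_frac R T M (t \<odot>\<^bsub>M\<^esub> m) (t \<otimes>\<^bsub>R\<^esub> s) = loc_frac R T M m' \<one>\<^bsub>R\<^esub>"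
    using T.frac_eq_iff[of "s' \<odot>\<^bsub>M\<^esub> (t \<odot>\<^bsub>M\<^esub> m)" "t \<otimes>\<^bsub>R\<^esub> s" m' "\<one>\<^bsub>R\<^esub>"] v(1) m t carr T.S.one_closed
    by (simp add: T.loc_smult)
  }
  then show "loc_frac R T M (t \<odot>\<^bsub>M\<^esub> m) (t \<otimes>\<^bsub>R\<^esub> s) \<in> carrier (localization R T M) \<and>
    (\<forall>(m', s')\<in>loc_frac R S M m s. s' \<odot>\<^bsub>localization R T M\<^esub> loc_frac R T M (t \<odot>\<^bsub>M\<^esub> m) (t \<otimes>\<^bsub>R\<^esub> s) =
      loc_frac R T M m' \<one>\<^bsub>R\<^esub>)"
    using m t by auto
next
  fix y assume y: "y \<in> carrier (localization R T M) \<and>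
    (\<forall>(m', s')\<in>loc_frac R S M m s. s' \<odot>\<^bsub>localization R T M\<^esub> y = loc_frac R T M m' \<one>\<^bsub>R\<^esub>)"
  then obtain n r where nr: "n \<in> carrier M" "r \<in> T" "y = loc_frac R T M n r" by (auto elim: T.locE)
  have s': "s \<in> carrier R" using s by auto
  have "s \<odot>\<^bsub>localization R T M\<^esub> y = loc_frac R T M m \<one>\<^bsub>R\<^esub>"
    using y S.mem_frac_self[OF m s] by blast
  then have "loc_frac R T M (s \<odot>\<^bsub>M\<^esub> n) r = loc_frac R T M m \<one>\<^bsub>R\<^esub>"
    using nr s' by (simp add: T.loc_smult)
  then obtain u where u: "u \<in> T" "u \<odot>\<^bsub>M\<^esub> (\<one>\<^bsub>R\<^esub> \<odot>\<^bsub>M\<^esub> (s \<odot>\<^bsub>M\<^esub> n)) = u \<odot>\<^bsub>M\<^esub> (r \<odot>\<^bsub>M\<^esub> m)"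
    using nr m s' T.frac_eq_iff[of "s \<odot>\<^bsub>M\<^esub> n" r m "\<one>\<^bsub>R\<^esub>"] T.S.one_closed by auto
  have carr: "u \<in> carrier R" "r \<in> carrier R" using u nr by auto
  have "u \<odot>\<^bsub>M\<^esub> ((t \<otimes>\<^bsub>R\<^esub> s) \<odot>\<^bsub>M\<^esub> n) = t \<odot>\<^bsub>M\<^esub> (u \<odot>\<^bsub>M\<^esub> (\<one>\<^bsub>R\<^esub> \<odot>\<^bsub>M\<^esub> (s \<odot>\<^bsub>M\<^esub> n)))"
    using carr s' t nr(1) by algebra
  also have "\<dots> = u \<odot>\<^bsub>M\<^esub> (r \<odot>\<^bsub>M\<^esub> (t \<odot>\<^bsub>M\<^esub> m))"
    unfolding u(2) using carr m t by algebra
  finally show "y = loc_frac R T M (t \<odot>\<^bsub>M\<^esub> m) (t \<otimes>\<^bsub>R\<^esub> s)"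
    unfolding nr(3) using u(1) nr m t by (subst T.frac_eq_iff) auto
qed

lemma loc_map_hom: "loc_map R T M \<in> module_hom R (localization R S M) (localization R T M)"
proof (rule module_homI)
  have *: "\<exists>t. t \<in> carrier R \<and> t \<otimes>\<^bsub>R\<^esub> s \<in> T" if "s \<in> S" for s using dvd that by blast
  show "loc_map R T M x \<in> carrier (localization R T M)" if x: "x \<in> carrier (localization R S M)" for x
  proof -
    obtain m s where ms: "m \<in> carrier M" "s \<in> S" "x = loc_frac R S M m s" using x by (rule S.locE)
    obtain t where "t \<in> carrier R" "t \<otimes>\<^bsub>R\<^esub> s \<in> T" using *[OF ms(2)] by blast
    then show ?thesis using ms by (simp add: loc_map_frac)
  qed
  show "loc_map R T M (a \<odot>\<^bsub>localization R S M\<^esub> x) = a \<odot>\<^bsub>localization R T M\<^esub> loc_map R T M x"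
    if a: "a \<in> carrier R" and x: "x \<in> carrier (localization R S M)" for a x
  proof -
    obtain m s where ms: "m \<in> carrier M" "s \<in> S" "x = loc_frac R S M m s" using x by (rule S.locE)
    obtain t where t: "t \<in> carrier R" "t \<otimes>\<^bsub>R\<^esub> s \<in> T" using *[OF ms(2)] by blast
    then show ?thesis
      using ms a by (simp add: S.loc_smult T.loc_smult loc_map_frac[OF _ _ t] S.smult_left_commute)
  qed
  show "loc_map R T M (x \<oplus>\<^bsub>localization R S M\<^esub> y) =
      loc_map R T M x \<oplus>\<^bsub>localization R T M\<^esub> loc_map R T M y"
    if x: "x \<in> carrier (localization R S M)" "y \<in> carrier (localization R S M)" for x y
  proof -
    obtain m n s where ms: "m \<in> carrier M" "n \<in> carrier M" "s \<in> S"
      "x = loc_frac R S M m s" "y = loc_frac R S M n s"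
      using S.frac_common[OF x] .
    obtain t where t: "t \<in> carrier R" "t \<otimes>\<^bsub>R\<^esub> s \<in> T" using *[OF ms(3)] by blast
    then show ?thesis
      using ms by (simp add: S.loc_add_same T.loc_add_same loc_map_frac[OF _ _ t] S.smult_r_distr)
  qed
qed

end

section \<open>Products and cubes of modules\<close>

lemma pi_module_simps [simp]:
  "carrier (pi_module J M) = (\<Pi>\<^sub>E j\<in>J. carrier (M j))"
  "\<zero>\<^bsub>pi_module J M\<^esub> = (\<lambda>j\<in>J. \<zero>\<^bsub>M j\<^esub>)"
  "x \<oplus>\<^bsub>pi_module J M\<^esub> y = (\<lambda>j\<in>J. x j \<oplus>\<^bsub>M j\<^esub> y j)"
  "a \<odot>\<^bsub>pi_module J M\<^esub> x = (\<lambda>j\<in>J. a \<odot>\<^bsub>M j\<^esub> x j)"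
  by (simp_all add: pi_module_def)

lemma module_pi:
  assumes R: "cring R" and M: "\<And>j. j \<in> J \<Longrightarrow> module R (M j)"
  shows "module R (pi_module J M)"
proof -
  have ag: "abelian_group (M j)" if "j \<in> J" for j using M[OF that] by (simp add: module_def)
  note am = ag[THEN abelian_group.axioms(1)]
  have c: "x j \<in> carrier (M j)" if "x \<in> (\<Pi>\<^sub>E j\<in>J. carrier (M j))" "j \<in> J" for x j
    using that by auto
  note rules = c M module.smult_closed module.smult_l_distr module.smult_r_distr module.smult_assoc1
    module.smult_one abelian_monoid.a_assoc am abelian_monoid.l_zero
    abelian_monoid.zero_closed abelian_monoid.a_closed
  show ?thesis
  proof (rule moduleI)
    show "abelian_group (pi_module J M)"
    proof (rule abelian_groupI)
      fix x y assume "x \<in> carrier (pi_module J M)" "y \<in> carrier (pi_module J M)"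
      then show "x \<oplus>\<^bsub>pi_module J M\<^esub> y = y \<oplus>\<^bsub>pi_module J M\<^esub> x"
        by (auto simp: fun_eq_iff restrict_def intro!: abelian_monoid.a_comm am)
    next
      fix x assume x: "x \<in> carrier (pi_module J M)"
      then have "(\<lambda>j\<in>J. \<ominus>\<^bsub>M j\<^esub> x j) \<oplus>\<^bsub>pi_module J M\<^esub> x = \<zero>\<^bsub>pi_module J M\<^esub>"
        by (auto simp: restrict_def fun_eq_iff intro!: abelian_group.l_neg ag)
      moreover have "(\<lambda>j\<in>J. \<ominus>\<^bsub>M j\<^esub> x j) \<in> carrier (pi_module J M)"
        using x by (auto intro: abelian_group.a_inv_closed ag)
      ultimately show "\<exists>y\<in>carrier (pi_module J M). y \<oplus>\<^bsub>pi_module J M\<^esub> x = \<zero>\<^bsub>pi_module J M\<^esub>" by blast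
    next
      fix x assume x: "x \<in> carrier (pi_module J M)"
      show "\<zero>\<^bsub>pi_module J M\<^esub> \<oplus>\<^bsub>pi_module J M\<^esub> x = x"
        using x by (intro ext) (auto simp: rules restrict_def PiE_def extensional_def)
    qed (auto simp: rules fun_eq_iff restrict_def)
    show "\<one>\<^bsub>R\<^esub> \<odot>\<^bsub>pi_module J M\<^esub> x = x" if x: "x \<in> carrier (pi_module J M)" for x
      using x by (intro ext) (auto simp: rules restrict_def PiE_def extensional_def)
    show "a \<odot>\<^bsub>pi_module J M\<^esub> x \<in> carrier (pi_module J M)"
      if "a \<in> carrier R" "x \<in> carrier (pi_module J M)" for a x
      using that by (auto intro: module.smult_closed[OF M])
    show "a \<odot>\<^bsub>pi_module J M\<^esub> (x \<oplus>\<^bsub>pi_module J M\<^esub> y) =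
      a \<odot>\<^bsub>pi_module J M\<^esub> x \<oplus>\<^bsub>pi_module J M\<^esub> a \<odot>\<^bsub>pi_module J M\<^esub> y"
      if "a \<in> carrier R" "x \<in> carrier (pi_module J M)" "y \<in> carrier (pi_module J M)" for a x y
      using that by (auto simp: fun_eq_iff restrict_def intro!: module.smult_r_distr[OF M])
  qed (auto simp: R fun_eq_iff restrict_def rules)
qed

lemma pi_module_inv:
  assumes R: "cring R" and M: "\<And>j. j \<in> J \<Longrightarrow> module R (M j)" and x: "x \<in> carrier (pi_module J M)"
  shows "\<ominus>\<^bsub>pi_module J M\<^esub> x = (\<lambda>j\<in>J. \<ominus>\<^bsub>M j\<^esub> x j)"
proof -
  have ag: "abelian_group (M j)" if "j \<in> J" for j using M[OF that] by (simp add: module_def)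
  interpret pi: module R "pi_module J M" by (rule module_pi[OF R M])
  show ?thesis
  proof (rule pi.M.minus_equality)
    show "(\<lambda>j\<in>J. \<ominus>\<^bsub>M j\<^esub> x j) \<oplus>\<^bsub>pi_module J M\<^esub> x = \<zero>\<^bsub>pi_module J M\<^esub>"
      using x by (auto simp: restrict_def fun_eq_iff intro!: abelian_group.l_neg ag)
    show "(\<lambda>j\<in>J. \<ominus>\<^bsub>M j\<^esub> x j) \<in> carrier (pi_module J M)"
      using x by (auto intro: abelian_group.a_inv_closed ag)
  qed (rule x)
qed

lemma pi_module_signed:
  assumes "cring R" "\<And>j. j \<in> J \<Longrightarrow> module R (M j)" "x \<in> carrier (pi_module J M)" "j \<in> J"
  shows "signed (pi_module J M) n x j = signed (M j) n (x j)"
  using pi_module_inv[OF assms(1-3)] assms(4) by (simp add: signed_def)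

lemma pi_module_ext:
  assumes "x \<in> carrier (pi_module J M)" "y \<in> carrier (pi_module J M)" "\<And>j. j \<in> J \<Longrightarrow> x j = y j"
  shows "x = y"
  using assms by (auto intro: PiE_ext)

text \<open>The ordered pairs \<open>(b, b')\<close> and \<open>(b', b)\<close> cancel; a new index
  \<open>c\<close> contributes such pairs with each old index. The diagonal has to be left out, as
  antisymmetry there would give only that twice the term is zero.\<close>

lemma finsum_antisymmetric:
  assumes "abelian_group G" "finite B"
    and "\<And>b b'. b \<in> B \<Longrightarrow> b' \<in> B \<Longrightarrow> h b b' \<in> carrier G"
    and "\<And>b b'. b \<in> B \<Longrightarrow> b' \<in> B \<Longrightarrow> b \<noteq> b' \<Longrightarrow> h b b' = \<ominus>\<^bsub>G\<^esub> h b' b"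
  shows "(\<Oplus>\<^bsub>G\<^esub>b\<in>B. \<Oplus>\<^bsub>G\<^esub>b'\<in>B - {b}. h b b') = \<zero>\<^bsub>G\<^esub>"
  using assms(2-)
proof (induction B)
  case empty
  interpret abelian_group G by fact
  show ?case by simp
next
  case (insert c B)
  interpret abelian_group G by fact
  have cl: "h b b' \<in> carrier G" if "b \<in> insert c B" "b' \<in> insert c B" for b b' using insert.prems that by blast
  have "(\<Oplus>\<^bsub>G\<^esub>b'\<in>insert c B - {b}. h b b') = h b c \<oplus>\<^bsub>G\<^esub> (\<Oplus>\<^bsub>G\<^esub>b'\<in>B - {b}. h b b')"
    if b: "b \<in> B" for b
  proof -
    have "insert c B - {b} = insert c (B - {b})" using b insert.hyps by auto
    then show ?thesis using insert.hyps b cl by (simp add: finsum_insert Pi_def)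
  qed
  then have "(\<Oplus>\<^bsub>G\<^esub>b\<in>B. \<Oplus>\<^bsub>G\<^esub>b'\<in>insert c B - {b}. h b b') =
      (\<Oplus>\<^bsub>G\<^esub>b\<in>B. h b c \<oplus>\<^bsub>G\<^esub> (\<Oplus>\<^bsub>G\<^esub>b'\<in>B - {b}. h b b'))"
    using cl by (intro finsum_cong') (auto simp: Pi_def intro!: finsum_closed)
  also have "\<dots> = (\<Oplus>\<^bsub>G\<^esub>b\<in>B. h b c) \<oplus>\<^bsub>G\<^esub> (\<Oplus>\<^bsub>G\<^esub>b\<in>B. \<Oplus>\<^bsub>G\<^esub>b'\<in>B - {b}. h b b')"
    using cl by (intro finsum_addf) (auto simp: Pi_def intro!: finsum_closed)
  also have "(\<Oplus>\<^bsub>G\<^esub>b\<in>B. \<Oplus>\<^bsub>G\<^esub>b'\<in>B - {b}. h b b') = \<zero>\<^bsub>G\<^esub>"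
    by (rule insert.IH) (rule insert.prems(1) insert.prems(2), simp_all)+
  finally have 1: "(\<Oplus>\<^bsub>G\<^esub>b\<in>B. \<Oplus>\<^bsub>G\<^esub>b'\<in>insert c B - {b}. h b b') = (\<Oplus>\<^bsub>G\<^esub>b\<in>B. h b c)"
    using cl by (simp add: Pi_def finsum_closed)
  have "insert c B - {c} = B" using insert.hyps by auto
  then have "(\<Oplus>\<^bsub>G\<^esub>b\<in>insert c B. \<Oplus>\<^bsub>G\<^esub>b'\<in>insert c B - {b}. h b b') =
      (\<Oplus>\<^bsub>G\<^esub>b\<in>B. h c b) \<oplus>\<^bsub>G\<^esub> (\<Oplus>\<^bsub>G\<^esub>b\<in>B. \<Oplus>\<^bsub>G\<^esub>b'\<in>insert c B - {b}. h b b')"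
    using insert.hyps cl by (subst finsum_insert) (auto simp: Pi_def intro!: finsum_closed)
  also have "\<dots> = (\<Oplus>\<^bsub>G\<^esub>b\<in>B. h c b \<oplus>\<^bsub>G\<^esub> h b c)"
    unfolding 1 using cl by (intro finsum_addf[symmetric]) (auto simp: Pi_def)
  also have "\<dots> = (\<Oplus>\<^bsub>G\<^esub>b\<in>B. \<zero>\<^bsub>G\<^esub>)"
  proof (rule finsum_cong')
    fix b assume "b \<in> B"
    then have "h c b = \<ominus>\<^bsub>G\<^esub> h b c" using insert by (metis insertCI)
    then show "h c b \<oplus>\<^bsub>G\<^esub> h b c = \<zero>\<^bsub>G\<^esub>" using cl \<open>b \<in> B\<close> by (simp add: l_neg)
  qed auto
  finally show ?case by simp
qed

section \<open>Subsets, positions and the complex of a cube of modules\<close>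

lemma subsets_iff: "A \<in> subsets n i \<longleftrightarrow> A \<subseteq> {..<n} \<and> int (card A) = i"
  by (simp add: subsets_def)

lemma subsets_finite: "A \<in> subsets n i \<Longrightarrow> finite A"
  by (auto simp: subsets_def intro: finite_subset)

lemma subsets_remove: "A \<in> subsets n (i + 1) \<Longrightarrow> a \<in> A \<Longrightarrow> A - {a} \<in> subsets n i"
  using subsets_finite[of A n "i + 1"] card_Suc_Diff1[of A a] by (auto simp: subsets_def)

lemma subsets_insert: "A \<in> subsets n i \<Longrightarrow> a < n \<Longrightarrow> a \<notin> A \<Longrightarrow> insert a A \<in> subsets n (i + 1)"
  using subsets_finite[of A n] by (auto simp: subsets_def)

lemma subsets_eq_empty: "i < 0 \<or> i > int n \<Longrightarrow> subsets n i = {}"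
proof -
  have "card A \<le> n" if "A \<subseteq> {..<n}" for A using card_mono[OF _ that] by simp
  then have "0 \<le> i \<and> i \<le> int n" if "A \<in> subsets n i" for A
    using that by (auto simp: subsets_iff)
  then show "i < 0 \<or> i > int n \<Longrightarrow> subsets n i = {}" by fastforce
qed

lemma position_remove_greater: "b' < b \<Longrightarrow> position b' (B - {b}) = position b' B"
  unfolding position_def by (rule arg_cong[where f = "\<lambda>X. int (card X)"]) auto

text \<open>Removing a smaller element shifts the position by one. Together with the absence of a
  shift for larger elements, this yields the sign that makes the square of the differential
  vanish.\<close>

lemma position_remove_less:
  assumes "b' < b" "b' \<in> B" "finite B"
  shows "position b B = position b (B - {b'}) + 1"
proof -
  have "{x \<in> B. x < b} = insert b' {x \<in> B - {b'}. x < b}" using assms by auto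
  then show ?thesis using assms by (simp add: position_def)
qed

definition cube_diff ::
    "nat \<Rightarrow> (nat set \<Rightarrow> ('a, 'b) module) \<Rightarrow> (nat \<Rightarrow> nat set \<Rightarrow> 'b \<Rightarrow> 'b) \<Rightarrow> int \<Rightarrow>
     (nat set \<Rightarrow> 'b) \<Rightarrow> nat set \<Rightarrow> 'b"
  where "cube_diff n L \<phi> i x =
    (\<lambda>B\<in>subsets n (i + 1). \<Oplus>\<^bsub>L B\<^esub>b\<in>B. signed (L B) (position b B) (\<phi> b B (x (B - {b}))))"

text \<open>Both the Koszul cocomplex and the Cech complex are the complexes of commuting cubes of modules.\<close>

locale cube =
  fixes R :: "('a, 'm) ring_scheme" and n :: nat
    and L :: "nat set \<Rightarrow> ('a, 'b) module" and \<phi> :: "nat \<Rightarrow> nat set \<Rightarrow> 'b \<Rightarrow> 'b"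
  assumes R: "cring R"
    and L: "\<And>B. B \<subseteq> {..<n} \<Longrightarrow> module R (L B)"
    and \<phi>: "\<And>b B. B \<subseteq> {..<n} \<Longrightarrow> b \<in> B \<Longrightarrow> \<phi> b B \<in> module_hom R (L (B - {b})) (L B)"
    and \<phi>_comm: "\<And>b b' B x. B \<subseteq> {..<n} \<Longrightarrow> b \<in> B \<Longrightarrow> b' \<in> B \<Longrightarrow> b \<noteq> b' \<Longrightarrow> x \<in> carrier (L (B - {b, b'})) \<Longrightarrow>
      \<phi> b B (\<phi> b' (B - {b}) x) = \<phi> b' B (\<phi> b (B - {b'}) x)"
begin

abbreviation C where "C i \<equiv> pi_module (subsets n i) L"
abbreviation diff where "diff \<equiv> cube_diff n L \<phi>"

lemma L_plain: "B \<subseteq> {..<n} \<Longrightarrow> plain_module R (L B)"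
  using L by (simp add: plain_module_def)

lemma module_C: "module R (C i)"
  by (rule module_pi[OF R]) (auto simp: subsets_def L)

lemma \<phi>_closed:
  "B \<in> subsets n (i + 1) \<Longrightarrow> b \<in> B \<Longrightarrow> x \<in> carrier (C i) \<Longrightarrow> \<phi> b B (x (B - {b})) \<in> carrier (L B)"
  using \<phi>[of B b, THEN module_hom_closed] subsets_remove[of B n i b]
  by (auto simp: subsets_def PiE_iff)

lemma summand_closed:
  assumes "B \<in> subsets n (i + 1)" "b \<in> B" "x \<in> carrier (C i)"
  shows "signed (L B) k (\<phi> b B (x (B - {b}))) \<in> carrier (L B)"
  using plain_module.signed_closed[OF L_plain \<phi>_closed[OF assms]] assms by (simp add: subsets_def)

lemma diff_hom: "diff i \<in> module_hom R (C i) (C (i + 1))"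
proof (rule module_homI)
  have m: "plain_module R (L B)" if "B \<in> subsets n k" for B k using that L_plain by (simp add: subsets_def)
  show "diff i x \<in> carrier (C (i + 1))" if x: "x \<in> carrier (C i)" for x
  proof -
    have "(\<Oplus>\<^bsub>L B\<^esub>b\<in>B. signed (L B) (position b B) (\<phi> b B (x (B - {b})))) \<in> carrier (L B)"
      if B: "B \<in> subsets n (i + 1)" for B
    proof -
      interpret plain_module R "L B" by (rule m[OF B])
      show ?thesis using summand_closed[OF B _ x] by (intro M.finsum_closed) auto
    qed
    then show ?thesis by (auto simp: cube_diff_def)
  qed
  show "diff i (x \<oplus>\<^bsub>C i\<^esub> y) = diff i x \<oplus>\<^bsub>C (i + 1)\<^esub> diff i y"
    if x: "x \<in> carrier (C i)" and y: "y \<in> carrier (C i)" for x y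
  proof (rule ext)
    fix B
    show "diff i (x \<oplus>\<^bsub>C i\<^esub> y) B = (diff i x \<oplus>\<^bsub>C (i + 1)\<^esub> diff i y) B"
    proof (cases "B \<in> subsets n (i + 1)")
      case B: True
      interpret plain_module R "L B" by (rule m[OF B])
      have "signed (L B) (position b B) (\<phi> b B ((x \<oplus>\<^bsub>C i\<^esub> y) (B - {b}))) =
          signed (L B) (position b B) (\<phi> b B (x (B - {b}))) \<oplus>\<^bsub>L B\<^esub>
          signed (L B) (position b B) (\<phi> b B (y (B - {b})))" if b: "b \<in> B" for b
      proof -
        have "\<phi> b B \<in> module_hom R (L (B - {b})) (L B)" using \<phi> B b by (simp add: subsets_def)
        then have "\<phi> b B ((x \<oplus>\<^bsub>C i\<^esub> y) (B - {b})) = \<phi> b B (x (B - {b})) \<oplus>\<^bsub>L B\<^esub> \<phi> b B (y (B - {b}))"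
          using x y subsets_remove[OF B b] by (simp add: module_hom_add PiE_iff)
        then show ?thesis using \<phi>_closed[OF B b] x y by (simp add: signed_add)
      qed
      then have "(\<Oplus>\<^bsub>L B\<^esub>b\<in>B. signed (L B) (position b B) (\<phi> b B ((x \<oplus>\<^bsub>C i\<^esub> y) (B - {b})))) =
         (\<Oplus>\<^bsub>L B\<^esub>b\<in>B. signed (L B) (position b B) (\<phi> b B (x (B - {b}))) \<oplus>\<^bsub>L B\<^esub>
          signed (L B) (position b B) (\<phi> b B (y (B - {b}))))"
        using summand_closed[OF B _ x] summand_closed[OF B _ y] by (intro M.finsum_cong') auto
      also have "\<dots> = (\<Oplus>\<^bsub>L B\<^esub>b\<in>B. signed (L B) (position b B) (\<phi> b B (x (B - {b})))) \<oplus>\<^bsub>L B\<^esub>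
          (\<Oplus>\<^bsub>L B\<^esub>b\<in>B. signed (L B) (position b B) (\<phi> b B (y (B - {b}))))"
        using summand_closed[OF B _ x] summand_closed[OF B _ y] by (intro M.finsum_addf) auto
      finally show ?thesis using B by (simp add: cube_diff_def)
    qed (simp add: cube_diff_def)
  qed
  show "diff i (a \<odot>\<^bsub>C i\<^esub> x) = a \<odot>\<^bsub>C (i + 1)\<^esub> diff i x"
    if a: "a \<in> carrier R" and x: "x \<in> carrier (C i)" for a x
  proof (rule ext)
    fix B
    show "diff i (a \<odot>\<^bsub>C i\<^esub> x) B = (a \<odot>\<^bsub>C (i + 1)\<^esub> diff i x) B"
    proof (cases "B \<in> subsets n (i + 1)")
      case B: True
      interpret plain_module R "L B" by (rule m[OF B])
      have "signed (L B) (position b B) (\<phi> b B ((a \<odot>\<^bsub>C i\<^esub> x) (B - {b}))) =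
          a \<odot>\<^bsub>L B\<^esub> signed (L B) (position b B) (\<phi> b B (x (B - {b})))" if b: "b \<in> B" for b
      proof -
        have "\<phi> b B \<in> module_hom R (L (B - {b})) (L B)" using \<phi> B b by (simp add: subsets_def)
        then have "\<phi> b B ((a \<odot>\<^bsub>C i\<^esub> x) (B - {b})) = a \<odot>\<^bsub>L B\<^esub> \<phi> b B (x (B - {b}))"
          using x a subsets_remove[OF B b] by (simp add: module_hom_smult PiE_iff)
        then show ?thesis using \<phi>_closed[OF B b x] a by (simp add: signed_smult)
      qed
      then have "(\<Oplus>\<^bsub>L B\<^esub>b\<in>B. signed (L B) (position b B) (\<phi> b B ((a \<odot>\<^bsub>C i\<^esub> x) (B - {b})))) =
         (\<Oplus>\<^bsub>L B\<^esub>b\<in>B. a \<odot>\<^bsub>L B\<^esub> signed (L B) (position b B) (\<phi> b B (x (B - {b}))))"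
        using summand_closed[OF B _ x] a by (intro M.finsum_cong') auto
      also have "\<dots> = a \<odot>\<^bsub>L B\<^esub> (\<Oplus>\<^bsub>L B\<^esub>b\<in>B. signed (L B) (position b B) (\<phi> b B (x (B - {b}))))"
        using summand_closed[OF B _ x] a subsets_finite[OF B] by (intro finsum_smult_ldistr[symmetric]) auto
      finally show ?thesis using B by (simp add: cube_diff_def)
    qed (simp add: cube_diff_def)
  qed
qed

text \<open>The component at \<open>B\<close> is a double sum over ordered pairs of removed
  elements. Exchanging the two gives the same value, as the cube commutes, with opposite sign, as
  the positions add up to numbers differing by one.\<close>

lemma diff_diff:
  assumes x: "x \<in> carrier (C i)"
  shows "diff (i + 1) (diff i x) = \<zero>\<^bsub>C (i + 2)\<^esub>"
proof (rule pi_module_ext)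
  have i2: "i + 2 = i + 1 + 1" by simp
  have dx: "diff i x \<in> carrier (C (i + 1))" by (rule module_hom_closed[OF diff_hom x])
  show "diff (i + 1) (diff i x) \<in> carrier (C (i + 2))"
    unfolding i2 by (rule module_hom_closed[OF diff_hom dx])
  show "\<zero>\<^bsub>C (i + 2)\<^esub> \<in> carrier (C (i + 2))"
    by (rule abelian_monoid.zero_closed) (use module_C in \<open>simp add: module_def abelian_group_def\<close>)
  fix B assume B': "B \<in> subsets n (i + 2)"
  then have B: "B \<in> subsets n (i + 1 + 1)" by (simp add: algebra_simps)
  have Bn: "B \<subseteq> {..<n}" using B by (simp add: subsets_def)
  interpret plain_module R "L B" by (rule L_plain[OF Bn])
  let ?v = "\<lambda>b b'. \<phi> b B (\<phi> b' (B - {b}) (x (B - {b} - {b'})))"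
  \<comment> \<open>The value zero on the diagonal is a filler that makes \<open>?h\<close> take
    values in the carrier for all pairs; the sums below skip the diagonal.\<close>
  let ?h = "\<lambda>b b'. if b = b' then \<zero>\<^bsub>L B\<^esub> else
    signed (L B) (position b B + position b' (B - {b})) (?v b b')"
  have v: "?v b b' \<in> carrier (L B)" if "b \<in> B" "b' \<in> B" "b \<noteq> b'" for b b'
  proof -
    have "\<phi> b' (B - {b}) (x (B - {b} - {b'})) \<in> carrier (L (B - {b}))"
      using \<phi>_closed[OF subsets_remove[OF B that(1)] _ x, of b'] that by simp
    then show ?thesis using \<phi>[OF Bn that(1)] by (rule module_hom_closed[rotated])
  qed
  have vv: "?v b b' = ?v b' b" if "b \<in> B" "b' \<in> B" "b \<noteq> b'" for b b'
  proof -
    have "B - {b} - {b'} \<in> subsets n i"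
      using subsets_remove[OF subsets_remove[OF B that(1)], of b'] that by simp
    moreover have "B - {b} - {b'} = B - {b, b'}" "B - {b'} - {b} = B - {b, b'}" by auto
    ultimately show ?thesis using \<phi>_comm[OF Bn that, of "x (B - {b, b'})"] x by (simp add: PiE_iff)
  qed
  have hc: "?h b b' \<in> carrier (L B)" if "b \<in> B" "b' \<in> B" for b b'
    using v[OF that] by simp
  have anti: "?h b b' = \<ominus>\<^bsub>L B\<^esub> ?h b' b" if bb': "b \<in> B" "b' \<in> B" "b' < b" for b b'
  proof -
    have "position b' (B - {b}) = position b' B" "position b B = position b (B - {b'}) + 1"
      using position_remove_greater position_remove_less subsets_finite[OF B] bb' by auto
    then have eq: "position b B + position b' (B - {b}) = position b' B + position b (B - {b'}) + 1"
      by simp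
    have "signed (L B) (position b B + position b' (B - {b})) (?v b b') =
      \<ominus>\<^bsub>L B\<^esub> signed (L B) (position b' B + position b (B - {b'})) (?v b b')"
      unfolding eq by (rule signed_Suc) (use v bb' in auto)
    moreover have "?v b b' = ?v b' b" by (rule vv) (use bb' in auto)
    ultimately show ?thesis using bb' by simp
  qed
  have anti': "?h b b' = \<ominus>\<^bsub>L B\<^esub> ?h b' b" if bb': "b \<in> B" "b' \<in> B" "b \<noteq> b'" for b b'
  proof (cases "b' < b")
    case False
    then have "?h b' b = \<ominus>\<^bsub>L B\<^esub> ?h b b'" using bb' by (intro anti) simp_all
    then show ?thesis using M.minus_minus[OF hc[OF bb'(1,2)]] by (simp only:)
  next
    case True
    show ?thesis by (rule anti[OF bb'(1,2) True])
  qed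
  have "(\<Oplus>\<^bsub>L B\<^esub>b\<in>B. signed (L B) (position b B) (\<phi> b B (diff i x (B - {b})))) =
    (\<Oplus>\<^bsub>L B\<^esub>b\<in>B. \<Oplus>\<^bsub>L B\<^esub>b'\<in>B - {b}. ?h b b')"
  proof (rule M.finsum_cong')
    show "(\<lambda>b. \<Oplus>\<^bsub>L B\<^esub>b'\<in>B - {b}. ?h b b') \<in> B \<rightarrow> carrier (L B)"
      using hc by (auto intro!: M.finsum_closed)
    fix b assume b: "b \<in> B"
    have Bb: "B - {b} \<in> subsets n (i + 1)" using subsets_remove[OF B b] .
    then have Bbn: "B - {b} \<subseteq> {..<n}" by (simp add: subsets_def)
    interpret Lb: plain_module R "L (B - {b})" by (rule L_plain[OF Bbn])
    note hom = \<phi>[OF Bn b] and c = summand_closed[OF Bb _ x]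
    have "signed (L B) (position b B) (\<phi> b B (diff i x (B - {b}))) = signed (L B) (position b B)
       (\<Oplus>\<^bsub>L B\<^esub>b'\<in>B - {b}. \<phi> b B (signed (L (B - {b})) (position b' (B - {b})) (\<phi> b' (B - {b}) (x (B - {b} - {b'})))))"
      using Bb c by (simp add: cube_diff_def module_hom_finsum[OF Lb.module_axioms module_axioms hom] Pi_def)
    also have "\<dots> = (\<Oplus>\<^bsub>L B\<^esub>b'\<in>B - {b}. signed (L B) (position b B)
        (\<phi> b B (signed (L (B - {b})) (position b' (B - {b})) (\<phi> b' (B - {b}) (x (B - {b} - {b'}))))))"
    proof (rule module_hom_finsum[OF module_axioms module_axioms])
      show "signed (L B) (position b B) \<in> module_hom R (L B) (L B)"
        by (rule module_homI) (simp_all add: signed_add signed_smult)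
      show "(\<lambda>b'. \<phi> b B (signed (L (B - {b})) (position b' (B - {b})) (\<phi> b' (B - {b}) (x (B - {b} - {b'}))))) \<in>
          B - {b} \<rightarrow> carrier (L B)"
        using c module_hom_closed[OF hom] by auto
    qed
    also have "\<dots> = (\<Oplus>\<^bsub>L B\<^esub>b'\<in>B - {b}. ?h b b')"
    proof (rule M.finsum_cong')
      fix b' assume b': "b' \<in> B - {b}"
      have "\<phi> b' (B - {b}) (x (B - {b} - {b'})) \<in> carrier (L (B - {b}))"
        by (rule \<phi>_closed[OF Bb b' x])
      then show "signed (L B) (position b B)
        (\<phi> b B (signed (L (B - {b})) (position b' (B - {b})) (\<phi> b' (B - {b}) (x (B - {b} - {b'}))))) = ?h b b'"
        using b' b v[OF b, of b']
        by (auto simp: module_hom_signed[OF Lb.module_axioms module_axioms hom] signed_signed)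
    qed (use hc b in auto)
    finally show "signed (L B) (position b B) (\<phi> b B (diff i x (B - {b}))) = (\<Oplus>\<^bsub>L B\<^esub>b'\<in>B - {b}. ?h b b')" .
  qed simp
  also have "\<dots> = \<zero>\<^bsub>L B\<^esub>"
    by (rule finsum_antisymmetric[OF M.abelian_group_axioms subsets_finite[OF B]], rule hc, assumption+, rule anti', assumption+)
  finally have "diff (i + 1) (diff i x) B = \<zero>\<^bsub>L B\<^esub>"
    using B by (subst cube_diff_def) (simp only: restrict_apply if_True)
  then show "diff (i + 1) (diff i x) B = \<zero>\<^bsub>C (i + 2)\<^esub> B" using B' by simp
qed

end

text \<open>Used twice: for a homomorphism of coefficients in the Cech complex, and for the Cech
  differential acting on the coefficients of the Koszul cocomplex.\<close>

lemma cube_diff_natural: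
  assumes L: "cube R n L \<phi>" and L': "cube R n L' \<phi>'"
    and h: "\<And>B. B \<subseteq> {..<n} \<Longrightarrow> h B \<in> module_hom R (L B) (L' B)"
    and nat: "\<And>B b x. B \<subseteq> {..<n} \<Longrightarrow> b \<in> B \<Longrightarrow> x \<in> carrier (L (B - {b})) \<Longrightarrow>
      h B (\<phi> b B x) = \<phi>' b B (h (B - {b}) x)"
    and x: "x \<in> carrier (pi_module (subsets n i) L)"
  shows "cube_diff n L' \<phi>' i (\<lambda>B\<in>subsets n i. h B (x B)) =
    (\<lambda>B\<in>subsets n (i + 1). h B (cube_diff n L \<phi> i x B))"
proof (rule ext)
  fix B
  show "cube_diff n L' \<phi>' i (\<lambda>B\<in>subsets n i. h B (x B)) B =
    (\<lambda>B\<in>subsets n (i + 1). h B (cube_diff n L \<phi> i x B)) B"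
  proof (cases "B \<in> subsets n (i + 1)")
    case B: True
    then have Bn: "B \<subseteq> {..<n}" by (simp add: subsets_def)
    interpret L: cube R n L \<phi> by fact
    interpret L': cube R n L' \<phi>' by fact
    interpret LB: plain_module R "L B" by (rule L.L_plain[OF Bn])
    interpret LB': plain_module R "L' B" by (rule L'.L_plain[OF Bn])
    have "h B (\<Oplus>\<^bsub>L B\<^esub>b\<in>B. signed (L B) (position b B) (\<phi> b B (x (B - {b})))) =
      (\<Oplus>\<^bsub>L' B\<^esub>b\<in>B. h B (signed (L B) (position b B) (\<phi> b B (x (B - {b})))))"
      using L.summand_closed[OF B _ x]
      by (intro module_hom_finsum[OF LB.module_axioms LB'.module_axioms h[OF Bn]]) auto
    also have "\<dots> = (\<Oplus>\<^bsub>L' B\<^esub>b\<in>B. signed (L' B) (position b B)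
        (\<phi>' b B ((\<lambda>B\<in>subsets n i. h B (x B)) (B - {b}))))"
    proof (rule LB'.M.finsum_cong')
      have *: "h B (signed (L B) (position b B) (\<phi> b B (x (B - {b})))) = signed (L' B) (position b B)
        (\<phi>' b B ((\<lambda>B\<in>subsets n i. h B (x B)) (B - {b})))" if b: "b \<in> B" for b
        using L.\<phi>_closed[OF B b x] subsets_remove[OF B b] x nat[OF Bn b]
        by (auto simp: module_hom_signed[OF LB.module_axioms LB'.module_axioms h[OF Bn]] PiE_iff)
      then show "\<And>b. b \<in> B \<Longrightarrow> h B (signed (L B) (position b B) (\<phi> b B (x (B - {b})))) = signed (L' B) (position b B)
        (\<phi>' b B ((\<lambda>B\<in>subsets n i. h B (x B)) (B - {b})))" .
      show "(\<lambda>b. signed (L' B) (position b B) (\<phi>' b B ((\<lambda>B\<in>subsets n i. h B (x B)) (B - {b})))) \<in> B \<rightarrow> carrier (L' B)"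
        using L.summand_closed[OF B _ x] module_hom_closed[OF h[OF Bn]] *[symmetric] by auto
    qed simp
    finally show ?thesis using B by (simp add: cube_diff_def)
  qed (simp add: cube_diff_def)
qed

section \<open>The Cech complex\<close>

locale cech_complex = plain_module R M
  for R (structure) and gs :: "'a list" and M :: "('a, 'b) module" (structure) +
  assumes gs: "set gs \<subseteq> carrier R"
begin

abbreviation t where "t \<equiv> length gs"
definition g :: "nat set \<Rightarrow> 'a" where "g B = (\<Otimes>b\<in>B. gs ! b)"
abbreviation D where "D \<equiv> cech_denominators R gs"
abbreviation LL where "LL B \<equiv> localization R (D B) M"
text \<open>The denominators at \<open>B\<close> are the powers of \<open>g B\<close>, so a fraction
  is given by a numerator and an exponent, and passing to a common denominator is addition of
  exponents.\<close>

definition fr :: "nat set \<Rightarrow> 'b \<Rightarrow> nat \<Rightarrow> ('b \<times> 'a) set" where "fr B m k = loc_frac R (D B) M m (g B [^] k)"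

lemma gs_closed: "b < t \<Longrightarrow> gs ! b \<in> carrier R"
  using gs nth_mem by blast

lemma g_closed: "B \<subseteq> {..<t} \<Longrightarrow> g B \<in> carrier R"
  unfolding g_def by (rule R.finprod_closed) (use gs_closed in auto)

lemma g_remove:
  assumes "B \<subseteq> {..<t}" "b \<in> B"
  shows "g B = gs ! b \<otimes> g (B - {b})"
proof -
  have "g (insert b (B - {b})) = gs ! b \<otimes> g (B - {b})"
    unfolding g_def using assms gs_closed
    by (intro R.finprod_insert) (auto intro: finite_subset)
  then show ?thesis using assms(2) by (simp add: insert_absorb)
qed

lemma D_eq: "D B = powers R (g B)"
  by (simp add: cech_denominators_def g_def)

lemma localized: "B \<subseteq> {..<t} \<Longrightarrow> localized_module R (D B) M"
  by (simp add: localized_module_def D_eq R.powers_submonoid g_closed module_axioms)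

lemma g_pow_D [simp]: "g B [^] (k::nat) \<in> D B"
  by (simp add: D_eq power_in_powers)

lemma g_power_remove:
  assumes "B \<subseteq> {..<t}" "b \<in> B"
  shows "(gs ! b) [^] (k::nat) \<otimes> g (B - {b}) [^] k = g B [^] k"
  using g_remove[OF assms] g_closed[of "B - {b}"] gs_closed[of b] assms
  by (simp add: R.nat_pow_distrib subset_iff)

lemma fr_closed: "B \<subseteq> {..<t} \<Longrightarrow> m \<in> carrier M \<Longrightarrow> fr B m k \<in> carrier (LL B)"
  unfolding fr_def by (rule localized_module.frac_closed[OF localized]) simp_all

lemma frE:
  assumes "x \<in> carrier (LL B)" "B \<subseteq> {..<t}"
  obtains m k where "m \<in> carrier M" "x = fr B m k"
proof -
  obtain m s where ms: "m \<in> carrier M" "s \<in> D B" "x = loc_frac R (D B) M m s"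
    using localized_module.locE[OF localized[OF assms(2)] assms(1)] .
  then obtain k where "s = g B [^] (k::nat)" by (auto simp: D_eq powers_def)
  then show thesis using that ms by (auto simp: fr_def)
qed

lemma fr_smult: "B \<subseteq> {..<t} \<Longrightarrow> m \<in> carrier M \<Longrightarrow> a \<in> carrier R \<Longrightarrow> a \<odot>\<^bsub>LL B\<^esub> fr B m k = fr B (a \<odot>\<^bsub>M\<^esub> m) k"
  unfolding fr_def by (rule localized_module.loc_smult[OF localized]) simp_all

lemma fr_add:
  "B \<subseteq> {..<t} \<Longrightarrow> m \<in> carrier M \<Longrightarrow> m' \<in> carrier M \<Longrightarrow> fr B m k \<oplus>\<^bsub>LL B\<^esub> fr B m' k = fr B (m \<oplus>\<^bsub>M\<^esub> m') k"
  unfolding fr_def by (rule localized_module.loc_add_same[OF localized]) simp_all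

lemma fr_expand:
  assumes "B \<subseteq> {..<t}" "m \<in> carrier M"
  shows "fr B m k = fr B (g B [^] (l::nat) \<odot>\<^bsub>M\<^esub> m) (l + k)"
  using localized_module.frac_cancel[OF localized[OF assms(1)] assms(2), of "g B [^] k" "g B [^] l"]
    g_pow_D[of B "l + k"] g_closed[OF assms(1)]
  by (simp add: fr_def R.nat_pow_mult)

lemma fr_eq_zero_iff:
  assumes "B \<subseteq> {..<t}" "m \<in> carrier M"
  shows "fr B m k = \<zero>\<^bsub>LL B\<^esub> \<longleftrightarrow> (\<exists>l::nat. g B [^] l \<odot>\<^bsub>M\<^esub> m = \<zero>\<^bsub>M\<^esub>)"
  unfolding fr_def localized_module.frac_eq_zero_iff[OF localized[OF assms(1)] assms(2) g_pow_D]
  by (auto simp: D_eq powers_def)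

text \<open>This is the invertibility hypothesis of \<open>loc_map_frac\<close>; the factor missing
  from a power of \<open>g (B - {b})\<close> is the same power of \<open>gs ! b\<close>.\<close>

lemma denominators_dvd:
  assumes "B \<subseteq> {..<t}" "b \<in> B" "s \<in> D (B - {b})"
  shows "\<exists>r\<in>carrier R. r \<otimes> s \<in> D B"
proof -
  obtain k where "s = g (B - {b}) [^] (k::nat)" using assms(3) by (auto simp: D_eq powers_def)
  then have "(gs ! b) [^] k \<otimes> s \<in> D B" using g_power_remove[OF assms(1,2)] by simp
  then show ?thesis using gs_closed[of b] assms by (meson R.nat_pow_closed lessThan_iff subsetD)
qed

text \<open>The canonical map only rewrites a fraction: enlarging the denominator from a power of
  \<open>g (B - {b})\<close> to that of \<open>g B\<close> costs the factor \<open>gs ! b\<close> to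
  the power \<open>k\<close> in the numerator.\<close>

lemma loc_map_fr:
  assumes "B \<subseteq> {..<t}" "b \<in> B" "m \<in> carrier M"
  shows "loc_map R (D B) M (fr (B - {b}) m k) = fr B ((gs ! b) [^] k \<odot>\<^bsub>M\<^esub> m) k"
proof -
  have B': "B - {b} \<subseteq> {..<t}" using assms by auto
  have "loc_map R (D B) M (loc_frac R (D (B - {b})) M m (g (B - {b}) [^] k)) =
    loc_frac R (D B) M ((gs ! b) [^] k \<odot>\<^bsub>M\<^esub> m) ((gs ! b) [^] k \<otimes> g (B - {b}) [^] k)"
  proof (rule loc_map_frac[OF _ _ module_axioms])
    show "submonoid (D (B - {b})) R" "submonoid (D B) R"
      using localized[OF B'] localized[OF assms(1)] by (simp_all add: localized_module_def)
  qed (use assms denominators_dvd gs_closed g_power_remove[OF assms(1,2)] in auto)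
  then show ?thesis using g_power_remove[OF assms(1,2)] by (simp add: fr_def)
qed

lemma loc_map_hom':
  assumes "B \<subseteq> {..<t}" "b \<in> B"
  shows "loc_map R (D B) M \<in> module_hom R (LL (B - {b})) (LL B)"
proof (rule loc_map_hom[OF _ _ module_axioms])
  have B': "B - {b} \<subseteq> {..<t}" using assms by auto
  show "submonoid (D (B - {b})) R" "submonoid (D B) R"
    using localized[OF B'] localized[OF assms(1)] by (simp_all add: localized_module_def)
qed (use assms denominators_dvd in auto)

lemma module_LL: "B \<subseteq> {..<t} \<Longrightarrow> module R (LL B)"
  using localized localized_module.module_localization by blast

lemma cech_cube: "cube R t LL (\<lambda>b B. loc_map R (D B) M)"
proof (rule cube.intro)
  show "cring R" by (rule R.is_cring)
  show "module R (LL B)" if "B \<subseteq> {..<t}" for B by (rule module_LL[OF that])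
  show "loc_map R (D B) M \<in> module_hom R (LL (B - {b})) (LL B)" if "B \<subseteq> {..<t}" "b \<in> B" for b B
    using loc_map_hom' that .
  fix b b' B x
  assume B: "B \<subseteq> {..<t}" and b: "b \<in> B" "b' \<in> B" "b \<noteq> b'" and x: "x \<in> carrier (LL (B - {b, b'}))"
  have B': "B - {b} \<subseteq> {..<t}" "B - {b'} \<subseteq> {..<t}" "B - {b, b'} \<subseteq> {..<t}" using B by auto
  have eq: "B - {b} - {b'} = B - {b, b'}" "B - {b'} - {b} = B - {b, b'}" by auto
  obtain m k where m: "m \<in> carrier M" "x = fr (B - {b, b'}) m k" using frE[OF x B'(3)] .
  have c: "gs ! b \<in> carrier R" "gs ! b' \<in> carrier R" using B b gs_closed by auto
  have "loc_map R (D (B - {b})) M x = fr (B - {b}) ((gs ! b') [^] k \<odot>\<^bsub>M\<^esub> m) k"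
    "loc_map R (D (B - {b'})) M x = fr (B - {b'}) ((gs ! b) [^] k \<odot>\<^bsub>M\<^esub> m) k"
    using loc_map_fr[OF B'(1), of b' m k] loc_map_fr[OF B'(2), of b m k] b m by (simp_all add: eq)
  then show "loc_map R (D B) M (loc_map R (D (B - {b})) M x) = loc_map R (D B) M (loc_map R (D (B - {b'})) M x)"
    using b m(1) c by (simp add: loc_map_fr[OF B] smult_left_commute)
qed

lemma cech_eq: "cech R gs M j = pi_module (subsets t j) LL"
  by (simp add: cech_def)

lemma cech_diff_eq: "cech_diff R gs M = cube_diff t LL (\<lambda>b B. loc_map R (D B) M)"
  by (intro ext) (simp add: cech_diff_def cube_diff_def)

lemma module_cech: "module R (cech R gs M j)"
  using cube.module_C[OF cech_cube] by (simp add: cech_eq)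

lemma cech_diff_hom: "cech_diff R gs M j \<in> module_hom R (cech R gs M j) (cech R gs M (j + 1))"
  using cube.diff_hom[OF cech_cube] by (simp add: cech_eq cech_diff_eq)

lemma cech_diff_diff:
  "x \<in> carrier (cech R gs M j) \<Longrightarrow> cech_diff R gs M (j + 1) (cech_diff R gs M j x) = \<zero>\<^bsub>cech R gs M (j + 2)\<^esub>"
  using cube.diff_diff[OF cech_cube] by (simp only: cech_eq cech_diff_eq)

end

section \<open>Functoriality and exactness of the Cech complex in its coefficients\<close>

definition cech_hom ::
    "('a, 'm) ring_scheme \<Rightarrow> 'a list \<Rightarrow> ('a, 'c) module \<Rightarrow> ('b \<Rightarrow> 'c) \<Rightarrow> int \<Rightarrow>
      (nat set \<Rightarrow> ('b \<times> 'a) set) \<Rightarrow> nat set \<Rightarrow> ('c \<times> 'a) set"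
  where "cech_hom R gs N h j x =
    (\<lambda>B\<in>subsets (length gs) j. loc_hom R (cech_denominators R gs B) N h (x B))"

context
  fixes R :: "('a, 'm) ring_scheme" and gs and M :: "('a, 'b) module" and N :: "('a, 'c) module" and h
  assumes M: "cech_complex R gs M" and N: "cech_complex R gs N" and h: "h \<in> module_hom R M N"
begin

interpretation M: cech_complex R gs M by (rule M)
interpretation N: cech_complex R gs N by (rule N)

lemma loc_hom_fr:
  assumes "B \<subseteq> {..<length gs}" "m \<in> carrier M"
  shows "loc_hom R (cech_denominators R gs B) N h (M.fr B m k) = N.fr B (h m) k"
  using M.localized[OF assms(1)] M.g_pow_D
  by (simp add: M.fr_def N.fr_def M.g_def N.g_def localized_module_def
    loc_hom_frac[OF _ M.module_axioms N.module_axioms h _] assms(2))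

lemma loc_hom_hom': "B \<subseteq> {..<length gs} \<Longrightarrow>
    loc_hom R (cech_denominators R gs B) N h \<in> module_hom R (M.LL B) (N.LL B)"
  using M.localized[of B] loc_hom_hom[OF _ M.module_axioms N.module_axioms h] by (simp add: localized_module_def)

lemma cech_hom_hom: "cech_hom R gs N h j \<in> module_hom R (cech R gs M j) (cech R gs N j)"
proof (rule module_homI)
  note hh = loc_hom_hom'
  have s: "B \<subseteq> {..<length gs}" if "B \<in> subsets (length gs) j" for B using that by (simp add: subsets_def)
  show "cech_hom R gs N h j x \<in> carrier (cech R gs N j)" if "x \<in> carrier (cech R gs M j)" for x
    using that by (auto simp: cech_hom_def M.cech_eq N.cech_eq intro!: module_hom_closed[OF hh] s)
  show "cech_hom R gs N h j (x \<oplus>\<^bsub>cech R gs M j\<^esub> y) =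
      cech_hom R gs N h j x \<oplus>\<^bsub>cech R gs N j\<^esub> cech_hom R gs N h j y"
    if "x \<in> carrier (cech R gs M j)" "y \<in> carrier (cech R gs M j)" for x y
    using that by (simp add: cech_hom_def M.cech_eq N.cech_eq)
      (intro restrict_ext, simp add: module_hom_add[OF hh[OF s]] PiE_iff)
  show "cech_hom R gs N h j (a \<odot>\<^bsub>cech R gs M j\<^esub> x) = a \<odot>\<^bsub>cech R gs N j\<^esub> cech_hom R gs N h j x"
    if "a \<in> carrier R" "x \<in> carrier (cech R gs M j)" for a x
    using that by (simp add: cech_hom_def M.cech_eq N.cech_eq)
      (intro restrict_ext, simp add: module_hom_smult[OF hh[OF s]] PiE_iff)
qed

lemma cech_hom_diff:
  assumes "x \<in> carrier (cech R gs M j)"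
  shows "cech_diff R gs N j (cech_hom R gs N h j x) = cech_hom R gs N h (j + 1) (cech_diff R gs M j x)"
  unfolding M.cech_diff_eq N.cech_diff_eq cech_hom_def
proof (rule cube_diff_natural[OF M.cech_cube N.cech_cube])
  fix B b x assume B: "B \<subseteq> {..<length gs}" "b \<in> B" and x: "x \<in> carrier (M.LL (B - {b}))"
  have B': "B - {b} \<subseteq> {..<length gs}" using B by auto
  obtain m k where m: "m \<in> carrier M" "x = M.fr (B - {b}) m k" using M.frE[OF x B'] .
  have "gs ! b \<in> carrier R" using B M.gs_closed by auto
  then show "loc_hom R (M.D B) N h (loc_map R (M.D B) M x) =
      loc_map R (M.D B) N (loc_hom R (M.D (B - {b})) N h x)"
    using m(1) module_hom_closed[OF h]
    by (simp add: m(2) M.loc_map_fr[OF B] loc_hom_fr B(1) B' N.loc_map_fr[OF B] module_hom_smult[OF h])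
qed (use assms loc_hom_hom' in \<open>simp_all add: M.cech_eq\<close>)

end

lemma loc_hom_comp_zero:
  assumes "cech_complex R gs M" "cech_complex R gs N" "cech_complex R gs N'"
    and h: "h \<in> module_hom R M N" and k: "k \<in> module_hom R N N'"
    and "\<And>m. m \<in> carrier M \<Longrightarrow> k (h m) = \<zero>\<^bsub>N'\<^esub>"
    and B: "B \<subseteq> {..<length gs}" and x: "x \<in> carrier (localization R (cech_denominators R gs B) M)"
  shows "loc_hom R (cech_denominators R gs B) N' k (loc_hom R (cech_denominators R gs B) N h x) =
    \<zero>\<^bsub>localization R (cech_denominators R gs B) N'\<^esub>"
proof -
  interpret M: cech_complex R gs M by fact
  interpret N: cech_complex R gs N by fact
  interpret N': cech_complex R gs N' by fact
  obtain m l where m: "m \<in> carrier M" "x = M.fr B m l" using M.frE[OF x B] .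
  have "N'.fr B \<zero>\<^bsub>N'\<^esub> l = \<zero>\<^bsub>N'.LL B\<^esub>"
    using N'.g_closed[OF B] by (simp add: N'.fr_eq_zero_iff[OF B])
  then show ?thesis
    using m(1) module_hom_closed[OF h] assms(6)
    by (simp add: m(2) loc_hom_fr[OF assms(1,2) h B] loc_hom_fr[OF assms(2,3) k B])
qed

text \<open>By \<open>loc_hom_kernel\<close> a fraction in the kernel has a representative whose
  numerator is in the kernel of \<open>k\<close>; lift that numerator along \<open>h\<close> and
  keep the denominator.\<close>

lemma loc_hom_exact:
  assumes "cech_complex R gs M" "cech_complex R gs N" "cech_complex R gs N'"
    and h: "h \<in> module_hom R M N" and k: "k \<in> module_hom R N N'"
    and ex: "\<And>m. m \<in> carrier N \<Longrightarrow> k m = \<zero>\<^bsub>N'\<^esub> \<Longrightarrow> m \<in> h ` carrier M"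
    and B: "B \<subseteq> {..<length gs}" and x: "x \<in> carrier (localization R (cech_denominators R gs B) N)"
    and "loc_hom R (cech_denominators R gs B) N' k x = \<zero>\<^bsub>localization R (cech_denominators R gs B) N'\<^esub>"
  obtains y where "y \<in> carrier (localization R (cech_denominators R gs B) M)"
    "x = loc_hom R (cech_denominators R gs B) N h y"
proof -
  interpret M: cech_complex R gs M by fact
  interpret N: cech_complex R gs N by fact
  interpret N': cech_complex R gs N' by fact
  have S: "submonoid (N.D B) R" using N.localized[OF B] by (simp add: localized_module_def)
  obtain m s where ms: "m \<in> carrier N" "s \<in> N.D B" "k m = \<zero>\<^bsub>N'\<^esub>" "x = loc_frac R (N.D B) N m s"
    using loc_hom_kernel[OF S N.module_axioms N'.module_axioms k x assms(9)] .
  then obtain n where n: "n \<in> carrier M" "m = h n" using ex by blast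
  then have "x = loc_hom R (N.D B) N h (loc_frac R (N.D B) M n s)"
    using loc_hom_frac[OF S M.module_axioms N.module_axioms h n(1) ms(2)] ms by simp
  moreover have "loc_frac R (N.D B) M n s \<in> carrier (M.LL B)"
    using localized_module.frac_closed[OF M.localized[OF B] n(1) ms(2)] .
  ultimately show thesis using that by blast
qed

lemma cech_hom_comp_zero:
  assumes "cech_complex R gs M" "cech_complex R gs N" "cech_complex R gs N'"
    and h: "h \<in> module_hom R M N" and k: "k \<in> module_hom R N N'"
    and "\<And>m. m \<in> carrier M \<Longrightarrow> k (h m) = \<zero>\<^bsub>N'\<^esub>"
    and x: "x \<in> carrier (cech R gs M j)"
  shows "cech_hom R gs N' k j (cech_hom R gs N h j x) = \<zero>\<^bsub>cech R gs N' j\<^esub>"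
  using x loc_hom_comp_zero[OF assms(1-6)]
  by (simp add: cech_hom_def cech_def) (intro restrict_ext, simp add: subsets_iff PiE_iff)

text \<open>A Cech term is a product of localizations, so a preimage is chosen separately at each
  subset.\<close>

lemma cech_hom_exact:
  assumes "cech_complex R gs M" "cech_complex R gs N" "cech_complex R gs N'"
    and h: "h \<in> module_hom R M N" and k: "k \<in> module_hom R N N'"
    and ex: "\<And>m. m \<in> carrier N \<Longrightarrow> k m = \<zero>\<^bsub>N'\<^esub> \<Longrightarrow> m \<in> h ` carrier M"
    and x: "x \<in> carrier (cech R gs N j)" and "cech_hom R gs N' k j x = \<zero>\<^bsub>cech R gs N' j\<^esub>"
  obtains y where "y \<in> carrier (cech R gs M j)" "x = cech_hom R gs N h j y"
proof -
  have "\<exists>y. y \<in> carrier (localization R (cech_denominators R gs B) M) \<and>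
      x B = loc_hom R (cech_denominators R gs B) N h y" if B: "B \<in> subsets (length gs) j" for B
  proof -
    have "B \<subseteq> {..<length gs}" using B by (simp add: subsets_def)
    moreover have "x B \<in> carrier (localization R (cech_denominators R gs B) N)"
      using x B by (auto simp: cech_def)
    moreover have "loc_hom R (cech_denominators R gs B) N' k (x B) =
        \<zero>\<^bsub>localization R (cech_denominators R gs B) N'\<^esub>"
      using fun_cong[OF assms(8), of B] B by (simp add: cech_hom_def cech_def)
    ultimately show ?thesis using loc_hom_exact[OF assms(1-6)] by metis
  qed
  then obtain y where y: "\<And>B. B \<in> subsets (length gs) j \<Longrightarrow>
      y B \<in> carrier (localization R (cech_denominators R gs B) M) \<and>
      x B = loc_hom R (cech_denominators R gs B) N h (y B)" by metis
  show thesis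
  proof (rule that)
    show "(\<lambda>B\<in>subsets (length gs) j. y B) \<in> carrier (cech R gs M j)" using y by (simp add: cech_def)
    show "x = cech_hom R gs N h j (\<lambda>B\<in>subsets (length gs) j. y B)"
      using x y by (intro ext) (auto simp: cech_hom_def cech_def PiE_def extensional_def)
  qed
qed

section \<open>The Koszul cocomplex\<close>

text \<open>Every vertex carries the same module and the edge adding \<open>a\<close> is
  multiplication by \<open>fs ! a\<close>; the squares commute because the ring does.\<close>

lemma (in plain_module) koszul_cube:
  assumes "set fs \<subseteq> carrier R"
  shows "cube R (length fs) (\<lambda>_. M) (\<lambda>a _ x. (fs ! a) \<odot>\<^bsub>M\<^esub> x)"
proof
  have f: "fs ! a \<in> carrier R" if "a < length fs" for a using assms that nth_mem by blast
  show "(\<odot>\<^bsub>M\<^esub>) (fs ! b) \<in> module_hom R M M" if "B \<subseteq> {..<length fs}" "b \<in> B" for b B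
    using f that by (intro module_homI) (auto simp: smult_r_distr smult_left_commute)
  show "(fs ! b) \<odot>\<^bsub>M\<^esub> ((fs ! b') \<odot>\<^bsub>M\<^esub> x) = (fs ! b') \<odot>\<^bsub>M\<^esub> ((fs ! b) \<odot>\<^bsub>M\<^esub> x)"
    if "B \<subseteq> {..<length fs}" "b \<in> B" "b' \<in> B" "x \<in> carrier M" for b b' B x
    using f that by (auto intro: smult_left_commute)
qed

lemma koszul_diff_eq: "koszul_diff fs N = cube_diff (length fs) (\<lambda>_. N) (\<lambda>a _ x. (fs ! a) \<odot>\<^bsub>N\<^esub> x)"
  by (intro ext) (simp add: koszul_diff_def cube_diff_def)

lemma (in plain_module) module_koszul: "module R (koszul fs M i)"
  unfolding koszul_def by (rule module_pi[OF R.is_cring]) (rule module_axioms)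

lemma (in plain_module) koszul_diff_hom:
  "set fs \<subseteq> carrier R \<Longrightarrow> koszul_diff fs M i \<in> module_hom R (koszul fs M i) (koszul fs M (i + 1))"
  using cube.diff_hom[OF koszul_cube] by (simp add: koszul_def koszul_diff_eq)

lemma (in plain_module) koszul_diff_diff:
  "set fs \<subseteq> carrier R \<Longrightarrow> x \<in> carrier (koszul fs M i) \<Longrightarrow>
    koszul_diff fs M (i + 1) (koszul_diff fs M i x) = \<zero>\<^bsub>koszul fs M (i + 2)\<^esub>"
  using cube.diff_diff[OF koszul_cube] by (simp only: koszul_def koszul_diff_eq)

lemma koszul_map_hom:
  assumes h: "h \<in> module_hom R M N"
  shows "koszul_map fs h i \<in> module_hom R (koszul fs M i) (koszul fs N i)"
  by (rule module_homI)
    (auto simp: koszul_map_def koszul_def PiE_mem intro!: module_hom_closed[OF h] module_hom_add[OF h]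
      module_hom_smult[OF h] restrict_ext)

lemma koszul_map_diff:
  assumes "plain_module R M" "plain_module R N" "h \<in> module_hom R M N" "set fs \<subseteq> carrier R"
    and "x \<in> carrier (koszul fs M i)"
  shows "koszul_diff fs N i (koszul_map fs h i x) = koszul_map fs h (i + 1) (koszul_diff fs M i x)"
  unfolding koszul_diff_eq koszul_map_def
proof (rule cube_diff_natural[OF plain_module.koszul_cube[OF assms(1,4)] plain_module.koszul_cube[OF assms(2,4)]])
  show "h ((fs ! b) \<odot>\<^bsub>M\<^esub> x) = (fs ! b) \<odot>\<^bsub>N\<^esub> h x"
    if "B \<subseteq> {..<length fs}" "b \<in> B" "x \<in> carrier M" for B b x
  proof (rule module_hom_smult[OF assms(3) _ that(3)])
    show "fs ! b \<in> carrier R" using assms(4) that nth_mem[of b fs] by blast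
  qed
qed (use assms in \<open>simp_all add: koszul_def\<close>)

section \<open>Filtered complexes\<close>

locale module_complex =
  fixes R :: "('a, 'm) ring_scheme" and T :: "int \<Rightarrow> ('a, 'b) module" and d :: "int \<Rightarrow> 'b \<Rightarrow> 'b"
  assumes T: "\<And>n. module R (T n)"
    and d: "\<And>n. d n \<in> module_hom R (T n) (T (n + 1))"
    and dd: "\<And>n x. x \<in> carrier (T n) \<Longrightarrow> d (n + 1) (d n x) = \<zero>\<^bsub>T (n + 2)\<^esub>"
begin

lemma d_closed: "x \<in> carrier (T n) \<Longrightarrow> d n x \<in> carrier (T (n + 1))"
  by (rule module_hom_closed[OF d])

lemma d_prev: "d (n - 1) \<in> module_hom R (T (n - 1)) (T n)"
  using d[of "n - 1"] by simp

lemma dd_prev: "x \<in> carrier (T (n - 1)) \<Longrightarrow> d n (d (n - 1) x) = \<zero>\<^bsub>T (n + 1)\<^esub>"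
  using dd[of x "n - 1"] by (simp add: add.commute)

lemma submodule_cocycles: "submodule {x \<in> carrier (T n). d n x = \<zero>\<^bsub>T (n + 1)\<^esub>} R (T n)"
  by (rule submodule_kernel[OF T T d])

lemma submodule_coboundaries: "submodule (d (n - 1) ` carrier (T (n - 1))) R (T n)"
  by (rule submodule_image[OF T T d_prev module.carrier_is_submodule[OF T]])

lemma Supp_cohomology_iff:
  "P \<in> Supp R (cohomology T d n) \<longleftrightarrow> primeideal P R \<and>
    (\<exists>x\<in>carrier (T n). d n x = \<zero>\<^bsub>T (n + 1)\<^esub> \<and>
      (\<forall>s\<in>carrier R - P. s \<odot>\<^bsub>T n\<^esub> x \<notin> d (n - 1) ` carrier (T (n - 1))))"
proof -
  have ker: "a_kernel (T n) (T (n + 1)) (d n) = {x \<in> carrier (T n). d n x = \<zero>\<^bsub>T (n + 1)\<^esub>}"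
    by (simp add: a_kernel_def')
  have "d (n - 1) ` carrier (T (n - 1)) \<subseteq> {x \<in> carrier (T n). d n x = \<zero>\<^bsub>T (n + 1)\<^esub>}"
    using dd_prev module_hom_closed[OF d_prev] by auto
  then show ?thesis
    unfolding cohomology_def ker
    by (subst Supp_quotient_iff[OF T submodule_cocycles submodule_coboundaries]) auto
qed

end

lemma submodule_set_add:
  assumes "module R M" and H: "submodule H R M" and K: "submodule K R M"
  shows "submodule (H <+>\<^bsub>M\<^esub> K) R M"
proof -
  interpret module R M by fact
  note [simp] = submoduleE(3,4,5)[OF H] submoduleE(3,4,5)[OF K] submodule_zero[OF H] submodule_zero[OF K]
  have c [simp]: "x \<in> carrier M" if "x \<in> H" for x using submodule_subset[OF H] that by auto
  have c' [simp]: "x \<in> carrier M" if "x \<in> K" for x using submodule_subset[OF K] that by auto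
  have mem: "x \<in> H <+>\<^bsub>M\<^esub> K \<longleftrightarrow> (\<exists>h\<in>H. \<exists>k\<in>K. x = h \<oplus>\<^bsub>M\<^esub> k)" for x by (auto simp: set_add_def')
  show ?thesis
  proof (rule submoduleI)
    show "H <+>\<^bsub>M\<^esub> K \<subseteq> carrier M" by (auto simp: mem)
    show "\<zero>\<^bsub>M\<^esub> \<in> H <+>\<^bsub>M\<^esub> K" unfolding mem by (intro bexI[of _ "\<zero>\<^bsub>M\<^esub>"]) auto
    fix x assume "x \<in> H <+>\<^bsub>M\<^esub> K"
    then obtain h k where h: "h \<in> H" "k \<in> K" and x: "x = h \<oplus>\<^bsub>M\<^esub> k" by (auto simp: mem)
    have "\<ominus>\<^bsub>M\<^esub> x = (\<ominus>\<^bsub>M\<^esub> h) \<oplus>\<^bsub>M\<^esub> (\<ominus>\<^bsub>M\<^esub> k)" using h by (simp add: x M.minus_add)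
    then show "\<ominus>\<^bsub>M\<^esub> x \<in> H <+>\<^bsub>M\<^esub> K" unfolding mem using h by (meson submoduleE(3) H K)
    show "a \<odot>\<^bsub>M\<^esub> x \<in> H <+>\<^bsub>M\<^esub> K" if a: "a \<in> carrier R" for a
    proof -
      have "a \<odot>\<^bsub>M\<^esub> x = (a \<odot>\<^bsub>M\<^esub> h) \<oplus>\<^bsub>M\<^esub> (a \<odot>\<^bsub>M\<^esub> k)" using h a by (simp add: x smult_r_distr)
      then show ?thesis unfolding mem using h a by (meson submoduleE(4) H K)
    qed
    fix y assume "y \<in> H <+>\<^bsub>M\<^esub> K"
    then obtain h' k' where h': "h' \<in> H" "k' \<in> K" and y: "y = h' \<oplus>\<^bsub>M\<^esub> k'" by (auto simp: mem)
    have "x \<oplus>\<^bsub>M\<^esub> y = (h \<oplus>\<^bsub>M\<^esub> h') \<oplus>\<^bsub>M\<^esub> (k \<oplus>\<^bsub>M\<^esub> k')" using h h' by (simp add: x y M.a_ac)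
    then show "x \<oplus>\<^bsub>M\<^esub> y \<in> H <+>\<^bsub>M\<^esub> K" unfolding mem using h h' by (meson submoduleE(5) H K)
  qed
qed

lemma submodule_Int:
  assumes "module R M" and H: "submodule H R M" and K: "submodule K R M"
  shows "submodule (H \<inter> K) R M"
proof -
  interpret module R M by fact
  show ?thesis
    by (rule submoduleI)
      (use submodule_subset[OF H] submoduleE(3-5)[OF H] submoduleE(3-5)[OF K]
        submodule_zero[OF H] submodule_zero[OF K] in auto)
qed

text \<open>\<open>F_all\<close> and \<open>F_none\<close> confine the jumps of the filtration to 0,
  ..., \<open>c\<close>. This is why the limit terms are already reached at a finite page.\<close>

locale filtered_complex = module_complex R T d
  for R :: "('a, 'm) ring_scheme" and T :: "int \<Rightarrow> ('a, 'b) module" and d :: "int \<Rightarrow> 'b \<Rightarrow> 'b" +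
  fixes F :: "int \<Rightarrow> int \<Rightarrow> 'b set" and c :: int
  assumes F: "\<And>p n. submodule (F p n) R (T n)"
    and F_Suc: "\<And>p n. F (p + 1) n \<subseteq> F p n"
    and F_d: "\<And>p n x. x \<in> F p n \<Longrightarrow> d n x \<in> F p (n + 1)"
    and F_all: "\<And>p n. p \<le> 0 \<Longrightarrow> F p n = carrier (T n)"
    and F_none: "\<And>p n. p > c \<Longrightarrow> F p n = {\<zero>\<^bsub>T n\<^esub>}"
begin

lemma F_carrier: "x \<in> F p n \<Longrightarrow> x \<in> carrier (T n)"
  using submodule_subset[OF F] by blast

lemma cycles_limit:
  "(\<Inter>r. ss_cycles T d F r p n) = {x \<in> F p n. d n x = \<zero>\<^bsub>T (n + 1)\<^esub>} <+>\<^bsub>T n\<^esub> F (p + 1) n"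
proof -
  have zero: "\<zero>\<^bsub>T n\<^esub> \<in> F p n" for p n by (rule module.submodule_zero[OF T F])
  \<comment> \<open>At page \<open>c - p + 1\<close> the differential is required to land beyond
    step \<open>c\<close>, hence to vanish. If \<open>p > c\<close>, \<open>nat\<close> truncates to
    0, which still works because \<open>F p\<close> itself is zero in every degree.\<close>
  have "F (p + int (nat (c - p + 1))) (n + 1) = {\<zero>\<^bsub>T (n + 1)\<^esub>}" by (rule F_none) simp
  then have eq: "ss_cycles T d F (nat (c - p + 1)) p n =
      {x \<in> F p n. d n x = \<zero>\<^bsub>T (n + 1)\<^esub>} <+>\<^bsub>T n\<^esub> F (p + 1) n"
    unfolding ss_cycles_def by (simp only: singleton_iff)
  moreover have "ss_cycles T d F (nat (c - p + 1)) p n \<subseteq> ss_cycles T d F r p n" for r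
    unfolding eq unfolding ss_cycles_def set_add_def' using zero by auto
  ultimately show ?thesis by blast
qed

lemma boundaries_limit:
  "(\<Union>r. ss_boundaries T d F r p n) = (F p n \<inter> d (n - 1) ` carrier (T (n - 1))) <+>\<^bsub>T n\<^esub> F (p + 1) n"
proof -
  \<comment> \<open>At page \<open>p + 1\<close> the sources of boundaries range over step 0, that
    is over everything; for negative \<open>p\<close> the truncated value 0 already gives a step at
    most 0.\<close>
  have "F (p - int (nat (p + 1)) + 1) (n - 1) = carrier (T (n - 1))" by (rule F_all) simp
  then have eq: "ss_boundaries T d F (nat (p + 1)) p n =
      (F p n \<inter> d (n - 1) ` carrier (T (n - 1))) <+>\<^bsub>T n\<^esub> F (p + 1) n"
    unfolding ss_boundaries_def by simp
  moreover have "ss_boundaries T d F r p n \<subseteq> ss_boundaries T d F (nat (p + 1)) p n" for r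
    unfolding eq unfolding ss_boundaries_def set_add_def' using F_carrier by blast
  ultimately show ?thesis by blast
qed

lemma Supp_limit_iff:
  "P \<in> Supp R (ss_limit T d F p q) \<longleftrightarrow> primeideal P R \<and>
    (\<exists>x\<in>F p (p + q). d (p + q) x = \<zero>\<^bsub>T (p + q + 1)\<^esub> \<and> (\<forall>s\<in>carrier R - P. s \<odot>\<^bsub>T (p + q)\<^esub> x \<notin>
      (F p (p + q) \<inter> d (p + q - 1) ` carrier (T (p + q - 1))) <+>\<^bsub>T (p + q)\<^esub> F (p + 1) (p + q)))"
proof -
  define n where "n = p + q"
  define K where "K = {x \<in> F p n. d n x = \<zero>\<^bsub>T (n + 1)\<^esub>}"
  define B where "B = F p n \<inter> d (n - 1) ` carrier (T (n - 1))"
  interpret T: module R "T n" by (rule T)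
  have K: "submodule K R (T n)"
  proof -
    have "K = F p n \<inter> {x \<in> carrier (T n). d n x = \<zero>\<^bsub>T (n + 1)\<^esub>}" using F_carrier by (auto simp: K_def)
    then show ?thesis using submodule_Int[OF T F submodule_cocycles] by simp
  qed
  have B: "submodule B R (T n)"
    unfolding B_def by (rule submodule_Int[OF T F submodule_coboundaries])
  have BK: "B \<subseteq> K" using dd_prev F_carrier by (auto simp: B_def K_def)
  let ?F = "F (p + 1) n"
  have "B <+>\<^bsub>T n\<^esub> ?F \<subseteq> K <+>\<^bsub>T n\<^esub> ?F" using BK by (auto simp: set_add_def')
  then have "P \<in> Supp R (ss_limit T d F p q) \<longleftrightarrow> primeideal P R \<and>
      (\<exists>x\<in>K <+>\<^bsub>T n\<^esub> ?F. \<forall>s\<in>carrier R - P. s \<odot>\<^bsub>T n\<^esub> x \<notin> B <+>\<^bsub>T n\<^esub> ?F)"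
    unfolding ss_limit_def n_def[symmetric] cycles_limit boundaries_limit K_def[symmetric] B_def[symmetric]
    by (rule Supp_quotient_iff[OF T submodule_set_add[OF T K F] submodule_set_add[OF T B F]])
  also have "(\<exists>x\<in>K <+>\<^bsub>T n\<^esub> ?F. \<forall>s\<in>carrier R - P. s \<odot>\<^bsub>T n\<^esub> x \<notin> B <+>\<^bsub>T n\<^esub> ?F) \<longleftrightarrow>
      (\<exists>x\<in>K. \<forall>s\<in>carrier R - P. s \<odot>\<^bsub>T n\<^esub> x \<notin> B <+>\<^bsub>T n\<^esub> ?F)"
  proof
    assume "\<exists>x\<in>K <+>\<^bsub>T n\<^esub> ?F. \<forall>s\<in>carrier R - P. s \<odot>\<^bsub>T n\<^esub> x \<notin> B <+>\<^bsub>T n\<^esub> ?F"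
    then obtain x y where xy: "x \<in> K" "y \<in> ?F"
      and *: "\<forall>s\<in>carrier R - P. s \<odot>\<^bsub>T n\<^esub> (x \<oplus>\<^bsub>T n\<^esub> y) \<notin> B <+>\<^bsub>T n\<^esub> ?F"
      by (auto simp: set_add_def')
    have "s \<odot>\<^bsub>T n\<^esub> x \<notin> B <+>\<^bsub>T n\<^esub> ?F" if s: "s \<in> carrier R - P" for s
    proof
      assume "s \<odot>\<^bsub>T n\<^esub> x \<in> B <+>\<^bsub>T n\<^esub> ?F"
      moreover have sy: "s \<odot>\<^bsub>T n\<^esub> y \<in> ?F" using s xy T.submoduleE(4)[OF F] by simp
      then have "\<zero>\<^bsub>T n\<^esub> \<oplus>\<^bsub>T n\<^esub> s \<odot>\<^bsub>T n\<^esub> y \<in> B <+>\<^bsub>T n\<^esub> ?F"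
        using T.submodule_zero[OF B] unfolding set_add_def' by blast
      then have "s \<odot>\<^bsub>T n\<^esub> y \<in> B <+>\<^bsub>T n\<^esub> ?F" using F_carrier[OF sy] by simp
      ultimately have "s \<odot>\<^bsub>T n\<^esub> x \<oplus>\<^bsub>T n\<^esub> s \<odot>\<^bsub>T n\<^esub> y \<in> B <+>\<^bsub>T n\<^esub> ?F"
        by (rule T.submoduleE(5)[OF submodule_set_add[OF T B F]])
      moreover have "x \<in> carrier (T n)" "y \<in> carrier (T n)" using submodule_subset[OF K] xy F_carrier by auto
      ultimately show False using * s by (simp add: T.smult_r_distr)
    qed
    then show "\<exists>x\<in>K. \<forall>s\<in>carrier R - P. s \<odot>\<^bsub>T n\<^esub> x \<notin> B <+>\<^bsub>T n\<^esub> ?F" using xy by blast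
  next
    assume "\<exists>x\<in>K. \<forall>s\<in>carrier R - P. s \<odot>\<^bsub>T n\<^esub> x \<notin> B <+>\<^bsub>T n\<^esub> ?F"
    then obtain x where x: "x \<in> K" "\<forall>s\<in>carrier R - P. s \<odot>\<^bsub>T n\<^esub> x \<notin> B <+>\<^bsub>T n\<^esub> ?F" by blast
    have "x \<oplus>\<^bsub>T n\<^esub> \<zero>\<^bsub>T n\<^esub> \<in> K <+>\<^bsub>T n\<^esub> ?F"
      using x(1) T.submodule_zero[OF F] unfolding set_add_def' by blast
    moreover have "x \<in> carrier (T n)" using submodule_subset[OF K] x by auto
    ultimately have "x \<in> K <+>\<^bsub>T n\<^esub> ?F" by simp
    then show "\<exists>x\<in>K <+>\<^bsub>T n\<^esub> ?F. \<forall>s\<in>carrier R - P. s \<odot>\<^bsub>T n\<^esub> x \<notin> B <+>\<^bsub>T n\<^esub> ?F" using x by blast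
  qed
  finally show ?thesis unfolding n_def[symmetric] K_def B_def by auto
qed

text \<open>If \<open>P\<close> avoids the limit terms, a cocycle that no multiplier outside
  \<open>P\<close> makes a coboundary can be pushed ever deeper into the filtration with the same
  property, until it is zero, which is absurd. The other inclusion holds for each \<open>p\<close>
  separately.\<close>

lemma Supp_cohomology_eq:
  "Supp R (cohomology T d n) = (\<Union>p\<in>{0..c}. Supp R (ss_limit T d F p (n - p)))"
proof (intro equalityI subsetI)
  interpret T: module R "T n" by (rule T)
  fix P assume "P \<in> Supp R (cohomology T d n)"
  then obtain x where P: "primeideal P R" and x: "x \<in> carrier (T n)" "d n x = \<zero>\<^bsub>T (n + 1)\<^esub>"
    "\<forall>s\<in>carrier R - P. s \<odot>\<^bsub>T n\<^esub> x \<notin> d (n - 1) ` carrier (T (n - 1))"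
    unfolding Supp_cohomology_iff by blast
  interpret S: submonoid "carrier R - P" R by (rule submonoid_prime_complement[OF P])
  note im = submodule_coboundaries[of n]
  show "P \<in> (\<Union>p\<in>{0..c}. Supp R (ss_limit T d F p (n - p)))"
  proof (rule ccontr)
    assume not: "P \<notin> (\<Union>p\<in>{0..c}. Supp R (ss_limit T d F p (n - p)))"
    have "\<exists>x\<in>F (int k) n. d n x = \<zero>\<^bsub>T (n + 1)\<^esub> \<and>
        (\<forall>s\<in>carrier R - P. s \<odot>\<^bsub>T n\<^esub> x \<notin> d (n - 1) ` carrier (T (n - 1)))"
      if "int k \<le> c + 1" for k
      using that
    proof (induction k)
      case 0
      then show ?case using x by (auto simp: F_all)
    next
      case (Suc k)
      then obtain y where y: "y \<in> F (int k) n" "d n y = \<zero>\<^bsub>T (n + 1)\<^esub>"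
        "\<forall>s\<in>carrier R - P. s \<odot>\<^bsub>T n\<^esub> y \<notin> d (n - 1) ` carrier (T (n - 1))" by auto
      have "P \<notin> Supp R (ss_limit T d F (int k) (n - int k))" using not Suc.prems by auto
      then obtain s where s: "s \<in> carrier R - P" "s \<odot>\<^bsub>T n\<^esub> y \<in>
        (F (int k) n \<inter> d (n - 1) ` carrier (T (n - 1))) <+>\<^bsub>T n\<^esub> F (int k + 1) n"
        unfolding Supp_limit_iff using P y by auto
      \<comment> \<open>The next cocycle is \<open>z\<close>: it equals a multiple of
        \<open>y\<close> up to a coboundary, and it lies one step deeper. Since the multiplier is
        outside the prime \<open>P\<close>, no further one can make \<open>z\<close> a
        coboundary.\<close>
      then obtain w z where w: "w \<in> carrier (T (n - 1))" "z \<in> F (int k + 1) n"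
        and eq: "s \<odot>\<^bsub>T n\<^esub> y = d (n - 1) w \<oplus>\<^bsub>T n\<^esub> z"
        by (auto simp: set_add_def')
      have c: "y \<in> carrier (T n)" "z \<in> carrier (T n)" "d (n - 1) w \<in> carrier (T n)" "s \<in> carrier R"
        using y w s F_carrier module_hom_closed[OF d_prev] by auto
      interpret T1: module R "T (n + 1)" by (rule T)
      have "d n (s \<odot>\<^bsub>T n\<^esub> y) = \<zero>\<^bsub>T (n + 1)\<^esub>" using c y by (simp add: module_hom_smult[OF d])
      then have dz: "d n z = \<zero>\<^bsub>T (n + 1)\<^esub>"
        using c w d_closed unfolding eq by (simp add: module_hom_add[OF d] dd_prev)
      have "u \<odot>\<^bsub>T n\<^esub> z \<notin> d (n - 1) ` carrier (T (n - 1))" if u: "u \<in> carrier R - P" for u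
      proof
        assume "u \<odot>\<^bsub>T n\<^esub> z \<in> d (n - 1) ` carrier (T (n - 1))"
        moreover have "u \<odot>\<^bsub>T n\<^esub> d (n - 1) w \<in> d (n - 1) ` carrier (T (n - 1))"
          using T.submoduleE(4)[OF im] u w by blast
        ultimately have "u \<odot>\<^bsub>T n\<^esub> d (n - 1) w \<oplus>\<^bsub>T n\<^esub> u \<odot>\<^bsub>T n\<^esub> z \<in> d (n - 1) ` carrier (T (n - 1))"
          using T.submoduleE(5)[OF im] by blast
        also have "u \<odot>\<^bsub>T n\<^esub> d (n - 1) w \<oplus>\<^bsub>T n\<^esub> u \<odot>\<^bsub>T n\<^esub> z = (u \<otimes>\<^bsub>R\<^esub> s) \<odot>\<^bsub>T n\<^esub> y"
          using c u by (simp add: T.smult_r_distr[symmetric] eq[symmetric] T.smult_assoc1)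
        finally show False using y(3) S.m_closed[OF u s(1)] by blast
      qed
      then show ?case using w dz by (auto simp: add.commute)
    qed
    \<comment> \<open>Step \<open>c + 1\<close> is the first that \<open>F_none\<close> makes zero.
      For \<open>c + 1 < 0\<close> the index is 0, where the step is both everything and
      zero.\<close>
    from this[of "nat (c + 1)"] obtain y where y: "y \<in> F (int (nat (c + 1))) n"
      "\<forall>s\<in>carrier R - P. s \<odot>\<^bsub>T n\<^esub> y \<notin> d (n - 1) ` carrier (T (n - 1))"
      by (cases "0 \<le> c + 1") (use x F_all in auto)
    have "y = \<zero>\<^bsub>T n\<^esub>" using y(1) F_none[of "int (nat (c + 1))"] by simp
    moreover have "\<one>\<^bsub>R\<^esub> \<odot>\<^bsub>T n\<^esub> y \<notin> d (n - 1) ` carrier (T (n - 1))"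
      using y(2) S.one_closed by blast
    ultimately show False using T.submodule_zero[OF im] by simp
  qed
next
  interpret T: module R "T n" by (rule T)
  fix P assume "P \<in> (\<Union>p\<in>{0..c}. Supp R (ss_limit T d F p (n - p)))"
  then obtain p where p: "P \<in> Supp R (ss_limit T d F p (n - p))" by blast
  then obtain x where P: "primeideal P R" and x: "x \<in> F p n" "d n x = \<zero>\<^bsub>T (n + 1)\<^esub>"
    and *: "\<forall>s\<in>carrier R - P. s \<odot>\<^bsub>T n\<^esub> x \<notin> (F p n \<inter> d (n - 1) ` carrier (T (n - 1))) <+>\<^bsub>T n\<^esub> F (p + 1) n"
    using Supp_limit_iff[of P p "n - p"] by auto
  \<comment> \<open>The multiple stays in \<open>F p\<close>, so a coboundary of this form would be
    one of the boundaries of the limit term.\<close>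
  have "s \<odot>\<^bsub>T n\<^esub> x \<notin> d (n - 1) ` carrier (T (n - 1))" if s: "s \<in> carrier R - P" for s
  proof
    assume a: "s \<odot>\<^bsub>T n\<^esub> x \<in> d (n - 1) ` carrier (T (n - 1))"
    have sx: "s \<odot>\<^bsub>T n\<^esub> x \<in> F p n" using T.submoduleE(4)[OF F] s x by simp
    then have "s \<odot>\<^bsub>T n\<^esub> x \<oplus>\<^bsub>T n\<^esub> \<zero>\<^bsub>T n\<^esub> \<in> (F p n \<inter> d (n - 1) ` carrier (T (n - 1))) <+>\<^bsub>T n\<^esub> F (p + 1) n"
      using a T.submodule_zero[OF F] unfolding set_add_def' by blast
    then show False using * s F_carrier[OF sx] by simp
  qed
  then show "P \<in> Supp R (cohomology T d n)"
    unfolding Supp_cohomology_iff using P x F_carrier by blast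
qed

end

section \<open>Finite unions of Zariski-closed sets\<close>

lemma zariski_closed_empty:
  assumes "ring R" shows "zariski_closed R {}"
proof -
  interpret ring R by fact
  have "\<not> carrier R \<subseteq> P" if "primeideal P R" for P
  proof -
    interpret P: primeideal P R by fact
    show ?thesis using P.I_notcarr P.a_subset by blast
  qed
  then show ?thesis unfolding zariski_closed_def using oneideal by blast
qed

text \<open>The union is cut out by the intersection of the two ideals: a prime containing neither
  ideal misses some \<open>i\<close> and some \<open>j\<close>, hence their product, which lies in
  both ideals.\<close>

lemma zariski_closed_Un:
  assumes "ring R" "zariski_closed R X" "zariski_closed R Y" shows "zariski_closed R (X \<union> Y)"
proof -
  interpret ring R by fact
  obtain I J where IJ: "ideal I R" "ideal J R" "X = {P. primeideal P R \<and> I \<subseteq> P}"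
    "Y = {P. primeideal P R \<and> J \<subseteq> P}" using assms(2,3) by (auto simp: zariski_closed_def)
  have "I \<subseteq> P \<or> J \<subseteq> P" if P: "primeideal P R" and le: "I \<inter> J \<subseteq> P" for P
  proof (rule ccontr)
    interpret P: primeideal P R by fact
    assume "\<not> (I \<subseteq> P \<or> J \<subseteq> P)"
    then obtain i j where ij: "i \<in> I" "j \<in> J" "i \<notin> P" "j \<notin> P" by blast
    have c: "i \<in> carrier R" "j \<in> carrier R"
      using ij IJ(1,2) by (meson ideal.Icarr)+
    have "i \<otimes>\<^bsub>R\<^esub> j \<in> I \<inter> J" using ideal.I_r_closed[OF IJ(1)] ideal.I_l_closed[OF IJ(2)] ij c by blast
    then show False using le P.I_prime[OF c] ij by blast
  qed
  then have "X \<union> Y = {P. primeideal P R \<and> I \<inter> J \<subseteq> P}" unfolding IJ(3,4) by blast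
  then show ?thesis unfolding zariski_closed_def using i_intersect[OF IJ(1,2)] by blast
qed

lemma zariski_closed_UN:
  assumes "ring R" "finite A" "\<And>a. a \<in> A \<Longrightarrow> zariski_closed R (X a)"
  shows "zariski_closed R (\<Union>a\<in>A. X a)"
  using assms(2,3)
  by (induction A) (auto simp: zariski_closed_empty[OF assms(1)] intro: zariski_closed_Un[OF assms(1)])

section \<open>Double complexes\<close>

locale double_complex =
  fixes R :: "('a, 'm) ring_scheme" and D :: "int \<Rightarrow> int \<Rightarrow> ('a, 'b) module" and d1 d2
  assumes R: "cring R"
    and D: "\<And>i j. module R (D i j)"
    and d1: "\<And>i j. d1 i j \<in> module_hom R (D i j) (D (i + 1) j)"
    and d2: "\<And>i j. d2 i j \<in> module_hom R (D i j) (D i (j + 1))"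
    and d1_d1: "\<And>i j x. x \<in> carrier (D i j) \<Longrightarrow> d1 (i + 1) j (d1 i j x) = \<zero>\<^bsub>D (i + 2) j\<^esub>"
    and d2_d2: "\<And>i j x. x \<in> carrier (D i j) \<Longrightarrow> d2 i (j + 1) (d2 i j x) = \<zero>\<^bsub>D i (j + 2)\<^esub>"
    and d1_d2: "\<And>i j x. x \<in> carrier (D i j) \<Longrightarrow> d1 i (j + 1) (d2 i j x) = d2 (i + 1) j (d1 i j x)"
begin

abbreviation Tot where "Tot \<equiv> total_complex D"
abbreviation td where "td \<equiv> total_diff D d1 d2"

lemma D_plain: "plain_module R (D i j)"
  by (simp add: plain_module_def D)

lemma module_Tot: "module R (Tot n)"
  unfolding total_complex_def by (rule module_pi[OF R D])

lemma Tot_iff: "x \<in> carrier (Tot n) \<longleftrightarrow> (\<forall>i. x i \<in> carrier (D i (n - i)))"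
  by (simp add: total_complex_def PiE_iff)

lemma Tot_simps [simp]: "\<zero>\<^bsub>Tot n\<^esub> i = \<zero>\<^bsub>D i (n - i)\<^esub>"
  "(x \<oplus>\<^bsub>Tot n\<^esub> y) i = x i \<oplus>\<^bsub>D i (n - i)\<^esub> y i" "(a \<odot>\<^bsub>Tot n\<^esub> x) i = a \<odot>\<^bsub>D i (n - i)\<^esub> x i"
  by (simp_all add: total_complex_def)

lemma d1': "d1 (i - 1) (n - (i - 1)) \<in> module_hom R (D (i - 1) (n - (i - 1))) (D i (n + 1 - i))"
proof -
  have "i - 1 + 1 = i" "n - (i - 1) = n + 1 - i" by simp_all
  then show ?thesis using d1[of "i - 1" "n - (i - 1)"] by metis
qed

lemma d2': "d2 i (n - i) \<in> module_hom R (D i (n - i)) (D i (n + 1 - i))"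
proof -
  have "n - i + 1 = n + 1 - i" by simp
  then show ?thesis using d2[of i "n - i"] by metis
qed

lemma td_summands:
  assumes "x \<in> carrier (Tot n)"
  shows "d1 (i - 1) (n - (i - 1)) (x (i - 1)) \<in> carrier (D i (n + 1 - i))"
    "d2 i (n - i) (x i) \<in> carrier (D i (n + 1 - i))"
  using assms module_hom_closed[OF d1'] module_hom_closed[OF d2'] by (auto simp: Tot_iff)

lemma td_hom: "td n \<in> module_hom R (Tot n) (Tot (n + 1))"
proof (rule module_homI)
  show "td n x \<in> carrier (Tot (n + 1))" if x: "x \<in> carrier (Tot n)" for x
  proof -
    have "td n x i \<in> carrier (D i (n + 1 - i))" for i
    proof -
      interpret plain_module R "D i (n + 1 - i)" by (rule D_plain)
      show ?thesis using td_summands[OF x] by (simp add: total_diff_def)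
    qed
    then show ?thesis by (simp add: Tot_iff)
  qed
  show "td n (x \<oplus>\<^bsub>Tot n\<^esub> y) = td n x \<oplus>\<^bsub>Tot (n + 1)\<^esub> td n y"
    if x: "x \<in> carrier (Tot n)" and y: "y \<in> carrier (Tot n)" for x y
  proof (rule ext)
    fix i
    interpret plain_module R "D i (n + 1 - i)" by (rule D_plain)
    have e1: "d1 (i - 1) (n - (i - 1)) ((x \<oplus>\<^bsub>Tot n\<^esub> y) (i - 1)) =
      d1 (i - 1) (n - (i - 1)) (x (i - 1)) \<oplus>\<^bsub>D i (n + 1 - i)\<^esub> d1 (i - 1) (n - (i - 1)) (y (i - 1))"
      unfolding Tot_simps using x y unfolding Tot_iff by (intro module_hom_add[OF d1']) blast+
    have e2: "d2 i (n - i) ((x \<oplus>\<^bsub>Tot n\<^esub> y) i) = d2 i (n - i) (x i) \<oplus>\<^bsub>D i (n + 1 - i)\<^esub> d2 i (n - i) (y i)"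
      unfolding Tot_simps using x y unfolding Tot_iff by (intro module_hom_add[OF d2']) blast+
    show "td n (x \<oplus>\<^bsub>Tot n\<^esub> y) i = (td n x \<oplus>\<^bsub>Tot (n + 1)\<^esub> td n y) i"
      unfolding total_diff_def Tot_simps e1[unfolded Tot_simps] e2[unfolded Tot_simps]
      using td_summands[OF x, of i] td_summands[OF y, of i] by (simp add: signed_add M.a_ac)
  qed
  show "td n (a \<odot>\<^bsub>Tot n\<^esub> x) = a \<odot>\<^bsub>Tot (n + 1)\<^esub> td n x"
    if a: "a \<in> carrier R" and x: "x \<in> carrier (Tot n)" for a x
  proof (rule ext)
    fix i
    interpret plain_module R "D i (n + 1 - i)" by (rule D_plain)
    have e1: "d1 (i - 1) (n - (i - 1)) ((a \<odot>\<^bsub>Tot n\<^esub> x) (i - 1)) =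
      a \<odot>\<^bsub>D i (n + 1 - i)\<^esub> d1 (i - 1) (n - (i - 1)) (x (i - 1))"
      unfolding Tot_simps using x a unfolding Tot_iff by (intro module_hom_smult[OF d1']) blast+
    have e2: "d2 i (n - i) ((a \<odot>\<^bsub>Tot n\<^esub> x) i) = a \<odot>\<^bsub>D i (n + 1 - i)\<^esub> d2 i (n - i) (x i)"
      unfolding Tot_simps using x a unfolding Tot_iff by (intro module_hom_smult[OF d2']) blast+
    show "td n (a \<odot>\<^bsub>Tot n\<^esub> x) i = (a \<odot>\<^bsub>Tot (n + 1)\<^esub> td n x) i"
      unfolding total_diff_def Tot_simps e1[unfolded Tot_simps] e2[unfolded Tot_simps]
      using td_summands[OF x, of i] a by (simp add: signed_smult smult_r_distr)
  qed
qed

text \<open>The two pure terms vanish because each direction is a complex. The two mixed terms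
  agree, as \<open>d1\<close> and \<open>d2\<close> commute, and they carry the signs for
  \<open>i - 1\<close> and for \<open>i\<close>.\<close>

lemma td_td:
  assumes x: "x \<in> carrier (Tot n)"
  shows "td (n + 1) (td n x) = \<zero>\<^bsub>Tot (n + 2)\<^esub>"
proof (rule ext)
  fix i
  \<comment> \<open>The degrees are part of the modules and maps, so equal integers written
    differently would block rewriting. The equations \<open>ar\<close> bring all degrees into one
    form.\<close>
  define j k l where "j = n - i" and "k = i - 1" and "l = i - 1 - 1"
  then have ar: "i - 1 = k" "k - 1 = l" "k + 1 = i" "l + 1 = k" "l + 2 = i"
    "n - i = j" "n - k = j + 1" "n + 1 - i = j + 1" "n + 1 - k = j + 2" "n - l = j + 2"
    "n + 1 + 1 - i = j + 2" "n + 2 - i = j + 2" "j + 1 + 1 = j + 2" by simp_all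
  have "x m \<in> carrier (D m (n - m))" for m using x by (simp add: Tot_iff)
  from this[of l] this[of k] this[of i]
  have c: "x l \<in> carrier (D l (j + 2))" "x k \<in> carrier (D k (j + 1))" "x i \<in> carrier (D i j)"
    unfolding ar by blast+
  interpret A: plain_module R "D k (j + 2)" by (rule D_plain)
  interpret B: plain_module R "D i (j + 1)" by (rule D_plain)
  interpret plain_module R "D i (j + 2)" by (rule D_plain)
  have D1: "d1 k m \<in> module_hom R (D k m) (D i m)" for m using d1[of k m] by (simp only: ar)
  have D1': "d1 l m \<in> module_hom R (D l m) (D k m)" for m using d1[of l m] by (simp only: ar)
  have D2: "d2 m (j + 1) \<in> module_hom R (D m (j + 1)) (D m (j + 2))" for m
    using d2[of m "j + 1"] by (simp only: ar)
  have e: "d1 k (j + 2) (d1 l (j + 2) (x l)) = \<zero>\<^bsub>D i (j + 2)\<^esub>"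
    "d2 i (j + 1) (d2 i j (x i)) = \<zero>\<^bsub>D i (j + 2)\<^esub>"
    "d1 k (j + 2) (d2 k (j + 1) (x k)) = d2 i (j + 1) (d1 k (j + 1) (x k))"
    using d1_d1[OF c(1)] d2_d2[OF c(3)] d1_d2[OF c(2)] by (simp_all only: ar)
  have cl: "d1 l (j + 2) (x l) \<in> carrier (D k (j + 2))"
    "d2 k (j + 1) (x k) \<in> carrier (D k (j + 2))"
    "d1 k (j + 1) (x k) \<in> carrier (D i (j + 1))" "d2 i j (x i) \<in> carrier (D i (j + 1))"
    using module_hom_closed[OF D1' c(1)] module_hom_closed[OF D2 c(2)] module_hom_closed[OF D1 c(2)]
      module_hom_closed[OF d2 c(3)] by blast+
  have cl': "d2 i (j + 1) (d1 k (j + 1) (x k)) \<in> carrier (D i (j + 2))"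
    using module_hom_closed[OF D2] cl by blast
  have "td (n + 1) (td n x) i =
      d1 k (j + 2) (d1 l (j + 2) (x l) \<oplus>\<^bsub>D k (j + 2)\<^esub>
        signed (D k (j + 2)) k (d2 k (j + 1) (x k))) \<oplus>\<^bsub>D i (j + 2)\<^esub>
      signed (D i (j + 2)) i (d2 i (j + 1) (d1 k (j + 1) (x k) \<oplus>\<^bsub>D i (j + 1)\<^esub>
        signed (D i (j + 1)) i (d2 i j (x i))))"
    by (simp only: total_diff_def ar)
  also have "\<dots> = signed (D i (j + 2)) k (d2 i (j + 1) (d1 k (j + 1) (x k))) \<oplus>\<^bsub>D i (j + 2)\<^esub>
      signed (D i (j + 2)) i (d2 i (j + 1) (d1 k (j + 1) (x k)))"
    using cl cl' by (simp add: module_hom_add[OF D1] module_hom_add[OF D2] e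
      module_hom_signed[OF A.module_axioms module_axioms D1] module_hom_signed[OF B.module_axioms module_axioms D2])
  also have "\<dots> = \<zero>\<^bsub>D i (j + 2)\<^esub>"
    using signed_Suc[OF cl', of k] cl' unfolding ar by (simp add: M.r_neg)
  finally show "td (n + 1) (td n x) i = \<zero>\<^bsub>Tot (n + 2)\<^esub> i" by (simp only: Tot_simps ar)
qed

sublocale Tot: module_complex R Tot td
  by (rule module_complex.intro[OF module_Tot td_hom td_td])

lemma filtered_complex_Tot:
  assumes low: "\<And>i j. i < 0 \<Longrightarrow> carrier (D i j) = {\<zero>\<^bsub>D i j\<^esub>}"
    and high: "\<And>i j. i > c \<Longrightarrow> carrier (D i j) = {\<zero>\<^bsub>D i j\<^esub>}"
  shows "filtered_complex R Tot td (total_filtration D) c"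
proof (rule filtered_complex.intro[OF Tot.module_complex_axioms filtered_complex_axioms.intro])
  have mem: "x \<in> total_filtration D p n \<longleftrightarrow> x \<in> carrier (Tot n) \<and> (\<forall>i<p. x i = \<zero>\<^bsub>D i (n - i)\<^esub>)" for p n x
    by (simp add: total_filtration_def)
  show "submodule (total_filtration D p n) R (Tot n)" for p n
  proof -
    interpret T: module R "Tot n" by (rule module_Tot)
    have inv: "(\<ominus>\<^bsub>Tot n\<^esub> x) i = \<ominus>\<^bsub>D i (n - i)\<^esub> x i" if "x \<in> carrier (Tot n)" for x i
      using that pi_module_inv[OF R D, of x UNIV] by (simp add: total_complex_def)
    have "\<ominus>\<^bsub>D i j\<^esub> \<zero>\<^bsub>D i j\<^esub> = \<zero>\<^bsub>D i j\<^esub>" "\<zero>\<^bsub>D i j\<^esub> \<oplus>\<^bsub>D i j\<^esub> \<zero>\<^bsub>D i j\<^esub> = \<zero>\<^bsub>D i j\<^esub>"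
      "a \<in> carrier R \<Longrightarrow> a \<odot>\<^bsub>D i j\<^esub> \<zero>\<^bsub>D i j\<^esub> = \<zero>\<^bsub>D i j\<^esub>" for i j a
    proof -
      interpret plain_module R "D i j" by (rule D_plain)
      show "\<ominus>\<^bsub>D i j\<^esub> \<zero>\<^bsub>D i j\<^esub> = \<zero>\<^bsub>D i j\<^esub>" "\<zero>\<^bsub>D i j\<^esub> \<oplus>\<^bsub>D i j\<^esub> \<zero>\<^bsub>D i j\<^esub> = \<zero>\<^bsub>D i j\<^esub>"
        "a \<in> carrier R \<Longrightarrow> a \<odot>\<^bsub>D i j\<^esub> \<zero>\<^bsub>D i j\<^esub> = \<zero>\<^bsub>D i j\<^esub>" by simp_all
    qed
    note [simp] = this
    show ?thesis
    proof (rule T.submoduleI)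
      show "total_filtration D p n \<subseteq> carrier (Tot n)" using mem by blast
      show "\<zero>\<^bsub>Tot n\<^esub> \<in> total_filtration D p n" using T.M.zero_closed unfolding mem by simp
      show "\<ominus>\<^bsub>Tot n\<^esub> x \<in> total_filtration D p n" if "x \<in> total_filtration D p n" for x
        using that T.M.a_inv_closed[of x] unfolding mem by (simp add: inv)
      show "x \<oplus>\<^bsub>Tot n\<^esub> y \<in> total_filtration D p n"
        if "x \<in> total_filtration D p n" "y \<in> total_filtration D p n" for x y
        using that T.M.a_closed[of x y] unfolding mem by simp
      show "a \<odot>\<^bsub>Tot n\<^esub> x \<in> total_filtration D p n"
        if "a \<in> carrier R" "x \<in> total_filtration D p n" for a x
        using that T.smult_closed[of a x] unfolding mem by simp
    qed
  qed
  show "total_filtration D (p + 1) n \<subseteq> total_filtration D p n" for p n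
    unfolding total_filtration_def by force
  show "td n x \<in> total_filtration D p (n + 1)" if x: "x \<in> total_filtration D p n" for p n x
    unfolding mem
  proof (intro conjI allI impI)
    have xT: "x \<in> carrier (Tot n)" using x mem by blast
    show "td n x \<in> carrier (Tot (n + 1))" by (rule module_hom_closed[OF td_hom xT])
    fix i assume i: "i < p"
    interpret plain_module R "D i (n + 1 - i)" by (rule D_plain)
    have "x (i - 1) = \<zero>\<^bsub>D (i - 1) (n - (i - 1))\<^esub>" "x i = \<zero>\<^bsub>D i (n - i)\<^esub>"
      using x i unfolding mem by simp_all
    then show "td n x i = \<zero>\<^bsub>D i (n + 1 - i)\<^esub>"
      unfolding total_diff_def by (simp only: module_hom_zero[OF D D d1'] module_hom_zero[OF D D d2']
        signed_zero M.r_zero[OF M.zero_closed])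
  qed
  have el: "x i = \<zero>\<^bsub>D i (n - i)\<^esub>" if "x \<in> carrier (Tot n)" "carrier (D i (n - i)) = {\<zero>\<^bsub>D i (n - i)\<^esub>}" for x n i
    using that by (auto simp: Tot_iff)
  show "total_filtration D p n = carrier (Tot n)" if "p \<le> 0" for p n
    using that low el unfolding set_eq_iff mem by (metis less_le_trans)
  show "total_filtration D p n = {\<zero>\<^bsub>Tot n\<^esub>}" if "p > c" for p n
  proof -
    have "x = \<zero>\<^bsub>Tot n\<^esub>" if "x \<in> total_filtration D p n" for x
    proof (rule ext)
      fix i show "x i = \<zero>\<^bsub>Tot n\<^esub> i"
        using that \<open>p > c\<close> high el[of x n i] unfolding mem by (cases "i < p") auto
    qed
    moreover have "\<zero>\<^bsub>Tot n\<^esub> \<in> total_filtration D p n"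
      unfolding mem using abelian_monoid.zero_closed[of "Tot n"] module_Tot[of n]
      by (simp add: module_def abelian_group_def)
    ultimately show ?thesis by blast
  qed
qed

end

section \<open>The Koszul direction for a regular sequence\<close>

text \<open>\<open>N i j\<close> plays the role of \<open>(f\<^sub>0, \<dots>, f\<^sub>i\<^sub>-\<^sub>1) W\<^sup>j\<close>.\<close>

locale koszul_regular =
  fixes R :: "('a, 'm) ring_scheme" and fs :: "'a list" and W :: "int \<Rightarrow> ('a, 'b) module"
    and \<delta> :: "int \<Rightarrow> 'b \<Rightarrow> 'b" and N :: "nat \<Rightarrow> int \<Rightarrow> 'b set"
  assumes fs: "set fs \<subseteq> carrier R"
    and W: "module_complex R W \<delta>"
    and N: "\<And>i j. submodule (N i j) R (W j)"
    and N_0: "\<And>j. N 0 j = {\<zero>\<^bsub>W j\<^esub>}"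
    and N_Suc: "\<And>i j x. i < length fs \<Longrightarrow>
      x \<in> N (Suc i) j \<longleftrightarrow> (\<exists>y\<in>N i j. \<exists>w\<in>carrier (W j). x = y \<oplus>\<^bsub>W j\<^esub> (fs ! i) \<odot>\<^bsub>W j\<^esub> w)"
    and N_regular: "\<And>i j w. i < length fs \<Longrightarrow> w \<in> carrier (W j) \<Longrightarrow> (fs ! i) \<odot>\<^bsub>W j\<^esub> w \<in> N i j \<Longrightarrow> w \<in> N i j"
    and N_\<delta>: "\<And>i j x. x \<in> N i j \<Longrightarrow> \<delta> j x \<in> N i (j + 1)"
begin

sublocale W: module_complex R W \<delta> by (rule W)

abbreviation c where "c \<equiv> length fs"
abbreviation KD where "KD i j \<equiv> koszul fs (W j) i"

lemma W_plain: "plain_module R (W j)"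
  by (simp add: plain_module_def W.T)

lemma R_cring: "cring R"
  using W.T[of 0] by (simp add: module_def)

lemma f_closed [simp]: "a < c \<Longrightarrow> fs ! a \<in> carrier R"
  using fs nth_mem by blast

sublocale K: double_complex R KD "\<lambda>i j. koszul_diff fs (W j) i" "\<lambda>i j. koszul_map fs (\<delta> j) i"
proof (rule double_complex.intro)
  show "cring R" by (rule R_cring)
  fix i j
  interpret plain_module R "W j" by (rule W_plain)
  show "module R (KD i j)" by (rule module_koszul)
  show "koszul_diff fs (W j) i \<in> module_hom R (KD i j) (KD (i + 1) j)" by (rule koszul_diff_hom[OF fs])
  show "koszul_map fs (\<delta> j) i \<in> module_hom R (KD i j) (KD i (j + 1))" by (rule koszul_map_hom[OF W.d])
  fix x assume x: "x \<in> carrier (KD i j)"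
  show "koszul_diff fs (W j) (i + 1) (koszul_diff fs (W j) i x) = \<zero>\<^bsub>KD (i + 2) j\<^esub>"
    by (rule koszul_diff_diff[OF fs x])
  show "koszul_map fs (\<delta> (j + 1)) i (koszul_map fs (\<delta> j) i x) = \<zero>\<^bsub>KD i (j + 2)\<^esub>"
    using x by (simp add: koszul_map_def koszul_def) (intro restrict_ext, auto simp: PiE_iff intro!: W.dd)
  show "koszul_diff fs (W (j + 1)) i (koszul_map fs (\<delta> j) i x) =
    koszul_map fs (\<delta> j) (i + 1) (koszul_diff fs (W j) i x)"
    by (rule koszul_map_diff[OF plain_module_axioms W_plain W.d fs x])
qed

subsection \<open>Elements of the total complex as families\<close>

text \<open>The differential \<open>fd n\<close> has target degree \<open>n\<close>.\<close>

definition fam :: "int \<Rightarrow> (nat set \<Rightarrow> 'b) \<Rightarrow> bool" where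
  "fam n X \<longleftrightarrow> (\<forall>A\<subseteq>{..<c}. X A \<in> carrier (W (n - int (card A))))"

definition fd_term :: "int \<Rightarrow> (nat set \<Rightarrow> 'b) \<Rightarrow> nat set \<Rightarrow> nat \<Rightarrow> 'b" where
  "fd_term n X A a = signed (W (n - int (card A))) (position a A) ((fs ! a) \<odot>\<^bsub>W (n - int (card A))\<^esub> X (A - {a}))"

text \<open>Restricting the Koszul sum to a part \<open>B\<close> of \<open>A\<close> makes it
  possible to split off the term of a single element; \<open>B = A\<close> gives the total
  differential.\<close>

definition fd_rest :: "int \<Rightarrow> (nat set \<Rightarrow> 'b) \<Rightarrow> nat set \<Rightarrow> nat set \<Rightarrow> 'b" where
  "fd_rest n X A B = (\<Oplus>\<^bsub>W (n - int (card A))\<^esub>a\<in>B. fd_term n X A a) \<oplus>\<^bsub>W (n - int (card A))\<^esub>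
    signed (W (n - int (card A))) (int (card A)) (\<delta> (n - 1 - int (card A)) (X A))"

abbreviation fd where "fd n X A \<equiv> fd_rest n X A A"

lemma card_Diff: "A \<subseteq> {..<c} \<Longrightarrow> a \<in> A \<Longrightarrow> int (card (A - {a})) = int (card A) - 1"
  using card_Suc_Diff1[of A a] finite_subset[of A "{..<c}"] by auto

lemma famD: "fam n X \<Longrightarrow> A \<subseteq> {..<c} \<Longrightarrow> X A \<in> carrier (W (n - int (card A)))"
  by (simp add: fam_def)

lemma famD_Diff:
  assumes "fam (n - 1) X" "A \<subseteq> {..<c}" "a \<in> A"
  shows "X (A - {a}) \<in> carrier (W (n - int (card A)))"
proof -
  have "n - 1 - int (card (A - {a})) = n - int (card A)" using card_Diff[OF assms(2,3)] by simp
  then show ?thesis using famD[OF assms(1), of "A - {a}"] assms(2) by (metis Diff_subset subset_trans)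
qed

lemma fd_term_closed:
  assumes "fam (n - 1) X" "A \<subseteq> {..<c}" "a \<in> A"
  shows "fd_term n X A a \<in> carrier (W (n - int (card A)))"
proof -
  interpret plain_module R "W (n - int (card A))" by (rule W_plain)
  have "a < c" using assms by auto
  then show ?thesis using famD_Diff[OF assms] by (simp add: fd_term_def)
qed

lemma \<delta>_closed':
  "w \<in> carrier (W (n - 1 - k)) \<Longrightarrow> \<delta> (n - 1 - k) w \<in> carrier (W (n - k))"
  using W.d_closed[of w "n - 1 - k"] by (simp add: algebra_simps)

lemma \<delta>_hom': "\<delta> (n - 1 - k) \<in> module_hom R (W (n - 1 - k)) (W (n - k))"
  using W.d[of "n - 1 - k"] by (simp add: algebra_simps)

lemma fd_rest_closed:
  assumes "fam (n - 1) X" "A \<subseteq> {..<c}" "B \<subseteq> A"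
  shows "fd_rest n X A B \<in> carrier (W (n - int (card A)))"
proof -
  interpret plain_module R "W (n - int (card A))" by (rule W_plain)
  show ?thesis
    unfolding fd_rest_def using fd_term_closed[OF assms(1,2)] assms(3) \<delta>_closed'[OF famD[OF assms(1,2)]]
    by (intro M.a_closed M.finsum_closed signed_closed) auto
qed

lemma fam_fd: "fam (n - 1) X \<Longrightarrow> fam n (fd n X)"
  by (simp add: fam_def[of n] fd_rest_closed)

lemma fd_split:
  assumes "fam (n - 1) X" "A \<subseteq> {..<c}" "k \<in> A"
  shows "fd n X A = fd_term n X A k \<oplus>\<^bsub>W (n - int (card A))\<^esub> fd_rest n X A (A - {k})"
proof -
  interpret plain_module R "W (n - int (card A))" by (rule W_plain)
  have fin: "finite A" using assms(2) finite_subset by blast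
  have t: "fd_term n X A a \<in> carrier (W (n - int (card A)))" if "a \<in> A" for a
    using fd_term_closed[OF assms(1,2) that] .
  have "(\<Oplus>\<^bsub>W (n - int (card A))\<^esub>a\<in>insert k (A - {k}). fd_term n X A a) =
    fd_term n X A k \<oplus>\<^bsub>W (n - int (card A))\<^esub> (\<Oplus>\<^bsub>W (n - int (card A))\<^esub>a\<in>A - {k}. fd_term n X A a)"
    using fin t assms(3) by (intro M.finsum_insert) auto
  moreover have "insert k (A - {k}) = A" using assms(3) by auto
  ultimately show ?thesis
    unfolding fd_rest_def using t assms(3) \<delta>_closed'[OF famD[OF assms(1,2)]]
    by (simp add: M.a_assoc Pi_def)
qed

lemma fd_rest_cong:
  assumes "fam (n - 1) Y" "A \<subseteq> {..<c}" "B \<subseteq> A" "\<And>a. a \<in> B \<Longrightarrow> X (A - {a}) = Y (A - {a})" "X A = Y A"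
  shows "fd_rest n X A B = fd_rest n Y A B"
proof -
  interpret plain_module R "W (n - int (card A))" by (rule W_plain)
  have "(\<Oplus>\<^bsub>W (n - int (card A))\<^esub>a\<in>B. fd_term n X A a) = (\<Oplus>\<^bsub>W (n - int (card A))\<^esub>a\<in>B. fd_term n Y A a)"
  proof (rule M.finsum_cong')
    show "fd_term n Y A \<in> B \<rightarrow> carrier (W (n - int (card A)))"
      using fd_term_closed[OF assms(1,2)] assms(3) by auto
    show "fd_term n X A a = fd_term n Y A a" if "a \<in> B" for a
      using assms(4)[OF that] by (simp add: fd_term_def)
  qed simp
  then show ?thesis by (simp add: fd_rest_def assms(5))
qed

lemma fd_rest_in_submodule:
  assumes X: "fam (n - 1) X" and A: "A \<subseteq> {..<c}" and B: "B \<subseteq> A"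
    and H: "submodule H R (W (n - int (card A)))"
    and t: "\<And>a. a \<in> B \<Longrightarrow> (fs ! a) \<odot>\<^bsub>W (n - int (card A))\<^esub> X (A - {a}) \<in> H"
    and "\<delta> (n - 1 - int (card A)) (X A) \<in> H"
  shows "fd_rest n X A B \<in> H"
proof -
  interpret plain_module R "W (n - int (card A))" by (rule W_plain)
  have c: "x \<in> carrier (W (n - int (card A)))" if "x \<in> H" for x using submodule_subset[OF H] that by auto
  have "fd_term n X A a \<in> H" if "a \<in> B" for a
    using t[OF that] c[OF t[OF that]] by (simp add: fd_term_def signed_in_submodule_iff[OF H])
  then show ?thesis
    unfolding fd_rest_def using assms(6) c[OF assms(6)]
    by (intro submoduleE(5)[OF H] submodule_finsum[OF H]) (simp_all add: signed_in_submodule_iff[OF H])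
qed

section \<open>The submodules generated by initial segments of the sequence\<close>

lemma zero_in_N: "\<zero>\<^bsub>W j\<^esub> \<in> N i j"
  by (rule module.submodule_zero[OF W.T N])

lemma N_mono:
  assumes "i < c" shows "N i j \<subseteq> N (Suc i) j"
proof
  fix x assume x: "x \<in> N i j"
  interpret plain_module R "W j" by (rule W_plain)
  have "x \<in> carrier (W j)" using x submodule_subset[OF N] by blast
  then have "x = x \<oplus>\<^bsub>W j\<^esub> (fs ! i) \<odot>\<^bsub>W j\<^esub> \<zero>\<^bsub>W j\<^esub>" using assms by simp
  then show "x \<in> N (Suc i) j" using N_Suc[OF assms] x by blast
qed

text \<open>A multiple of \<open>fs ! a\<close> enters at stage \<open>Suc a\<close> and remains, as
  the stages increase.\<close>

lemma f_smult_in_N: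
  assumes "a < c" "y \<in> carrier (W j)" shows "(fs ! a) \<odot>\<^bsub>W j\<^esub> y \<in> N c j"
proof -
  interpret plain_module R "W j" by (rule W_plain)
  have "(fs ! a) \<odot>\<^bsub>W j\<^esub> y = \<zero>\<^bsub>W j\<^esub> \<oplus>\<^bsub>W j\<^esub> (fs ! a) \<odot>\<^bsub>W j\<^esub> y" using assms by simp
  then have *: "(fs ! a) \<odot>\<^bsub>W j\<^esub> y \<in> N (Suc a) j" using N_Suc[OF assms(1)] zero_in_N assms(2) by blast
  have "i \<le> c \<Longrightarrow> (fs ! a) \<odot>\<^bsub>W j\<^esub> y \<in> N i j" if "Suc a \<le> i" for i
    using that
  proof (induction i rule: dec_induct)
    case base
    show ?case by (rule *)
  next
    case (step i)
    then show ?case using N_mono[of i j] by auto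
  qed
  then show ?thesis using assms(1) by simp
qed

lemma f_smult_N:
  assumes "x \<in> N i j" "a < c" shows "(fs ! a) \<odot>\<^bsub>W j\<^esub> x \<in> N i j"
  using module.submoduleE(4)[OF W.T N] assms by simp

lemma \<delta>_N: "x \<in> N i (n - 1 - k) \<Longrightarrow> \<delta> (n - 1 - k) x \<in> N i (n - k)"
  using N_\<delta>[of x i "n - 1 - k"] by (simp add: algebra_simps)

lemma fd_rest_in_N:
  assumes X: "fam (n - 1) X" and A: "A \<subseteq> {..<c}" and B: "B \<subseteq> A"
    and t: "\<And>a. a \<in> B \<Longrightarrow> X (A - {a}) \<in> N i (n - int (card A))"
    and "X A \<in> N i (n - 1 - int (card A))"
  shows "fd_rest n X A B \<in> N i (n - int (card A))"
  using A B by (intro fd_rest_in_submodule[OF X A B N] f_smult_N t \<delta>_N assms(5)) auto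

text \<open>The corrections below have the form X - dY. Linearity is proved termwise because
  families are plain functions, constrained only on subsets of \<open>{..<c}\<close>.\<close>

lemma fd_minus:
  assumes X: "fam (n - 1) X" and Y: "fam (n - 1) Y" and A: "A \<subseteq> {..<c}"
    and Z: "\<And>A. A \<subseteq> {..<c} \<Longrightarrow> Z A = X A \<ominus>\<^bsub>W (n - 1 - int (card A))\<^esub> Y A"
  shows "fd n Z A = fd n X A \<ominus>\<^bsub>W (n - int (card A))\<^esub> fd n Y A"
proof -
  interpret plain_module R "W (n - int (card A))" by (rule W_plain)
  interpret W': plain_module R "W (n - 1 - int (card A))" by (rule W_plain)
  have sm: "signed (W (n - int (card A))) k (x \<ominus>\<^bsub>W (n - int (card A))\<^esub> y) =
    signed (W (n - int (card A))) k x \<ominus>\<^bsub>W (n - int (card A))\<^esub> signed (W (n - int (card A))) k y"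
    if "x \<in> carrier (W (n - int (card A)))" "y \<in> carrier (W (n - int (card A)))" for k x y
    using that unfolding signed_def by (cases "even k") (simp_all, algebra)
  have t: "fd_term n Z A a = fd_term n X A a \<ominus>\<^bsub>W (n - int (card A))\<^esub> fd_term n Y A a" if a: "a \<in> A" for a
  proof -
    have "n - 1 - int (card (A - {a})) = n - int (card A)" using card_Diff[OF A a] by simp
    moreover have "A - {a} \<subseteq> {..<c}" using A by auto
    ultimately have "Z (A - {a}) = X (A - {a}) \<ominus>\<^bsub>W (n - int (card A))\<^esub> Y (A - {a})" using Z by metis
    moreover have f: "fs ! a \<in> carrier R" using A a by auto
    note c = famD_Diff[OF X A a] famD_Diff[OF Y A a]
    have "(fs ! a) \<odot>\<^bsub>W (n - int (card A))\<^esub> (X (A - {a}) \<ominus>\<^bsub>W (n - int (card A))\<^esub> Y (A - {a})) =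
      (fs ! a) \<odot>\<^bsub>W (n - int (card A))\<^esub> X (A - {a}) \<ominus>\<^bsub>W (n - int (card A))\<^esub>
      (fs ! a) \<odot>\<^bsub>W (n - int (card A))\<^esub> Y (A - {a})"
      using c f by algebra
    ultimately show ?thesis using c f by (simp add: fd_term_def sm)
  qed
  have tc: "fd_term n X A a \<in> carrier (W (n - int (card A)))" "fd_term n Y A a \<in> carrier (W (n - int (card A)))"
    if "a \<in> A" for a using fd_term_closed[OF X A that] fd_term_closed[OF Y A that] by auto
  have fin: "finite A" using A finite_subset by blast
  have neg: "(\<Oplus>\<^bsub>W (n - int (card A))\<^esub>a\<in>A. \<ominus>\<^bsub>W (n - int (card A))\<^esub> fd_term n Y A a) =
    \<ominus>\<^bsub>W (n - int (card A))\<^esub> (\<Oplus>\<^bsub>W (n - int (card A))\<^esub>a\<in>A. fd_term n Y A a)"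
  proof (rule module_hom_finsum[OF module_axioms module_axioms, symmetric])
    show "a_inv (W (n - int (card A))) \<in> module_hom R (W (n - int (card A))) (W (n - int (card A)))"
      by (rule module_homI) (simp_all add: M.minus_add M.a_comm smult_r_minus)
  qed (use tc in auto)
  have "(\<Oplus>\<^bsub>W (n - int (card A))\<^esub>a\<in>A. fd_term n Z A a) =
    (\<Oplus>\<^bsub>W (n - int (card A))\<^esub>a\<in>A. fd_term n X A a \<oplus>\<^bsub>W (n - int (card A))\<^esub> \<ominus>\<^bsub>W (n - int (card A))\<^esub> fd_term n Y A a)"
    by (rule M.finsum_cong') (use t tc in \<open>auto simp: a_minus_def\<close>)
  also have "\<dots> = (\<Oplus>\<^bsub>W (n - int (card A))\<^esub>a\<in>A. fd_term n X A a) \<ominus>\<^bsub>W (n - int (card A))\<^esub>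
    (\<Oplus>\<^bsub>W (n - int (card A))\<^esub>a\<in>A. fd_term n Y A a)"
    unfolding M.minus_eq neg[symmetric] using tc by (intro M.finsum_addf) auto
  finally have s: "(\<Oplus>\<^bsub>W (n - int (card A))\<^esub>a\<in>A. fd_term n Z A a) =
    (\<Oplus>\<^bsub>W (n - int (card A))\<^esub>a\<in>A. fd_term n X A a) \<ominus>\<^bsub>W (n - int (card A))\<^esub>
    (\<Oplus>\<^bsub>W (n - int (card A))\<^esub>a\<in>A. fd_term n Y A a)" .
  define x y u v where "x = (\<Oplus>\<^bsub>W (n - int (card A))\<^esub>a\<in>A. fd_term n X A a)"
    and "y = (\<Oplus>\<^bsub>W (n - int (card A))\<^esub>a\<in>A. fd_term n Y A a)"
    and "u = signed (W (n - int (card A))) (int (card A)) (\<delta> (n - 1 - int (card A)) (X A))"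
    and "v = signed (W (n - int (card A))) (int (card A)) (\<delta> (n - 1 - int (card A)) (Y A))"
  have cl: "x \<in> carrier (W (n - int (card A)))" "y \<in> carrier (W (n - int (card A)))"
    "u \<in> carrier (W (n - int (card A)))" "v \<in> carrier (W (n - int (card A)))"
    using tc \<delta>_closed'[OF famD[OF X A]] \<delta>_closed'[OF famD[OF Y A]]
    by (auto simp: x_def y_def u_def v_def intro!: M.finsum_closed)
  have "signed (W (n - int (card A))) (int (card A)) (\<delta> (n - 1 - int (card A)) (Z A)) = u \<ominus>\<^bsub>W (n - int (card A))\<^esub> v"
    unfolding Z[OF A] u_def v_def
    using famD[OF X A] famD[OF Y A] \<delta>_closed'[OF famD[OF X A]] \<delta>_closed'[OF famD[OF Y A]]
    by (simp add: module_hom_minus[OF W'.module_axioms module_axioms \<delta>_hom'] sm)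
  then have "fd n Z A = (x \<ominus>\<^bsub>W (n - int (card A))\<^esub> y) \<oplus>\<^bsub>W (n - int (card A))\<^esub> (u \<ominus>\<^bsub>W (n - int (card A))\<^esub> v)"
    unfolding fd_rest_def s x_def y_def by simp
  also have "\<dots> = (x \<oplus>\<^bsub>W (n - int (card A))\<^esub> u) \<ominus>\<^bsub>W (n - int (card A))\<^esub> (y \<oplus>\<^bsub>W (n - int (card A))\<^esub> v)"
    using cl by algebra
  finally show ?thesis by (simp add: fd_rest_def x_def y_def u_def v_def)
qed

text \<open>In the total complex the first index of a component is determined by its subset, being
  its cardinality. \<open>un\<close> forgets this index and \<open>emb\<close> restores it, so that
  the inductions can run over subsets.\<close>

definition un :: "(int \<Rightarrow> nat set \<Rightarrow> 'b) \<Rightarrow> nat set \<Rightarrow> 'b" where "un x A = x (int (card A)) A"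
definition emb :: "(nat set \<Rightarrow> 'b) \<Rightarrow> int \<Rightarrow> nat set \<Rightarrow> 'b" where "emb X i = restrict X (subsets c i)"

lemma Tot_mem: "x \<in> carrier (K.Tot n) \<longleftrightarrow> (\<forall>i. x i \<in> (\<Pi>\<^sub>E A\<in>subsets c i. carrier (W (n - i))))"
  unfolding K.Tot_iff by (simp add: koszul_def)

lemma emb_Tot: "fam n X \<Longrightarrow> emb X \<in> carrier (K.Tot n)"
  unfolding Tot_mem emb_def by (auto simp: subsets_iff fam_def)

lemma un_emb: "A \<subseteq> {..<c} \<Longrightarrow> un (emb X) A = X A"
  by (simp add: un_def emb_def subsets_iff)

lemma fam_un: "x \<in> carrier (K.Tot n) \<Longrightarrow> fam n (un x)"
  unfolding Tot_mem by (auto simp: fam_def un_def subsets_iff PiE_iff)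

text \<open>The component at \<open>A\<close> sits in Koszul degree \<open>card A\<close>, so the
  sign of the total differential at this place is the one that \<open>fd_rest\<close> puts on
  \<delta>.\<close>

lemma td_un:
  assumes x: "x \<in> carrier (K.Tot n)" and A: "A \<subseteq> {..<c}"
  shows "un (K.td n x) A = fd (n + 1) (un x) A"
proof -
  define i where "i = int (card A)"
  have Ai: "A \<in> subsets c i" using A by (simp add: subsets_iff i_def)
  have xi: "x i \<in> carrier (KD i (n - i))" using x by (simp add: K.Tot_iff)
  interpret KD: plain_module R "KD i (n + 1 - i)" by (rule K.D_plain)
  interpret plain_module R "W (n + 1 - i)" by (rule W_plain)
  have ar: "n - (i - 1) = n + 1 - i" by simp
  have "koszul_diff fs (W (n + 1 - i)) (i - 1) (x (i - 1)) A =
    (\<Oplus>\<^bsub>W (n + 1 - i)\<^esub>a\<in>A. fd_term (n + 1) (un x) A a)"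
  proof -
    have "koszul_diff fs (W (n + 1 - i)) (i - 1) (x (i - 1)) A =
      (\<Oplus>\<^bsub>W (n + 1 - i)\<^esub>a\<in>A. signed (W (n + 1 - i)) (position a A) ((fs ! a) \<odot>\<^bsub>W (n + 1 - i)\<^esub> x (i - 1) (A - {a})))"
      using Ai by (simp add: koszul_diff_def)
    also have "\<dots> = (\<Oplus>\<^bsub>W (n + 1 - i)\<^esub>a\<in>A. fd_term (n + 1) (un x) A a)"
    proof (rule M.finsum_cong')
      show "fd_term (n + 1) (un x) A \<in> A \<rightarrow> carrier (W (n + 1 - i))"
        using fd_term_closed[of "n + 1" "un x" A] fam_un[OF x] A by (auto simp: i_def)
      show "signed (W (n + 1 - i)) (position a A) ((fs ! a) \<odot>\<^bsub>W (n + 1 - i)\<^esub> x (i - 1) (A - {a})) =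
        fd_term (n + 1) (un x) A a" if "a \<in> A" for a
        using card_Diff[OF A that] by (simp add: fd_term_def un_def i_def)
    qed simp
    finally show ?thesis .
  qed
  moreover have "signed (KD i (n + 1 - i)) i (koszul_map fs (\<delta> (n - i)) i (x i)) A =
      signed (W (n + 1 - i)) i (\<delta> (n - i) (un x A))"
  proof -
    have "koszul_map fs (\<delta> (n - i)) i (x i) \<in> carrier (KD i (n + 1 - i))"
      using K.td_summands(2)[OF x] .
    then have "signed (KD i (n + 1 - i)) i (koszul_map fs (\<delta> (n - i)) i (x i)) A =
      signed (W (n + 1 - i)) i (koszul_map fs (\<delta> (n - i)) i (x i) A)"
      using pi_module_signed[of R "subsets c i" "\<lambda>_. W (n + 1 - i)", OF R_cring module_axioms _ Ai]
      by (simp add: koszul_def)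
    then show ?thesis using Ai by (simp add: koszul_map_def un_def i_def)
  qed
  moreover have "un (K.td n x) A = koszul_diff fs (W (n + 1 - i)) (i - 1) (x (i - 1)) A \<oplus>\<^bsub>W (n + 1 - i)\<^esub>
    signed (KD i (n + 1 - i)) i (koszul_map fs (\<delta> (n - i)) i (x i)) A"
    unfolding un_def i_def[symmetric] total_diff_def ar using Ai
    by (simp add: koszul_def)
  ultimately show ?thesis unfolding fd_rest_def by (simp add: i_def)
qed

lemma Tot_ext:
  assumes "x \<in> carrier (K.Tot n)" "y \<in> carrier (K.Tot n)" "\<And>A. A \<subseteq> {..<c} \<Longrightarrow> un x A = un y A"
  shows "x = y"
proof (rule ext, rule pi_module_ext)
  fix i
  show "x i \<in> carrier (pi_module (subsets c i) (\<lambda>_. W (n - i)))"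
    "y i \<in> carrier (pi_module (subsets c i) (\<lambda>_. W (n - i)))"
    using assms(1,2) unfolding Tot_mem by simp_all
  show "x i A = y i A" if "A \<in> subsets c i" for A
    using assms(3)[of A] that by (auto simp: un_def subsets_iff)
qed

lemma un_zero: "A \<subseteq> {..<c} \<Longrightarrow> un \<zero>\<^bsub>K.Tot n\<^esub> A = \<zero>\<^bsub>W (n - int (card A))\<^esub>"
  unfolding un_def K.Tot_simps by (simp add: koszul_def subsets_iff)

lemma fd_cong:
  assumes "fam (n - 1) Y" "A \<subseteq> {..<c}" "\<And>A. A \<subseteq> {..<c} \<Longrightarrow> X A = Y A"
  shows "fd n X A = fd n Y A"
  by (rule fd_rest_cong[OF assms(1,2) subset_refl]) (rule assms(3), use assms(2) in blast)+

text \<open>Transported from the total complex through \<open>emb\<close> and \<open>un\<close>,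
  which spares a second computation with signs.\<close>

lemma fd_fd:
  assumes X: "fam (n - 1) X" and A: "A \<subseteq> {..<c}"
  shows "fd (n + 1) (fd n X) A = \<zero>\<^bsub>W (n + 1 - int (card A))\<^esub>"
proof -
  have e: "emb X \<in> carrier (K.Tot (n - 1))" by (rule emb_Tot[OF X])
  have t: "K.td (n - 1) (emb X) \<in> carrier (K.Tot n)" using module_hom_closed[OF K.td_hom e] by simp
  have 1: "un (K.td (n - 1) (emb X)) A = fd n X A" if "A \<subseteq> {..<c}" for A
  proof -
    have "un (K.td (n - 1) (emb X)) A = fd n (un (emb X)) A" using td_un[OF e that] by simp
    also have "\<dots> = fd n X A" by (rule fd_cong[OF X that]) (rule un_emb)
    finally show ?thesis .
  qed
  have "fd (n + 1) (fd n X) A = fd (n + 1) (un (K.td (n - 1) (emb X))) A"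
    using fam_un[OF t] A by (intro fd_cong) (simp_all add: 1)
  also have "\<dots> = un (K.td n (K.td (n - 1) (emb X))) A" by (rule td_un[OF t A, symmetric])
  also have "K.td n (K.td (n - 1) (emb X)) = \<zero>\<^bsub>K.Tot (n + 1)\<^esub>" by (rule K.Tot.dd_prev[OF e])
  also have "un \<zero>\<^bsub>K.Tot (n + 1)\<^esub> A = \<zero>\<^bsub>W (n + 1 - int (card A))\<^esub>" by (rule un_zero[OF A])
  finally show ?thesis .
qed

text \<open>Families living on the subsets that contain the first \<open>i\<close> indices; modulo
  \<open>N i\<close> they model the total complex for the remaining elements of the sequence. For
  \<open>i = 0\<close> this is no condition, for \<open>i = c\<close> only the top component is
  left.\<close>

definition supported :: "nat \<Rightarrow> int \<Rightarrow> (nat set \<Rightarrow> 'b) \<Rightarrow> bool" where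
  "supported i n X \<longleftrightarrow> (\<forall>A\<subseteq>{..<c}. \<not> {..<i} \<subseteq> A \<longrightarrow> X A = \<zero>\<^bsub>W (n - int (card A))\<^esub>)"

text \<open>The component at \<open>A\<close> is formed from components at \<open>A\<close> and at
  subsets of \<open>A\<close>, so an index missing from \<open>A\<close> is missing from all of
  them.\<close>

lemma supported_fd:
  assumes X: "fam (n - 1) X" and "supported i (n - 1) X"
  shows "supported i n (fd n X)"
  unfolding supported_def
proof (intro allI impI)
  fix A assume A: "A \<subseteq> {..<c}" and nA: "\<not> {..<i} \<subseteq> A"
  have z: "X A' = \<zero>\<^bsub>W (n - 1 - int (card A'))\<^esub>" if "A' \<subseteq> A" for A'
    using assms(2) that A nA by (auto simp: supported_def)
  have "fd n X A \<in> N 0 (n - int (card A))"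
  proof (rule fd_rest_in_N[OF X A subset_refl])
    show "X (A - {a}) \<in> N 0 (n - int (card A))" if "a \<in> A" for a
      using z[of "A - {a}"] card_Diff[OF A that] by (auto simp: N_0)
    show "X A \<in> N 0 (n - 1 - int (card A))" using z[of A] by (simp add: N_0)
  qed
  then show "fd n X A = \<zero>\<^bsub>W (n - int (card A))\<^esub>" by (simp add: N_0)
qed

text \<open>Injectivity on cohomology of taking the top component, relative to stage
  \<open>i\<close>. The induction descends from \<open>i = c\<close>, where the hypothesis on the
  top component is the claim, to \<open>i = 0\<close>, where \<open>N 0\<close> is zero and
  congruences become equations.\<close>

lemma koszul_inj:
  assumes "i \<le> c" "fam n X" "supported i n X"
    and "\<And>A. {..<i} \<subseteq> A \<Longrightarrow> A \<subseteq> {..<c} \<Longrightarrow> fd (n + 1) X A \<in> N i (n + 1 - int (card A))"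
    and "w \<in> carrier (W (n - 1 - int c))" "\<nu> \<in> N c (n - int c)"
    and "X {..<c} = \<delta> (n - 1 - int c) w \<oplus>\<^bsub>W (n - int c)\<^esub> \<nu>"
  shows "\<exists>Y. fam (n - 1) Y \<and> supported i (n - 1) Y \<and>
    (\<forall>A\<subseteq>{..<c}. {..<i} \<subseteq> A \<longrightarrow> X A \<ominus>\<^bsub>W (n - int (card A))\<^esub> fd n Y A \<in> N i (n - int (card A)))"
  using assms
proof (induction i arbitrary: X rule: inc_induct)
  case base
  interpret plain_module R "W (n - int c)" by (rule W_plain)
  interpret W': plain_module R "W (n - 1 - int c)" by (rule W_plain)
  \<comment> \<open>The sign on \<open>w\<close> compensates the one that the total differential
    puts on \<delta> at the top subset.\<close>
  define Y where "Y = (\<lambda>A. if A = {..<c} then signed (W (n - 1 - int c)) (int c) w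
    else \<zero>\<^bsub>W (n - 1 - int (card A))\<^esub>)"
  have z: "\<zero>\<^bsub>W j\<^esub> \<in> carrier (W j)" for j using submodule_subset[OF N] zero_in_N by blast
  have Y: "fam (n - 1) Y" using base z by (simp add: fam_def Y_def)
  have \<nu>: "\<nu> \<in> carrier (W (n - int c))" using submodule_subset[OF N] base by blast
  have dw: "\<delta> (n - 1 - int c) w \<in> carrier (W (n - int c))" using \<delta>_closed' base by blast
  have "fd_term n Y {..<c} a = \<zero>\<^bsub>W (n - int c)\<^esub>" if "a < c" for a
  proof -
    have "{..<c} - {a} \<noteq> {..<c}" using that by auto
    moreover have "int (card ({..<c} - {a})) = int c - 1" using card_Diff[of "{..<c}" a] that by simp
    ultimately have "Y ({..<c} - {a}) = \<zero>\<^bsub>W (n - int c)\<^esub>" by (simp add: Y_def)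
    then show ?thesis using that by (simp add: fd_term_def)
  qed
  then have "(\<Oplus>\<^bsub>W (n - int c)\<^esub>a\<in>{..<c}. fd_term n Y {..<c} a) = (\<Oplus>\<^bsub>W (n - int c)\<^esub>a\<in>{..<c}. \<zero>\<^bsub>W (n - int c)\<^esub>)"
    by (intro M.finsum_cong') auto
  then have "(\<Oplus>\<^bsub>W (n - int c)\<^esub>a\<in>{..<c}. fd_term n Y {..<c} a) = \<zero>\<^bsub>W (n - int c)\<^esub>" by simp
  moreover have "signed (W (n - int c)) (int c) (\<delta> (n - 1 - int c) (Y {..<c})) = \<delta> (n - 1 - int c) w"
    using base dw by (simp add: Y_def module_hom_signed[OF W'.module_axioms module_axioms \<delta>_hom'] signed_signed)
      (simp add: signed_def)
  ultimately have "fd n Y {..<c} = \<delta> (n - 1 - int c) w"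
    unfolding fd_rest_def card_lessThan using dw by simp
  then have "X {..<c} \<ominus>\<^bsub>W (n - int c)\<^esub> fd n Y {..<c} = \<nu>"
    using base(6) \<nu> dw by (simp only:) algebra
  then have "\<forall>A\<subseteq>{..<c}. {..<c} \<subseteq> A \<longrightarrow> X A \<ominus>\<^bsub>W (n - int (card A))\<^esub> fd n Y A \<in> N c (n - int (card A))"
    using base(5) by (metis card_lessThan subset_antisym)
  moreover have "supported c (n - 1) Y" unfolding supported_def Y_def by auto
  ultimately show ?case using Y by blast
next
  case (step i)
  note X = step.prems(1) and supp = step.prems(2) and dX = step.prems(3)
  have ic: "i < c" by fact
  have z: "\<zero>\<^bsub>W j\<^esub> \<in> carrier (W j)" for j using submodule_subset[OF N] zero_in_N by blast
  have lessSuc: "{..<Suc i} \<subseteq> A \<longleftrightarrow> {..<i} \<subseteq> A \<and> i \<in> A" for A by (auto simp: lessThan_Suc)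
  \<comment> \<open>Cutting \<open>X\<close> down to the subsets containing \<open>i\<close> changes
    its differential there by multiples of \<open>fs ! i\<close>, which are negligible modulo
    \<open>N (Suc i)\<close>. The top component is untouched because \<open>i < c\<close>.\<close>
  define X1 where "X1 = (\<lambda>A. if i \<in> A then X A else \<zero>\<^bsub>W (n - int (card A))\<^esub>)"
  have X1: "fam n X1" using X z by (simp add: fam_def X1_def)
  have "\<exists>Y. fam (n - 1) Y \<and> supported (Suc i) (n - 1) Y \<and>
    (\<forall>A\<subseteq>{..<c}. {..<Suc i} \<subseteq> A \<longrightarrow> X1 A \<ominus>\<^bsub>W (n - int (card A))\<^esub> fd n Y A \<in> N (Suc i) (n - int (card A)))"
  proof (rule step.IH[OF X1])
    show "supported (Suc i) n X1" using supp by (auto simp: supported_def X1_def lessSuc)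
    show "X1 {..<c} = \<delta> (n - 1 - int c) w \<oplus>\<^bsub>W (n - int c)\<^esub> \<nu>" using step.prems(6) ic by (simp add: X1_def)
    fix A assume A: "{..<Suc i} \<subseteq> A" "A \<subseteq> {..<c}"
    define U where "U = W (n + 1 - int (card A))"
    interpret U: plain_module R U unfolding U_def by (rule W_plain)
    have i: "i \<in> A" "{..<i} \<subseteq> A" using A by (auto simp: lessSuc)
    have fX: "fam (n + 1 - 1) X" "fam (n + 1 - 1) X1" using X X1 by simp_all
    have eq: "fd_rest (n + 1) X1 A (A - {i}) = fd_rest (n + 1) X A (A - {i})"
      by (rule fd_rest_cong[OF fX(1) A(2)]) (use i in \<open>auto simp: X1_def\<close>)
    have Xc: "X (A - {i}) \<in> carrier U" using famD_Diff[OF fX(1) A(2) i(1)] by (simp add: U_def)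
    have "i \<notin> A - {i}" by simp
    moreover have "n - int (card (A - {i})) = n + 1 - int (card A)" using card_Diff[OF A(2) i(1)] by simp
    ultimately have "X1 (A - {i}) = \<zero>\<^bsub>U\<^esub>" unfolding X1_def U_def by (simp only: if_False)
    then have t1: "fd_term (n + 1) X1 A i = \<zero>\<^bsub>U\<^esub>" using ic by (simp add: fd_term_def U_def[symmetric])
    have rc: "fd_rest (n + 1) X A (A - {i}) \<in> carrier U"
      unfolding U_def by (rule fd_rest_closed[OF fX(1) A(2)]) auto
    have "fd (n + 1) X1 A = fd_rest (n + 1) X A (A - {i})"
      using fd_split[OF fX(2) A(2) i(1)] rc by (simp add: U_def[symmetric] t1 eq)
    moreover have "fd (n + 1) X A = fd_term (n + 1) X A i \<oplus>\<^bsub>U\<^esub> fd_rest (n + 1) X A (A - {i})"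
      using fd_split[OF fX(1) A(2) i(1)] by (simp add: U_def)
    ultimately have "fd (n + 1) X1 A = fd (n + 1) X A \<ominus>\<^bsub>U\<^esub> fd_term (n + 1) X A i"
      using rc fd_term_closed[OF fX(1) A(2) i(1)] unfolding U_def[symmetric] by (simp only:) algebra
    moreover have "fd (n + 1) X A \<in> N (Suc i) (n + 1 - int (card A))"
      using dX[OF i(2) A(2)] N_mono[OF ic] by blast
    moreover have "fd_term (n + 1) X A i \<in> N (Suc i) (n + 1 - int (card A))"
    proof -
      have "(fs ! i) \<odot>\<^bsub>U\<^esub> X (A - {i}) = \<zero>\<^bsub>U\<^esub> \<oplus>\<^bsub>U\<^esub> (fs ! i) \<odot>\<^bsub>U\<^esub> X (A - {i})" using Xc ic by simp
      then have "(fs ! i) \<odot>\<^bsub>U\<^esub> X (A - {i}) \<in> N (Suc i) (n + 1 - int (card A))"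
        using N_Suc[OF ic] zero_in_N Xc unfolding U_def by blast
      moreover have "(fs ! i) \<odot>\<^bsub>U\<^esub> X (A - {i}) \<in> carrier U" using Xc ic by simp
      ultimately show ?thesis using U.signed_in_submodule_iff[of "N (Suc i) (n + 1 - int (card A))"] N
        by (simp add: fd_term_def U_def)
    qed
    ultimately show "fd (n + 1) X1 A \<in> N (Suc i) (n + 1 - int (card A))"
      using U.submodule_minus[of "N (Suc i) (n + 1 - int (card A))"] N by (simp add: U_def)
  qed (use step.prems in auto)
  then obtain Y1 where Y1: "fam (n - 1) Y1" and Y1s: "supported (Suc i) (n - 1) Y1" and
    Y1': "\<And>A. A \<subseteq> {..<c} \<Longrightarrow> {..<i} \<subseteq> A \<Longrightarrow> i \<in> A \<Longrightarrow>
      X A \<ominus>\<^bsub>W (n - int (card A))\<^esub> fd n Y1 A \<in> N (Suc i) (n - int (card A))"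
    unfolding lessSuc X1_def by auto
  \<comment> \<open>The defect is known modulo \<open>N (Suc i)\<close>, which is \<open>N i\<close>
    plus multiples of \<open>fs ! i\<close>; \<open>v A\<close> is the cofactor in that
    multiple.\<close>
  have "\<exists>w\<in>carrier (W (n - int (card A))). \<exists>y\<in>N i (n - int (card A)).
      X A \<ominus>\<^bsub>W (n - int (card A))\<^esub> fd n Y1 A = y \<oplus>\<^bsub>W (n - int (card A))\<^esub> (fs ! i) \<odot>\<^bsub>W (n - int (card A))\<^esub> w"
    if "A \<subseteq> {..<c} \<and> {..<i} \<subseteq> A \<and> i \<in> A" for A
    using Y1'[of A] that N_Suc[OF ic] by blast
  then obtain v where v: "\<And>A. A \<subseteq> {..<c} \<Longrightarrow> {..<i} \<subseteq> A \<Longrightarrow> i \<in> A \<Longrightarrow> v A \<in> carrier (W (n - int (card A)))"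
    and v': "\<And>A. A \<subseteq> {..<c} \<Longrightarrow> {..<i} \<subseteq> A \<Longrightarrow> i \<in> A \<Longrightarrow> \<exists>y\<in>N i (n - int (card A)).
      X A \<ominus>\<^bsub>W (n - int (card A))\<^esub> fd n Y1 A = y \<oplus>\<^bsub>W (n - int (card A))\<^esub> (fs ! i) \<odot>\<^bsub>W (n - int (card A))\<^esub> v A"
    by metis
  \<comment> \<open>The components on subsets without \<open>i\<close> are still free. Filled with
    the cofactors, and with the sign of the Koszul term undone, they contribute exactly the multiple
    of \<open>fs ! i\<close> that separates the defect from \<open>N i\<close>.\<close>
  define Y where "Y = (\<lambda>B. if i \<in> B then Y1 B
    else if {..<i} \<subseteq> B then signed (W (n - 1 - int (card B))) (position i (insert i B)) (v (insert i B))
    else \<zero>\<^bsub>W (n - 1 - int (card B))\<^esub>)"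
  have cardI: "n - 1 - int (card B) = n - int (card (insert i B))" if "i \<notin> B" "B \<subseteq> {..<c}" for B
    using that finite_subset[of B "{..<c}"] by simp
  have Yfam: "fam (n - 1) Y"
    unfolding fam_def
  proof (intro allI impI)
    fix B assume B: "B \<subseteq> {..<c}"
    interpret plain_module R "W (n - 1 - int (card B))" by (rule W_plain)
    have "v (insert i B) \<in> carrier (W (n - 1 - int (card B)))" if "i \<notin> B" "{..<i} \<subseteq> B"
      unfolding cardI[OF that(1) B] by (rule v) (use B ic that in auto)
    then show "Y B \<in> carrier (W (n - 1 - int (card B)))"
      using famD[OF Y1 B] by (simp add: Y_def)
  qed
  have Ysupp: "supported i (n - 1) Y" using Y1s by (auto simp: supported_def Y_def lessSuc)
  have main: "X A \<ominus>\<^bsub>W (n - int (card A))\<^esub> fd n Y A \<in> N i (n - int (card A))"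
    if A: "A \<subseteq> {..<c}" "{..<i} \<subseteq> A" "i \<in> A" for A
  proof -
    define U where "U = W (n - int (card A))"
    interpret U: plain_module R U unfolding U_def by (rule W_plain)
    have Ai: "A - {i} \<subseteq> {..<c}" "i \<notin> A - {i}" "{..<i} \<subseteq> A - {i}" "insert i (A - {i}) = A" using A by auto
    have cA: "n - 1 - int (card (A - {i})) = n - int (card A)" using cardI[OF Ai(2,1)] Ai(4) by simp
    have YA: "Y (A - {i}) = signed U (position i A) (v A)"
      unfolding Y_def cA U_def using Ai by simp
    have vA: "v A \<in> carrier U" using v[OF A] by (simp add: U_def)
    have "fd_term n Y A i = (fs ! i) \<odot>\<^bsub>U\<^esub> v A"
      using vA ic unfolding fd_term_def U_def[symmetric] YA
      by (simp add: U.signed_smult[symmetric] U.signed_signed) (simp add: signed_def)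
    moreover have rc: "fd_rest n Y A (A - {i}) \<in> carrier U"
      unfolding U_def by (rule fd_rest_closed[OF Yfam A(1)]) auto
    moreover have "fd n Y A = fd_term n Y A i \<oplus>\<^bsub>U\<^esub> fd_rest n Y A (A - {i})"
      using fd_split[OF Yfam A(1,3)] by (simp add: U_def)
    moreover have "fd_rest n Y A (A - {i}) = fd_rest n Y1 A (A - {i})"
      by (rule fd_rest_cong[OF Y1 A(1)]) (use A in \<open>auto simp: Y_def\<close>)
    moreover have "fd n Y1 A = fd_rest n Y1 A (A - {i})"
    proof -
      have "Y1 (A - {i}) = \<zero>\<^bsub>W (n - 1 - int (card (A - {i})))\<^esub>"
        using Y1s Ai by (simp add: supported_def lessSuc)
      then have "Y1 (A - {i}) = \<zero>\<^bsub>U\<^esub>" by (simp only: cA U_def)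
      then have "fd_term n Y1 A i = \<zero>\<^bsub>U\<^esub>" using ic by (simp add: fd_term_def U_def[symmetric])
      moreover have "fd_rest n Y1 A (A - {i}) \<in> carrier U"
        unfolding U_def by (rule fd_rest_closed[OF Y1 A(1)]) auto
      ultimately show ?thesis using fd_split[OF Y1 A(1,3)] by (simp add: U_def[symmetric])
    qed
    moreover obtain y where y: "y \<in> N i (n - int (card A))"
      "X A \<ominus>\<^bsub>U\<^esub> fd n Y1 A = y \<oplus>\<^bsub>U\<^esub> (fs ! i) \<odot>\<^bsub>U\<^esub> v A"
      using v'[OF A] unfolding U_def by blast
    moreover have "X A \<in> carrier U" using famD[OF X A(1)] by (simp add: U_def)
    moreover have "y \<in> carrier U" using submodule_subset[OF N] y(1) unfolding U_def by blast
    moreover have f: "(fs ! i) \<odot>\<^bsub>U\<^esub> v A \<in> carrier U" using ic vA by simp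
    ultimately have e: "fd n Y A = (fs ! i) \<odot>\<^bsub>U\<^esub> v A \<oplus>\<^bsub>U\<^esub> fd n Y1 A" "fd n Y1 A \<in> carrier U"
      by simp_all
    define p q r where "p = X A" and "q = fd n Y1 A" and "r = (fs ! i) \<odot>\<^bsub>U\<^esub> v A"
    have c: "p \<in> carrier U" "q \<in> carrier U" "r \<in> carrier U" "y \<in> carrier U" "p \<ominus>\<^bsub>U\<^esub> q = y \<oplus>\<^bsub>U\<^esub> r"
      using \<open>X A \<in> carrier U\<close> e(2) f \<open>y \<in> carrier U\<close> y(2) by (simp_all add: p_def q_def r_def)
    have "p \<ominus>\<^bsub>U\<^esub> (r \<oplus>\<^bsub>U\<^esub> q) = (p \<ominus>\<^bsub>U\<^esub> q) \<ominus>\<^bsub>U\<^esub> r" using c(1-4) by algebra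
    also have "\<dots> = y" unfolding c(5) using c(1-4) by algebra
    finally have "X A \<ominus>\<^bsub>U\<^esub> fd n Y A = y" unfolding e p_def q_def r_def .
    then show ?thesis using y(1) by (simp add: U_def)
  qed
  \<comment> \<open>By construction the new defect is in \<open>N i\<close> on subsets containing
    \<open>i\<close>. On the others it is controlled by the cocycle condition one subset
    higher.\<close>
  define Z where "Z = (\<lambda>A. X A \<ominus>\<^bsub>W (n - int (card A))\<^esub> fd n Y A)"
  have fY: "fam n (fd n Y)" by (rule fam_fd[OF Yfam])
  have Z: "fam n Z"
    unfolding fam_def
  proof (intro allI impI)
    fix B assume B: "B \<subseteq> {..<c}"
    interpret plain_module R "W (n - int (card B))" by (rule W_plain)
    show "Z B \<in> carrier (W (n - int (card B)))"
      unfolding Z_def by (rule M.minus_closed[OF famD[OF X B] famD[OF fY B]])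
  qed
  have "Z A \<in> N i (n - int (card A))" if A: "A \<subseteq> {..<c}" "{..<i} \<subseteq> A" for A
  proof (cases "i \<in> A")
    case True
    then show ?thesis using main[OF A] by (simp add: Z_def)
  next
    case False
    \<comment> \<open>In the differential of \<open>Z\<close> at \<open>B\<close> every term except
      the one for \<open>i\<close> is in \<open>N i\<close>, and so is the sum. Hence
      \<open>fs ! i\<close> times \<open>Z A\<close> is in \<open>N i\<close>, and regularity
      removes the factor.\<close>
    define B where "B = insert i A"
    have B: "B \<subseteq> {..<c}" "{..<i} \<subseteq> B" "i \<in> B" "B - {i} = A" using A ic False by (auto simp: B_def)
    define U where "U = W (n + 1 - int (card B))"
    interpret U: plain_module R U unfolding U_def by (rule W_plain)
    have cB: "n - int (card A) = n + 1 - int (card B)"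
      using finite_subset[OF A(1)] False by (simp add: B_def)
    have Z1: "fam (n + 1 - 1) Z" and X1: "fam (n + 1 - 1) X" and fY1: "fam (n + 1 - 1) (fd n Y)"
      using Z X fY by simp_all
    have "fd (n + 1) Z B = fd (n + 1) X B \<ominus>\<^bsub>U\<^esub> fd (n + 1) (fd n Y) B"
      unfolding U_def by (rule fd_minus[OF X1 fY1 B(1)]) (simp add: Z_def)
    also have "\<dots> = fd (n + 1) X B"
      using fd_fd[OF Yfam B(1)] fd_rest_closed[OF X1 B(1) subset_refl]
      by (simp add: U_def[symmetric] U.minus_zero_right)
    finally have "fd (n + 1) Z B \<in> N i (n + 1 - int (card B))" using dX[OF B(2,1)] by simp
    moreover have "fd_rest (n + 1) Z B (B - {i}) \<in> N i (n + 1 - int (card B))"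
    proof (rule fd_rest_in_N[OF Z1 B(1)])
      show "Z B \<in> N i (n + 1 - 1 - int (card B))" using main[OF B(1-3)] by (simp add: Z_def)
      fix a assume a: "a \<in> B - {i}"
      have cBa: "n - int (card (B - {a})) = n + 1 - int (card B)" using card_Diff[OF B(1), of a] a by simp
      have Ba: "B - {a} \<subseteq> {..<c}" using B by auto
      show "Z (B - {a}) \<in> N i (n + 1 - int (card B))"
      proof (cases "{..<i} \<subseteq> B - {a}")
        case True
        have "i \<in> B - {a}" using a B(3) by simp
        from main[OF Ba True this] show ?thesis unfolding Z_def cBa .
      next
        case False
        then have "X (B - {a}) = \<zero>\<^bsub>U\<^esub>" "fd n Y (B - {a}) = \<zero>\<^bsub>U\<^esub>"
          using supp supported_fd[OF Yfam Ysupp] Ba cBa unfolding supported_def U_def by metis+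
        then have "Z (B - {a}) = \<zero>\<^bsub>U\<^esub>"
          unfolding Z_def cBa U_def[symmetric] by (simp add: U.minus_zero_right)
        then show ?thesis using zero_in_N by (simp add: U_def)
      qed
    qed auto
    moreover have "fd (n + 1) Z B = fd_term (n + 1) Z B i \<oplus>\<^bsub>U\<^esub> fd_rest (n + 1) Z B (B - {i})"
      using fd_split[OF Z1 B(1,3)] by (simp add: U_def)
    moreover have tc: "fd_term (n + 1) Z B i \<in> carrier U"
      using fd_term_closed[OF Z1 B(1,3)] by (simp add: U_def)
    moreover have "fd_rest (n + 1) Z B (B - {i}) \<in> carrier U"
      unfolding U_def by (rule fd_rest_closed[OF Z1 B(1)]) auto
    ultimately have "fd_term (n + 1) Z B i \<in> N i (n + 1 - int (card B))"
      using U.submodule_add_cancel[OF N[of i "n + 1 - int (card B)", folded U_def]] by metis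
    moreover have ZA: "Z A \<in> carrier U" using famD[OF Z A(1)] by (simp add: U_def cB)
    ultimately have "(fs ! i) \<odot>\<^bsub>U\<^esub> Z A \<in> N i (n + 1 - int (card B))"
      using U.signed_in_submodule_iff[OF N[of i "n + 1 - int (card B)", folded U_def]] ic
      by (simp add: fd_term_def B(4) U_def[symmetric])
    then have "Z A \<in> N i (n + 1 - int (card B))" using N_regular[OF ic] ZA by (simp add: U_def)
    then show ?thesis by (simp add: cB)
  qed
  then show ?case using Yfam Ysupp by (auto simp: Z_def)
qed

text \<open>Surjectivity counterpart of \<open>koszul_inj\<close>, by the same descent: a top
  component that is a cocycle modulo \<open>N c\<close> is extended downwards to a family that is a
  cocycle modulo \<open>N i\<close>.\<close>

lemma koszul_surj:
  assumes "i \<le> c" "w \<in> carrier (W (n - int c))" "\<delta> (n - int c) w \<in> N c (n + 1 - int c)"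
  shows "\<exists>X. fam n X \<and> supported i n X \<and> X {..<c} = w \<and>
    (\<forall>A\<subseteq>{..<c}. {..<i} \<subseteq> A \<longrightarrow> fd (n + 1) X A \<in> N i (n + 1 - int (card A)))"
  using assms
proof (induction i rule: inc_induct)
  case base
  have z: "\<zero>\<^bsub>W j\<^esub> \<in> carrier (W j)" for j using submodule_subset[OF N] zero_in_N by blast
  \<comment> \<open>With nothing below the top subset, the top component of the differential is
    \<delta> \<open>w\<close> up to sign, which is in \<open>N c\<close> by assumption.\<close>
  define X where "X = (\<lambda>A. if A = {..<c} then w else \<zero>\<^bsub>W (n - int (card A))\<^esub>)"
  have X: "fam n X" using base z by (simp add: fam_def X_def)
  have "fd (n + 1) X {..<c} \<in> N c (n + 1 - int (card {..<c}))"
  proof (rule fd_rest_in_submodule[OF _ _ subset_refl N])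
    show "fam (n + 1 - 1) X" using X by simp
    show "\<delta> (n + 1 - 1 - int (card {..<c})) (X {..<c}) \<in> N c (n + 1 - int (card {..<c}))"
      using base by (simp add: X_def)
    fix a assume a: "a \<in> {..<c}"
    interpret plain_module R "W (n + 1 - int c)" by (rule W_plain)
    have "{..<c} - {a} \<noteq> {..<c}" using a by auto
    moreover have "n - int (card ({..<c} - {a})) = n + 1 - int c" using card_Diff[of "{..<c}" a] a by simp
    ultimately have "X ({..<c} - {a}) = \<zero>\<^bsub>W (n + 1 - int c)\<^esub>" unfolding X_def by (simp only: if_False)
    then show "(fs ! a) \<odot>\<^bsub>W (n + 1 - int (card {..<c}))\<^esub> X ({..<c} - {a}) \<in> N c (n + 1 - int (card {..<c}))"
      using a zero_in_N by simp
  qed simp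
  then have "\<forall>A\<subseteq>{..<c}. {..<c} \<subseteq> A \<longrightarrow> fd (n + 1) X A \<in> N c (n + 1 - int (card A))"
    by (metis subset_antisym)
  moreover have "supported c n X" unfolding supported_def X_def by auto
  moreover have "X {..<c} = w" by (simp add: X_def)
  ultimately show ?case using X by blast
next
  case (step i)
  have ic: "i < c" by fact
  have z: "\<zero>\<^bsub>W j\<^esub> \<in> carrier (W j)" for j using submodule_subset[OF N] zero_in_N by blast
  have lessSuc: "{..<Suc i} \<subseteq> A \<longleftrightarrow> {..<i} \<subseteq> A \<and> i \<in> A" for A by (auto simp: lessThan_Suc)
  obtain X1 where X1: "fam n X1" and X1s: "supported (Suc i) n X1" and X1c: "X1 {..<c} = w" and
    X1': "\<And>A. A \<subseteq> {..<c} \<Longrightarrow> {..<i} \<subseteq> A \<Longrightarrow> i \<in> A \<Longrightarrow> fd (n + 1) X1 A \<in> N (Suc i) (n + 1 - int (card A))"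
    using step unfolding lessSuc by auto
  have "\<exists>v\<in>carrier (W (n + 1 - int (card A))). \<exists>y\<in>N i (n + 1 - int (card A)).
      fd (n + 1) X1 A = y \<oplus>\<^bsub>W (n + 1 - int (card A))\<^esub> (fs ! i) \<odot>\<^bsub>W (n + 1 - int (card A))\<^esub> v"
    if "A \<subseteq> {..<c} \<and> {..<i} \<subseteq> A \<and> i \<in> A" for A
    using X1'[of A] that N_Suc[OF ic] by blast
  then obtain v where v: "\<And>A. A \<subseteq> {..<c} \<Longrightarrow> {..<i} \<subseteq> A \<Longrightarrow> i \<in> A \<Longrightarrow> v A \<in> carrier (W (n + 1 - int (card A)))"
    and v': "\<And>A. A \<subseteq> {..<c} \<Longrightarrow> {..<i} \<subseteq> A \<Longrightarrow> i \<in> A \<Longrightarrow> \<exists>y\<in>N i (n + 1 - int (card A)).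
      fd (n + 1) X1 A = y \<oplus>\<^bsub>W (n + 1 - int (card A))\<^esub> (fs ! i) \<odot>\<^bsub>W (n + 1 - int (card A))\<^esub> v A"
    by metis
  \<comment> \<open>As in \<open>koszul_inj\<close>, but with a minus sign: the multiple of
    \<open>fs ! i\<close> in the differential of \<open>X1\<close> is to be cancelled rather than
    reproduced.\<close>
  define X where "X = (\<lambda>B. if i \<in> B then X1 B
    else if {..<i} \<subseteq> B then \<ominus>\<^bsub>W (n - int (card B))\<^esub> signed (W (n - int (card B))) (position i (insert i B)) (v (insert i B))
    else \<zero>\<^bsub>W (n - int (card B))\<^esub>)"
  have cardI: "n - int (card B) = n + 1 - int (card (insert i B))" if "i \<notin> B" "B \<subseteq> {..<c}" for B
    using that finite_subset[of B "{..<c}"] by simp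
  have X: "fam n X"
    unfolding fam_def
  proof (intro allI impI)
    fix B assume B: "B \<subseteq> {..<c}"
    interpret plain_module R "W (n - int (card B))" by (rule W_plain)
    have "v (insert i B) \<in> carrier (W (n - int (card B)))" if "i \<notin> B" "{..<i} \<subseteq> B"
      unfolding cardI[OF that(1) B] by (rule v) (use B ic that in auto)
    then show "X B \<in> carrier (W (n - int (card B)))"
      using famD[OF X1 B] by (simp add: X_def)
  qed
  have Xs: "supported i n X" using X1s by (auto simp: supported_def X_def lessSuc)
  have fX: "fam (n + 1 - 1) X" "fam (n + 1 - 1) X1" using X X1 by simp_all
  have main: "fd (n + 1) X A \<in> N i (n + 1 - int (card A))"
    if A: "A \<subseteq> {..<c}" "{..<i} \<subseteq> A" "i \<in> A" for A
  proof -
    define U where "U = W (n + 1 - int (card A))"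
    interpret U: plain_module R U unfolding U_def by (rule W_plain)
    have Ai: "A - {i} \<subseteq> {..<c}" "i \<notin> A - {i}" "{..<i} \<subseteq> A - {i}" "insert i (A - {i}) = A" using A by auto
    have cA: "n - int (card (A - {i})) = n + 1 - int (card A)" using cardI[OF Ai(2,1)] Ai(4) by simp
    have XA: "X (A - {i}) = \<ominus>\<^bsub>U\<^esub> signed U (position i A) (v A)"
      unfolding X_def cA U_def using Ai by simp
    have vA: "v A \<in> carrier U" using v[OF A] by (simp add: U_def)
    have "fd_term (n + 1) X A i = \<ominus>\<^bsub>U\<^esub> ((fs ! i) \<odot>\<^bsub>U\<^esub> v A)"
      using vA ic unfolding fd_term_def U_def[symmetric] XA
      by (auto simp: signed_def U.smult_r_minus)
    moreover have "fd (n + 1) X A = fd_term (n + 1) X A i \<oplus>\<^bsub>U\<^esub> fd_rest (n + 1) X A (A - {i})"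
      using fd_split[OF fX(1) A(1,3)] by (simp add: U_def)
    moreover have "fd_rest (n + 1) X A (A - {i}) = fd_rest (n + 1) X1 A (A - {i})"
      by (rule fd_rest_cong[OF fX(2) A(1)]) (use A in \<open>auto simp: X_def\<close>)
    moreover have "fd (n + 1) X1 A = fd_rest (n + 1) X1 A (A - {i})"
    proof -
      have "X1 (A - {i}) = \<zero>\<^bsub>W (n - int (card (A - {i})))\<^esub>"
        using X1s Ai by (simp add: supported_def lessSuc)
      then have "X1 (A - {i}) = \<zero>\<^bsub>U\<^esub>" by (simp only: cA U_def)
      then have "fd_term (n + 1) X1 A i = \<zero>\<^bsub>U\<^esub>" using ic by (simp add: fd_term_def U_def[symmetric])
      moreover have "fd_rest (n + 1) X1 A (A - {i}) \<in> carrier U"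
        unfolding U_def by (rule fd_rest_closed[OF fX(2) A(1)]) auto
      ultimately show ?thesis using fd_split[OF fX(2) A(1,3)] by (simp add: U_def[symmetric])
    qed
    moreover obtain y where y: "y \<in> N i (n + 1 - int (card A))"
      "fd (n + 1) X1 A = y \<oplus>\<^bsub>U\<^esub> (fs ! i) \<odot>\<^bsub>U\<^esub> v A"
      using v'[OF A] unfolding U_def by blast
    ultimately have e: "fd (n + 1) X A = \<ominus>\<^bsub>U\<^esub> ((fs ! i) \<odot>\<^bsub>U\<^esub> v A) \<oplus>\<^bsub>U\<^esub> (y \<oplus>\<^bsub>U\<^esub> (fs ! i) \<odot>\<^bsub>U\<^esub> v A)"
      by simp
    define r where "r = (fs ! i) \<odot>\<^bsub>U\<^esub> v A"
    have "y \<in> carrier U" using submodule_subset[OF N] y(1) unfolding U_def by blast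
    moreover have "r \<in> carrier U" using ic vA by (simp add: r_def)
    ultimately have "\<ominus>\<^bsub>U\<^esub> r \<oplus>\<^bsub>U\<^esub> (y \<oplus>\<^bsub>U\<^esub> r) = y" by algebra
    then show ?thesis using y(1) e by (simp add: r_def)
  qed
  have "fd (n + 1) X A \<in> N i (n + 1 - int (card A))" if A: "A \<subseteq> {..<c}" "{..<i} \<subseteq> A" for A
  proof (cases "i \<in> A")
    case True
    then show ?thesis using main[OF A] by simp
  next
    case False
    define B where "B = insert i A"
    \<comment> \<open>The differential of \<open>X\<close> is itself a cocycle. This replaces the
      cocycle hypothesis of \<open>koszul_inj\<close> in the argument that strips
      \<open>fs ! i\<close> by regularity.\<close>
    define Z where "Z = fd (n + 1) X"
    have B: "B \<subseteq> {..<c}" "{..<i} \<subseteq> B" "i \<in> B" "B - {i} = A" using A ic False by (auto simp: B_def)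
    define U where "U = W (n + 2 - int (card B))"
    interpret U: plain_module R U unfolding U_def by (rule W_plain)
    have cB: "n + 1 - int (card A) = n + 2 - int (card B)"
      using finite_subset[OF A(1)] False by (simp add: B_def)
    have Z: "fam (n + 1) Z" unfolding Z_def by (rule fam_fd[OF fX(1)])
    then have Z1: "fam (n + 2 - 1) Z" by (simp add: algebra_simps)
    have Zs: "supported i (n + 1) Z" unfolding Z_def by (rule supported_fd[OF fX(1)]) (simp add: Xs)
    have "fd (n + 2) Z B = \<zero>\<^bsub>U\<^esub>" using fd_fd[OF fX(1) B(1)] by (simp add: Z_def U_def add.assoc)
    then have "fd (n + 2) Z B \<in> N i (n + 2 - int (card B))" using zero_in_N by (simp add: U_def)
    moreover have "fd_rest (n + 2) Z B (B - {i}) \<in> N i (n + 2 - int (card B))"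
    proof (rule fd_rest_in_N[OF Z1 B(1)])
      show "Z B \<in> N i (n + 2 - 1 - int (card B))" using main[OF B(1-3)] by (simp add: Z_def algebra_simps)
      fix a assume a: "a \<in> B - {i}"
      have cBa: "n + 1 - int (card (B - {a})) = n + 2 - int (card B)" using card_Diff[OF B(1), of a] a by simp
      have Ba: "B - {a} \<subseteq> {..<c}" using B by auto
      show "Z (B - {a}) \<in> N i (n + 2 - int (card B))"
      proof (cases "{..<i} \<subseteq> B - {a}")
        case True
        have "i \<in> B - {a}" using a B(3) by simp
        from main[OF Ba True this] show ?thesis unfolding Z_def cBa .
      next
        case False
        then have "Z (B - {a}) = \<zero>\<^bsub>U\<^esub>" using Zs Ba cBa unfolding supported_def U_def by metis
        then show ?thesis using zero_in_N by (simp add: U_def)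
      qed
    qed auto
    moreover have "fd (n + 2) Z B = fd_term (n + 2) Z B i \<oplus>\<^bsub>U\<^esub> fd_rest (n + 2) Z B (B - {i})"
      using fd_split[OF Z1 B(1,3)] by (simp add: U_def)
    moreover have tc: "fd_term (n + 2) Z B i \<in> carrier U"
      using fd_term_closed[OF Z1 B(1,3)] by (simp add: U_def)
    moreover have "fd_rest (n + 2) Z B (B - {i}) \<in> carrier U"
      unfolding U_def by (rule fd_rest_closed[OF Z1 B(1)]) auto
    ultimately have "fd_term (n + 2) Z B i \<in> N i (n + 2 - int (card B))"
      using U.submodule_add_cancel[OF N[of i "n + 2 - int (card B)", folded U_def]] by metis
    moreover have ZA: "Z A \<in> carrier U" using famD[OF Z A(1)] by (simp add: U_def cB)
    ultimately have "(fs ! i) \<odot>\<^bsub>U\<^esub> Z A \<in> N i (n + 2 - int (card B))"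
      using U.signed_in_submodule_iff[OF N[of i "n + 2 - int (card B)", folded U_def]] ic
      by (simp add: fd_term_def B(4) U_def[symmetric])
    then have "Z A \<in> N i (n + 2 - int (card B))" using N_regular[OF ic] ZA by (simp add: U_def)
    then show ?thesis by (simp add: cB Z_def)
  qed
  moreover have "X {..<c} = w" using X1c ic by (simp add: X_def)
  ultimately show ?case using X Xs by blast
qed

text \<open>The Koszul terms at the top subset are multiples of elements of the sequence, hence in
  \<open>N c\<close>. So the top component commutes with the differentials modulo
  \<open>N c\<close>, up to sign.\<close>

lemma fd_top:
  assumes X: "fam (n - 1) X"
  obtains \<nu> where "\<nu> \<in> N c (n - int c)"
    "fd n X {..<c} = \<nu> \<oplus>\<^bsub>W (n - int c)\<^esub> \<delta> (n - 1 - int c) (signed (W (n - 1 - int c)) (int c) (X {..<c}))"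
proof -
  interpret plain_module R "W (n - int c)" by (rule W_plain)
  interpret W': plain_module R "W (n - 1 - int c)" by (rule W_plain)
  have "(\<Oplus>\<^bsub>W (n - int c)\<^esub>a\<in>{..<c}. fd_term n X {..<c} a) \<in> N c (n - int c)"
  proof (rule submodule_finsum[OF N])
    fix a assume a: "a \<in> {..<c}"
    have "X ({..<c} - {a}) \<in> carrier (W (n - int c))" using famD_Diff[OF X subset_refl a] by simp
    then show "fd_term n X {..<c} a \<in> N c (n - int c)"
      using a f_smult_in_N by (simp add: fd_term_def signed_in_submodule_iff[OF N])
  qed
  then show thesis
  proof (rule that)
    have "X {..<c} \<in> carrier (W (n - 1 - int c))" using famD[OF X subset_refl] by simp
    then show "fd n X {..<c} = (\<Oplus>\<^bsub>W (n - int c)\<^esub>a\<in>{..<c}. fd_term n X {..<c} a) \<oplus>\<^bsub>W (n - int c)\<^esub>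
        \<delta> (n - 1 - int c) (signed (W (n - 1 - int c)) (int c) (X {..<c}))"
      by (simp add: fd_rest_def module_hom_signed[OF W'.module_axioms module_axioms \<delta>_hom'])
  qed
qed

text \<open>The right-hand side describes the support of the cohomology of W modulo
  \<open>N c\<close> in degree \<open>k\<close>. The top component carries one description to the
  other; the degree drops by \<open>c\<close>, the cardinality of the top subset.\<close>

theorem Supp_koszul_total_iff:
  "P \<in> Supp R (cohomology K.Tot K.td (k + int c)) \<longleftrightarrow> primeideal P R \<and>
    (\<exists>w\<in>carrier (W k). \<delta> k w \<in> N c (k + 1) \<and>
      (\<forall>s\<in>carrier R - P. s \<odot>\<^bsub>W k\<^esub> w \<notin> \<delta> (k - 1) ` carrier (W (k - 1)) <+>\<^bsub>W k\<^esub> N c k))"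
proof -
  define n where "n = k + int c"
  have nk: "n - int c = k" "n - 1 - int c = k - 1" "n + 1 - int c = k + 1" by (simp_all add: n_def)
  interpret Wk: plain_module R "W k" by (rule W_plain)
  interpret Wk1: plain_module R "W (k + 1)" by (rule W_plain)
  have un_smult: "un (s \<odot>\<^bsub>K.Tot n\<^esub> x) {..<c} = s \<odot>\<^bsub>W k\<^esub> un x {..<c}" for s x
    unfolding un_def K.Tot_simps by (simp add: koszul_def subsets_iff nk)
  have "(\<exists>x\<in>carrier (K.Tot n). K.td n x = \<zero>\<^bsub>K.Tot (n + 1)\<^esub> \<and>
      (\<forall>s\<in>carrier R - P. s \<odot>\<^bsub>K.Tot n\<^esub> x \<notin> K.td (n - 1) ` carrier (K.Tot (n - 1)))) \<longleftrightarrow>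
    (\<exists>w\<in>carrier (W k). \<delta> k w \<in> N c (k + 1) \<and>
      (\<forall>s\<in>carrier R - P. s \<odot>\<^bsub>W k\<^esub> w \<notin> \<delta> (k - 1) ` carrier (W (k - 1)) <+>\<^bsub>W k\<^esub> N c k))"
    (is "(\<exists>x\<in>carrier (K.Tot n). ?A x) \<longleftrightarrow> (\<exists>w\<in>carrier (W k). ?B w)")
  proof
    assume "\<exists>x\<in>carrier (K.Tot n). ?A x"
    then obtain x where x: "x \<in> carrier (K.Tot n)" "K.td n x = \<zero>\<^bsub>K.Tot (n + 1)\<^esub>"
      "\<forall>s\<in>carrier R - P. s \<odot>\<^bsub>K.Tot n\<^esub> x \<notin> K.td (n - 1) ` carrier (K.Tot (n - 1))" by blast
    define w where "w = un x {..<c}"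
    have fx: "fam (n + 1 - 1) (un x)" using fam_un[OF x(1)] by simp
    have w: "w \<in> carrier (W k)" using famD[OF fam_un[OF x(1)], of "{..<c}"] by (simp add: w_def nk)
    obtain \<nu> where \<nu>: "\<nu> \<in> N c (k + 1)"
      "fd (n + 1) (un x) {..<c} = \<nu> \<oplus>\<^bsub>W (k + 1)\<^esub> \<delta> k (signed (W k) (int c) w)"
      using fd_top[OF fx] by (auto simp: nk w_def)
    have "fd (n + 1) (un x) {..<c} = \<zero>\<^bsub>W (k + 1)\<^esub>"
      using td_un[OF x(1), of "{..<c}"] un_zero[of "{..<c}" "n + 1"] x(2) by (simp add: nk)
    moreover have "\<nu> \<in> carrier (W (k + 1))" using \<nu>(1) submodule_subset[OF N] by blast
    ultimately have "\<delta> k (signed (W k) (int c) w) \<oplus>\<^bsub>W (k + 1)\<^esub> \<nu> = \<zero>\<^bsub>W (k + 1)\<^esub>"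
      using \<nu>(2) w W.d_closed[of "signed (W k) (int c) w" k] Wk1.M.a_comm by simp
    then have "\<delta> k (signed (W k) (int c) w) \<oplus>\<^bsub>W (k + 1)\<^esub> \<nu> \<in> N c (k + 1)"
      using zero_in_N by simp
    then have "\<delta> k (signed (W k) (int c) w) \<in> N c (k + 1)"
      using Wk1.submodule_add_cancel[OF N] \<nu>(1) w W.d_closed by simp
    then have dw: "\<delta> k w \<in> N c (k + 1)"
      using w W.d_closed by (simp add: module_hom_signed[OF Wk.module_axioms Wk1.module_axioms W.d]
        Wk1.signed_in_submodule_iff[OF N])
    have "s \<odot>\<^bsub>W k\<^esub> w \<notin> \<delta> (k - 1) ` carrier (W (k - 1)) <+>\<^bsub>W k\<^esub> N c k" if s: "s \<in> carrier R - P" for s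
    proof
      assume "s \<odot>\<^bsub>W k\<^esub> w \<in> \<delta> (k - 1) ` carrier (W (k - 1)) <+>\<^bsub>W k\<^esub> N c k"
      then obtain u \<nu> where u: "u \<in> carrier (W (k - 1))" "\<nu> \<in> N c k"
        "s \<odot>\<^bsub>W k\<^esub> w = \<delta> (k - 1) u \<oplus>\<^bsub>W k\<^esub> \<nu>" by (auto simp: set_add_def')
      let ?x = "s \<odot>\<^bsub>K.Tot n\<^esub> x"
      have sx: "?x \<in> carrier (K.Tot n)" using module.smult_closed[OF K.module_Tot] s x by blast
      have "K.td n ?x = s \<odot>\<^bsub>K.Tot (n + 1)\<^esub> \<zero>\<^bsub>K.Tot (n + 1)\<^esub>"
        using module_hom_smult[OF K.td_hom _ x(1)] s x(2) by simp
      then have dsx: "K.td n ?x = \<zero>\<^bsub>K.Tot (n + 1)\<^esub>"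
        using module.smult_r_null[OF K.module_Tot] s by simp
      \<comment> \<open>The multiple \<open>?x\<close> is a cocycle whose top component is a
        coboundary modulo \<open>N c\<close>, so at stage 0 it is a coboundary outright.\<close>
      have "\<exists>Y. fam (n - 1) Y \<and> supported 0 (n - 1) Y \<and>
        (\<forall>A\<subseteq>{..<c}. {..<0} \<subseteq> A \<longrightarrow> un ?x A \<ominus>\<^bsub>W (n - int (card A))\<^esub> fd n Y A \<in> N 0 (n - int (card A)))"
      proof (rule koszul_inj[OF _ fam_un[OF sx]])
        show "supported 0 n (un ?x)" by (simp add: supported_def)
        show "fd (n + 1) (un ?x) A \<in> N 0 (n + 1 - int (card A))" if "A \<subseteq> {..<c}" for A
          using td_un[OF sx that] un_zero[OF that, of "n + 1"] dsx by (simp add: N_0)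
        show "u \<in> carrier (W (n - 1 - int c))" "\<nu> \<in> N c (n - int c)"
          "un ?x {..<c} = \<delta> (n - 1 - int c) u \<oplus>\<^bsub>W (n - int c)\<^esub> \<nu>"
          using u unfolding un_smult nk by (simp_all add: w_def)
      qed simp
      then obtain Y where Y: "fam (n - 1) Y"
        "\<And>A. A \<subseteq> {..<c} \<Longrightarrow> un ?x A \<ominus>\<^bsub>W (n - int (card A))\<^esub> fd n Y A = \<zero>\<^bsub>W (n - int (card A))\<^esub>"
        by (auto simp: N_0)
      have e: "emb Y \<in> carrier (K.Tot (n - 1))" by (rule emb_Tot[OF Y(1)])
      have "?x = K.td (n - 1) (emb Y)"
      proof (rule Tot_ext[OF sx])
        show "K.td (n - 1) (emb Y) \<in> carrier (K.Tot n)" using module_hom_closed[OF K.td_hom e] by simp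
        fix A assume A: "A \<subseteq> {..<c}"
        interpret V: plain_module R "W (n - int (card A))" by (rule W_plain)
        have "un (K.td (n - 1) (emb Y)) A = fd n (un (emb Y)) A" using td_un[OF e A] by simp
        also have "\<dots> = fd n Y A" by (rule fd_cong[OF Y(1) A]) (rule un_emb)
        also have "\<dots> = un ?x A"
          using V.minus_eq_zero_iff[OF famD[OF fam_un[OF sx] A] fd_rest_closed[OF Y(1) A subset_refl]] Y(2)[OF A]
          by simp
        finally show "un ?x A = un (K.td (n - 1) (emb Y)) A" by simp
      qed
      then show False using x(3) s e by blast
    qed
    then show "\<exists>w\<in>carrier (W k). ?B w" using w dw by blast
  next
    assume "\<exists>w\<in>carrier (W k). ?B w"
    then obtain w where w: "w \<in> carrier (W k)" "\<delta> k w \<in> N c (k + 1)"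
      "\<forall>s\<in>carrier R - P. s \<odot>\<^bsub>W k\<^esub> w \<notin> \<delta> (k - 1) ` carrier (W (k - 1)) <+>\<^bsub>W k\<^esub> N c k" by blast
    \<comment> \<open>At stage 0 the extension of \<open>w\<close> is a true cocycle, since
      \<open>N 0\<close> is zero.\<close>
    obtain X where X: "fam n X" "X {..<c} = w"
      "\<And>A. A \<subseteq> {..<c} \<Longrightarrow> fd (n + 1) X A \<in> N 0 (n + 1 - int (card A))"
      using koszul_surj[of 0 w n] w by (auto simp: nk)
    have e: "emb X \<in> carrier (K.Tot n)" by (rule emb_Tot[OF X(1)])
    have z: "\<zero>\<^bsub>K.Tot (n + 1)\<^esub> \<in> carrier (K.Tot (n + 1))"
      using module.submodule_zero[OF K.module_Tot module.carrier_is_submodule[OF K.module_Tot]] .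
    have "K.td n (emb X) = \<zero>\<^bsub>K.Tot (n + 1)\<^esub>"
    proof (rule Tot_ext[OF module_hom_closed[OF K.td_hom e] z])
      fix A assume A: "A \<subseteq> {..<c}"
      have "un (K.td n (emb X)) A = fd (n + 1) (un (emb X)) A" using td_un[OF e A] .
      also have "\<dots> = fd (n + 1) X A" by (rule fd_cong[OF _ A]) (use X(1) un_emb in auto)
      finally show "un (K.td n (emb X)) A = un \<zero>\<^bsub>K.Tot (n + 1)\<^esub> A"
        using X(3)[OF A] un_zero[OF A] by (simp add: N_0)
    qed
    moreover have "s \<odot>\<^bsub>K.Tot n\<^esub> emb X \<notin> K.td (n - 1) ` carrier (K.Tot (n - 1))" if s: "s \<in> carrier R - P" for s
    proof
      assume "s \<odot>\<^bsub>K.Tot n\<^esub> emb X \<in> K.td (n - 1) ` carrier (K.Tot (n - 1))"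
      then obtain y where y: "y \<in> carrier (K.Tot (n - 1))" "s \<odot>\<^bsub>K.Tot n\<^esub> emb X = K.td (n - 1) y" by blast
      interpret W': plain_module R "W (k - 1)" by (rule W_plain)
      obtain \<nu> where \<nu>: "\<nu> \<in> N c k"
        "fd n (un y) {..<c} = \<nu> \<oplus>\<^bsub>W k\<^esub> \<delta> (k - 1) (signed (W (k - 1)) (int c) (un y {..<c}))"
        using fd_top[OF fam_un[OF y(1)]] by (auto simp: nk)
      have yc: "signed (W (k - 1)) (int c) (un y {..<c}) \<in> carrier (W (k - 1))"
        using famD[OF fam_un[OF y(1)], of "{..<c}"] by (simp add: nk)
      have "s \<odot>\<^bsub>W k\<^esub> w = un (s \<odot>\<^bsub>K.Tot n\<^esub> emb X) {..<c}"
        unfolding un_smult using un_emb[of "{..<c}" X] X(2) by simp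
      also have "\<dots> = fd n (un y) {..<c}" unfolding y(2) using td_un[OF y(1), of "{..<c}"] by simp
      also have "\<dots> = \<delta> (k - 1) (signed (W (k - 1)) (int c) (un y {..<c})) \<oplus>\<^bsub>W k\<^esub> \<nu>"
        unfolding \<nu>(2) using \<nu>(1) submodule_subset[OF N] module_hom_closed[OF W.d_prev yc]
        by (intro Wk.M.a_comm) blast+
      finally have "s \<odot>\<^bsub>W k\<^esub> w \<in> \<delta> (k - 1) ` carrier (W (k - 1)) <+>\<^bsub>W k\<^esub> N c k"
        using yc \<nu>(1) unfolding set_add_def' by blast
      then show False using w(3) s by blast
    qed
    ultimately show "\<exists>x\<in>carrier (K.Tot n). ?A x" using e by blast
  qed
  then show ?thesis unfolding K.Tot.Supp_cohomology_iff n_def[symmetric] by blast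
qed

end

section \<open>Injective modules over a noetherian ring\<close>

lemma (in cring) ideal_submodule:
  assumes "submodule J R (regular_module R)" shows "ideal J R"
proof -
  interpret r: module R "regular_module R" by (rule regular_module_module)
  note J = r.submoduleE[OF assms] r.submodule_zero[OF assms]
  have sub: "J \<subseteq> carrier R" using J(1) by simp
  show ?thesis
  proof (rule idealI[OF ring_axioms])
    show "subgroup J (add_monoid R)"
    proof (rule add.subgroupI)
      show "J \<subseteq> carrier R" by (rule sub)
      show "J \<noteq> {}" using J(7) by auto
      show "\<ominus> a \<in> J" if "a \<in> J" for a using J(3)[OF that] that sub by auto
      show "a \<oplus> b \<in> J" if "a \<in> J" "b \<in> J" for a b using J(5)[OF that] by simp
    qed
    show "x \<otimes> a \<in> J" if "a \<in> J" "x \<in> carrier R" for a x using J(4)[of x a] that by simp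
    then show "a \<otimes> x \<in> J" if "a \<in> J" "x \<in> carrier R" for a x using that sub m_comm[of a x] by auto
  qed
qed

lemma (in module) ideal_annihilator:
  assumes "m \<in> carrier M" shows "ideal {r \<in> carrier R. r \<odot>\<^bsub>M\<^esub> m = \<zero>\<^bsub>M\<^esub>} R"
proof (rule R.ideal_submodule)
  have "submodule {r \<in> carrier R. r \<odot>\<^bsub>M\<^esub> m = \<zero>\<^bsub>M\<^esub>} R (regular_module R)"
    using assms by (intro module.submoduleI[OF R.regular_module_module])
      (auto simp: smult_l_minus smult_l_distr smult_assoc1)
  then show "submodule {r \<in> carrier R. r \<odot>\<^bsub>M\<^esub> m = \<zero>\<^bsub>M\<^esub>} R (regular_module R)" .
qed

lemma (in module) smult_split:
  assumes "r \<in> carrier R" "s \<in> carrier R" "m \<in> carrier M"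
  shows "r \<odot>\<^bsub>M\<^esub> m = (r \<ominus>\<^bsub>R\<^esub> s) \<odot>\<^bsub>M\<^esub> m \<oplus>\<^bsub>M\<^esub> s \<odot>\<^bsub>M\<^esub> m"
proof -
  have "(r \<ominus>\<^bsub>R\<^esub> s) \<oplus>\<^bsub>R\<^esub> s = r" using assms by algebra
  then show ?thesis using assms smult_l_distr[of "r \<ominus>\<^bsub>R\<^esub> s" s m] by simp
qed

lemma (in cring) ideal_colon:
  assumes J: "ideal J R" and a: "a \<in> carrier R"
  shows "ideal {s \<in> carrier R. a \<otimes> s \<in> J} R"
proof (rule ideal_submodule)
  have "(\<lambda>s. a \<otimes> s) \<in> module_hom R (regular_module R) (regular_module R)"
    using a by (intro module_homI) (auto simp: r_distr m_lcomm)
  from submodule_preimage[OF regular_module_module regular_module_module this submodule_ideal[OF J]]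
  show "submodule {s \<in> carrier R. a \<otimes> s \<in> J} R (regular_module R)" by simp
qed

text \<open>The union of a chain of ideals is a member of the chain, and the index of that member is
  the point of stabilisation.\<close>

lemma (in noetherian_ring) ideal_sequence_stable:
  assumes "\<And>n. ideal (J n) R" "\<And>n. J n \<subseteq> J (Suc n)"
  obtains c :: nat where "\<And>n. c \<le> n \<Longrightarrow> J n = J c"
proof -
  have mono: "m \<le> n \<Longrightarrow> J m \<subseteq> J n" for m n using assms(2) by (rule lift_Suc_mono_le)
  have "subset.chain {I. ideal I R} (range J)"
    unfolding subset_chain_def using assms(1) mono nat_le_linear by (metis image_subsetI mem_Collect_eq rangeE)
  then have "\<Union>(range J) \<in> range J" by (intro ideal_chain_is_trivial) auto
  then obtain c where c: "\<Union>(range J) = J c" by blast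
  show thesis
  proof (rule that)
    show "J n = J c" if "c \<le> n" for n using mono[OF that] c by blast
  qed
qed

text \<open>Zorn's lemma applies because the union of a nonempty chain in \<open>S\<close> belongs
  to the chain and therefore to \<open>S\<close>.\<close>

lemma (in noetherian_ring) ideal_maximal:
  assumes "\<And>J. J \<in> S \<Longrightarrow> ideal J R" "S \<noteq> {}"
  obtains J where "J \<in> S" "\<And>K. K \<in> S \<Longrightarrow> J \<subseteq> K \<Longrightarrow> K = J"
proof -
  have "\<exists>M\<in>S. \<forall>X\<in>S. M \<subseteq> X \<longrightarrow> X = M"
  proof (rule subset_Zorn)
    fix C assume C: "subset.chain S C"
    show "\<exists>U\<in>S. \<forall>X\<in>C. X \<subseteq> U"
    proof (cases "C = {}")
      case False
      have "subset.chain {I. ideal I R} C" using C assms(1) by (auto simp: subset_chain_def)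
      then have "\<Union>C \<in> C" by (rule ideal_chain_is_trivial[OF False])
      moreover have "C \<subseteq> S" using C by (simp add: subset_chain_def)
      ultimately show ?thesis by blast
    qed (use assms(2) in auto)
  qed
  then show thesis using that by blast
qed

text \<open>The elements of an injective module that are killed by powers of all elements of \<open>X\<close> form
  again an injective module; this is the part of that fact needed for the Cech complex. The ideal
  \<open>b\<close> of the proof replaces an appeal to the Artin-Rees lemma.\<close>

lemma injective_power_torsion_divide:
  fixes R (structure) and E :: "('a, 'e) module"
  assumes "cring R" "noetherian_ring R" "injective_module R E" and X: "X \<subseteq> carrier R" and g: "g \<in> carrier R"
    and m: "m \<in> carrier E" "\<And>x. x \<in> X \<Longrightarrow> \<exists>a::nat. x [^]\<^bsub>R\<^esub> a \<odot>\<^bsub>E\<^esub> m = \<zero>\<^bsub>E\<^esub>"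
  obtains m' and k :: nat where "m' \<in> carrier E" "\<And>x. x \<in> X \<Longrightarrow> \<exists>a::nat. x [^]\<^bsub>R\<^esub> a \<odot>\<^bsub>E\<^esub> m' = \<zero>\<^bsub>E\<^esub>"
    "g [^]\<^bsub>R\<^esub> k \<odot>\<^bsub>E\<^esub> (g [^]\<^bsub>R\<^esub> (n::nat) \<odot>\<^bsub>E\<^esub> m') = g [^]\<^bsub>R\<^esub> k \<odot>\<^bsub>E\<^esub> m"
proof -
  interpret cring R by fact
  interpret noetherian_ring R by fact
  interpret E: module R E using assms(3) by (simp add: injective_module_def)
  interpret r: module R "regular_module R" by (rule regular_module_module)
  \<comment> \<open>The annihilators of the powers of \<open>g\<close> stabilise at some
    \<open>k\<close>. Then \<open>h r = 0\<close> forces \<open>g^k r = 0\<close> for the higher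
    power \<open>h\<close>, so sending \<open>h r\<close> to \<open>g^k r m\<close> makes sense;
    this is where the \<open>k\<close> of the conclusion comes from.\<close>
  define J where "J k = {r \<in> carrier R. g [^] (k::nat) \<otimes> r \<in> {\<zero>}}" for k
  have "ideal (J k) R" for k unfolding J_def by (rule ideal_colon[OF zeroideal]) (simp add: g)
  moreover have "J k \<subseteq> J (Suc k)" for k
    using g m_assoc[of g "g [^] k"] unfolding J_def nat_pow_Suc2[OF g] by auto
  ultimately obtain k where k: "\<And>n. k \<le> n \<Longrightarrow> J n = J k" by (rule ideal_sequence_stable) blast
  define h where "h = g [^] (k + n)"
  have h: "h \<in> carrier R" and gk: "g [^] k \<in> carrier R" using g by (simp_all add: h_def)
  have gk_zero: "g [^] k \<otimes> r = \<zero>" if "r \<in> carrier R" "h \<otimes> r = \<zero>" for r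
  proof -
    have "r \<in> J (k + n)" using that by (simp add: J_def h_def)
    then have "r \<in> J k" using k[of "k + n"] by simp
    then show ?thesis by (simp add: J_def)
  qed
  \<comment> \<open>The first condition says that the assignment from \<open>h r\<close> to
    \<open>g^k r m\<close> extends by zero on \<open>b\<close>. The second one makes it possible to
    enlarge \<open>b\<close> until it contains a power of every element of \<open>X\<close>.\<close>
  define S where "S = {b. ideal b R \<and> (\<forall>r\<in>carrier R. h \<otimes> r \<in> b \<longrightarrow> g [^] k \<odot>\<^bsub>E\<^esub> (r \<odot>\<^bsub>E\<^esub> m) = \<zero>\<^bsub>E\<^esub>) \<and>
    (\<forall>x\<in>X. \<exists>a::nat. x [^] a \<otimes> h \<in> b)}"
  \<comment> \<open>The product of \<open>h\<close> with the annihilator of \<open>m\<close>: it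
    contains \<open>x^a h\<close> as soon as \<open>x^a\<close> kills \<open>m\<close>, which gives
    the second condition.\<close>
  define b0 where "b0 = (\<lambda>r. h \<otimes> r) ` {r \<in> carrier R. r \<odot>\<^bsub>E\<^esub> m = \<zero>\<^bsub>E\<^esub>}"
  have "b0 \<in> S"
    unfolding S_def
  proof (intro CollectI conjI ballI impI)
    have "(\<lambda>s. h \<otimes> s) \<in> module_hom R (regular_module R) (regular_module R)"
      using h by (intro module_homI) (auto simp: r_distr m_lcomm)
    then show "ideal b0 R"
      unfolding b0_def
      by (rule ideal_submodule[OF submodule_image[OF r.module_axioms r.module_axioms _
          submodule_ideal[OF E.ideal_annihilator[OF m(1)]]]])
    fix r assume r: "r \<in> carrier R" "h \<otimes> r \<in> b0"
    then obtain s where s: "s \<in> carrier R" "s \<odot>\<^bsub>E\<^esub> m = \<zero>\<^bsub>E\<^esub>" "h \<otimes> r = h \<otimes> s"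
      unfolding b0_def by blast
    have "h \<otimes> (r \<ominus> s) = h \<otimes> r \<ominus> h \<otimes> s"
      using h r(1) s(1) by (simp add: a_minus_def r_distr r_minus)
    also have "\<dots> = \<zero>" unfolding s(3) using h s(1) by (simp add: r_neg a_minus_def)
    finally have "h \<otimes> (r \<ominus> s) = \<zero>" .
    then have z: "g [^] k \<otimes> (r \<ominus> s) = \<zero>" using gk_zero r s by simp
    have "g [^] k \<odot>\<^bsub>E\<^esub> ((r \<ominus> s) \<odot>\<^bsub>E\<^esub> m) = \<zero>\<^bsub>E\<^esub>"
      using z gk r(1) s(1) m(1) by (simp add: E.smult_assoc1[symmetric])
    then show "g [^] k \<odot>\<^bsub>E\<^esub> (r \<odot>\<^bsub>E\<^esub> m) = \<zero>\<^bsub>E\<^esub>"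
      using E.smult_split[OF r(1) s(1) m(1)] s(2) gk r(1) s(1) m(1) by simp
  next
    fix x assume x: "x \<in> X"
    then obtain a :: nat where "x [^] a \<odot>\<^bsub>E\<^esub> m = \<zero>\<^bsub>E\<^esub>" using m(2) by blast
    moreover have "x [^] a \<in> carrier R" using x X by auto
    ultimately show "\<exists>a::nat. x [^] a \<otimes> h \<in> b0" unfolding b0_def using m_comm h by blast
  qed
  then have "S \<noteq> {}" by blast
  moreover have "ideal b R" if "b \<in> S" for b using that by (simp add: S_def)
  ultimately obtain b where b: "b \<in> S" and max: "\<And>b'. b' \<in> S \<Longrightarrow> b \<subseteq> b' \<Longrightarrow> b' = b"
    using ideal_maximal[of S] by metis
  have b1: "ideal b R" and b2: "\<And>r. r \<in> carrier R \<Longrightarrow> h \<otimes> r \<in> b \<Longrightarrow> g [^] k \<odot>\<^bsub>E\<^esub> (r \<odot>\<^bsub>E\<^esub> m) = \<zero>\<^bsub>E\<^esub>"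
    and b3: "\<And>x. x \<in> X \<Longrightarrow> \<exists>a::nat. x [^] a \<otimes> h \<in> b" using b by (auto simp: S_def)
  interpret b: ideal b R by (rule b1)
  have power_b: "\<exists>a::nat. x [^] a \<in> b" if x: "x \<in> X" for x
  proof -
    have xR: "x \<in> carrier R" using x X by blast
    obtain a :: nat where a: "x [^] a \<otimes> h \<in> b" using b3 x by blast
    \<comment> \<open>The colon ideals of \<open>b\<close> by powers of \<open>x\<close> stabilise
      at \<open>c\<close>. Adjoining \<open>x^c\<close> to \<open>b\<close> is then shown to stay
      within \<open>S\<close>, so maximality puts this power into \<open>b\<close>.\<close>
    define K where "K c = {s \<in> carrier R. x [^] (c::nat) \<otimes> s \<in> b}" for c
    have "ideal (K c) R" for c unfolding K_def by (rule ideal_colon[OF b1]) (simp add: xR)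
    moreover have "K c \<subseteq> K (Suc c)" for c
      using xR m_assoc[of x "x [^] c"] b.I_l_closed unfolding K_def nat_pow_Suc2[OF xR] by auto
    ultimately obtain c where c: "\<And>n. c \<le> n \<Longrightarrow> K n = K c" by (rule ideal_sequence_stable) blast
    define y where "y = x [^] c"
    have y: "y \<in> carrier R" using xR by (simp add: y_def)
    define b' where "b' = b <+>\<^bsub>R\<^esub> PIdl y"
    have b': "ideal b' R" unfolding b'_def by (rule add_ideals[OF b1 cgenideal_ideal[OF y]])
    have bb': "b \<subseteq> b'" and yb': "y \<in> b'"
    proof -
      have "b \<union> PIdl y \<subseteq> b'"
        unfolding b'_def union_genideal[OF b1 cgenideal_ideal[OF y], symmetric]
        using b.a_subset ideal.Icarr[OF cgenideal_ideal[OF y]] by (intro genideal_self) auto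
      then show "b \<subseteq> b'" "y \<in> b'" using cgenideal_self[OF y] by auto
    qed
    have "b' \<in> S"
      unfolding S_def
    proof (intro CollectI conjI ballI impI b')
      show "\<exists>a::nat. x [^] a \<otimes> h \<in> b'" if "x \<in> X" for x using b3[OF that] bb' by blast
      fix r assume r: "r \<in> carrier R" "h \<otimes> r \<in> b'"
      then obtain \<beta> s where \<beta>: "\<beta> \<in> b" "s \<in> carrier R" "h \<otimes> r = \<beta> \<oplus> s \<otimes> y"
        by (auto simp: b'_def set_add_def' cgenideal_def)
      have \<beta>R: "\<beta> \<in> carrier R" using \<beta>(1) by (rule b.Icarr)
      have xa: "x [^] a \<in> carrier R" using xR by simp
      \<comment> \<open>Multiplying \<open>h r = \<beta> + s y\<close> by \<open>x^a\<close> brings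
        the left side into \<open>b\<close>, hence also \<open>x^(a+c) s\<close>. By stability
        \<open>x^c s\<close> is already in \<open>b\<close>, and so is \<open>h r\<close>.\<close>
      have "x [^] (a + c) \<otimes> s = x [^] a \<otimes> (s \<otimes> y)"
        using xR \<beta>(2) unfolding nat_pow_mult[OF xR, symmetric] y_def by (simp add: m_ac)
      also have "\<dots> = (x [^] a \<otimes> h) \<otimes> r \<ominus> x [^] a \<otimes> \<beta>"
      proof -
        have "(x [^] a \<otimes> h) \<otimes> r \<ominus> x [^] a \<otimes> \<beta> = x [^] a \<otimes> (\<beta> \<oplus> s \<otimes> y) \<ominus> x [^] a \<otimes> \<beta>"
          unfolding \<beta>(3)[symmetric] using xa h r by (simp add: m_assoc)
        also have "\<dots> = x [^] a \<otimes> (s \<otimes> y)" using xa \<beta>R \<beta>(2) y by algebra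
        finally show ?thesis by simp
      qed
      also have "\<dots> \<in> b"
        using b.I_r_closed[OF a r(1)] b.I_l_closed[OF \<beta>(1) xa] b.a_closed b.a_inv_closed by (simp add: a_minus_def)
      finally have "s \<in> K (a + c)" using \<beta>(2) by (simp add: K_def)
      then have "s \<in> K c" using c[of "a + c"] by simp
      then have "y \<otimes> s \<in> b" by (simp add: K_def y_def)
      then have "h \<otimes> r \<in> b" unfolding \<beta>(3) using \<beta>(1,2) y m_comm[of s y] b.a_closed by simp
      then show "g [^] k \<odot>\<^bsub>E\<^esub> (r \<odot>\<^bsub>E\<^esub> m) = \<zero>\<^bsub>E\<^esub>" using b2 r(1) by blast
    qed
    then show ?thesis using max[OF _ bb'] yb' unfolding y_def by blast
  qed
  define A where "A = b <+>\<^bsub>R\<^esub> PIdl h"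
  have A: "ideal A R" unfolding A_def by (rule add_ideals[OF b1 cgenideal_ideal[OF h]])
  have A_iff: "x \<in> A \<longleftrightarrow> (\<exists>\<beta>\<in>b. \<exists>r\<in>carrier R. x = \<beta> \<oplus> h \<otimes> r)" for x
  proof -
    have "x \<in> A \<longleftrightarrow> (\<exists>\<beta>\<in>b. \<exists>r\<in>carrier R. x = \<beta> \<oplus> r \<otimes> h)"
      unfolding A_def set_add_def' cgenideal_def by auto
    then show ?thesis using h m_comm by metis
  qed
  \<comment> \<open>The map on \<open>b + (h)\<close> that kills \<open>b\<close> and sends
    \<open>h\<close> to \<open>g^k m\<close>; the first condition of \<open>S\<close> makes it well
    defined.\<close>
  define \<phi> where "\<phi> x = (THE y. \<exists>\<beta>\<in>b. \<exists>r\<in>carrier R. x = \<beta> \<oplus> h \<otimes> r \<and> y = g [^] k \<odot>\<^bsub>E\<^esub> (r \<odot>\<^bsub>E\<^esub> m))" for x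
  have \<phi>: "\<phi> (\<beta> \<oplus> h \<otimes> r) = g [^] k \<odot>\<^bsub>E\<^esub> (r \<odot>\<^bsub>E\<^esub> m)" if \<beta>: "\<beta> \<in> b" "r \<in> carrier R" for \<beta> r
    unfolding \<phi>_def
  proof (rule the_equality)
    fix y assume "\<exists>\<beta>'\<in>b. \<exists>r'\<in>carrier R. \<beta> \<oplus> h \<otimes> r = \<beta>' \<oplus> h \<otimes> r' \<and> y = g [^] k \<odot>\<^bsub>E\<^esub> (r' \<odot>\<^bsub>E\<^esub> m)"
    then obtain \<beta>' r' where \<beta>': "\<beta>' \<in> b" "r' \<in> carrier R" "\<beta> \<oplus> h \<otimes> r = \<beta>' \<oplus> h \<otimes> r'"
      "y = g [^] k \<odot>\<^bsub>E\<^esub> (r' \<odot>\<^bsub>E\<^esub> m)" by blast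
    have c: "\<beta> \<in> carrier R" "\<beta>' \<in> carrier R" using \<beta> \<beta>' b.Icarr by auto
    have "h \<otimes> (r' \<ominus> r) = (\<beta>' \<oplus> h \<otimes> r') \<ominus> \<beta>' \<ominus> h \<otimes> r" using c h \<beta> \<beta>'(2) by algebra
    also have "\<dots> = \<beta> \<ominus> \<beta>'" unfolding \<beta>'(3)[symmetric] using c h \<beta> by algebra
    also have "\<dots> \<in> b" using \<beta> \<beta>' b.a_closed b.a_inv_closed by (simp add: a_minus_def)
    finally have "g [^] k \<odot>\<^bsub>E\<^esub> ((r' \<ominus> r) \<odot>\<^bsub>E\<^esub> m) = \<zero>\<^bsub>E\<^esub>" using b2 \<beta> \<beta>' by simp
    moreover have "g [^] k \<odot>\<^bsub>E\<^esub> (r' \<odot>\<^bsub>E\<^esub> m) =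
        g [^] k \<odot>\<^bsub>E\<^esub> ((r' \<ominus> r) \<odot>\<^bsub>E\<^esub> m) \<oplus>\<^bsub>E\<^esub> g [^] k \<odot>\<^bsub>E\<^esub> (r \<odot>\<^bsub>E\<^esub> m)"
      using E.smult_split[OF \<beta>'(2) \<beta>(2) m(1)] gk \<beta>(2) \<beta>'(2) m(1) by (simp add: E.smult_r_distr)
    ultimately show "y = g [^] k \<odot>\<^bsub>E\<^esub> (r \<odot>\<^bsub>E\<^esub> m)" using \<beta>'(4) gk \<beta> m(1) by simp
  qed (use \<beta> in blast)
  have "\<phi> \<in> module_hom R (regular_module R\<lparr>carrier := A\<rparr>) E"
  proof (rule module_homI; simp)
    fix x assume "x \<in> A"
    then obtain \<beta> r where \<beta>: "\<beta> \<in> b" "r \<in> carrier R" "x = \<beta> \<oplus> h \<otimes> r" using A_iff by auto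
    then show "\<phi> x \<in> carrier E" using gk m by (simp add: \<phi>)
    have c: "\<beta> \<in> carrier R" using \<beta> b.Icarr by auto
    show "\<phi> (a \<otimes> x) = a \<odot>\<^bsub>E\<^esub> \<phi> x" if a: "a \<in> carrier R" for a
    proof -
      have "a \<otimes> x = a \<otimes> \<beta> \<oplus> h \<otimes> (a \<otimes> r)" unfolding \<beta>(3) using a c h \<beta> by algebra
      then have "\<phi> (a \<otimes> x) = g [^] k \<odot>\<^bsub>E\<^esub> ((a \<otimes> r) \<odot>\<^bsub>E\<^esub> m)"
        using \<phi>[of "a \<otimes> \<beta>" "a \<otimes> r"] a \<beta> b.I_l_closed by simp
      also have "\<dots> = a \<odot>\<^bsub>E\<^esub> (g [^] k \<odot>\<^bsub>E\<^esub> (r \<odot>\<^bsub>E\<^esub> m))" using a \<beta>(2) gk m(1) by algebra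
      finally show ?thesis using \<beta> by (simp add: \<phi>)
    qed
    fix y assume "y \<in> A"
    then obtain \<beta>' r' where \<beta>': "\<beta>' \<in> b" "r' \<in> carrier R" "y = \<beta>' \<oplus> h \<otimes> r'" using A_iff by auto
    have c': "\<beta>' \<in> carrier R" using \<beta>' b.Icarr by auto
    have "x \<oplus> y = (\<beta> \<oplus> \<beta>') \<oplus> h \<otimes> (r \<oplus> r')" unfolding \<beta>(3) \<beta>'(3) using c c' h \<beta>(2) \<beta>'(2) by algebra
    then have "\<phi> (x \<oplus> y) = g [^] k \<odot>\<^bsub>E\<^esub> ((r \<oplus> r') \<odot>\<^bsub>E\<^esub> m)"
      using \<phi>[of "\<beta> \<oplus> \<beta>'" "r \<oplus> r'"] \<beta> \<beta>' b.a_closed by simp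
    also have "\<dots> = g [^] k \<odot>\<^bsub>E\<^esub> (r \<odot>\<^bsub>E\<^esub> m) \<oplus>\<^bsub>E\<^esub> g [^] k \<odot>\<^bsub>E\<^esub> (r' \<odot>\<^bsub>E\<^esub> m)"
      using \<beta>(2) \<beta>'(2) gk m(1) by algebra
    finally show "\<phi> (x \<oplus> y) = \<phi> x \<oplus>\<^bsub>E\<^esub> \<phi> y" using \<beta> \<beta>' by (simp add: \<phi>)
  qed
  \<comment> \<open>Extending to R yields the element \<open>H\<close> of 1. It is killed by
    whatever \<open>b\<close> contains, in particular by powers of the elements of \<open>X\<close>,
    and \<open>h\<close> maps it to \<open>g^k m\<close>.\<close>
  then obtain H where H: "H \<in> module_hom R (regular_module R) E" "\<And>x. x \<in> A \<Longrightarrow> H x = \<phi> x"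
    using assms(3) regular_module_module submodule_ideal[OF A] unfolding injective_module_def by metis
  have H_smult: "a \<odot>\<^bsub>E\<^esub> H \<one> = H a" if "a \<in> carrier R" for a
    using module_hom_smult[OF H(1) that, of \<one>] that by simp
  show thesis
  proof (rule that)
    show H1: "H \<one> \<in> carrier E" using module_hom_closed[OF H(1), of \<one>] by simp
    show "\<exists>a::nat. x [^] a \<odot>\<^bsub>E\<^esub> H \<one> = \<zero>\<^bsub>E\<^esub>" if x: "x \<in> X" for x
    proof -
      obtain a :: nat where a: "x [^] a \<in> b" using power_b[OF x] by blast
      have xR: "x [^] a \<in> carrier R" using a b.Icarr by blast
      have e: "x [^] a \<oplus> h \<otimes> \<zero> = x [^] a" using xR h by simp
      have "x [^] a \<in> A" unfolding A_iff using e a zero_closed by metis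
      moreover have "\<phi> (x [^] a) = \<zero>\<^bsub>E\<^esub>"
        using \<phi>[OF a zero_closed] unfolding e using m(1) gk by simp
      ultimately show ?thesis using H_smult[OF xR] H(2) by auto
    qed
    have e: "\<zero> \<oplus> h \<otimes> \<one> = h" using h by simp
    have "h \<in> A" unfolding A_iff using e b.zero_closed one_closed by metis
    moreover have "\<phi> h = g [^] k \<odot>\<^bsub>E\<^esub> m"
      using \<phi>[OF b.zero_closed one_closed] unfolding e using m(1) by simp
    ultimately have "h \<odot>\<^bsub>E\<^esub> H \<one> = g [^] k \<odot>\<^bsub>E\<^esub> m" using H_smult[OF h] H(2) by simp
    then show "g [^] k \<odot>\<^bsub>E\<^esub> (g [^] n \<odot>\<^bsub>E\<^esub> H \<one>) = g [^] k \<odot>\<^bsub>E\<^esub> m"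
      using H1 g by (simp add: h_def nat_pow_mult[symmetric] E.smult_assoc1)
  qed
qed

section \<open>Torsion submodules\<close>

lemma ideals_set_simps [simp]:
  "\<one>\<^bsub>ideals_set R\<^esub> = carrier R" "I \<otimes>\<^bsub>ideals_set R\<^esub> J = ideal_prod R I J"
  by (simp_all add: ideals_set_def)

lemma (in cring) ideal_ideal_power: "ideal I R \<Longrightarrow> ideal (I [^]\<^bsub>ideals_set R\<^esub> (n::nat)) R"
  by (induction n) (simp_all add: oneideal ideal_prod_is_ideal)

lemma (in cring) power_in_ideal_power:
  "ideal I R \<Longrightarrow> a \<in> I \<Longrightarrow> a [^] n \<in> I [^]\<^bsub>ideals_set R\<^esub> (n::nat)"
  by (induction n) (simp_all add: ideal_prod.prod)

text \<open>Induction on the sum of the exponents: multiplying \<open>x\<close> by a generator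
  lowers one exponent by one, so one power of the ideal less kills the product.\<close>

lemma (in module) power_torsion_ideal_power:
  assumes gs: "set gs \<subseteq> carrier R"
  shows "\<lbrakk>x \<in> carrier M; \<And>b. b < length gs \<Longrightarrow> (gs ! b) [^] (a b :: nat) \<odot>\<^bsub>M\<^esub> x = \<zero>\<^bsub>M\<^esub>;
      (\<Sum>b<length gs. a b) = n; r \<in> (Idl (set gs)) [^]\<^bsub>ideals_set R\<^esub> Suc n\<rbrakk>
    \<Longrightarrow> r \<odot>\<^bsub>M\<^esub> x = \<zero>\<^bsub>M\<^esub>"
proof (induction n arbitrary: x a r)
  case (0 x a r)
  have I: "ideal (Idl (set gs)) R" by (rule R.genideal_ideal[OF gs])
  have "a b = 0" if "b < length gs" for b using 0(3) that by simp
  then have "gs ! b \<odot>\<^bsub>M\<^esub> x = \<zero>\<^bsub>M\<^esub>" if "b < length gs" for b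
    using 0(1) 0(2)[OF that] that gs by (metis R.nat_pow_0 nth_mem smult_one smult_r_null subsetD)
  then have "set gs \<subseteq> {r \<in> carrier R. r \<odot>\<^bsub>M\<^esub> x = \<zero>\<^bsub>M\<^esub>}" using gs by (force simp: in_set_conv_nth)
  then have "Idl (set gs) \<subseteq> {r \<in> carrier R. r \<odot>\<^bsub>M\<^esub> x = \<zero>\<^bsub>M\<^esub>}"
    by (rule R.genideal_minimal[OF ideal_annihilator[OF 0(1)]])
  moreover have "r \<in> Idl (set gs)"
    using 0(4) R.ideal_prod_inter[OF R.oneideal I] by auto
  ultimately show ?case by blast
next
  case (Suc n x a r)
  let ?I = "Idl (set gs)"
  have I: "ideal ?I R" by (rule R.genideal_ideal[OF gs])
  have P: "ideal (?I [^]\<^bsub>ideals_set R\<^esub> Suc n) R" by (rule R.ideal_ideal_power[OF I])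
  have gen: "i \<odot>\<^bsub>M\<^esub> (gs ! b \<odot>\<^bsub>M\<^esub> x) = \<zero>\<^bsub>M\<^esub>"
    if i: "i \<in> ?I [^]\<^bsub>ideals_set R\<^esub> Suc n" and b: "b < length gs" for i b
  proof (cases "a b")
    case 0
    \<comment> \<open>An exponent 0 says that 1 kills \<open>x\<close>, so there is nothing to lower
      in this case.\<close>
    have "x = \<zero>\<^bsub>M\<^esub>" using Suc.prems(1) Suc.prems(2)[OF b] 0 by simp
    then show ?thesis using i b gs ideal.Icarr[OF P] by (simp add: nth_mem subset_iff)
  next
    case (Suc l)
    have c: "gs ! b' \<in> carrier R" if "b' < length gs" for b' using that gs nth_mem by blast
    show ?thesis
    proof (rule Suc.IH[OF _ _ _ i])
      show "gs ! b \<odot>\<^bsub>M\<^esub> x \<in> carrier M" using c[OF b] Suc.prems(1) by simp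
      show "(gs ! b') [^] (a(b := l)) b' \<odot>\<^bsub>M\<^esub> (gs ! b \<odot>\<^bsub>M\<^esub> x) = \<zero>\<^bsub>M\<^esub>" if b': "b' < length gs" for b'
      proof (cases "b' = b")
        case True
        then show ?thesis using Suc.prems(1) Suc.prems(2)[OF b] c[OF b] Suc by (simp add: smult_assoc1)
      next
        case False
        then show ?thesis using Suc.prems(1) Suc.prems(2)[OF b'] c[OF b] c[OF b']
          by (simp add: smult_left_commute[of _ "gs ! b"])
      qed
      have "(\<Sum>b'<length gs. a b') = a b + (\<Sum>b'\<in>{..<length gs} - {b}. a b')"
        using b by (intro sum.remove) auto
      moreover have "(\<Sum>b'<length gs. (a(b := l)) b') = l + (\<Sum>b'\<in>{..<length gs} - {b}. (a(b := l)) b')"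
        using b by (subst sum.remove[of _ b]) auto
      moreover have "(\<Sum>b'\<in>{..<length gs} - {b}. (a(b := l)) b') = (\<Sum>b'\<in>{..<length gs} - {b}. a b')"
        by (intro sum.cong) auto
      ultimately show "(\<Sum>b'<length gs. (a(b := l)) b') = n" using Suc.prems(3) Suc by linarith
    qed
  qed
  have main: "i \<odot>\<^bsub>M\<^esub> (j \<odot>\<^bsub>M\<^esub> x) = \<zero>\<^bsub>M\<^esub>" if i: "i \<in> ?I [^]\<^bsub>ideals_set R\<^esub> Suc n" and j: "j \<in> ?I" for i j
  proof -
    have iR: "i \<in> carrier R" using i ideal.Icarr[OF P] by blast
    have "ideal {r \<in> carrier R. r \<odot>\<^bsub>M\<^esub> (i \<odot>\<^bsub>M\<^esub> x) = \<zero>\<^bsub>M\<^esub>} R"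
      by (rule ideal_annihilator) (use iR Suc.prems(1) in simp)
    moreover have "set gs \<subseteq> {r \<in> carrier R. r \<odot>\<^bsub>M\<^esub> (i \<odot>\<^bsub>M\<^esub> x) = \<zero>\<^bsub>M\<^esub>}"
    proof
      fix r assume r: "r \<in> set gs"
      then obtain b where "b < length gs" "r = gs ! b" by (auto simp: in_set_conv_nth)
      then show "r \<in> {r \<in> carrier R. r \<odot>\<^bsub>M\<^esub> (i \<odot>\<^bsub>M\<^esub> x) = \<zero>\<^bsub>M\<^esub>}"
        using gen[OF i, of b] r gs smult_left_commute[of i r x] iR Suc.prems(1) by fastforce
    qed
    ultimately have "?I \<subseteq> {r \<in> carrier R. r \<odot>\<^bsub>M\<^esub> (i \<odot>\<^bsub>M\<^esub> x) = \<zero>\<^bsub>M\<^esub>}" by (rule R.genideal_minimal)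
    then have "j \<in> carrier R" "j \<odot>\<^bsub>M\<^esub> (i \<odot>\<^bsub>M\<^esub> x) = \<zero>\<^bsub>M\<^esub>" using j by auto
    then show ?thesis using smult_left_commute[of i j x] iR Suc.prems(1) by simp
  qed
  have "r \<in> (?I [^]\<^bsub>ideals_set R\<^esub> Suc n) \<cdot> ?I" using Suc.prems(4) by simp
  then have "r \<in> carrier R \<and> r \<odot>\<^bsub>M\<^esub> x = \<zero>\<^bsub>M\<^esub>"
  proof induction
    case (prod i j)
    then show ?case
      using main[OF prod] Suc.prems(1) ideal.Icarr[OF P] ideal.Icarr[OF I] by (simp add: smult_assoc1)
  qed (use Suc.prems(1) in \<open>auto simp: smult_l_distr\<close>)
  then show ?case by blast
qed

text \<open>Finite generation is what turns separate exponents for the generators into one power of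
  the ideal: the sum of the exponents plus one suffices.\<close>

lemma (in plain_module) torsion_iff:
  assumes gs: "set gs \<subseteq> carrier R"
  shows "x \<in> carrier (torsion_submodule R (Idl (set gs)) M) \<longleftrightarrow>
    x \<in> carrier M \<and> (\<forall>b<length gs. \<exists>a::nat. (gs ! b) [^] a \<odot>\<^bsub>M\<^esub> x = \<zero>\<^bsub>M\<^esub>)"
proof
  have I: "ideal (Idl (set gs)) R" by (rule R.genideal_ideal[OF gs])
  assume "x \<in> carrier (torsion_submodule R (Idl (set gs)) M)"
  then obtain n :: nat where "x \<in> carrier M" "\<forall>a\<in>(Idl (set gs)) [^]\<^bsub>ideals_set R\<^esub> n. a \<odot>\<^bsub>M\<^esub> x = \<zero>\<^bsub>M\<^esub>"
    by (auto simp: torsion_submodule_def)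
  moreover have "(gs ! b) [^] n \<in> (Idl (set gs)) [^]\<^bsub>ideals_set R\<^esub> n" if "b < length gs" for b
    using R.power_in_ideal_power[OF I] R.genideal_self[OF gs] that by (meson nth_mem subsetD)
  ultimately show "x \<in> carrier M \<and> (\<forall>b<length gs. \<exists>a::nat. (gs ! b) [^] a \<odot>\<^bsub>M\<^esub> x = \<zero>\<^bsub>M\<^esub>)" by blast
next
  assume *: "x \<in> carrier M \<and> (\<forall>b<length gs. \<exists>a::nat. (gs ! b) [^] a \<odot>\<^bsub>M\<^esub> x = \<zero>\<^bsub>M\<^esub>)"
  then have "\<forall>b\<in>{..<length gs}. \<exists>a::nat. (gs ! b) [^] a \<odot>\<^bsub>M\<^esub> x = \<zero>\<^bsub>M\<^esub>" by simp
  from bchoice[OF this] obtain a :: "nat \<Rightarrow> nat"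
    where a: "\<And>b. b < length gs \<Longrightarrow> (gs ! b) [^] a b \<odot>\<^bsub>M\<^esub> x = \<zero>\<^bsub>M\<^esub>" by auto
  have "\<forall>r\<in>(Idl (set gs)) [^]\<^bsub>ideals_set R\<^esub> Suc (\<Sum>b<length gs. a b). r \<odot>\<^bsub>M\<^esub> x = \<zero>\<^bsub>M\<^esub>"
    using power_torsion_ideal_power[OF gs _ a refl] * by blast
  then have "\<exists>n::nat. \<forall>r\<in>(Idl (set gs)) [^]\<^bsub>ideals_set R\<^esub> n. r \<odot>\<^bsub>M\<^esub> x = \<zero>\<^bsub>M\<^esub>" by (rule exI)
  then show "x \<in> carrier (torsion_submodule R (Idl (set gs)) M)"
    using * by (simp add: torsion_submodule_def)
qed

section \<open>Fractions with numerators in a submodule\<close>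

context cech_complex
begin

text \<open>The localization of a submodule, realised inside that of \<open>M\<close>. Submodules
  and quotients are thus handled without changing the type of the fractions.\<close>

definition fracs :: "nat set \<Rightarrow> 'b set \<Rightarrow> ('b \<times> 'a) set set" where
  "fracs B Q = {fr B m k | m k. m \<in> Q}"

lemma plain_LL: "B \<subseteq> {..<t} \<Longrightarrow> plain_module R (LL B)"
  using module_LL by (simp add: plain_module_def)

lemma fr_zero: "B \<subseteq> {..<t} \<Longrightarrow> fr B \<zero>\<^bsub>M\<^esub> k = \<zero>\<^bsub>LL B\<^esub>"
  using g_closed by (simp add: fr_eq_zero_iff)

lemma fr_eqI:
  assumes "B \<subseteq> {..<t}" "m \<in> carrier M" "m' \<in> carrier M" "g B [^] (l::nat) \<odot>\<^bsub>M\<^esub> m = g B [^] l \<odot>\<^bsub>M\<^esub> m'"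
  shows "fr B m k = fr B m' k"
  using fr_expand[OF assms(1,2), of k l] fr_expand[OF assms(1,3), of k l] assms(4) by simp

lemma fr_eqD:
  assumes B: "B \<subseteq> {..<t}" and "m \<in> carrier M" "m' \<in> carrier M" "fr B m k = fr B m' k'"
  obtains l :: nat where "g B [^] l \<odot>\<^bsub>M\<^esub> (g B [^] k' \<odot>\<^bsub>M\<^esub> m) = g B [^] l \<odot>\<^bsub>M\<^esub> (g B [^] k \<odot>\<^bsub>M\<^esub> m')"
proof -
  have "\<exists>u\<in>D B. u \<odot>\<^bsub>M\<^esub> (g B [^] k' \<odot>\<^bsub>M\<^esub> m) = u \<odot>\<^bsub>M\<^esub> (g B [^] k \<odot>\<^bsub>M\<^esub> m')"
    using localized_module.frac_eq_iff[OF localized[OF B] assms(2) g_pow_D assms(3) g_pow_D] assms(4)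
    by (simp add: fr_def)
  then show thesis using that by (auto simp: D_eq powers_def)
qed

text \<open>A numerator is determined only up to multiplication by powers of \<open>g B\<close>,
  which explains the exponent \<open>l\<close>.\<close>

lemma fr_mem_fracs_iff:
  assumes Q: "submodule Q R M" and B: "B \<subseteq> {..<t}" and m: "m \<in> carrier M"
  shows "fr B m k \<in> fracs B Q \<longleftrightarrow> (\<exists>l::nat. g B [^] l \<odot>\<^bsub>M\<^esub> m \<in> Q)"
proof
  note gB = g_closed[OF B]
  assume "fr B m k \<in> fracs B Q"
  then obtain q k' where q: "q \<in> Q" "fr B m k = fr B q k'" by (auto simp: fracs_def)
  have qM: "q \<in> carrier M" using q(1) submodule_subset[OF Q] by blast
  obtain l :: nat where l: "g B [^] l \<odot>\<^bsub>M\<^esub> (g B [^] k' \<odot>\<^bsub>M\<^esub> m) = g B [^] l \<odot>\<^bsub>M\<^esub> (g B [^] k \<odot>\<^bsub>M\<^esub> q)"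
    using fr_eqD[OF B m qM q(2)] .
  have "g B [^] (l + k') \<odot>\<^bsub>M\<^esub> m = g B [^] l \<odot>\<^bsub>M\<^esub> (g B [^] k \<odot>\<^bsub>M\<^esub> q)"
    using l gB m by (simp add: R.nat_pow_mult[symmetric] smult_assoc1)
  also have "\<dots> \<in> Q" using submoduleE(4)[OF Q] gB q(1) by simp
  finally show "\<exists>l::nat. g B [^] l \<odot>\<^bsub>M\<^esub> m \<in> Q" by blast
next
  assume "\<exists>l::nat. g B [^] l \<odot>\<^bsub>M\<^esub> m \<in> Q"
  then show "fr B m k \<in> fracs B Q" using fr_expand[OF B m, of k] unfolding fracs_def by blast
qed

lemma submodule_fracs:
  assumes Q: "submodule Q R M" and B: "B \<subseteq> {..<t}"
  shows "submodule (fracs B Q) R (LL B)"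
proof -
  interpret L: plain_module R "LL B" by (rule plain_LL[OF B])
  note gB = g_closed[OF B]
  have c: "q \<in> carrier M" if "q \<in> Q" for q using that submodule_subset[OF Q] by blast
  have smult: "a \<odot>\<^bsub>LL B\<^esub> x \<in> fracs B Q" if a: "a \<in> carrier R" and x: "x \<in> fracs B Q" for a x
  proof -
    obtain m k where m: "m \<in> Q" "x = fr B m k" using x by (auto simp: fracs_def)
    then have "a \<odot>\<^bsub>LL B\<^esub> x = fr B (a \<odot>\<^bsub>M\<^esub> m) k" using fr_smult[OF B c a] by simp
    then show ?thesis using submoduleE(4)[OF Q a m(1)] unfolding fracs_def by blast
  qed
  show ?thesis
  proof (rule L.submoduleI)
    show sub: "fracs B Q \<subseteq> carrier (LL B)" using c fr_closed[OF B] by (auto simp: fracs_def)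
    show "\<zero>\<^bsub>LL B\<^esub> \<in> fracs B Q" using fr_zero[OF B, of 0] submodule_zero[OF Q] unfolding fracs_def by force
    show "a \<odot>\<^bsub>LL B\<^esub> x \<in> fracs B Q" if "a \<in> carrier R" "x \<in> fracs B Q" for a x using smult that .
    show "\<ominus>\<^bsub>LL B\<^esub> x \<in> fracs B Q" if x: "x \<in> fracs B Q" for x
    proof -
      have "x \<in> carrier (LL B)" using sub x by blast
      then have "\<ominus>\<^bsub>LL B\<^esub> x = (\<ominus> \<one>) \<odot>\<^bsub>LL B\<^esub> x" by (simp add: L.smult_l_minus)
      then show ?thesis using smult[OF _ x, of "\<ominus> \<one>"] by simp
    qed
    fix x y assume "x \<in> fracs B Q" "y \<in> fracs B Q"
    then obtain m k n l where m: "m \<in> Q" "x = fr B m k" and n: "n \<in> Q" "y = fr B n l" by (auto simp: fracs_def)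
    have "x = fr B (g B [^] l \<odot>\<^bsub>M\<^esub> m) (l + k)" "y = fr B (g B [^] k \<odot>\<^bsub>M\<^esub> n) (l + k)"
      using fr_expand[OF B c[OF m(1)], of k l] fr_expand[OF B c[OF n(1)], of l k] m(2) n(2)
      by (simp_all add: add.commute)
    then have "x \<oplus>\<^bsub>LL B\<^esub> y = fr B (g B [^] l \<odot>\<^bsub>M\<^esub> m \<oplus>\<^bsub>M\<^esub> g B [^] k \<odot>\<^bsub>M\<^esub> n) (l + k)"
      using gB c m n by (simp add: fr_add[OF B])
    moreover have "g B [^] l \<odot>\<^bsub>M\<^esub> m \<oplus>\<^bsub>M\<^esub> g B [^] k \<odot>\<^bsub>M\<^esub> n \<in> Q"
      using submoduleE(4,5)[OF Q] gB m n by simp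
    ultimately show "x \<oplus>\<^bsub>LL B\<^esub> y \<in> fracs B Q" unfolding fracs_def by blast
  qed
qed

lemma loc_map_fracs:
  assumes Q: "submodule Q R M" and B: "B \<subseteq> {..<t}" "b \<in> B" and x: "x \<in> fracs (B - {b}) Q"
  shows "loc_map R (D B) M x \<in> fracs B Q"
proof -
  obtain m k where m: "m \<in> Q" "x = fr (B - {b}) m k" using x by (auto simp: fracs_def)
  have "gs ! b \<in> carrier R" using B gs_closed by auto
  then have "(gs ! b) [^] k \<odot>\<^bsub>M\<^esub> m \<in> Q" using submoduleE(4)[OF Q] m(1) by simp
  moreover have "m \<in> carrier M" using m(1) submodule_subset[OF Q] by blast
  ultimately show ?thesis using m(2) loc_map_fr[OF B] unfolding fracs_def by blast
qed

lemma cech_iff: "x \<in> carrier (cech R gs M j) \<longleftrightarrow> x \<in> (\<Pi>\<^sub>E B\<in>subsets t j. carrier (LL B))"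
  by (simp add: cech_eq)

lemma cech_diff_apply:
  "B \<in> subsets t (j + 1) \<Longrightarrow> cech_diff R gs M j x B =
    (\<Oplus>\<^bsub>LL B\<^esub>b\<in>B. signed (LL B) (position b B) (loc_map R (D B) M (x (B - {b}))))"
  by (simp add: cech_diff_def)

lemma cech_simps:
  assumes "B \<in> subsets t j"
  shows "\<zero>\<^bsub>cech R gs M j\<^esub> B = \<zero>\<^bsub>LL B\<^esub>"
    "(x \<oplus>\<^bsub>cech R gs M j\<^esub> y) B = x B \<oplus>\<^bsub>LL B\<^esub> y B"
    "(a \<odot>\<^bsub>cech R gs M j\<^esub> x) B = a \<odot>\<^bsub>LL B\<^esub> x B"
    "x \<in> carrier (cech R gs M j) \<Longrightarrow> (\<ominus>\<^bsub>cech R gs M j\<^esub> x) B = \<ominus>\<^bsub>LL B\<^esub> x B"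
  using assms pi_module_inv[of R "subsets t j" LL x] module_LL R.is_cring
  by (simp_all add: cech_eq subsets_iff)

lemma cech_ext:
  assumes "x \<in> carrier (cech R gs M j)" "y \<in> carrier (cech R gs M j)" "\<And>B. B \<in> subsets t j \<Longrightarrow> x B = y B"
  shows "x = y"
  using pi_module_ext[of x "subsets t j" LL y] assms by (simp add: cech_eq)

text \<open>The image of the Cech complex of \<open>Q\<close> in that of \<open>M\<close>. For
  \<open>Q = (f)\<close> in R, dividing by it gives the Cech complex of R/(f).\<close>

definition cech_fracs :: "'b set \<Rightarrow> int \<Rightarrow> (nat set \<Rightarrow> ('b \<times> 'a) set) set" where
  "cech_fracs Q j = {x \<in> carrier (cech R gs M j). \<forall>B\<in>subsets t j. x B \<in> fracs B Q}"

lemma submodule_cech_fracs: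
  assumes Q: "submodule Q R M"
  shows "submodule (cech_fracs Q j) R (cech R gs M j)"
proof -
  interpret C: module R "cech R gs M j" by (rule module_cech)
  have s: "submodule (fracs B Q) R (LL B)" "module R (LL B)" if "B \<in> subsets t j" for B
    using submodule_fracs[OF Q] module_LL that by (simp_all add: subsets_iff)
  note rules = module.submoduleE[OF s(2) s(1)] module.submodule_zero[OF s(2) s(1)]
  show ?thesis
    by (rule C.submoduleI) (auto simp: cech_fracs_def cech_simps rules simp del: pi_module_simps)
qed

lemma cech_diff_fracs:
  assumes Q: "submodule Q R M" and x: "x \<in> cech_fracs Q j"
  shows "cech_diff R gs M j x \<in> cech_fracs Q (j + 1)"
proof -
  have xC: "x \<in> carrier (cech R gs M j)" using x by (simp add: cech_fracs_def)
  have "cech_diff R gs M j x B \<in> fracs B Q" if B: "B \<in> subsets t (j + 1)" for B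
  proof -
    have Bt: "B \<subseteq> {..<t}" using B by (simp add: subsets_iff)
    interpret L: plain_module R "LL B" by (rule plain_LL[OF Bt])
    note F = submodule_fracs[OF Q Bt]
    have "signed (LL B) (position b B) (loc_map R (D B) M (x (B - {b}))) \<in> fracs B Q" if b: "b \<in> B" for b
    proof -
      have "loc_map R (D B) M (x (B - {b})) \<in> fracs B Q"
        using loc_map_fracs[OF Q Bt b] x subsets_remove[OF B b] by (simp add: cech_fracs_def)
      then show ?thesis using L.signed_in_submodule_iff[OF F] submodule_subset[OF F] by blast
    qed
    then show ?thesis unfolding cech_diff_apply[OF B] by (intro L.submodule_finsum[OF F])
  qed
  then show ?thesis using module_hom_closed[OF cech_diff_hom xC] by (simp add: cech_fracs_def)
qed

section \<open>Acyclicity of the Cech complex of an injective module\<close>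

text \<open>Interpolates between the whole module, at \<open>i = 0\<close>, and the torsion for the
  ideal of all generators, at \<open>i = t\<close>.\<close>

definition pow_torsion :: "nat \<Rightarrow> 'b set" where
  "pow_torsion i = {m \<in> carrier M. \<forall>b<i. \<exists>a::nat. (gs ! b) [^] a \<odot>\<^bsub>M\<^esub> m = \<zero>\<^bsub>M\<^esub>}"

lemma submodule_pow_torsion:
  assumes "i \<le> t" shows "submodule (pow_torsion i) R M"
proof (rule submoduleI)
  have c: "gs ! b \<in> carrier R" if "b < i" for b using gs_closed assms that by simp
  show "pow_torsion i \<subseteq> carrier M" by (auto simp: pow_torsion_def)
  show "\<zero>\<^bsub>M\<^esub> \<in> pow_torsion i" using c by (simp add: pow_torsion_def)
  show "\<ominus>\<^bsub>M\<^esub> m \<in> pow_torsion i" if "m \<in> pow_torsion i" for m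
    using that c by (fastforce simp: pow_torsion_def smult_r_minus)
  show "r \<odot>\<^bsub>M\<^esub> m \<in> pow_torsion i" if "r \<in> carrier R" "m \<in> pow_torsion i" for r m
    using that c unfolding pow_torsion_def
    by simp (metis R.nat_pow_closed smult_left_commute smult_r_null)
  fix m n assume m: "m \<in> pow_torsion i" and n: "n \<in> pow_torsion i"
  have "\<exists>a::nat. (gs ! b) [^] a \<odot>\<^bsub>M\<^esub> (m \<oplus>\<^bsub>M\<^esub> n) = \<zero>\<^bsub>M\<^esub>" if b: "b < i" for b
  proof -
    obtain a a' :: nat where a: "(gs ! b) [^] a \<odot>\<^bsub>M\<^esub> m = \<zero>\<^bsub>M\<^esub>" "(gs ! b) [^] a' \<odot>\<^bsub>M\<^esub> n = \<zero>\<^bsub>M\<^esub>"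
      using m n b unfolding pow_torsion_def by blast
    have mn: "m \<in> carrier M" "n \<in> carrier M" using m n by (auto simp: pow_torsion_def)
    let ?g = "gs ! b"
    have "?g [^] (a' + a) \<odot>\<^bsub>M\<^esub> m = ?g [^] a' \<odot>\<^bsub>M\<^esub> (?g [^] a \<odot>\<^bsub>M\<^esub> m)"
      "?g [^] (a' + a) \<odot>\<^bsub>M\<^esub> n = ?g [^] a \<odot>\<^bsub>M\<^esub> (?g [^] a' \<odot>\<^bsub>M\<^esub> n)"
      using mn c[OF b] smult_assoc1[of "?g [^] a'" "?g [^] a" m] smult_assoc1[of "?g [^] a" "?g [^] a'" n]
      by (simp_all add: R.nat_pow_mult add.commute)
    then have "?g [^] (a' + a) \<odot>\<^bsub>M\<^esub> (m \<oplus>\<^bsub>M\<^esub> n) = \<zero>\<^bsub>M\<^esub>"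
      using a mn c[OF b] by (simp add: smult_r_distr)
    then show ?thesis by blast
  qed
  then show "m \<oplus>\<^bsub>M\<^esub> n \<in> pow_torsion i" using m n by (simp add: pow_torsion_def)
qed

text \<open>Inverting \<open>gs ! b\<close> destroys a numerator that a power of
  \<open>gs ! b\<close> kills.\<close>

lemma loc_map_torsion:
  assumes B: "B \<subseteq> {..<t}" "b \<in> B" and "b < i" "i \<le> t" and x: "x \<in> fracs (B - {b}) (pow_torsion i)"
  shows "loc_map R (D B) M x = \<zero>\<^bsub>LL B\<^esub>"
proof -
  obtain m k where m: "m \<in> pow_torsion i" "x = fr (B - {b}) m k" using x by (auto simp: fracs_def)
  obtain a :: nat where a: "(gs ! b) [^] a \<odot>\<^bsub>M\<^esub> m = \<zero>\<^bsub>M\<^esub>" using m(1) assms(3) by (auto simp: pow_torsion_def)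
  have c: "gs ! b \<in> carrier R" "g (B - {b}) \<in> carrier R" "m \<in> carrier M"
    using B gs_closed g_closed[of "B - {b}"] m(1) by (auto simp: pow_torsion_def)
  have "g B [^] a \<odot>\<^bsub>M\<^esub> ((gs ! b) [^] k \<odot>\<^bsub>M\<^esub> m) =
      (g (B - {b}) [^] a \<otimes> (gs ! b) [^] k) \<odot>\<^bsub>M\<^esub> ((gs ! b) [^] a \<odot>\<^bsub>M\<^esub> m)"
    using c by (simp add: g_power_remove[OF B, symmetric] smult_assoc1[symmetric] R.m_ac)
  also have "\<dots> = \<zero>\<^bsub>M\<^esub>" unfolding a using c by simp
  finally show ?thesis using m(2) c loc_map_fr[OF B] fr_eq_zero_iff[OF B(1)] by auto
qed

text \<open>Removing any element other than \<open>i\<close> leaves a subset that still contains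
  \<open>i\<close>, where \<open>y\<close> vanishes. The surviving term has sign plus, as
  \<open>i\<close> is the smallest element of \<open>B\<close>.\<close>

lemma cech_diff_single:
  assumes y: "y \<in> carrier (cech R gs M j)" and i: "i < t"
    and sup: "\<And>C. C \<in> subsets t j \<Longrightarrow> i \<in> C \<Longrightarrow> y C = \<zero>\<^bsub>LL C\<^esub>"
    and B: "B \<in> subsets t (j + 1)" "i \<in> B" "B \<inter> {..<i} = {}"
  shows "cech_diff R gs M j y B = loc_map R (D B) M (y (B - {i}))"
proof -
  have Bt: "B \<subseteq> {..<t}" using B by (simp add: subsets_iff)
  interpret L: plain_module R "LL B" by (rule plain_LL[OF Bt])
  have c: "loc_map R (D B) M (y (B - {b})) \<in> carrier (LL B)" if "b \<in> B" for b
    using module_hom_closed[OF loc_map_hom'[OF Bt that]] y subsets_remove[OF B(1) that]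
    by (auto simp: cech_iff)
  have "loc_map R (D B) M (y (B - {b})) = \<zero>\<^bsub>LL B\<^esub>" if b: "b \<in> B" "b \<noteq> i" for b
  proof -
    have "y (B - {b}) = \<zero>\<^bsub>LL (B - {b})\<^esub>" using sup[OF subsets_remove[OF B(1) b(1)]] b B(2) by simp
    then show ?thesis
      using module_hom_zero[OF module_LL L.module_axioms loc_map_hom'[OF Bt b(1)]] Bt by auto
  qed
  then have "cech_diff R gs M j y B = signed (LL B) (position i B) (loc_map R (D B) M (y (B - {i})))"
    unfolding cech_diff_apply[OF B(1)] using c B subsets_finite[OF B(1)] by (intro L.finsum_eq_single) auto
  moreover have "position i B = 0" using B(3) by (auto simp: position_def)
  ultimately show ?thesis by (simp add: signed_def)
qed

text \<open>Subtracting a coboundary clears the components at subsets with smallest element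
  \<open>i\<close>, using divisibility by \<open>gs ! i\<close>. The cocycle condition at the
  subsets obtained by adding \<open>i\<close> then shows that the remaining components die when
  \<open>gs ! i\<close> is inverted, so that their numerators can be taken torsion for it
  too.\<close>

lemma cech_acyclic_step:
  assumes i: "i < t"
    and divide: "\<And>m n. m \<in> pow_torsion i \<Longrightarrow> \<exists>m'\<in>pow_torsion i. \<exists>k::nat.
      (gs ! i) [^] k \<odot>\<^bsub>M\<^esub> ((gs ! i) [^] (n::nat) \<odot>\<^bsub>M\<^esub> m') = (gs ! i) [^] k \<odot>\<^bsub>M\<^esub> m"
    and x: "x \<in> cech_fracs (pow_torsion i) (j + 1)" "cech_diff R gs M (j + 1) x = \<zero>\<^bsub>cech R gs M (j + 2)\<^esub>"
      "\<And>B. B \<in> subsets t (j + 1) \<Longrightarrow> B \<inter> {..<i} \<noteq> {} \<Longrightarrow> x B = \<zero>\<^bsub>LL B\<^esub>"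
  obtains y where "y \<in> carrier (cech R gs M j)"
    "x \<ominus>\<^bsub>cech R gs M (j + 1)\<^esub> cech_diff R gs M j y \<in> cech_fracs (pow_torsion (Suc i)) (j + 1)"
    "\<And>B. B \<in> subsets t (j + 1) \<Longrightarrow> B \<inter> {..<Suc i} \<noteq> {} \<Longrightarrow>
      (x \<ominus>\<^bsub>cech R gs M (j + 1)\<^esub> cech_diff R gs M j y) B = \<zero>\<^bsub>LL B\<^esub>"
proof -
  let ?C = "cech R gs M (j + 1)" and ?Q = "pow_torsion i"
  have Q: "submodule ?Q R M" using submodule_pow_torsion i by simp
  have QM: "m \<in> carrier M" if "m \<in> ?Q" for m using that by (simp add: pow_torsion_def)
  have gi: "gs ! i \<in> carrier R" by (rule gs_closed[OF i])
  interpret C: module R ?C by (rule module_cech)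
  \<comment> \<open>The canonical map multiplies a numerator over the \<open>n\<close>-th power by
    \<open>gs ! i\<close> to the power \<open>n\<close>; so \<open>divide\<close> is invoked with
    the exponent of the denominator of \<open>x\<close>.\<close>
  have "\<exists>v\<in>fracs C ?Q. loc_map R (D (insert i C)) M v = x (insert i C)"
    if C: "C \<in> subsets t j" "C \<inter> {..<Suc i} = {}" for C
  proof -
    have iC: "i \<notin> C" using C(2) by auto
    have B: "insert i C \<in> subsets t (j + 1)" by (rule subsets_insert[OF C(1) i iC])
    then have Bt: "insert i C \<subseteq> {..<t}" by (simp add: subsets_iff)
    obtain m n where m: "m \<in> ?Q" "x (insert i C) = fr (insert i C) m n"
      using x(1) B by (auto simp: cech_fracs_def fracs_def)
    obtain m' k where m': "m' \<in> ?Q" "(gs ! i) [^] (k::nat) \<odot>\<^bsub>M\<^esub> ((gs ! i) [^] n \<odot>\<^bsub>M\<^esub> m') = (gs ! i) [^] k \<odot>\<^bsub>M\<^esub> m"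
      using divide[OF m(1)] by blast
    have e: "insert i C - {i} = C" using iC by auto
    have gC: "g C \<in> carrier R" using g_closed[of C] Bt by auto
    have gB: "g (insert i C) [^] k = g C [^] k \<otimes> (gs ! i) [^] k"
      using g_power_remove[OF Bt, of i k] gi gC e by (simp add: R.m_comm)
    have "fr (insert i C) ((gs ! i) [^] n \<odot>\<^bsub>M\<^esub> m') n = fr (insert i C) m n"
      using QM[OF m(1)] QM[OF m'(1)] gi gC m'(2)
      by (intro fr_eqI[OF Bt, of _ _ k]) (simp_all add: gB smult_assoc1)
    then have "loc_map R (D (insert i C)) M (fr C m' n) = x (insert i C)"
      using loc_map_fr[OF Bt, of i m' n] QM[OF m'(1)] m(2) by (simp add: e)
    moreover have "fr C m' n \<in> fracs C ?Q" using m'(1) by (auto simp: fracs_def)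
    ultimately show ?thesis by blast
  qed
  then obtain v where v: "\<And>C. C \<in> subsets t j \<Longrightarrow> C \<inter> {..<Suc i} = {} \<Longrightarrow>
      v C \<in> fracs C ?Q \<and> loc_map R (D (insert i C)) M (v C) = x (insert i C)" by metis
  \<comment> \<open>Extension by zero to the subsets meeting the first \<open>i + 1\<close> indices
    keeps \<open>y\<close> away from subsets containing \<open>i\<close>, as
    \<open>cech_diff_single\<close> requires.\<close>
  define y where "y = (\<lambda>C\<in>subsets t j. if C \<inter> {..<Suc i} = {} then v C else \<zero>\<^bsub>LL C\<^esub>)"
  have y: "y \<in> cech_fracs ?Q j"
  proof -
    have "y C \<in> fracs C ?Q \<and> y C \<in> carrier (LL C)" if C: "C \<in> subsets t j" for C
    proof -
      have Ct: "C \<subseteq> {..<t}" using C by (simp add: subsets_iff)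
      have "y C \<in> fracs C ?Q"
        using v[OF C] C module.submodule_zero[OF module_LL[OF Ct] submodule_fracs[OF Q Ct]] by (simp add: y_def)
      then show ?thesis using submodule_subset[OF submodule_fracs[OF Q Ct]] by blast
    qed
    moreover have "y \<in> extensional (subsets t j)" by (simp add: y_def)
    ultimately show ?thesis by (simp add: cech_fracs_def cech_iff PiE_iff)
  qed
  then have yC: "y \<in> carrier (cech R gs M j)" by (simp add: cech_fracs_def)
  have y_zero: "y C = \<zero>\<^bsub>LL C\<^esub>" if "C \<in> subsets t j" "C \<inter> {..<Suc i} \<noteq> {}" for C
    using that by (simp add: y_def)
  define dy where "dy = cech_diff R gs M j y"
  define x' where "x' = x \<ominus>\<^bsub>?C\<^esub> dy"
  have dy: "dy \<in> cech_fracs ?Q (j + 1)" unfolding dy_def by (rule cech_diff_fracs[OF Q y])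
  then have dyC: "dy \<in> carrier ?C" by (simp add: cech_fracs_def)
  have xC: "x \<in> carrier ?C" using x(1) by (simp add: cech_fracs_def)
  have x': "x' \<in> cech_fracs ?Q (j + 1)"
    unfolding x'_def by (rule C.submodule_minus[OF submodule_cech_fracs[OF Q] x(1) dy])
  then have x'C: "x' \<in> carrier ?C" by (simp add: cech_fracs_def)
  have x'_eq: "x' B = x B \<ominus>\<^bsub>LL B\<^esub> dy B" if "B \<in> subsets t (j + 1)" for B
    unfolding x'_def a_minus_def using dyC by (simp add: cech_simps[OF that])
  have zero: "x' B = \<zero>\<^bsub>LL B\<^esub>" if B: "B \<in> subsets t (j + 1)" "B \<inter> {..<Suc i} \<noteq> {}" for B
  proof -
    have Bt: "B \<subseteq> {..<t}" using B by (simp add: subsets_iff)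
    interpret L: plain_module R "LL B" by (rule plain_LL[OF Bt])
    show ?thesis
    proof (cases "B \<inter> {..<i} = {}")
      case True
      then have iB: "i \<in> B" using B(2) by (auto simp: less_Suc_eq)
      have "dy B = loc_map R (D B) M (y (B - {i}))"
        unfolding dy_def by (rule cech_diff_single[OF yC i _ B(1) iB True]) (rule y_zero, auto)
      moreover have "B - {i} \<in> subsets t j" "(B - {i}) \<inter> {..<Suc i} = {}" "insert i (B - {i}) = B"
        using subsets_remove[OF B(1) iB] True iB by (auto simp: less_Suc_eq)
      ultimately have "dy B = x B" using v[of "B - {i}"] by (simp add: y_def)
      moreover have "x B \<in> carrier (LL B)" using xC B(1) by (auto simp: cech_iff)
      ultimately show ?thesis using x'_eq[OF B(1)] L.minus_eq_zero_iff by simp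
    next
      case False
      \<comment> \<open>The components cleared earlier must not be spoiled. Either
        \<open>B - {b}\<close> still meets the first \<open>i + 1\<close> indices, where
        \<open>y\<close> is zero, or \<open>b < i\<close> and the torsion numerator of
        \<open>y\<close> dies as \<open>gs ! b\<close> is inverted.\<close>
      have "loc_map R (D B) M (y (B - {b})) = \<zero>\<^bsub>LL B\<^esub>" if b: "b \<in> B" for b
      proof (cases "(B - {b}) \<inter> {..<Suc i} = {}")
        case True
        then have "b < i" using False b by (auto simp: less_Suc_eq)
        moreover have "y (B - {b}) \<in> fracs (B - {b}) ?Q"
          using y subsets_remove[OF B(1) b] by (simp add: cech_fracs_def)
        ultimately show ?thesis using loc_map_torsion[OF Bt b] i by simp
      next
        case False
        then show ?thesis
          using module_hom_zero[OF module_LL L.module_axioms loc_map_hom'[OF Bt b]] Bt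
            y_zero[OF subsets_remove[OF B(1) b]] by auto
      qed
      then have "dy B = (\<Oplus>\<^bsub>LL B\<^esub>b\<in>B. \<zero>\<^bsub>LL B\<^esub>)"
        unfolding dy_def cech_diff_apply[OF B(1)] by (intro L.M.finsum_cong') auto
      then show ?thesis using x'_eq[OF B(1)] x(3)[OF B(1) False] by (simp add: L.minus_eq_zero_iff)
    qed
  qed
  have dx': "cech_diff R gs M (j + 1) x' = \<zero>\<^bsub>cech R gs M (j + 2)\<^esub>"
  proof -
    interpret C2: module R "cech R gs M (j + 2)" by (rule module_cech)
    have h: "cech_diff R gs M (j + 1) \<in> module_hom R ?C (cech R gs M (j + 2))"
      using cech_diff_hom[of "j + 1"] by (simp add: add.assoc)
    show ?thesis
      using module_hom_minus[OF C.module_axioms C2.module_axioms h xC dyC] x(2) cech_diff_diff[OF yC]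
      by (simp add: x'_def dy_def C2.minus_eq_zero_iff)
  qed
  \<comment> \<open>If \<open>B\<close> avoids the first \<open>i + 1\<close> indices, the cocycle
    condition at \<open>insert i B\<close> involves only the component at \<open>B\<close>. It
    yields a power of \<open>gs ! i\<close> killing the numerator after multiplication by a power of
    \<open>g B\<close>, and this is the numerator to use.\<close>
  have "x' B \<in> fracs B (pow_torsion (Suc i))" if B: "B \<in> subsets t (j + 1)" for B
  proof (cases "B \<inter> {..<Suc i} = {}")
    case False
    have Bt: "B \<subseteq> {..<t}" using B by (simp add: subsets_iff)
    show ?thesis
      using zero[OF B False] module.submodule_zero[OF module_LL[OF Bt] submodule_fracs[OF submodule_pow_torsion Bt]] i
      by simp
  next
    case True
    have Bt: "B \<subseteq> {..<t}" and iB: "i \<notin> B" using B True by (auto simp: subsets_iff)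
    let ?B = "insert i B"
    have B': "?B \<in> subsets t (j + 1 + 1)" by (rule subsets_insert[OF B i iB])
    have Bt': "?B \<subseteq> {..<t}" using Bt i by simp
    have e: "?B - {i} = B" using iB by auto
    obtain m n where m: "m \<in> ?Q" "x' B = fr B m n" using x' B by (auto simp: cech_fracs_def fracs_def)
    have mM: "m \<in> carrier M" by (rule QM[OF m(1)])
    have "cech_diff R gs M (j + 1) x' ?B = loc_map R (D ?B) M (x' (?B - {i}))"
    proof (rule cech_diff_single[OF x'C i _ B'])
      show "?B \<inter> {..<i} = {}" using True by auto
    qed (rule zero, auto)
    moreover have "\<zero>\<^bsub>cech R gs M (j + 2)\<^esub> ?B = \<zero>\<^bsub>LL ?B\<^esub>"
      using cech_simps(1)[of ?B "j + 2"] B' by (simp add: add.assoc)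
    ultimately have "fr ?B ((gs ! i) [^] n \<odot>\<^bsub>M\<^esub> m) n = \<zero>\<^bsub>LL ?B\<^esub>"
      using dx' loc_map_fr[OF Bt' _ mM, of i n] m(2) by (simp add: e)
    then obtain l :: nat where l: "g ?B [^] l \<odot>\<^bsub>M\<^esub> ((gs ! i) [^] n \<odot>\<^bsub>M\<^esub> m) = \<zero>\<^bsub>M\<^esub>"
      using fr_eq_zero_iff[OF Bt'] gi mM by auto
    have gB: "g B \<in> carrier R" by (rule g_closed[OF Bt])
    have "(gs ! i) [^] (l + n) \<odot>\<^bsub>M\<^esub> (g B [^] l \<odot>\<^bsub>M\<^esub> m) = g ?B [^] l \<odot>\<^bsub>M\<^esub> ((gs ! i) [^] n \<odot>\<^bsub>M\<^esub> m)"
      using g_power_remove[OF Bt', of i l, symmetric] gB gi mM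
      by (simp add: e R.nat_pow_mult[symmetric] smult_assoc1[symmetric] R.m_ac)
    then have "\<exists>a::nat. (gs ! i) [^] a \<odot>\<^bsub>M\<^esub> (g B [^] l \<odot>\<^bsub>M\<^esub> m) = \<zero>\<^bsub>M\<^esub>" using l by metis
    moreover have "g B [^] l \<odot>\<^bsub>M\<^esub> m \<in> ?Q" using submoduleE(4)[OF Q] gB m(1) by simp
    ultimately have "g B [^] l \<odot>\<^bsub>M\<^esub> m \<in> pow_torsion (Suc i)" by (auto simp: pow_torsion_def less_Suc_eq)
    then show ?thesis using fr_expand[OF Bt mM, of n l] m(2) by (auto simp: fracs_def)
  qed
  then show thesis using that[OF yC] zero x'C unfolding x'_def dy_def cech_fracs_def by blast
qed

text \<open>Iterating \<open>cech_acyclic_step\<close> from 0 to \<open>t\<close> changes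
  \<open>x\<close> by coboundaries only; at the end \<open>x\<close> vanishes on every subset
  meeting \<open>{..<t}\<close>.\<close>

lemma cech_acyclic:
  assumes divide: "\<And>i m n. i < t \<Longrightarrow> m \<in> pow_torsion i \<Longrightarrow> \<exists>m'\<in>pow_torsion i. \<exists>k::nat.
      (gs ! i) [^] k \<odot>\<^bsub>M\<^esub> ((gs ! i) [^] (n::nat) \<odot>\<^bsub>M\<^esub> m') = (gs ! i) [^] k \<odot>\<^bsub>M\<^esub> m"
    and j: "j \<ge> 0" and x: "x \<in> carrier (cech R gs M (j + 1))"
    and dx: "cech_diff R gs M (j + 1) x = \<zero>\<^bsub>cech R gs M (j + 2)\<^esub>"
  shows "x \<in> cech_diff R gs M j ` carrier (cech R gs M j)"
proof -
  let ?C = "cech R gs M (j + 1)" and ?I = "cech_diff R gs M j ` carrier (cech R gs M j)"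
  interpret C: module R ?C by (rule module_cech)
  interpret C2: module R "cech R gs M (j + 2)" by (rule module_cech)
  have h: "cech_diff R gs M (j + 1) \<in> module_hom R ?C (cech R gs M (j + 2))"
    using cech_diff_hom[of "j + 1"] by (simp add: add.assoc)
  have I: "submodule ?I R ?C"
    by (rule submodule_image[OF module_cech module_cech cech_diff_hom module.carrier_is_submodule[OF module_cech]])
  have "x \<in> ?I" if "i \<le> t" "x \<in> cech_fracs (pow_torsion i) (j + 1)"
    "cech_diff R gs M (j + 1) x = \<zero>\<^bsub>cech R gs M (j + 2)\<^esub>"
    "\<And>B. B \<in> subsets t (j + 1) \<Longrightarrow> B \<inter> {..<i} \<noteq> {} \<Longrightarrow> x B = \<zero>\<^bsub>LL B\<^esub>" for i x
    using that
  proof (induction i arbitrary: x rule: inc_induct)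
    case (base x)
    have "x = \<zero>\<^bsub>?C\<^esub>"
    proof (rule cech_ext)
      show "x \<in> carrier ?C" using base by (simp add: cech_fracs_def)
      fix B assume B: "B \<in> subsets t (j + 1)"
      \<comment> \<open>Positivity of the degree enters here: the empty subset, which meets no
        initial segment, does not occur in degree \<open>j + 1\<close>.\<close>
      then have "B \<noteq> {}" "B \<subseteq> {..<t}" using j by (auto simp: subsets_iff)
      then have "B \<inter> {..<t} \<noteq> {}" by blast
      then show "x B = \<zero>\<^bsub>?C\<^esub> B" using base(3)[OF B] cech_simps(1)[OF B] by simp
    qed (rule C.M.zero_closed)
    then show ?case using C.submodule_zero[OF I] by simp
  next
    case (step i x)
    have xC: "x \<in> carrier ?C" using step.prems by (simp add: cech_fracs_def)
    obtain y where y: "y \<in> carrier (cech R gs M j)"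
      "x \<ominus>\<^bsub>?C\<^esub> cech_diff R gs M j y \<in> cech_fracs (pow_torsion (Suc i)) (j + 1)"
      "\<And>B. B \<in> subsets t (j + 1) \<Longrightarrow> B \<inter> {..<Suc i} \<noteq> {} \<Longrightarrow> (x \<ominus>\<^bsub>?C\<^esub> cech_diff R gs M j y) B = \<zero>\<^bsub>LL B\<^esub>"
    proof (rule cech_acyclic_step[OF step.hyps(2) divide[OF step.hyps(2)] step.prems])
      fix y
      assume "y \<in> carrier (cech R gs M j)"
        "x \<ominus>\<^bsub>?C\<^esub> cech_diff R gs M j y \<in> cech_fracs (pow_torsion (Suc i)) (j + 1)"
        "\<And>B. B \<in> subsets t (j + 1) \<Longrightarrow> B \<inter> {..<Suc i} \<noteq> {} \<Longrightarrow> (x \<ominus>\<^bsub>?C\<^esub> cech_diff R gs M j y) B = \<zero>\<^bsub>LL B\<^esub>"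
      then show thesis by (rule that)
    qed
    have dyC: "cech_diff R gs M j y \<in> carrier ?C" by (rule module_hom_closed[OF cech_diff_hom y(1)])
    have "cech_diff R gs M (j + 1) (x \<ominus>\<^bsub>?C\<^esub> cech_diff R gs M j y) = \<zero>\<^bsub>cech R gs M (j + 2)\<^esub>"
      using module_hom_minus[OF C.module_axioms C2.module_axioms h xC dyC] step.prems(2) cech_diff_diff[OF y(1)]
      by (simp add: C2.minus_eq_zero_iff)
    then have "x \<ominus>\<^bsub>?C\<^esub> cech_diff R gs M j y \<in> ?I" using step.IH[OF y(2) _ y(3)] by blast
    then have "x \<ominus>\<^bsub>?C\<^esub> cech_diff R gs M j y \<oplus>\<^bsub>?C\<^esub> cech_diff R gs M j y \<in> ?I"
      using C.submoduleE(5)[OF I] y(1) by blast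
    moreover have "x \<ominus>\<^bsub>?C\<^esub> cech_diff R gs M j y \<oplus>\<^bsub>?C\<^esub> cech_diff R gs M j y = x"
      using xC dyC by (simp add: C.M.minus_eq C.M.a_assoc C.M.l_neg)
    ultimately show ?case by simp
  qed
  moreover have "x \<in> cech_fracs (pow_torsion 0) (j + 1)"
  proof -
    have "x B \<in> fracs B (pow_torsion 0)" if B: "B \<in> subsets t (j + 1)" for B
    proof -
      have "x B \<in> carrier (LL B)" "B \<subseteq> {..<t}" using x B by (auto simp: cech_iff subsets_iff)
      then obtain m k where "m \<in> carrier M" "x B = fr B m k" by (rule frE)
      then show ?thesis by (auto simp: fracs_def pow_torsion_def)
    qed
    then show ?thesis using x by (simp add: cech_fracs_def)
  qed
  ultimately show ?thesis using dx by blast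
qed

subsection \<open>Degree zero\<close>

text \<open>Degree 0 of the Cech complex is a copy of \<open>M\<close>, localized at 1; this map
  identifies the two, which have different types.\<close>

definition cech_unit :: "'b \<Rightarrow> nat set \<Rightarrow> ('b \<times> 'a) set" where
  "cech_unit m = (\<lambda>B\<in>subsets t 0. fr B m 0)"

lemma subsets_0: "subsets n 0 = {{}}"
  by (auto simp: subsets_def dest: finite_subset)

lemma g_empty: "g {} = \<one>"
  by (simp add: g_def)

lemma cech_unit_hom: "cech_unit \<in> module_hom R M (cech R gs M 0)"
  by (rule module_homI) (auto simp: cech_unit_def cech_eq subsets_0 fr_closed fr_add fr_smult fun_eq_iff)

lemma cech_unit_surj:
  assumes "x \<in> carrier (cech R gs M 0)" obtains m where "m \<in> carrier M" "x = cech_unit m"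
proof -
  have "x {} \<in> carrier (LL {})" using assms by (auto simp: cech_iff subsets_0)
  then obtain m k where m: "m \<in> carrier M" "x {} = fr {} m k" by (rule frE) auto
  have "x {} = fr {} m 0" using fr_expand[of "{}" m 0 k] m by (simp add: g_empty)
  then have "x = cech_unit m"
    using assms m(1) by (intro cech_ext[OF assms module_hom_closed[OF cech_unit_hom]]) (auto simp: cech_unit_def subsets_0)
  then show thesis using that m(1) by blast
qed

lemma cech_unit_inj:
  assumes "m \<in> carrier M" "n \<in> carrier M" "cech_unit m = cech_unit n" shows "m = n"
proof -
  interpret L: plain_module R "LL {}" by (rule plain_LL) simp
  have "fr {} m 0 = fr {} n 0" using fun_cong[OF assms(3), of "{}"] by (simp add: cech_unit_def subsets_0)
  then obtain l :: nat where "g {} [^] l \<odot>\<^bsub>M\<^esub> (g {} [^] (0::nat) \<odot>\<^bsub>M\<^esub> m) = g {} [^] l \<odot>\<^bsub>M\<^esub> (g {} [^] (0::nat) \<odot>\<^bsub>M\<^esub> n)"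
    using fr_eqD[of "{}" m n 0 0] assms by auto
  then show ?thesis using assms by (simp add: g_empty)
qed

text \<open>The component of the differential at \<open>{b}\<close> is \<open>m/1\<close> over the
  powers of \<open>gs ! b\<close>, which vanishes precisely when such a power kills
  \<open>m\<close>. So the zeroth Cech cohomology is the torsion.\<close>

lemma cech_unit_cocycle_iff:
  assumes m: "m \<in> carrier M"
  shows "cech_diff R gs M 0 (cech_unit m) = \<zero>\<^bsub>cech R gs M 1\<^esub> \<longleftrightarrow> m \<in> pow_torsion t"
proof -
  have S: "B \<in> subsets t 1 \<longleftrightarrow> (\<exists>b<t. B = {b})" for B
    by (auto simp: subsets_iff card_1_singleton_iff)
  have eq: "cech_diff R gs M 0 (cech_unit m) {b} = fr {b} m 0" if b: "b < t" for b
  proof -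
    have bt: "{b} \<subseteq> {..<t}" using b by simp
    interpret L: plain_module R "LL {b}" by (rule plain_LL[OF bt])
    have p: "position b {b} = 0" by (auto simp: position_def)
    have "loc_map R (D {b}) M (fr {} m 0) = fr {b} m 0" using loc_map_fr[OF bt, of b m 0] m by simp
    then show ?thesis
      using cech_diff_apply[of "{b}" 0 "cech_unit m"] S b fr_closed[OF bt m]
      by (simp add: cech_unit_def subsets_0 p signed_def)
  qed
  have g1: "g {b} = gs ! b" if "b < t" for b using gs_closed[OF that] by (simp add: g_def)
  have z: "fr {b} m 0 = \<zero>\<^bsub>LL {b}\<^esub> \<longleftrightarrow> (\<exists>a::nat. (gs ! b) [^] a \<odot>\<^bsub>M\<^esub> m = \<zero>\<^bsub>M\<^esub>)" if "b < t" for b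
    using fr_eq_zero_iff[of "{b}" m 0] m that by (simp add: g1)
  have c: "cech_diff R gs M 0 (cech_unit m) \<in> carrier (cech R gs M 1)"
    using module_hom_closed[OF cech_diff_hom module_hom_closed[OF cech_unit_hom m]] by simp
  have z1: "\<zero>\<^bsub>cech R gs M 1\<^esub> \<in> carrier (cech R gs M 1)"
    by (rule module.submodule_zero[OF module_cech module.carrier_is_submodule[OF module_cech]])
  have "cech_diff R gs M 0 (cech_unit m) = \<zero>\<^bsub>cech R gs M 1\<^esub> \<longleftrightarrow>
      (\<forall>b<t. cech_diff R gs M 0 (cech_unit m) {b} = \<zero>\<^bsub>LL {b}\<^esub>)"
    using cech_ext[OF c z1] cech_simps(1)[of _ 1] S by metis
  also have "\<dots> \<longleftrightarrow> m \<in> pow_torsion t" using eq z m by (auto simp: pow_torsion_def)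
  finally show ?thesis .
qed

end

lemma cech_hom_unit:
  assumes M: "cech_complex R gs M" and N: "cech_complex R gs N" and h: "h \<in> module_hom R M N" and "m \<in> carrier M"
  shows "cech_hom R gs N h 0 (cech_complex.cech_unit R gs M m) = cech_complex.cech_unit R gs N (h m)"
  using loc_hom_fr[OF M N h _ assms(4)]
  by (simp add: cech_hom_def cech_complex.cech_unit_def[OF M] cech_complex.cech_unit_def[OF N]
      cech_complex.subsets_0[OF M] fun_eq_iff)

section \<open>The staircase argument\<close>

context double_complex
begin

definition Z1 where "Z1 i j = {x \<in> carrier (D i j). d1 i j x = \<zero>\<^bsub>D (i + 1) j\<^esub>}"
definition Z2 where "Z2 i j = {x \<in> carrier (D i j). d2 i j x = \<zero>\<^bsub>D i (j + 1)\<^esub>}"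

text \<open>\<open>supp1 P i j\<close> and \<open>supp2 P i j\<close> say that \<open>P\<close> lies in the support of
  \<open>(Z1 \<inter> Z2) / d2 Z1\<close> and of \<open>(Z1 \<inter> Z2) / d1 Z2\<close> at \<open>(i, j)\<close>, respectively.\<close>

definition supp1 where
  "supp1 P i j \<longleftrightarrow> (\<exists>x\<in>Z1 i j \<inter> Z2 i j. \<forall>s\<in>carrier R - P. s \<odot>\<^bsub>D i j\<^esub> x \<notin> d2 i (j - 1) ` Z1 i (j - 1))"
definition supp2 where
  "supp2 P i j \<longleftrightarrow> (\<exists>x\<in>Z1 i j \<inter> Z2 i j. \<forall>s\<in>carrier R - P. s \<odot>\<^bsub>D i j\<^esub> x \<notin> d1 (i - 1) j ` Z2 (i - 1) j)"

context
  assumes exact1: "\<And>i j. i \<ge> 0 \<Longrightarrow> Z1 (i + 1) j \<subseteq> d1 i j ` carrier (D i j)"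
    and exact2: "\<And>i j. j \<ge> 0 \<Longrightarrow> Z2 i (j + 1) \<subseteq> d2 i j ` carrier (D i j)"
begin

text \<open>A zigzag through a common preimage: lift \<open>x\<close> to \<open>y\<close> along
  \<open>d2\<close> and pass to \<open>d1 y\<close>, or go back the other way. Only exactness at the
  starting end is needed in each direction.\<close>

lemma supp_diagonal:
  assumes "i \<ge> 0" "j \<ge> 0"
  shows "supp1 P i (j + 1) \<longleftrightarrow> supp2 P (i + 1) j"
proof -
  interpret A: module R "D i j" by (rule D)
  interpret B: module R "D (i + 1) j" by (rule D)
  interpret C: module R "D i (j + 1)" by (rule D)
  show ?thesis
  proof
    assume "supp1 P i (j + 1)"
    then obtain x where x: "x \<in> Z1 i (j + 1)" "x \<in> Z2 i (j + 1)"
      "\<And>s. s \<in> carrier R - P \<Longrightarrow> s \<odot>\<^bsub>D i (j + 1)\<^esub> x \<notin> d2 i j ` Z1 i j" by (auto simp: supp1_def)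
    obtain y where y: "y \<in> carrier (D i j)" "x = d2 i j y" using exact2[OF assms(2)] x(2) by blast
    have z: "d1 i j y \<in> carrier (D (i + 1) j)" by (rule module_hom_closed[OF d1 y(1)])
    have "d1 i j y \<in> Z1 (i + 1) j" using z d1_d1[OF y(1)] by (simp add: Z1_def add.assoc)
    moreover have "d1 i j y \<in> Z2 (i + 1) j"
      using z d1_d2[OF y(1)] x(1) by (simp add: Z1_def Z2_def y(2))
    moreover have "s \<odot>\<^bsub>D (i + 1) j\<^esub> d1 i j y \<notin> d1 i j ` Z2 i j" if s: "s \<in> carrier R - P" for s
    proof
      assume "s \<odot>\<^bsub>D (i + 1) j\<^esub> d1 i j y \<in> d1 i j ` Z2 i j"
      then obtain u where u: "u \<in> Z2 i j" "s \<odot>\<^bsub>D (i + 1) j\<^esub> d1 i j y = d1 i j u" by blast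
      have uc: "u \<in> carrier (D i j)" "d2 i j u = \<zero>\<^bsub>D i (j + 1)\<^esub>" using u by (auto simp: Z2_def)
      have sy: "s \<in> carrier R" "s \<odot>\<^bsub>D i j\<^esub> y \<in> carrier (D i j)" using s y by auto
      \<comment> \<open>Correcting the multiple of \<open>y\<close> by \<open>u\<close> makes it a
        \<open>d1\<close>-cocycle without changing its image under \<open>d2\<close>; so a relation
        for \<open>d1 y\<close> would give one for \<open>x\<close>.\<close>
      let ?v = "s \<odot>\<^bsub>D i j\<^esub> y \<ominus>\<^bsub>D i j\<^esub> u"
      have "d1 i j ?v = \<zero>\<^bsub>D (i + 1) j\<^esub>"
        using sy y(1) uc(1) u(2)[symmetric] z
        by (simp add: module_hom_minus[OF A.module_axioms B.module_axioms d1] module_hom_smult[OF d1] B.minus_eq_zero_iff)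
      then have "?v \<in> Z1 i j" using sy uc by (simp add: Z1_def)
      moreover have "d2 i j ?v = s \<odot>\<^bsub>D i (j + 1)\<^esub> x"
        using sy y uc module_hom_closed[OF d2 y(1)]
        by (simp add: module_hom_minus[OF A.module_axioms C.module_axioms d2] module_hom_smult[OF d2] C.minus_zero_right)
      ultimately show False using x(3)[OF s] by (metis imageI)
    qed
    ultimately show "supp2 P (i + 1) j" unfolding supp2_def by auto
  next
    assume "supp2 P (i + 1) j"
    then obtain z where z: "z \<in> Z1 (i + 1) j" "z \<in> Z2 (i + 1) j"
      "\<And>s. s \<in> carrier R - P \<Longrightarrow> s \<odot>\<^bsub>D (i + 1) j\<^esub> z \<notin> d1 i j ` Z2 i j" by (auto simp: supp2_def)
    obtain y where y: "y \<in> carrier (D i j)" "z = d1 i j y" using exact1[OF assms(1)] z(1) by blast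
    have x: "d2 i j y \<in> carrier (D i (j + 1))" by (rule module_hom_closed[OF d2 y(1)])
    have "d2 i j y \<in> Z2 i (j + 1)" using x d2_d2[OF y(1)] by (simp add: Z2_def add.assoc)
    moreover have "d2 i j y \<in> Z1 i (j + 1)"
      using x d1_d2[OF y(1)] z(2) by (simp add: Z1_def Z2_def y(2))
    moreover have "s \<odot>\<^bsub>D i (j + 1)\<^esub> d2 i j y \<notin> d2 i j ` Z1 i j" if s: "s \<in> carrier R - P" for s
    proof
      assume "s \<odot>\<^bsub>D i (j + 1)\<^esub> d2 i j y \<in> d2 i j ` Z1 i j"
      then obtain u where u: "u \<in> Z1 i j" "s \<odot>\<^bsub>D i (j + 1)\<^esub> d2 i j y = d2 i j u" by blast
      have uc: "u \<in> carrier (D i j)" "d1 i j u = \<zero>\<^bsub>D (i + 1) j\<^esub>" using u by (auto simp: Z1_def)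
      have sy: "s \<in> carrier R" "s \<odot>\<^bsub>D i j\<^esub> y \<in> carrier (D i j)" using s y by auto
      let ?v = "s \<odot>\<^bsub>D i j\<^esub> y \<ominus>\<^bsub>D i j\<^esub> u"
      have "d2 i j ?v = \<zero>\<^bsub>D i (j + 1)\<^esub>"
        using sy y(1) uc(1) u(2)[symmetric] x
        by (simp add: module_hom_minus[OF A.module_axioms C.module_axioms d2] module_hom_smult[OF d2] C.minus_eq_zero_iff)
      then have "?v \<in> Z2 i j" using sy uc by (simp add: Z2_def)
      moreover have "d1 i j ?v = s \<odot>\<^bsub>D (i + 1) j\<^esub> z"
        using sy y uc module_hom_closed[OF d1 y(1)]
        by (simp add: module_hom_minus[OF A.module_axioms B.module_axioms d1] module_hom_smult[OF d1] B.minus_zero_right)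
      ultimately show False using z(3)[OF s] by (metis imageI)
    qed
    ultimately show "supp1 P i (j + 1)" unfolding supp1_def by auto
  qed
qed

text \<open>Away from the edges of the double complex both submodules divided out equal the image of
  \<open>d1 d2\<close>: by exactness the cocycles of either direction are images of the preceding
  term, and the differentials commute.\<close>

lemma supp1_eq_supp2:
  assumes "i \<ge> 0" "j \<ge> 0"
  shows "supp1 P (i + 1) (j + 1) \<longleftrightarrow> supp2 P (i + 1) (j + 1)"
proof -
  have "d2 (i + 1) j ` Z1 (i + 1) j = d1 i (j + 1) ` Z2 i (j + 1)"
  proof (intro equalityI subsetI)
    fix x assume "x \<in> d2 (i + 1) j ` Z1 (i + 1) j"
    then obtain y where y: "y \<in> carrier (D i j)" "x = d2 (i + 1) j (d1 i j y)"
      using exact1[OF assms(1)] by blast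
    have "d2 i j y \<in> Z2 i (j + 1)"
      using d2_d2[OF y(1)] module_hom_closed[OF d2 y(1)] by (simp add: Z2_def add.assoc)
    then show "x \<in> d1 i (j + 1) ` Z2 i (j + 1)" using y(2) d1_d2[OF y(1)] by (metis imageI)
  next
    fix x assume "x \<in> d1 i (j + 1) ` Z2 i (j + 1)"
    then obtain y where y: "y \<in> carrier (D i j)" "x = d1 i (j + 1) (d2 i j y)"
      using exact2[OF assms(2)] by blast
    have "d1 i j y \<in> Z1 (i + 1) j"
      using d1_d1[OF y(1)] module_hom_closed[OF d1 y(1)] by (simp add: Z1_def add.assoc)
    then show "x \<in> d2 (i + 1) j ` Z1 (i + 1) j" using y(2) d1_d2[OF y(1)] by (metis imageI)
  qed
  then show ?thesis by (simp add: supp1_def supp2_def)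
qed

text \<open>Alternating \<open>supp_diagonal\<close> and \<open>supp1_eq_supp2\<close> leads from
  the column \<open>i = 0\<close> to the row \<open>j = 0\<close>. In degree 0 both submodules
  divided out are zero, and in negative degrees the modules themselves are.\<close>

lemma supp_staircase:
  assumes zero1: "\<And>i j. i < 0 \<Longrightarrow> carrier (D i j) = {\<zero>\<^bsub>D i j\<^esub>}"
    and zero2: "\<And>i j. j < 0 \<Longrightarrow> carrier (D i j) = {\<zero>\<^bsub>D i j\<^esub>}"
    and P: "primeideal P R"
  shows "supp1 P 0 n \<longleftrightarrow> supp2 P n 0"
proof -
  have z1: "d2 i (j - 1) \<zero>\<^bsub>D i (j - 1)\<^esub> = \<zero>\<^bsub>D i j\<^esub>" "d1 (i - 1) j \<zero>\<^bsub>D (i - 1) j\<^esub> = \<zero>\<^bsub>D i j\<^esub>" for i j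
    using module_hom_zero[OF D D d2, of i "j - 1"] module_hom_zero[OF D D d1, of "i - 1" j] by simp_all
  have z2: "\<zero>\<^bsub>D i j\<^esub> \<in> Z1 i j" "\<zero>\<^bsub>D i j\<^esub> \<in> Z2 i j" for i j
    using module_hom_zero[OF D D d2, of i j] module_hom_zero[OF D D d1, of i j]
      module.submodule_zero[OF D module.carrier_is_submodule[OF D]] by (simp_all add: Z1_def Z2_def)
  show ?thesis
  proof (cases "n > 0")
    case True
    \<comment> \<open>After \<open>k\<close> further steps the staircase stands at
      \<open>(k + 1, m - k)\<close>; with \<open>k = m = n - 1\<close> it ends at
      \<open>(n, 0)\<close>.\<close>
    have "supp1 P 0 (int m + 1) \<longleftrightarrow> supp2 P (int k + 1) (int m - int k)" if "k \<le> m" for m k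
      using that
    proof (induction k)
      case 0
      show ?case using supp_diagonal[of 0 "int m"] by simp
    next
      case (Suc k)
      then have "supp1 P 0 (int m + 1) \<longleftrightarrow> supp2 P (int k + 1) (int m - int k)" by simp
      also have "\<dots> \<longleftrightarrow> supp1 P (int k + 1) (int m - int k)"
        using supp1_eq_supp2[of "int k" "int m - int k - 1"] Suc.prems by simp
      also have "\<dots> \<longleftrightarrow> supp2 P (int k + 1 + 1) (int m - int k - 1)"
        using supp_diagonal[of "int k + 1" "int m - int k - 1"] Suc.prems by simp
      finally show ?case by (simp add: algebra_simps)
    qed
    from this[of "nat (n - 1)" "nat (n - 1)"] show ?thesis using True by simp
  next
    case False
    have im: "d2 0 (n - 1) ` Z1 0 (n - 1) = {\<zero>\<^bsub>D 0 n\<^esub>}" "d1 (n - 1) 0 ` Z2 (n - 1) 0 = {\<zero>\<^bsub>D n 0\<^esub>}"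
    proof -
      have "Z1 0 (n - 1) = {\<zero>\<^bsub>D 0 (n - 1)\<^esub>}" "Z2 (n - 1) 0 = {\<zero>\<^bsub>D (n - 1) 0\<^esub>}"
        using False zero1[of "n - 1" 0] zero2[of "n - 1" 0] z2 by (auto simp: Z1_def Z2_def)
      then show "d2 0 (n - 1) ` Z1 0 (n - 1) = {\<zero>\<^bsub>D 0 n\<^esub>}" "d1 (n - 1) 0 ` Z2 (n - 1) 0 = {\<zero>\<^bsub>D n 0\<^esub>}"
        by (simp_all add: z1)
    qed
    show ?thesis
    proof (cases "n = 0")
      case True
      then show ?thesis unfolding supp1_def supp2_def im by simp
    next
      case False
      then have n: "n < 0" using \<open>\<not> n > 0\<close> by simp
      have one: "\<one>\<^bsub>R\<^esub> \<in> carrier R - P"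
        using submonoid.one_closed[OF submonoid_prime_complement[OF P]] .
      have s: "\<one>\<^bsub>R\<^esub> \<odot>\<^bsub>D i j\<^esub> \<zero>\<^bsub>D i j\<^esub> = \<zero>\<^bsub>D i j\<^esub>" for i j
      proof -
        interpret module R "D i j" by (rule D)
        show ?thesis by simp
      qed
      have "\<not> supp1 P 0 n" unfolding supp1_def im using zero2[OF n, of 0] s[of 0 n] one by (auto simp: Z1_def)
      moreover have "\<not> supp2 P n 0" unfolding supp2_def im using zero1[OF n, of 0] s[of n 0] one by (auto simp: Z1_def)
      ultimately show ?thesis by simp
    qed
  qed
qed

end

end

section \<open>Fractions modulo a regular sequence\<close>

context cech_complex
begin

lemma cech_fracs_zero: "cech_fracs {\<zero>\<^bsub>M\<^esub>} j = {\<zero>\<^bsub>cech R gs M j\<^esub>}"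
proof -
  interpret C: module R "cech R gs M j" by (rule module_cech)
  have "fracs B {\<zero>\<^bsub>M\<^esub>} = {\<zero>\<^bsub>LL B\<^esub>}" if "B \<in> subsets t j" for B
    using that fr_zero[of B] by (auto simp: fracs_def subsets_iff)
  then have "x \<in> cech_fracs {\<zero>\<^bsub>M\<^esub>} j \<longleftrightarrow> x = \<zero>\<^bsub>cech R gs M j\<^esub>" for x
    unfolding cech_fracs_def using cech_ext[OF _ C.M.zero_closed, of x] C.M.zero_closed cech_simps(1)[of _ j] by auto
  then show ?thesis by blast
qed

lemma cech_zero: "carrier M = {\<zero>\<^bsub>M\<^esub>} \<Longrightarrow> carrier (cech R gs M j) = {\<zero>\<^bsub>cech R gs M j\<^esub>}"
proof -
  assume M: "carrier M = {\<zero>\<^bsub>M\<^esub>}"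
  have "x \<in> cech_fracs {\<zero>\<^bsub>M\<^esub>} j" if x: "x \<in> carrier (cech R gs M j)" for x
  proof -
    have "x B \<in> fracs B {\<zero>\<^bsub>M\<^esub>}" if B: "B \<in> subsets t j" for B
    proof -
      have "x B \<in> carrier (LL B)" "B \<subseteq> {..<t}" using x B by (auto simp: cech_iff subsets_iff)
      then obtain m k where "m \<in> carrier M" "x B = fr B m k" by (rule frE)
      then show ?thesis using M by (auto simp: fracs_def)
    qed
    then show ?thesis using x by (simp add: cech_fracs_def)
  qed
  moreover have "\<zero>\<^bsub>cech R gs M j\<^esub> \<in> carrier (cech R gs M j)"
    by (rule module.submodule_zero[OF module_cech module.carrier_is_submodule[OF module_cech]])
  ultimately show ?thesis unfolding cech_fracs_zero by blast
qed

text \<open>Localization commutes with the sum of \<open>Q\<close> and the multiples of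
  \<open>f\<close>: the two fractions are brought to a common power of \<open>g B\<close>. This
  provides \<open>N_Suc\<close> for the Koszul argument.\<close>

lemma cech_fracs_add_iff:
  assumes Q: "submodule Q R M" and f: "f \<in> carrier R"
    and Q': "\<And>m. m \<in> Q' \<longleftrightarrow> (\<exists>q\<in>Q. \<exists>w\<in>carrier M. m = q \<oplus>\<^bsub>M\<^esub> f \<odot>\<^bsub>M\<^esub> w)"
  shows "x \<in> cech_fracs Q' j \<longleftrightarrow>
    (\<exists>y\<in>cech_fracs Q j. \<exists>w\<in>carrier (cech R gs M j). x = y \<oplus>\<^bsub>cech R gs M j\<^esub> f \<odot>\<^bsub>cech R gs M j\<^esub> w)"
proof -
  let ?C = "cech R gs M j"
  interpret C: module R ?C by (rule module_cech)
  have c: "q \<in> carrier M" if "q \<in> Q" for q using that submodule_subset[OF Q] by blast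
  have eq: "z \<in> fracs B Q' \<longleftrightarrow> (\<exists>y\<in>fracs B Q. \<exists>w\<in>carrier (LL B). z = y \<oplus>\<^bsub>LL B\<^esub> f \<odot>\<^bsub>LL B\<^esub> w)"
    if B: "B \<subseteq> {..<t}" for B z
  proof
    assume "z \<in> fracs B Q'"
    then obtain q w k where q: "q \<in> Q" "w \<in> carrier M" "z = fr B (q \<oplus>\<^bsub>M\<^esub> f \<odot>\<^bsub>M\<^esub> w) k"
      by (auto simp: fracs_def Q')
    then have "z = fr B q k \<oplus>\<^bsub>LL B\<^esub> f \<odot>\<^bsub>LL B\<^esub> fr B w k"
      using c f by (simp add: fr_smult[OF B] fr_add[OF B])
    moreover have "fr B q k \<in> fracs B Q" "fr B w k \<in> carrier (LL B)"
      using q fr_closed[OF B] by (auto simp: fracs_def)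
    ultimately show "\<exists>y\<in>fracs B Q. \<exists>w\<in>carrier (LL B). z = y \<oplus>\<^bsub>LL B\<^esub> f \<odot>\<^bsub>LL B\<^esub> w" by blast
  next
    assume "\<exists>y\<in>fracs B Q. \<exists>w\<in>carrier (LL B). z = y \<oplus>\<^bsub>LL B\<^esub> f \<odot>\<^bsub>LL B\<^esub> w"
    then obtain y v where y: "y \<in> fracs B Q" and v: "v \<in> carrier (LL B)"
      and z: "z = y \<oplus>\<^bsub>LL B\<^esub> f \<odot>\<^bsub>LL B\<^esub> v" by blast
    obtain q k where q: "q \<in> Q" "y = fr B q k" using y by (auto simp: fracs_def)
    obtain w l where w: "w \<in> carrier M" "v = fr B w l" using v B by (rule frE)
    note gB = g_closed[OF B]
    have e: "y = fr B (g B [^] l \<odot>\<^bsub>M\<^esub> q) (l + k)" "v = fr B (g B [^] k \<odot>\<^bsub>M\<^esub> w) (l + k)"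
      using fr_expand[OF B c[OF q(1)], of k l] fr_expand[OF B w(1), of l k] q(2) w(2) by (simp_all add: add.commute)
    have "z = fr B (g B [^] l \<odot>\<^bsub>M\<^esub> q \<oplus>\<^bsub>M\<^esub> f \<odot>\<^bsub>M\<^esub> (g B [^] k \<odot>\<^bsub>M\<^esub> w)) (l + k)"
      unfolding z e using c[OF q(1)] w(1) f gB by (simp add: fr_smult[OF B] fr_add[OF B])
    moreover have "g B [^] l \<odot>\<^bsub>M\<^esub> q \<oplus>\<^bsub>M\<^esub> f \<odot>\<^bsub>M\<^esub> (g B [^] k \<odot>\<^bsub>M\<^esub> w) \<in> Q'"
      unfolding Q' using submoduleE(4)[OF Q _ q(1), of "g B [^] l"] gB w(1) R.nat_pow_closed smult_closed by blast
    ultimately show "z \<in> fracs B Q'" unfolding fracs_def by blast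
  qed
  show ?thesis
  proof
    assume x: "x \<in> cech_fracs Q' j"
    have "\<forall>B\<in>subsets t j. \<exists>y w. y \<in> fracs B Q \<and> w \<in> carrier (LL B) \<and> x B = y \<oplus>\<^bsub>LL B\<^esub> f \<odot>\<^bsub>LL B\<^esub> w"
    proof
      fix B assume B: "B \<in> subsets t j"
      then have "x B \<in> fracs B Q'" using x by (simp add: cech_fracs_def)
      moreover have "B \<subseteq> {..<t}" using B by (simp add: subsets_iff)
      ultimately show "\<exists>y w. y \<in> fracs B Q \<and> w \<in> carrier (LL B) \<and> x B = y \<oplus>\<^bsub>LL B\<^esub> f \<odot>\<^bsub>LL B\<^esub> w"
        using eq by blast
    qed
    from bchoice[OF this] obtain u where
      "\<forall>B\<in>subsets t j. \<exists>w. u B \<in> fracs B Q \<and> w \<in> carrier (LL B) \<and> x B = u B \<oplus>\<^bsub>LL B\<^esub> f \<odot>\<^bsub>LL B\<^esub> w" by blast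
    from bchoice[OF this] obtain v where p: "\<And>B. B \<in> subsets t j \<Longrightarrow>
        u B \<in> fracs B Q \<and> v B \<in> carrier (LL B) \<and> x B = u B \<oplus>\<^bsub>LL B\<^esub> f \<odot>\<^bsub>LL B\<^esub> v B" by blast
    define y w where "y = (\<lambda>B\<in>subsets t j. u B)" and "w = (\<lambda>B\<in>subsets t j. v B)"
    have "u B \<in> carrier (LL B)" if "B \<in> subsets t j" for B
      using p[OF that] submodule_subset[OF submodule_fracs[OF Q]] that by (auto simp: subsets_iff)
    then have yw: "y \<in> cech_fracs Q j" "w \<in> carrier ?C"
      using p by (simp_all add: y_def w_def cech_fracs_def cech_iff)
    have "x = y \<oplus>\<^bsub>?C\<^esub> f \<odot>\<^bsub>?C\<^esub> w"
    proof (rule cech_ext)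
      show "x \<in> carrier ?C" using x by (simp add: cech_fracs_def)
      show "y \<oplus>\<^bsub>?C\<^esub> f \<odot>\<^bsub>?C\<^esub> w \<in> carrier ?C" using yw f by (simp add: cech_fracs_def)
      show "x B = (y \<oplus>\<^bsub>?C\<^esub> f \<odot>\<^bsub>?C\<^esub> w) B" if "B \<in> subsets t j" for B
        using p[OF that] that by (simp add: cech_simps[OF that] y_def w_def)
    qed
    then show "\<exists>y\<in>cech_fracs Q j. \<exists>w\<in>carrier ?C. x = y \<oplus>\<^bsub>?C\<^esub> f \<odot>\<^bsub>?C\<^esub> w" using yw by blast
  next
    assume "\<exists>y\<in>cech_fracs Q j. \<exists>w\<in>carrier ?C. x = y \<oplus>\<^bsub>?C\<^esub> f \<odot>\<^bsub>?C\<^esub> w"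
    then obtain y w where yw: "y \<in> cech_fracs Q j" "w \<in> carrier ?C" "x = y \<oplus>\<^bsub>?C\<^esub> f \<odot>\<^bsub>?C\<^esub> w" by blast
    have "x B \<in> fracs B Q'" if B: "B \<in> subsets t j" for B
    proof -
      have "y B \<in> fracs B Q" "w B \<in> carrier (LL B)" using yw B by (auto simp: cech_fracs_def cech_iff)
      moreover have "x B = y B \<oplus>\<^bsub>LL B\<^esub> f \<odot>\<^bsub>LL B\<^esub> w B" using yw(3) by (simp add: cech_simps[OF B])
      ultimately show ?thesis using eq[of B] B by (auto simp: subsets_iff)
    qed
    moreover have "x \<in> carrier ?C" using yw f by (simp add: cech_fracs_def)
    ultimately show "x \<in> cech_fracs Q' j" by (simp add: cech_fracs_def)
  qed
qed

text \<open>That \<open>f\<close> is a nonzerodivisor modulo \<open>Q\<close> survives localization,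
  because \<open>f\<close> commutes with the powers of \<open>g B\<close> that clear denominators.
  This provides \<open>N_regular\<close>.\<close>

lemma cech_fracs_regular:
  assumes Q: "submodule Q R M" and f: "f \<in> carrier R"
    and reg: "\<And>m. m \<in> carrier M \<Longrightarrow> f \<odot>\<^bsub>M\<^esub> m \<in> Q \<Longrightarrow> m \<in> Q"
    and w: "w \<in> carrier (cech R gs M j)" "f \<odot>\<^bsub>cech R gs M j\<^esub> w \<in> cech_fracs Q j"
  shows "w \<in> cech_fracs Q j"
proof -
  have "w B \<in> fracs B Q" if B: "B \<in> subsets t j" for B
  proof -
    have Bt: "B \<subseteq> {..<t}" using B by (simp add: subsets_iff)
    have "w B \<in> carrier (LL B)" using w B by (auto simp: cech_iff)
    then obtain m k where m: "m \<in> carrier M" "w B = fr B m k" using Bt by (rule frE)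
    have "f \<odot>\<^bsub>LL B\<^esub> w B \<in> fracs B Q" using w(2) B unfolding cech_fracs_def cech_simps(3)[OF B, symmetric] by blast
    then have "fr B (f \<odot>\<^bsub>M\<^esub> m) k \<in> fracs B Q" using m f by (simp add: fr_smult[OF Bt])
    then obtain l :: nat where l: "g B [^] l \<odot>\<^bsub>M\<^esub> (f \<odot>\<^bsub>M\<^esub> m) \<in> Q"
      using fr_mem_fracs_iff[OF Q Bt] m f by auto
    have gB: "g B [^] l \<in> carrier R" using g_closed[OF Bt] by simp
    have "g B [^] l \<odot>\<^bsub>M\<^esub> m \<in> Q"
      using reg[of "g B [^] l \<odot>\<^bsub>M\<^esub> m"] l smult_left_commute[OF gB f m(1)] gB m(1) by simp
    then show ?thesis unfolding m(2) fr_mem_fracs_iff[OF Q Bt m(1)] by blast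
  qed
  then show ?thesis using w(1) by (simp add: cech_fracs_def)
qed

end

text \<open>The kernel commutes with localization at each subset; the power of \<open>g B\<close>
  witnessing the vanishing is the one allowed by \<open>fr_mem_fracs_iff\<close>.\<close>

lemma cech_hom_eq_zero_iff:
  assumes M: "cech_complex R gs M" and N: "cech_complex R gs N" and h: "h \<in> module_hom R M N"
    and x: "x \<in> carrier (cech R gs M j)"
  shows "cech_hom R gs N h j x = \<zero>\<^bsub>cech R gs N j\<^esub> \<longleftrightarrow>
    x \<in> cech_complex.cech_fracs R gs M {m \<in> carrier M. h m = \<zero>\<^bsub>N\<^esub>} j"
proof -
  interpret M: cech_complex R gs M by fact
  interpret N: cech_complex R gs N by fact
  let ?K = "{m \<in> carrier M. h m = \<zero>\<^bsub>N\<^esub>}"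
  have K: "submodule ?K R M" by (rule submodule_kernel[OF M.module_axioms N.module_axioms h])
  have z: "\<zero>\<^bsub>cech R gs N j\<^esub> \<in> carrier (cech R gs N j)"
    by (rule module.submodule_zero[OF N.module_cech module.carrier_is_submodule[OF N.module_cech]])
  have "loc_hom R (M.D B) N h (x B) = \<zero>\<^bsub>N.LL B\<^esub> \<longleftrightarrow> x B \<in> M.fracs B ?K"
    if B: "B \<in> subsets (length gs) j" for B
  proof -
    have Bt: "B \<subseteq> {..<length gs}" using B by (simp add: subsets_iff)
    have "x B \<in> carrier (M.LL B)" using x B by (auto simp: M.cech_iff)
    then obtain m k where m: "m \<in> carrier M" "x B = M.fr B m k" using Bt by (rule M.frE)
    have "loc_hom R (M.D B) N h (x B) = N.fr B (h m) k" using loc_hom_fr[OF M N h Bt m(1)] m(2) by simp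
    also have "\<dots> = \<zero>\<^bsub>N.LL B\<^esub> \<longleftrightarrow> (\<exists>l::nat. N.g B [^]\<^bsub>R\<^esub> l \<odot>\<^bsub>N\<^esub> h m = \<zero>\<^bsub>N\<^esub>)"
      by (rule N.fr_eq_zero_iff[OF Bt module_hom_closed[OF h m(1)]])
    also have "\<dots> \<longleftrightarrow> (\<exists>l::nat. M.g B [^]\<^bsub>R\<^esub> l \<odot>\<^bsub>M\<^esub> m \<in> ?K)"
      using m(1) M.g_closed[OF Bt] by (simp add: N.g_def M.g_def module_hom_smult[OF h])
    also have "\<dots> \<longleftrightarrow> x B \<in> M.fracs B ?K" using M.fr_mem_fracs_iff[OF K Bt m(1)] m(2) by simp
    finally show ?thesis .
  qed
  moreover have "cech_hom R gs N h j x = \<zero>\<^bsub>cech R gs N j\<^esub> \<longleftrightarrow>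
      (\<forall>B\<in>subsets (length gs) j. loc_hom R (M.D B) N h (x B) = \<zero>\<^bsub>N.LL B\<^esub>)"
  proof
    assume a: "cech_hom R gs N h j x = \<zero>\<^bsub>cech R gs N j\<^esub>"
    show "\<forall>B\<in>subsets (length gs) j. loc_hom R (M.D B) N h (x B) = \<zero>\<^bsub>N.LL B\<^esub>"
      using fun_cong[OF a] N.cech_simps(1)[of _ j] by (simp add: cech_hom_def) metis
  next
    assume "\<forall>B\<in>subsets (length gs) j. loc_hom R (M.D B) N h (x B) = \<zero>\<^bsub>N.LL B\<^esub>"
    then show "cech_hom R gs N h j x = \<zero>\<^bsub>cech R gs N j\<^esub>"
      using N.cech_simps(1)[of _ j]
      by (intro N.cech_ext[OF module_hom_closed[OF cech_hom_hom[OF M N h] x] z]) (simp add: cech_hom_def)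
  qed
  ultimately show ?thesis using x by (simp add: M.cech_fracs_def)
qed

section \<open>Initial segments of a regular sequence and their Cech complexes\<close>

lemma (in cring) mem_genideal_insert_iff:
  assumes "S \<subseteq> carrier R" "a \<in> carrier R"
  shows "x \<in> Idl (insert a S) \<longleftrightarrow> (\<exists>y\<in>Idl S. \<exists>r\<in>carrier R. x = y \<oplus> a \<otimes> r)"
proof -
  have iS: "ideal (Idl S) R" by (rule genideal_ideal[OF assms(1)])
  have ia: "ideal (PIdl a) R" by (rule cgenideal_ideal[OF assms(2)])
  have sub: "Idl S \<union> PIdl a \<subseteq> carrier R" using ideal.Icarr[OF iS] ideal.Icarr[OF ia] by blast
  have "Idl (insert a S) = Idl (Idl S \<union> PIdl a)"
  proof
    have "insert a S \<subseteq> Idl S \<union> PIdl a" using genideal_self[OF assms(1)] cgenideal_self[OF assms(2)] by auto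
    then show "Idl (insert a S) \<subseteq> Idl (Idl S \<union> PIdl a)"
      using genideal_self[OF sub] by (intro genideal_minimal genideal_ideal[OF sub]) blast
    have i: "ideal (Idl (insert a S)) R" using assms by (intro genideal_ideal) simp
    have "insert a S \<subseteq> Idl (insert a S)" using assms by (intro genideal_self) simp
    then have "Idl S \<subseteq> Idl (insert a S)" "PIdl a \<subseteq> Idl (insert a S)"
      using genideal_minimal[OF i, of S] cgenideal_minimal[OF i, of a] by auto
    then show "Idl (Idl S \<union> PIdl a) \<subseteq> Idl (insert a S)" by (intro genideal_minimal[OF i]) simp
  qed
  also have "\<dots> = Idl S <+>\<^bsub>R\<^esub> PIdl a" by (rule union_genideal[OF iS ia])
  finally have "x \<in> Idl (insert a S) \<longleftrightarrow> (\<exists>y\<in>Idl S. \<exists>r\<in>carrier R. x = y \<oplus> r \<otimes> a)"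
    by (auto simp: set_add_def' cgenideal_def)
  then show ?thesis using m_comm assms(2) by metis
qed

text \<open>Rephrases regularity, which is stated in the quotient by the earlier elements, as a
  cancellation rule for membership in their ideal.\<close>

lemma (in cring) regular_sequenceD:
  assumes "regular_sequence R fs" "i < length fs" "r \<in> carrier R"
    and "fs ! i \<otimes> r \<in> Idl (set (take i fs))"
  shows "r \<in> Idl (set (take i fs))"
proof -
  let ?J = "Idl (set (take i fs))" and ?Q = "quotient_module (regular_module R) (Idl (set (take i fs)))"
  interpret r: module R "regular_module R" by (rule regular_module_module)
  have fs: "set fs \<subseteq> carrier R" using assms(1) by (simp add: regular_sequence_def)
  then have "set (take i fs) \<subseteq> carrier R" by (auto dest: in_set_takeD)
  then have J: "submodule ?J R (regular_module R)" by (rule submodule_ideal[OF genideal_ideal])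
  have f: "fs ! i \<in> carrier R" using fs assms(2) nth_mem by blast
  note rules = quotient_carrier[OF r.module_axioms J] quotient_zero[OF r.module_axioms J]
    quotient_smult[OF r.module_axioms J]
  have z: "?J +>\<^bsub>regular_module R\<^esub> x = \<zero>\<^bsub>?Q\<^esub> \<longleftrightarrow> x \<in> ?J" if "x \<in> carrier R" for x
    unfolding rules(2) using coset_eq_iff[OF r.module_axioms J, of x "\<zero>"] r.minus_zero_right[of x] that by simp
  have "(fs ! i) \<odot>\<^bsub>?Q\<^esub> (?J +>\<^bsub>regular_module R\<^esub> r) = \<zero>\<^bsub>?Q\<^esub>"
    using rules(3)[of "fs ! i" r] z[of "fs ! i \<otimes> r"] f assms(3,4) by simp
  moreover have "?J +>\<^bsub>regular_module R\<^esub> r \<in> carrier ?Q" unfolding rules(1) using assms(3) by auto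
  ultimately have "?J +>\<^bsub>regular_module R\<^esub> r = \<zero>\<^bsub>?Q\<^esub>"
    using assms(1,2) unfolding regular_sequence_def Let_def by blast
  then show ?thesis using z[OF assms(3)] by simp
qed

text \<open>Regularity on R passes to every term of its Cech complex, since each term is a finite
  product of localizations. The stages are the fractions with numerators in the ideals of the
  initial segments.\<close>

lemma koszul_regular_cech:
  assumes "cring R" "set gs \<subseteq> carrier R" "regular_sequence R fs"
  shows "koszul_regular R fs (cech R gs (regular_module R)) (cech_diff R gs (regular_module R))
    (\<lambda>i. cech_complex.cech_fracs R gs (regular_module R) (Idl\<^bsub>R\<^esub> (set (take i fs))))"
proof -
  interpret cring R by fact
  interpret C: cech_complex R gs "regular_module R"
    using regular_module_module assms(2) by (simp add: cech_complex_def plain_module_def cech_complex_axioms_def)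
  have fs: "set fs \<subseteq> carrier R" using assms(3) by (simp add: regular_sequence_def)
  have f: "fs ! i \<in> carrier R" if "i < length fs" for i using fs that nth_mem by blast
  have t: "set (take i fs) \<subseteq> carrier R" for i using fs by (auto dest: in_set_takeD)
  have J: "submodule (Idl\<^bsub>R\<^esub> (set (take i fs))) R (regular_module R)" for i
    by (rule submodule_ideal[OF genideal_ideal[OF t]])
  show ?thesis
  proof (rule koszul_regular.intro)
    show "set fs \<subseteq> carrier R" by (rule fs)
    show "module_complex R (cech R gs (regular_module R)) (cech_diff R gs (regular_module R))"
      by (rule module_complex.intro[OF C.module_cech C.cech_diff_hom C.cech_diff_diff])
    fix i j
    show "submodule (C.cech_fracs (Idl\<^bsub>R\<^esub> (set (take i fs))) j) R (cech R gs (regular_module R) j)"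
      by (rule C.submodule_cech_fracs[OF J])
    have "Idl\<^bsub>R\<^esub> {} = {\<zero>\<^bsub>R\<^esub>}"
      using genideal_minimal[OF zeroideal, of "{}"] ideal.axioms(1)[OF genideal_ideal[of "{}"]]
        additive_subgroup.zero_closed by auto
    then show "C.cech_fracs (Idl\<^bsub>R\<^esub> (set (take 0 fs))) j = {\<zero>\<^bsub>cech R gs (regular_module R) j\<^esub>}"
      using C.cech_fracs_zero by simp
    show "cech_diff R gs (regular_module R) j x \<in> C.cech_fracs (Idl\<^bsub>R\<^esub> (set (take i fs))) (j + 1)"
      if "x \<in> C.cech_fracs (Idl\<^bsub>R\<^esub> (set (take i fs))) j" for x
      by (rule C.cech_diff_fracs[OF J that])
    assume i: "i < length fs"
    show "w \<in> C.cech_fracs (Idl\<^bsub>R\<^esub> (set (take i fs))) j"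
      if "w \<in> carrier (cech R gs (regular_module R) j)"
        "(fs ! i) \<odot>\<^bsub>cech R gs (regular_module R) j\<^esub> w \<in> C.cech_fracs (Idl\<^bsub>R\<^esub> (set (take i fs))) j" for w
    proof (rule C.cech_fracs_regular[OF J f[OF i] _ that])
      show "m \<in> Idl\<^bsub>R\<^esub> (set (take i fs))"
        if "m \<in> carrier (regular_module R)" "(fs ! i) \<odot>\<^bsub>regular_module R\<^esub> m \<in> Idl\<^bsub>R\<^esub> (set (take i fs))" for m
        using regular_sequenceD[OF assms(3) i] that by simp
    qed
    show "x \<in> C.cech_fracs (Idl\<^bsub>R\<^esub> (set (take (Suc i) fs))) j \<longleftrightarrow>
      (\<exists>y\<in>C.cech_fracs (Idl\<^bsub>R\<^esub> (set (take i fs))) j. \<exists>w\<in>carrier (cech R gs (regular_module R) j).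
        x = y \<oplus>\<^bsub>cech R gs (regular_module R) j\<^esub> (fs ! i) \<odot>\<^bsub>cech R gs (regular_module R) j\<^esub> w)" for x
    proof (rule C.cech_fracs_add_iff[OF J f[OF i]])
      show "m \<in> Idl\<^bsub>R\<^esub> (set (take (Suc i) fs)) \<longleftrightarrow> (\<exists>q\<in>Idl\<^bsub>R\<^esub> (set (take i fs)).
          \<exists>w\<in>carrier (regular_module R). m = q \<oplus>\<^bsub>regular_module R\<^esub> (fs ! i) \<odot>\<^bsub>regular_module R\<^esub> w)" for m
        using mem_genideal_insert_iff[OF t f[OF i], of m i] i by (simp add: take_Suc_conv_app_nth)
    qed
  qed
qed

section \<open>Local cohomology\<close>

text \<open>Divisibility within \<open>pow_torsion i\<close> comes from
  \<open>injective_power_torsion_divide\<close>, with the first \<open>i\<close> generators as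
  \<open>X\<close>.\<close>

lemma (in cech_complex) cech_acyclic_injective:
  assumes "noetherian_ring R" "injective_module R M" "j \<ge> 0" "x \<in> carrier (cech R gs M (j + 1))"
    "cech_diff R gs M (j + 1) x = \<zero>\<^bsub>cech R gs M (j + 2)\<^esub>"
  shows "x \<in> cech_diff R gs M j ` carrier (cech R gs M j)"
proof (rule cech_acyclic[OF _ assms(3-5)])
  fix i m and n :: nat
  assume i: "i < t" and m: "m \<in> pow_torsion i"
  let ?X = "(!) gs ` {..<i}"
  have X: "?X \<subseteq> carrier R" using i gs_closed by auto
  have tor: "\<exists>a::nat. x [^] a \<odot>\<^bsub>M\<^esub> m = \<zero>\<^bsub>M\<^esub>" if "x \<in> ?X" for x
    using m that by (auto simp: pow_torsion_def)
  have mM: "m \<in> carrier M" using m by (simp add: pow_torsion_def)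
  obtain m' and k :: nat where m': "m' \<in> carrier M" "\<And>x. x \<in> ?X \<Longrightarrow> \<exists>a::nat. x [^] a \<odot>\<^bsub>M\<^esub> m' = \<zero>\<^bsub>M\<^esub>"
    "(gs ! i) [^] k \<odot>\<^bsub>M\<^esub> ((gs ! i) [^] n \<odot>\<^bsub>M\<^esub> m') = (gs ! i) [^] k \<odot>\<^bsub>M\<^esub> m"
    by (rule injective_power_torsion_divide[OF R.is_cring assms(1,2) X gs_closed[OF i] mM tor]) blast+
  have "m' \<in> pow_torsion i" using m'(1,2) by (simp add: pow_torsion_def)
  then show "\<exists>m'\<in>pow_torsion i. \<exists>k::nat.
      (gs ! i) [^] k \<odot>\<^bsub>M\<^esub> ((gs ! i) [^] n \<odot>\<^bsub>M\<^esub> m') = (gs ! i) [^] k \<odot>\<^bsub>M\<^esub> m" using m'(3) by blast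
qed

locale resolved_quotient = cring R + noetherian_ring R
  for R :: "('a, 'm) ring_scheme" (structure) +
  fixes gs fs :: "'a list" and E :: "int \<Rightarrow> ('a, 'e) module" and d :: "int \<Rightarrow> 'e \<Rightarrow> 'e" and \<epsilon> :: "'a set \<Rightarrow> 'e"
  assumes gs: "set gs \<subseteq> carrier R" and regular: "regular_sequence R fs"
    and resolution:
      "injective_resolution R (quotient_module (regular_module R) (Idl (set fs))) E d \<epsilon>"
begin

abbreviation A where "A \<equiv> regular_module R"
abbreviation W where "W \<equiv> cech R gs A"
abbreviation \<delta> where "\<delta> \<equiv> cech_diff R gs A"

lemma E_injective: "injective_module R (E n)"
  using resolution by (simp add: injective_resolution_def)

lemma E_module: "module R (E n)"
  using E_injective[of n] by (simp add: injective_module_def)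

lemma E_cech: "cech_complex R gs (E n)"
  using E_module[of n] gs by (simp add: cech_complex_def plain_module_def cech_complex_axioms_def)

lemma A_cech: "cech_complex R gs A"
  using regular_module_module gs by (simp add: cech_complex_def plain_module_def cech_complex_axioms_def)

lemma E_neg: "n < 0 \<Longrightarrow> carrier (E n) = {\<zero>\<^bsub>E n\<^esub>}"
  using resolution by (simp add: injective_resolution_def)

lemma d_hom: "d n \<in> module_hom R (E n) (E (n + 1))"
  using resolution by (simp add: injective_resolution_def)

lemma d_exact: "n \<ge> 0 \<Longrightarrow> d n ` carrier (E n) = {x \<in> carrier (E (n + 1)). d (n + 1) x = \<zero>\<^bsub>E (n + 2)\<^esub>}"
  using resolution by (simp add: injective_resolution_def a_kernel_def')

lemma d_d:
  assumes "x \<in> carrier (E n)" shows "d (n + 1) (d n x) = \<zero>\<^bsub>E (n + 2)\<^esub>"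
proof (cases "n \<ge> 0")
  case True
  then show ?thesis using d_exact assms by blast
next
  \<comment> \<open>The resolution is exact only from degree 0 on; below that the source is
    zero.\<close>
  case False
  then have "x = \<zero>\<^bsub>E n\<^esub>" using E_neg[of n] assms by simp
  moreover have "E (n + 1 + 1) = E (n + 2)" by (simp add: add.assoc)
  ultimately show ?thesis
    using module_hom_zero[OF E_module E_module d_hom[of n]] module_hom_zero[OF E_module E_module d_hom[of "n + 1"]]
    by simp
qed

text \<open>Composing \<epsilon> with the projection makes R the source and (f) the kernel. The Cech
  complex of R can then be mapped directly to that of \<open>E 0\<close>.\<close>

definition augmentation :: "'a \<Rightarrow> 'e" where "augmentation r = \<epsilon> (Idl (set fs) +>\<^bsub>A\<^esub> r)"

lemma augmentation:
  shows augmentation_hom: "augmentation \<in> module_hom R A (E 0)"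
    and augmentation_kernel: "{r \<in> carrier A. augmentation r = \<zero>\<^bsub>E 0\<^esub>} = Idl (set fs)"
    and augmentation_image: "augmentation ` carrier A = {x \<in> carrier (E 0). d 0 x = \<zero>\<^bsub>E 1\<^esub>}"
proof -
  let ?J = "Idl (set fs)" and ?Q = "quotient_module A (Idl (set fs))"
  have fs: "set fs \<subseteq> carrier R" using regular by (simp add: regular_sequence_def)
  have Ji: "ideal ?J R" by (rule genideal_ideal[OF fs])
  have J: "submodule ?J R A" by (rule submodule_ideal[OF Ji])
  interpret r: module R A by (rule regular_module_module)
  have Q: "module R ?Q" by (rule module_quotient[OF r.module_axioms J])
  note rules = quotient_carrier[OF r.module_axioms J] quotient_add[OF r.module_axioms J]
    quotient_smult[OF r.module_axioms J] quotient_zero[OF r.module_axioms J]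
  have \<epsilon>: "\<epsilon> \<in> module_hom R ?Q (E 0)" "inj_on \<epsilon> (carrier ?Q)"
    "\<epsilon> ` carrier ?Q = {x \<in> carrier (E 0). d 0 x = \<zero>\<^bsub>E 1\<^esub>}"
    using resolution by (simp_all add: injective_resolution_def a_kernel_def')
  have proj: "(\<lambda>r. ?J +>\<^bsub>A\<^esub> r) \<in> module_hom R A ?Q"
  proof (rule module_homI)
    show "?J +>\<^bsub>A\<^esub> x \<in> carrier ?Q" if "x \<in> carrier A" for x using that rules(1) by blast
  qed (simp_all add: rules(2,3) del: regular_module_simps)
  show "augmentation \<in> module_hom R A (E 0)"
    unfolding augmentation_def by (rule module_hom_comp[OF proj \<epsilon>(1)])
  have "augmentation r = \<zero>\<^bsub>E 0\<^esub> \<longleftrightarrow> r \<in> ?J" if r: "r \<in> carrier R" for r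
  proof -
    have "augmentation r = \<zero>\<^bsub>E 0\<^esub> \<longleftrightarrow> \<epsilon> (?J +>\<^bsub>A\<^esub> r) = \<epsilon> \<zero>\<^bsub>?Q\<^esub>"
      using module_hom_zero[OF Q E_module \<epsilon>(1)] by (simp add: augmentation_def)
    also have "\<dots> \<longleftrightarrow> ?J +>\<^bsub>A\<^esub> r = \<zero>\<^bsub>?Q\<^esub>"
      using inj_on_eq_iff[OF \<epsilon>(2)] module_hom_closed[OF proj, of r] r
        module.submodule_zero[OF Q module.carrier_is_submodule[OF Q]] by simp
    also have "\<dots> \<longleftrightarrow> r \<in> ?J"
      unfolding rules(4) using coset_eq_iff[OF r.module_axioms J, of r "\<zero>"] r.minus_zero_right[of r] r by simp
    finally show ?thesis .
  qed
  then show "{r \<in> carrier A. augmentation r = \<zero>\<^bsub>E 0\<^esub>} = ?J" using ideal.Icarr[OF Ji] by auto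
  have "augmentation ` carrier A = \<epsilon> ` carrier ?Q"
    unfolding rules(1) augmentation_def by blast
  then show "augmentation ` carrier A = {x \<in> carrier (E 0). d 0 x = \<zero>\<^bsub>E 1\<^esub>}" using \<epsilon>(3) by simp
qed

sublocale DC: double_complex R "\<lambda>i. cech R gs (E i)" "\<lambda>i. cech_hom R gs (E (i + 1)) (d i)"
  "\<lambda>i. cech_diff R gs (E i)"
proof (rule double_complex.intro)
  show "cring R" by (rule is_cring)
  fix i j
  show "module R (cech R gs (E i) j)" by (rule cech_complex.module_cech[OF E_cech])
  show "cech_hom R gs (E (i + 1)) (d i) j \<in> module_hom R (cech R gs (E i) j) (cech R gs (E (i + 1)) j)"
    by (rule cech_hom_hom[OF E_cech E_cech d_hom])
  show "cech_diff R gs (E i) j \<in> module_hom R (cech R gs (E i) j) (cech R gs (E i) (j + 1))"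
    by (rule cech_complex.cech_diff_hom[OF E_cech])
  fix x assume x: "x \<in> carrier (cech R gs (E i) j)"
  show "cech_diff R gs (E i) (j + 1) (cech_diff R gs (E i) j x) = \<zero>\<^bsub>cech R gs (E i) (j + 2)\<^esub>"
    by (rule cech_complex.cech_diff_diff[OF E_cech x])
  show "cech_hom R gs (E (i + 1)) (d i) (j + 1) (cech_diff R gs (E i) j x) =
      cech_diff R gs (E (i + 1)) j (cech_hom R gs (E (i + 1)) (d i) j x)"
    by (rule cech_hom_diff[OF E_cech E_cech d_hom x, symmetric])
  have eq: "i + 1 + 1 = i + 2" by simp
  show "cech_hom R gs (E (i + 1 + 1)) (d (i + 1)) j (cech_hom R gs (E (i + 1)) (d i) j x) = \<zero>\<^bsub>cech R gs (E (i + 2)) j\<^esub>"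
    unfolding eq
    by (rule cech_hom_comp_zero[OF E_cech E_cech E_cech d_hom d_hom[of "i + 1", unfolded eq] d_d x])
qed

text \<open>Exactness in the direction of the resolution is inherited through
  \<open>cech_hom_exact\<close>, exactness in the Cech direction comes from injectivity of each
  \<open>E i\<close>.\<close>

lemma supp1_iff_supp2:
  assumes "primeideal P R"
  shows "DC.supp1 P 0 n \<longleftrightarrow> DC.supp2 P n 0"
proof (rule DC.supp_staircase[OF _ _ _ _ assms])
  fix i j :: int
  show "DC.Z1 (i + 1) j \<subseteq> cech_hom R gs (E (i + 1)) (d i) j ` carrier (cech R gs (E i) j)" if i: "i \<ge> 0"
  proof
    have eq: "i + 1 + 1 = i + 2" by simp
    fix x assume "x \<in> DC.Z1 (i + 1) j"
    then have x: "x \<in> carrier (cech R gs (E (i + 1)) j)"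
      "cech_hom R gs (E (i + 2)) (d (i + 1)) j x = \<zero>\<^bsub>cech R gs (E (i + 2)) j\<^esub>"
      unfolding DC.Z1_def eq by simp_all
    have ex: "m \<in> d i ` carrier (E i)" if "m \<in> carrier (E (i + 1))" "d (i + 1) m = \<zero>\<^bsub>E (i + 2)\<^esub>" for m
      using d_exact[OF i] that by simp
    obtain y where "y \<in> carrier (cech R gs (E i) j)" "x = cech_hom R gs (E (i + 1)) (d i) j y"
      by (rule cech_hom_exact[OF E_cech E_cech E_cech d_hom d_hom[of "i + 1", unfolded eq] ex x])
    then show "x \<in> cech_hom R gs (E (i + 1)) (d i) j ` carrier (cech R gs (E i) j)" by blast
  qed
  show "DC.Z2 i (j + 1) \<subseteq> cech_diff R gs (E i) j ` carrier (cech R gs (E i) j)" if j: "j \<ge> 0"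
    using cech_complex.cech_acyclic_injective[OF E_cech noetherian_ring_axioms E_injective j]
    by (auto simp: DC.Z2_def add.assoc)
  show "carrier (cech R gs (E i) j) = {\<zero>\<^bsub>cech R gs (E i) j\<^esub>}" if "i < 0"
    by (rule cech_complex.cech_zero[OF E_cech E_neg[OF that]])
  show "carrier (cech R gs (E i) j) = {\<zero>\<^bsub>cech R gs (E i) j\<^esub>}" if "j < 0"
    using that by (simp add: cech_def subsets_eq_empty restrict_def)
qed

text \<open>In the row of Cech degree 0 the Cech cocycles are the torsion submodules of the
  \<open>E n\<close>, via \<open>cech_unit\<close>. Hence \<open>supp2\<close> there is the support
  criterion for the complex of torsion submodules.\<close>

lemma Supp_local_cohomology_iff:
  "P \<in> Supp R (local_cohomology R (Idl (set gs)) E d k) \<longleftrightarrow> primeideal P R \<and> DC.supp2 P k 0"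
proof -
  let ?t = "length gs" and ?I = "Idl (set gs)"
  define \<Gamma> where "\<Gamma> n = cech_complex.pow_torsion R gs (E n) ?t" for n
  define u where "u n = cech_complex.cech_unit R gs (E n)" for n
  have \<Gamma>_sub: "submodule (\<Gamma> n) R (E n)" for n
    unfolding \<Gamma>_def by (rule cech_complex.submodule_pow_torsion[OF E_cech]) simp
  have \<Gamma>_E: "m \<in> carrier (E n)" if "m \<in> \<Gamma> n" for m n using that submodule_subset[OF \<Gamma>_sub] by blast
  have tor: "torsion_submodule R ?I (E n) = E n\<lparr>carrier := \<Gamma> n\<rparr>" for n
  proof -
    interpret Ec: cech_complex R gs "E n" by (rule E_cech)
    have "carrier (torsion_submodule R ?I (E n)) = \<Gamma> n"
      using Ec.torsion_iff[OF gs] by (auto simp: \<Gamma>_def Ec.pow_torsion_def)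
    then show ?thesis by (simp add: torsion_submodule_def)
  qed
  note u_hom = cech_complex.cech_unit_hom[OF E_cech, folded u_def]
    and u_inj = cech_complex.cech_unit_inj[OF E_cech, folded u_def]
    and u_surj = cech_complex.cech_unit_surj[OF E_cech, folded u_def]
    and u_cocycle = cech_complex.cech_unit_cocycle_iff[OF E_cech, folded u_def \<Gamma>_def]
  have u_d: "cech_hom R gs (E (n + 1)) (d n) 0 (u n m) = u (n + 1) (d n m)" if "m \<in> carrier (E n)" for n m
    unfolding u_def by (rule cech_hom_unit[OF E_cech E_cech d_hom that])
  \<comment> \<open>Being torsion means being a Cech cocycle in degree 0, and the maps induced by
    \<open>d\<close> commute with the Cech differentials.\<close>
  have d_\<Gamma>: "d n m \<in> \<Gamma> (n + 1)" if m: "m \<in> \<Gamma> n" for n m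
  proof -
    note mE = \<Gamma>_E[OF m]
    have "cech_diff R gs (E (n + 1)) 0 (u (n + 1) (d n m)) =
        cech_hom R gs (E (n + 1)) (d n) 1 (cech_diff R gs (E n) 0 (u n m))"
      using cech_hom_diff[OF E_cech E_cech d_hom module_hom_closed[OF u_hom mE]] u_d[OF mE] by simp
    also have "\<dots> = \<zero>\<^bsub>cech R gs (E (n + 1)) 1\<^esub>"
      using u_cocycle[OF mE] m module_hom_zero[OF DC.D DC.D DC.d1] by simp
    finally show ?thesis using u_cocycle[OF module_hom_closed[OF d_hom mE]] by simp
  qed
  interpret T: module_complex R "\<lambda>n. torsion_submodule R ?I (E n)" d
  proof (rule module_complex.intro)
    show "module R (torsion_submodule R ?I (E n))" for n
      unfolding tor by (rule submodule.submodule_is_module[OF \<Gamma>_sub E_module])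
    show "d n \<in> module_hom R (torsion_submodule R ?I (E n)) (torsion_submodule R ?I (E (n + 1)))" for n
      unfolding tor
      by (rule module_homI) (simp_all add: d_\<Gamma> \<Gamma>_E module_hom_add[OF d_hom] module_hom_smult[OF d_hom])
    show "d (n + 1) (d n x) = \<zero>\<^bsub>torsion_submodule R ?I (E (n + 2))\<^esub>"
      if "x \<in> carrier (torsion_submodule R ?I (E n))" for n x
      using that d_d \<Gamma>_E unfolding tor by simp
  qed
  have Z2: "DC.Z2 n 0 = u n ` \<Gamma> n" for n
  proof
    show "DC.Z2 n 0 \<subseteq> u n ` \<Gamma> n"
    proof
      fix x assume "x \<in> DC.Z2 n 0"
      then have x: "x \<in> carrier (cech R gs (E n) 0)" "cech_diff R gs (E n) 0 x = \<zero>\<^bsub>cech R gs (E n) 1\<^esub>"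
        by (simp_all add: DC.Z2_def)
      obtain m where "m \<in> carrier (E n)" "x = u n m" using x(1) by (rule u_surj)
      then show "x \<in> u n ` \<Gamma> n" using x(2) u_cocycle by blast
    qed
    show "u n ` \<Gamma> n \<subseteq> DC.Z2 n 0"
      using u_cocycle module_hom_closed[OF u_hom] \<Gamma>_E by (auto simp: DC.Z2_def)
  qed
  have Z1: "u n m \<in> DC.Z1 n 0 \<longleftrightarrow> d n m = \<zero>\<^bsub>E (n + 1)\<^esub>" if m: "m \<in> carrier (E n)" for n m
  proof -
    have z: "\<zero>\<^bsub>E (n + 1)\<^esub> \<in> carrier (E (n + 1))"
      by (rule module.submodule_zero[OF E_module module.carrier_is_submodule[OF E_module]])
    have "u (n + 1) (d n m) = u (n + 1) \<zero>\<^bsub>E (n + 1)\<^esub> \<longleftrightarrow> d n m = \<zero>\<^bsub>E (n + 1)\<^esub>"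
      using u_inj[OF module_hom_closed[OF d_hom m] z] by auto
    then show ?thesis
      using module_hom_closed[OF u_hom m] u_d[OF m] module_hom_zero[OF E_module DC.D u_hom[of "n + 1"]]
      by (simp add: DC.Z1_def)
  qed
  have im: "s \<odot>\<^bsub>cech R gs (E k) 0\<^esub> u k m \<in> cech_hom R gs (E (k - 1 + 1)) (d (k - 1)) 0 ` DC.Z2 (k - 1) 0 \<longleftrightarrow>
      s \<odot>\<^bsub>E k\<^esub> m \<in> d (k - 1) ` \<Gamma> (k - 1)" if s: "s \<in> carrier R" and m: "m \<in> carrier (E k)" for s m
  proof -
    have d': "d (k - 1) x \<in> carrier (E k)" if "x \<in> \<Gamma> (k - 1)" for x
      using module_hom_closed[OF d_hom \<Gamma>_E[OF that]] by simp
    have sm: "s \<odot>\<^bsub>E k\<^esub> m \<in> carrier (E k)" using module.smult_closed[OF E_module s m] .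
    have "cech_hom R gs (E (k - 1 + 1)) (d (k - 1)) 0 ` DC.Z2 (k - 1) 0 = u k ` (d (k - 1) ` \<Gamma> (k - 1))"
      unfolding Z2 image_image
    proof (rule image_cong[OF refl])
      fix x assume "x \<in> \<Gamma> (k - 1)"
      then show "cech_hom R gs (E (k - 1 + 1)) (d (k - 1)) 0 (u (k - 1) x) = u k (d (k - 1) x)"
        using u_d[of x "k - 1"] \<Gamma>_E by simp
    qed
    moreover have "s \<odot>\<^bsub>cech R gs (E k) 0\<^esub> u k m = u k (s \<odot>\<^bsub>E k\<^esub> m)"
      using module_hom_smult[OF u_hom s m] by simp
    moreover have "u k (s \<odot>\<^bsub>E k\<^esub> m) \<in> u k ` (d (k - 1) ` \<Gamma> (k - 1)) \<longleftrightarrow> s \<odot>\<^bsub>E k\<^esub> m \<in> d (k - 1) ` \<Gamma> (k - 1)"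
      using u_inj[OF sm] d' by blast
    ultimately show ?thesis by simp
  qed
  have "DC.supp2 P k 0 \<longleftrightarrow> (\<exists>m\<in>\<Gamma> k. u k m \<in> DC.Z1 k 0 \<and> (\<forall>s\<in>carrier R - P.
      s \<odot>\<^bsub>cech R gs (E k) 0\<^esub> u k m \<notin> cech_hom R gs (E (k - 1 + 1)) (d (k - 1)) 0 ` DC.Z2 (k - 1) 0))"
    unfolding DC.supp2_def Z2[of k] by blast
  also have "\<dots> \<longleftrightarrow> (\<exists>m\<in>\<Gamma> k. d k m = \<zero>\<^bsub>E (k + 1)\<^esub> \<and>
      (\<forall>s\<in>carrier R - P. s \<odot>\<^bsub>E k\<^esub> m \<notin> d (k - 1) ` \<Gamma> (k - 1)))"
    using Z1 im \<Gamma>_E by (intro bex_cong refl conj_cong ball_cong) auto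
  finally show ?thesis
    unfolding local_cohomology_def unfolding T.Supp_cohomology_iff unfolding tor by simp
qed

text \<open>In the column of resolution degree 0 the \<open>d1\<close>-cocycles are the image of the
  Cech complex of R under the augmentation, with the fractions over (f) as kernel. So
  \<open>supp1\<close> there is the criterion that \<open>Supp_koszul_total_iff\<close> gives for
  the total complex.\<close>

lemma Supp_total_iff:
  "P \<in> Supp R (cohomology (total_complex (koszul_cech R fs gs)) (koszul_cech_total_diff R fs gs)
      (k + int (length fs))) \<longleftrightarrow> primeideal P R \<and> DC.supp1 P 0 k"
proof -
  let ?J = "Idl (set fs)"
  interpret C: cech_complex R gs A by (rule A_cech)
  interpret K: koszul_regular R fs W \<delta> "\<lambda>i. C.cech_fracs (Idl (set (take i fs)))"
    by (rule koszul_regular_cech[OF is_cring gs regular])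
  define \<Lambda> where "\<Lambda> j = cech_hom R gs (E 0) augmentation j" for j
  have kc: "koszul_cech R fs gs = (\<lambda>i j. koszul fs (W j) i)" by (intro ext) (simp add: koszul_cech_def)
  have \<Lambda>_hom: "\<Lambda> j \<in> module_hom R (W j) (cech R gs (E 0) j)" for j
    unfolding \<Lambda>_def by (rule cech_hom_hom[OF A_cech E_cech augmentation_hom])
  have \<Lambda>_diff: "cech_diff R gs (E 0) j (\<Lambda> j w) = \<Lambda> (j + 1) (\<delta> j w)" if "w \<in> carrier (W j)" for j w
    unfolding \<Lambda>_def by (rule cech_hom_diff[OF A_cech E_cech augmentation_hom that])
  have \<Lambda>_zero: "\<Lambda> j w = \<zero>\<^bsub>cech R gs (E 0) j\<^esub> \<longleftrightarrow> w \<in> C.cech_fracs ?J j" if "w \<in> carrier (W j)" for j w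
    using cech_hom_eq_zero_iff[OF A_cech E_cech augmentation_hom that] unfolding \<Lambda>_def augmentation_kernel .
  have d0: "d 0 \<in> module_hom R (E 0) (E 1)" using d_hom[of 0] by simp
  \<comment> \<open>The image of the augmentation is the kernel of \<open>d 0\<close>, and
    localization preserves this exactness.\<close>
  have Z1_\<Lambda>: "DC.Z1 0 j = \<Lambda> j ` carrier (W j)" for j
  proof
    show "\<Lambda> j ` carrier (W j) \<subseteq> DC.Z1 0 j"
    proof
      fix x assume "x \<in> \<Lambda> j ` carrier (W j)"
      then obtain w where w: "w \<in> carrier (W j)" "x = \<Lambda> j w" by blast
      have "d 0 (augmentation r) = \<zero>\<^bsub>E 1\<^esub>" if "r \<in> carrier A" for r
        using augmentation_image that by blast
      then have "cech_hom R gs (E 1) (d 0) j x = \<zero>\<^bsub>cech R gs (E 1) j\<^esub>"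
        unfolding w(2) \<Lambda>_def by (rule cech_hom_comp_zero[OF A_cech E_cech E_cech augmentation_hom d0 _ w(1)])
      then show "x \<in> DC.Z1 0 j" using module_hom_closed[OF \<Lambda>_hom w(1)] w(2) by (simp add: DC.Z1_def)
    qed
    show "DC.Z1 0 j \<subseteq> \<Lambda> j ` carrier (W j)"
    proof
      fix x assume "x \<in> DC.Z1 0 j"
      then have x: "x \<in> carrier (cech R gs (E 0) j)" "cech_hom R gs (E 1) (d 0) j x = \<zero>\<^bsub>cech R gs (E 1) j\<^esub>"
        by (simp_all add: DC.Z1_def)
      have ex: "m \<in> augmentation ` carrier A" if "m \<in> carrier (E 0)" "d 0 m = \<zero>\<^bsub>E 1\<^esub>" for m
        unfolding augmentation_image using that by simp
      obtain w where "w \<in> carrier (W j)" "x = cech_hom R gs (E 0) augmentation j w"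
        by (rule cech_hom_exact[OF A_cech E_cech E_cech augmentation_hom d0 ex x])
      then show "x \<in> \<Lambda> j ` carrier (W j)" unfolding \<Lambda>_def by blast
    qed
  qed
  have Z2_\<Lambda>: "\<Lambda> k w \<in> DC.Z2 0 k \<longleftrightarrow> \<delta> k w \<in> C.cech_fracs ?J (k + 1)" if w: "w \<in> carrier (W k)" for w
    using module_hom_closed[OF \<Lambda>_hom w] \<Lambda>_diff[OF w] \<Lambda>_zero[OF module_hom_closed[OF C.cech_diff_hom w]]
    by (simp add: DC.Z2_def)
  \<comment> \<open>Two elements have the same image under \<Lambda> if and only if they differ by a
    fraction over (f); so a coboundary downstairs is a coboundary upstairs up to such
    fractions.\<close>
  have im: "s \<odot>\<^bsub>cech R gs (E 0) k\<^esub> \<Lambda> k w \<in> cech_diff R gs (E 0) (k - 1) ` DC.Z1 0 (k - 1) \<longleftrightarrow>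
      s \<odot>\<^bsub>W k\<^esub> w \<in> \<delta> (k - 1) ` carrier (W (k - 1)) <+>\<^bsub>W k\<^esub> C.cech_fracs ?J k"
    if s: "s \<in> carrier R" and w: "w \<in> carrier (W k)" for s w
  proof -
    interpret Wk: module R "W k" by (rule C.module_cech)
    interpret Dk: module R "cech R gs (E 0) k" by (rule DC.D)
    define v where "v = s \<odot>\<^bsub>W k\<^esub> w"
    have v: "v \<in> carrier (W k)" using s w by (simp add: v_def)
    have dc: "\<delta> (k - 1) y \<in> carrier (W k)" if "y \<in> carrier (W (k - 1))" for y
      using module_hom_closed[OF C.cech_diff_hom that] by simp
    have dd: "cech_diff R gs (E 0) (k - 1) (\<Lambda> (k - 1) y) = \<Lambda> k (\<delta> (k - 1) y)" if "y \<in> carrier (W (k - 1))" for y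
      using \<Lambda>_diff[OF that] by simp
    have "\<Lambda> k v = \<Lambda> k (\<delta> (k - 1) y) \<longleftrightarrow> v \<ominus>\<^bsub>W k\<^esub> \<delta> (k - 1) y \<in> C.cech_fracs ?J k"
      if y: "y \<in> carrier (W (k - 1))" for y
    proof -
      have "v \<ominus>\<^bsub>W k\<^esub> \<delta> (k - 1) y \<in> carrier (W k)" using v dc[OF y] by simp
      then show ?thesis
        using \<Lambda>_zero module_hom_minus[OF Wk.module_axioms Dk.module_axioms \<Lambda>_hom v dc[OF y]]
          Dk.minus_eq_zero_iff[OF module_hom_closed[OF \<Lambda>_hom v] module_hom_closed[OF \<Lambda>_hom dc[OF y]]] by metis
    qed
    then have "\<Lambda> k v \<in> cech_diff R gs (E 0) (k - 1) ` DC.Z1 0 (k - 1) \<longleftrightarrow>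
        (\<exists>y\<in>carrier (W (k - 1)). v \<ominus>\<^bsub>W k\<^esub> \<delta> (k - 1) y \<in> C.cech_fracs ?J k)"
      unfolding Z1_\<Lambda> image_image using dd by (auto simp: image_iff)
    also have "\<dots> \<longleftrightarrow> (\<exists>y\<in>carrier (W (k - 1)). \<exists>\<nu>\<in>C.cech_fracs ?J k. v = \<delta> (k - 1) y \<oplus>\<^bsub>W k\<^esub> \<nu>)"
    proof (rule bex_cong[OF refl])
      fix y assume y: "y \<in> carrier (W (k - 1))"
      have "v = \<delta> (k - 1) y \<oplus>\<^bsub>W k\<^esub> (v \<ominus>\<^bsub>W k\<^esub> \<delta> (k - 1) y)"
        using v dc[OF y] by (simp add: Wk.M.minus_eq Wk.M.a_lcomm Wk.M.r_neg)
      moreover have "(\<delta> (k - 1) y \<oplus>\<^bsub>W k\<^esub> \<nu>) \<ominus>\<^bsub>W k\<^esub> \<delta> (k - 1) y = \<nu>" if "\<nu> \<in> C.cech_fracs ?J k" for \<nu>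
        using that dc[OF y] Wk.M.a_comm[of "\<delta> (k - 1) y" \<nu>]
        by (simp add: C.cech_fracs_def Wk.M.minus_eq Wk.M.a_assoc Wk.M.r_neg)
      ultimately show "v \<ominus>\<^bsub>W k\<^esub> \<delta> (k - 1) y \<in> C.cech_fracs ?J k \<longleftrightarrow>
          (\<exists>\<nu>\<in>C.cech_fracs ?J k. v = \<delta> (k - 1) y \<oplus>\<^bsub>W k\<^esub> \<nu>)" by metis
    qed
    finally have "\<Lambda> k v \<in> cech_diff R gs (E 0) (k - 1) ` DC.Z1 0 (k - 1) \<longleftrightarrow>
        v \<in> \<delta> (k - 1) ` carrier (W (k - 1)) <+>\<^bsub>W k\<^esub> C.cech_fracs ?J k"
      by (auto simp: set_add_def')
    moreover have "\<Lambda> k v = s \<odot>\<^bsub>cech R gs (E 0) k\<^esub> \<Lambda> k w"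
      unfolding v_def by (rule module_hom_smult[OF \<Lambda>_hom s w])
    ultimately show ?thesis by (simp add: v_def)
  qed
  have "DC.supp1 P 0 k \<longleftrightarrow> (\<exists>w\<in>carrier (W k). \<Lambda> k w \<in> DC.Z2 0 k \<and> (\<forall>s\<in>carrier R - P.
      s \<odot>\<^bsub>cech R gs (E 0) k\<^esub> \<Lambda> k w \<notin> cech_diff R gs (E 0) (k - 1) ` DC.Z1 0 (k - 1)))"
    unfolding DC.supp1_def Z1_\<Lambda>[of k] by blast
  also have "\<dots> \<longleftrightarrow> (\<exists>w\<in>carrier (W k). \<delta> k w \<in> C.cech_fracs ?J (k + 1) \<and> (\<forall>s\<in>carrier R - P.
      s \<odot>\<^bsub>W k\<^esub> w \<notin> \<delta> (k - 1) ` carrier (W (k - 1)) <+>\<^bsub>W k\<^esub> C.cech_fracs ?J k))"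
    using Z2_\<Lambda> im by (intro bex_cong refl conj_cong ball_cong) auto
  finally show ?thesis
    unfolding koszul_cech_total_diff_def kc using K.Supp_koszul_total_iff[of P k] by simp
qed

text \<open>The Koszul direction has nonzero terms only in degrees 0 to \<open>length fs\<close>.
  The filtration is therefore finite and the union over its steps is a finite union of closed
  sets.\<close>

lemma zariski_closed_Supp_total:
  assumes "\<And>i j. zariski_closed R (Supp R (koszul_cech_limit R fs gs i j))"
  shows "zariski_closed R (Supp R
    (cohomology (total_complex (koszul_cech R fs gs)) (koszul_cech_total_diff R fs gs) n))"
proof -
  interpret C: cech_complex R gs A by (rule A_cech)
  interpret K: koszul_regular R fs W \<delta> "\<lambda>i. C.cech_fracs (Idl (set (take i fs)))"
    by (rule koszul_regular_cech[OF is_cring gs regular])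
  have kc: "koszul_cech R fs gs = (\<lambda>i j. koszul fs (W j) i)" by (intro ext) (simp add: koszul_cech_def)
  interpret F: filtered_complex R K.K.Tot K.K.td "total_filtration (\<lambda>i j. koszul fs (W j) i)" "int (length fs)"
    by (rule K.K.filtered_complex_Tot) (simp_all add: koszul_def subsets_eq_empty restrict_def)
  show ?thesis
    using assms unfolding koszul_cech_limit_def koszul_cech_total_diff_def kc F.Supp_cohomology_eq
    by (intro zariski_closed_UN[OF ring_axioms]) auto
qed

end

theorem theorem1p3:
  fixes R :: "('a, 'm) ring_scheme"
    and I :: "'a set"
    and gs fs :: "'a list"
    and E :: "int \<Rightarrow> ('a, 'e) module"
    and d :: "int \<Rightarrow> 'e \<Rightarrow> 'e"
    and \<epsilon> :: "'a set \<Rightarrow> 'e"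
  assumes "cring R" and "noetherian_ring R"
    and "set gs \<subseteq> carrier R" and "I = Idl\<^bsub>R\<^esub> (set gs)"
    and "set fs \<subseteq> carrier R"
    and limit_closed: "\<forall>i j :: int. zariski_closed R (Supp R (koszul_cech_limit R fs gs i j))"
    and regular: "regular_sequence R fs"
    and resolution:
      "injective_resolution R (quotient_module (regular_module R) (Idl\<^bsub>R\<^esub> (set fs))) E d \<epsilon>"
  shows "\<forall>k :: int. zariski_closed R (Supp R (local_cohomology R I E d k))"
proof
  fix k :: int
  interpret cring R by fact
  interpret noetherian_ring R by fact
  interpret resolved_quotient R gs fs E d \<epsilon>
    by unfold_locales (use assms in auto)
  \<comment> \<open>The two ends of the staircase in degree \<open>k\<close> are joined; the shift
    by \<open>length fs\<close> is the Koszul degree in which the quotient by the regular sequence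
    appears.\<close>
  have "Supp R (local_cohomology R I E d k) = Supp R
      (cohomology (total_complex (koszul_cech R fs gs)) (koszul_cech_total_diff R fs gs) (k + int (length fs)))"
    using Supp_local_cohomology_iff Supp_total_iff supp1_iff_supp2 unfolding \<open>I = Idl\<^bsub>R\<^esub> (set gs)\<close> by blast
  then show "zariski_closed R (Supp R (local_cohomology R I E d k))"
    using zariski_closed_Supp_total limit_closed by simp
qed

end
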